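(* Let $p\in[1,+\infty)$. Then the closure of $\Omega^2_{p,R}(B)$ with respect to the strong $L^p(B)$ topology (taken in $\Omega^2_{L^p}(B)$) equals $\Omega^2_{p,\mathbb{Z}}(B)$, i.e. $\overline{\Omega^2_{p,R}(B)}^{L^p}=\Omega^2_{p,\mathbb{Z}}(B)$.
   Context: $B$ is the open unit ball in $\mathbb{R}^3$; $C=(-1/2,1/2)^3$ is the open unit cube centred at the origin and $C_r(x_0):=rC+x_0$. $\Omega^2_{L^p}(B)$ is the set of $2$-forms on $B$ whose coefficients belong to $L^p(B)$. Restriction to cubes. Let $\|x\|_*:=\max_j|x_j|$ and, for $x_0\in B$, $n_{x_0}(x):=\|x-x_0\|_*$ (a Lipschitz function whose level sets are boundaries of cubes centred at $x_0$). For $F\in\Omega^2_{L^p}(B)$, by Fubini's theorem, for a.e. $r$ with $C_r(x_0)\Subset B$ one sets $i^*_{\partial C_r(x_0)}F:=\star(F\wedge dn_{x_0})|_{\partial C_r(x_0)}\,\mathrm{vol}_{\partial C_r(x_0)}$, where $\star$ is the Hodge star of Euclidean $\mathbb{R}^3$; for smooth $F$ this is the usual pullback of $F$ to $\partial C_r(x_0)$. Equivalently, $\int_{\partial C_r(x_0)}i^*_{\partial C_r(x_0)}F=\int_{\partial C_r(x_0)}X\cdot\nu_{\partial C_r(x_0)}\,d\mathcal{H}^2$, where $\nu$ is the outward unit normal and $X=(F_{23},-F_{13},F_{12})$ is the vector field corresponding to $F=F_{12}dx^1\wedge dx^2+F_{13}dx^1\wedge dx^3+F_{23}dx^2\wedge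 dx^3$. $\Omega^2_{p,\mathbb{Z}}(B)$ is the set of all $F\in\Omega^2_{L^p}(B)$ such that for every $x_0\in B$ one has $\frac{1}{2\pi}\int_{\partial C_r(x_0)}i^*_{\partial C_r(x_0)}F\in\mathbb{Z}$ for $\mathcal{L}^1$-a.e. Lebesgue point $r$ of the function $F_{x_0}(r):=\frac{1}{2\pi}\int_{\partial C_r(x_0)}i^*_{\partial C_r(x_0)}F$, $r\in\big(0,\frac{1}{\sqrt3}\mathrm{dist}(x_0,\partial B)\big)$. $\Omega^2_{p,R}(B)$ is the set of all $F\in\Omega^2_{L^p}(B)$ for which there are finitely many points $x_1,\dots,x_m\in B$ and integers $h_1,\dots,h_m\in\mathbb{Z}$ such that $F\in C^\infty(B\setminus\{x_1,\dots,x_m\})$ and $dF=\big(\sum_{j=1}^m2\pi h_j\delta_{x_j}\big)dx^1\wedge dx^2\wedge dx^3$ in $\mathcal{D}'(B)$. *)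

theory Defs
  imports "HOL-Analysis.Analysis"
begin

section \<open>2-forms with coefficients in \<open>L\<^sup>p\<close> on the unit ball\<close>

abbreviation B3 :: "(real^3) set" where
  "B3 \<equiv> ball 0 1"

text \<open>A 2-form on a domain of \<open>\<real>\<^sup>3\<close> is given by its skew-symmetric coefficient field:
  \<open>F x $ i $ j\<close> is the coefficient \<open>F\<^sub>i\<^sub>j(x) = F(x)(e\<^sub>i, e\<^sub>j)\<close>, so that
  \<open>F = F\<^sub>1\<^sub>2 dx\<^sup>1\<and>dx\<^sup>2 + F\<^sub>1\<^sub>3 dx\<^sup>1\<and>dx\<^sup>3 + F\<^sub>2\<^sub>3 dx\<^sup>2\<and>dx\<^sup>3\<close>. Forms are functions, not classes
  modulo null sets, and their values outside the ball are irrelevant.\<close>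

type_synonym two_form = "real^3 \<Rightarrow> real^3^3"

definition alternating_on :: "(real^3) set \<Rightarrow> two_form \<Rightarrow> bool" where
  "alternating_on U F \<longleftrightarrow> (\<forall>x\<in>U. \<forall>i j. F x $ j $ i = - (F x $ i $ j))"

definition Lp_on :: "real \<Rightarrow> (real^3) set \<Rightarrow> (real^3 \<Rightarrow> real) \<Rightarrow> bool" where
  "Lp_on p U f \<longleftrightarrow> f \<in> borel_measurable (lebesgue_on U) \<and>
     integrable (lebesgue_on U) (\<lambda>x. \<bar>f x\<bar> powr p)"

definition Omega2_Lp :: "real \<Rightarrow> two_form set" where
  "Omega2_Lp p = {F. alternating_on B3 F \<and> (\<forall>i j. Lp_on p B3 (\<lambda>x. F x $ i $ j))}"

text \<open>The norm of \<open>real^3^3\<close> is the Frobenius norm, which is \<open>\<surd>2\<close> times the Euclidean norm of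
  \<open>(F\<^sub>1\<^sub>2, F\<^sub>1\<^sub>3, F\<^sub>2\<^sub>3)\<close>; the constant does not affect the topology.\<close>

definition Lp_dist :: "real \<Rightarrow> two_form \<Rightarrow> two_form \<Rightarrow> real" where
  "Lp_dist p F G = (\<integral>x. norm (F x - G x) powr p \<partial>lebesgue_on B3) powr (1 / p)"

text \<open>The strong \<open>L\<^sup>p\<close> topology on \<open>Omega2_Lp p\<close>. As forms are not identified when they agree
  almost everywhere, \<open>Lp_dist p\<close> is only a pseudometric. Forms that agree almost everywhere are
  topologically indistinguishable, so every closure is invariant under changes on null sets.\<close>

definition Lp_topology :: "real \<Rightarrow> two_form topology" where
  "Lp_topology p = topology (\<lambda>U. U \<subseteq> Omega2_Lp p \<and>
     (\<forall>F\<in>U. \<exists>e>0. \<forall>G\<in>Omega2_Lp p. Lp_dist p F G < e \<longrightarrow> G \<in> U))"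

lemma openin_Lp_topology:
  "openin (Lp_topology p) U \<longleftrightarrow> U \<subseteq> Omega2_Lp p \<and>
     (\<forall>F\<in>U. \<exists>e>0. \<forall>G\<in>Omega2_Lp p. Lp_dist p F G < e \<longrightarrow> G \<in> U)"
proof -
  let ?P = "\<lambda>U. U \<subseteq> Omega2_Lp p \<and>
     (\<forall>F\<in>U. \<exists>e>0. \<forall>G\<in>Omega2_Lp p. Lp_dist p F G < e \<longrightarrow> G \<in> U)"
  have "?P (S \<inter> T)" if S: "?P S" and T: "?P T" for S T
  proof (intro conjI ballI)
    show "S \<inter> T \<subseteq> Omega2_Lp p" using S by blast
    fix F assume "F \<in> S \<inter> T"
    then obtain d e where "d > 0" "\<forall>G\<in>Omega2_Lp p. Lp_dist p F G < d \<longrightarrow> G \<in> S"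
      and "e > 0" "\<forall>G\<in>Omega2_Lp p. Lp_dist p F G < e \<longrightarrow> G \<in> T"
      using S T by (metis Int_iff)
    then show "\<exists>e>0. \<forall>G\<in>Omega2_Lp p. Lp_dist p F G < e \<longrightarrow> G \<in> S \<inter> T"
      by (intro exI[of _ "min d e"]) auto
  qed
  moreover have "?P (\<Union>\<K>)" if "\<forall>K\<in>\<K>. ?P K" for \<K>
  proof (intro conjI ballI)
    show "\<Union>\<K> \<subseteq> Omega2_Lp p" using that by blast
    fix F assume "F \<in> \<Union>\<K>"
    then obtain K where "K \<in> \<K>" "F \<in> K" by blast
    with that obtain e where "e > 0" "\<forall>G\<in>Omega2_Lp p. Lp_dist p F G < e \<longrightarrow> G \<in> K" by blast
    with \<open>K \<in> \<K>\<close> show "\<exists>e>0. \<forall>G\<in>Omega2_Lp p. Lp_dist p F G < e \<longrightarrow> G \<in> \<Union>\<K>" by blast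
  qed
  ultimately have "istopology ?P"
    unfolding istopology_def by blast
  then show ?thesis
    by (simp add: Lp_topology_def topology_inverse')
qed

lemma topspace_Lp_topology: "topspace (Lp_topology p) = Omega2_Lp p"
proof -
  have "openin (Lp_topology p) (Omega2_Lp p)"
    unfolding openin_Lp_topology by (auto intro: exI[of _ 1])
  moreover have "topspace (Lp_topology p) \<subseteq> Omega2_Lp p"
    using openin_topspace[of "Lp_topology p"] unfolding openin_Lp_topology by blast
  ultimately show ?thesis
    using openin_subset by blast
qed

section \<open>Restriction to boundaries of cubes\<close>

text \<open>\<open>infnorm\<close> is the maximum norm, so the boundary of the cube \<open>C\<^sub>r(x\<^sub>0)\<close> of side length \<open>r\<close> is
  the level set \<open>cube_norm x\<^sub>0 = r / 2\<close>.\<close>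

definition cube_norm :: "real^3 \<Rightarrow> real^3 \<Rightarrow> real" where
  "cube_norm x0 x = infnorm (x - x0)"

text \<open>\<open>\<star>(F \<and> dn)\<close> at \<open>x\<close>, that is, the coefficient of \<open>F \<and> dn\<close> with respect to
  \<open>dx\<^sup>1\<and>dx\<^sup>2\<and>dx\<^sup>3\<close>. For \<open>n = cube_norm x\<^sub>0\<close> the differential exists except on the edges of the
  cubes.\<close>

definition star_wedge_d :: "two_form \<Rightarrow> (real^3 \<Rightarrow> real) \<Rightarrow> real^3 \<Rightarrow> real" where
  "star_wedge_d F n x = (let dn = frechet_derivative n (at x) in
     F x $ 1 $ 2 * dn (axis 3 1) - F x $ 1 $ 3 * dn (axis 2 1) + F x $ 2 $ 3 * dn (axis 1 1))"

text \<open>The point with coordinates \<open>y\<close> (relative to the centre) on the face of \<open>C\<^sub>r(x\<^sub>0)\<close> with outward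
  unit normal \<open>s e\<^sub>i\<close>, where \<open>s = 1\<close> or \<open>s = -1\<close>. Index arithmetic in type \<open>3\<close> is modulo 3.\<close>

definition face_point :: "real^3 \<Rightarrow> real \<Rightarrow> 3 \<Rightarrow> real \<Rightarrow> real \<times> real \<Rightarrow> real^3" where
  "face_point x0 r i s y =
     x0 + (\<chi> k. if k = i then s * (r / 2) else if k = i + 1 then fst y else snd y)"

text \<open>Integral over the boundary of \<open>C\<^sub>r(x\<^sub>0)\<close> with respect to its area form. The six faces are
  parametrised isometrically over the square of side length \<open>r\<close>.\<close>

definition cube_boundary_integral :: "real^3 \<Rightarrow> real \<Rightarrow> (real^3 \<Rightarrow> real) \<Rightarrow> real" where
  "cube_boundary_integral x0 r g =
     (\<Sum>i\<in>UNIV. \<Sum>s\<in>{-1, 1}.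
        \<integral>y. g (face_point x0 r i s y) \<partial>lebesgue_on ({-r/2<..<r/2} \<times> {-r/2<..<r/2}))"

definition flux :: "two_form \<Rightarrow> real^3 \<Rightarrow> real \<Rightarrow> real" where
  "flux F x0 r = 1 / (2 * pi) * cube_boundary_integral x0 r (star_wedge_d F (cube_norm x0))"

definition lebesgue_point :: "(real \<Rightarrow> real) \<Rightarrow> real \<Rightarrow> bool" where
  "lebesgue_point f r \<longleftrightarrow>
     (\<exists>d>0. integrable (lebesgue_on {r-d<..<r+d}) f) \<and>
     ((\<lambda>h. 1 / (2 * h) * (\<integral>t. \<bar>f t - f r\<bar> \<partial>lebesgue_on {r-h<..<r+h})) \<longlongrightarrow> 0) (at_right 0)"

definition Omega2_Z :: "real \<Rightarrow> two_form set" where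
  "Omega2_Z p = {F \<in> Omega2_Lp p. \<forall>x0\<in>B3. AE r in lebesgue.
     r \<in> {0<..<1 / sqrt 3 * infdist x0 (frontier B3)} \<longrightarrow>
     lebesgue_point (flux F x0) r \<longrightarrow> flux F x0 r \<in> \<int>}"

section \<open>Forms with finitely many integer singularities\<close>

primrec Ck_on :: "nat \<Rightarrow> (real^3) set \<Rightarrow> (real^3 \<Rightarrow> real) \<Rightarrow> bool" where
  "Ck_on 0 U f \<longleftrightarrow> continuous_on U f"
| "Ck_on (Suc k) U f \<longleftrightarrow> (\<forall>x\<in>U. f differentiable (at x)) \<and>
     (\<forall>i. Ck_on k U (\<lambda>x. frechet_derivative f (at x) (axis i 1)))"

text \<open>Used for open sets only.\<close>

definition smooth_on :: "(real^3) set \<Rightarrow> (real^3 \<Rightarrow> real) \<Rightarrow> bool" where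
  "smooth_on U f \<longleftrightarrow> (\<forall>k. Ck_on k U f)"

definition test_functions :: "(real^3) set \<Rightarrow> (real^3 \<Rightarrow> real) set" where
  "test_functions U = {\<phi>. smooth_on UNIV \<phi> \<and>
     compact (closure {x. \<phi> x \<noteq> 0}) \<and> closure {x. \<phi> x \<noteq> 0} \<subseteq> U}"

abbreviation partial_d :: "3 \<Rightarrow> (real^3 \<Rightarrow> real) \<Rightarrow> real^3 \<Rightarrow> real" where
  "partial_d i \<phi> x \<equiv> frechet_derivative \<phi> (at x) (axis i 1)"

text \<open>The coefficient \<open>\<partial>\<^sub>1F\<^sub>2\<^sub>3 - \<partial>\<^sub>2F\<^sub>1\<^sub>3 + \<partial>\<^sub>3F\<^sub>1\<^sub>2\<close> of \<open>dF\<close> with respect to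
  \<open>dx\<^sup>1\<and>dx\<^sup>2\<and>dx\<^sup>3\<close>, as a distribution on the unit ball; the partial derivatives are distributional,
  whence the sign.\<close>

definition distr_d :: "two_form \<Rightarrow> (real^3 \<Rightarrow> real) \<Rightarrow> real" where
  "distr_d F \<phi> = - (\<integral>x. F x $ 2 $ 3 * partial_d 1 \<phi> x - F x $ 1 $ 3 * partial_d 2 \<phi> x
     + F x $ 1 $ 2 * partial_d 3 \<phi> x \<partial>lebesgue_on B3)"

definition Omega2_R :: "real \<Rightarrow> two_form set" where
  "Omega2_R p = {F \<in> Omega2_Lp p. \<exists>S (h :: real^3 \<Rightarrow> int). finite S \<and> S \<subseteq> B3 \<and>
     (\<forall>i j. smooth_on (B3 - S) (\<lambda>x. F x $ i $ j)) \<and>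
     (\<forall>\<phi>\<in>test_functions B3. distr_d F \<phi> = (\<Sum>a\<in>S. 2 * pi * of_int (h a) * \<phi> a))}"

end

theory Submission
  imports Defs
begin

text \<open>
  A 2-form on the ball is identified with the vector field \<open>X\<close> of its coefficients. The flux of \<open>X\<close>
  through the boundary of a cube becomes a difference of integrals over opposite faces, and \<open>dF\<close>
  becomes the distributional divergence of \<open>X\<close>.

  \<^bold>\<open>Forms with finitely many singularities and their limits have integer fluxes.\<close> Testing the
  divergence of such a form against smooth cut-offs of cubes, and letting the cut-offs become sharp,
  shows that for every centre almost every flux is the total charge inside the cube (\<open>Omega2_R_subset_Z\<close>). For a
  fixed centre, the integral of the distance between two fluxes over the side lengths is bounded by the
  distance of the fields in \<open>L\<^sup>1\<close>, hence in \<open>L\<^sup>p\<close>. So the distance of the fluxes to the integers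
  passes to limits (\<open>Omega2_Z_closed\<close>).

  \<^bold>\<open>Density.\<close> Let \<open>X\<close> have integer fluxes. After a contraction, \<open>X\<close> has integer fluxes also through
  cubes near the boundary of the ball (\<open>dilate_near\<close>). By Fubini's theorem there are
  arbitrarily small \<open>\<epsilon>\<close> for which almost every cube of side \<open>\<epsilon>\<close> has an integer flux
  (\<open>generic_scale\<close>). Take a lattice of such cubes with a generic offset. On it, the averages of
  \<open>X\<close> over the faces are interpolated by \<open>\<Sum> face_mean i * weight i\<close>, where the weights are smooth tensor
  products of partitions of unity on the line. They are chosen such that the
  divergence of the interpolation is the sum of the bump functions around the cubes, each weighted with the flux
  through its cube. Hence only cubes with nonzero flux contribute to the divergence (\<open>interpolant_divergence\<close>).

  For such a bad cube, a multiple of a rescaled fixed field \<open>point_source\<close> is added. This field is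
  supported in a cube, and its divergence is the difference of a point mass and the bump function. The
  divergence of the sum is then a finite sum of integer multiples of \<open>2\<pi>\<close> times point masses, and the
  sum is smooth away from them (\<open>total_divergence\<close>, \<open>smooth_on_approximation\<close>).

  Both errors are controlled on average over the offset of the lattice. The interpolation error is bounded by
  the \<open>L\<^sup>p\<close> modulus of continuity of \<open>X\<close> at scale \<open>\<epsilon>\<close> (\<open>interp_error_integral\<close>). A nonzero
  integer flux through a cube of side \<open>\<epsilon>\<close> forces the face averages to be at least of order \<open>\<epsilon>\<^sup>-\<^sup>2\<close>. The
  \<open>L\<^sup>p\<close> norm of the correction is therefore controlled by the part of \<open>X\<close> where \<open>X\<close> is that large, up
  to its modulus of continuity (\<open>bad_error_integral\<close>), and this tends to zero by dominated convergence.
  The point source is in \<open>L\<^sup>p\<close> only for \<open>p < 3/2\<close>. For \<open>p \<ge> 3/2\<close> a single bad cube would already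
  contribute at least 1 to the same bound, so that there are no bad cubes at all
  (\<open>correction_error\<close>, \<open>approximation_at_scale\<close>).
\<close>

section \<open>Smooth functions of one variable\<close>

primrec times_differentiable :: "nat \<Rightarrow> (real \<Rightarrow> real) \<Rightarrow> bool" where
  "times_differentiable 0 f \<longleftrightarrow> True"
| "times_differentiable (Suc k) f \<longleftrightarrow>
     (\<exists>f'. (\<forall>t. (f has_real_derivative f' t) (at t)) \<and> times_differentiable k f')"

definition smooth1 :: "(real \<Rightarrow> real) \<Rightarrow> bool" where
  "smooth1 f \<longleftrightarrow> (\<forall>k. times_differentiable k f)"

lemma times_differentiable_Suc_imp:
  "times_differentiable (Suc k) f \<Longrightarrow> times_differentiable k f"
  by (induction k arbitrary: f) (simp, metis times_differentiable.simps(2))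

lemma times_differentiable_const: "times_differentiable k (\<lambda>t. c)"
  by (induction k arbitrary: c) (auto intro!: exI[of _ "\<lambda>_. 0"])

lemma times_differentiable_add:
  "times_differentiable k f \<Longrightarrow> times_differentiable k g \<Longrightarrow> times_differentiable k (\<lambda>t. f t + g t)"
proof (induction k arbitrary: f g)
  case (Suc k)
  then obtain f' g' where
    f: "\<And>t. (f has_real_derivative f' t) (at t)" "times_differentiable k f'" and
    g: "\<And>t. (g has_real_derivative g' t) (at t)" "times_differentiable k g'" by auto
  have "\<forall>t. ((\<lambda>t. f t + g t) has_real_derivative (f' t + g' t)) (at t)"
    using f g by (auto intro!: derivative_eq_intros)
  with Suc.IH[OF f(2) g(2)] show ?case by auto
qed simp

lemma times_differentiable_mult:
  "times_differentiable k f \<Longrightarrow> times_differentiable k g \<Longrightarrow> times_differentiable k (\<lambda>t. f t * g t)"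
proof (induction k arbitrary: f g)
  case (Suc k)
  then obtain f' g' where
    f: "\<And>t. (f has_real_derivative f' t) (at t)" "times_differentiable k f'" and
    g: "\<And>t. (g has_real_derivative g' t) (at t)" "times_differentiable k g'" by auto
  have "\<forall>t. ((\<lambda>t. f t * g t) has_real_derivative (f' t * g t + f t * g' t)) (at t)"
    using f g by (auto intro!: derivative_eq_intros)
  moreover have "times_differentiable k (\<lambda>t. f' t * g t + f t * g' t)"
    using Suc.IH f(2) g(2) Suc.prems times_differentiable_Suc_imp by (intro times_differentiable_add) blast+
  ultimately show ?case by (auto simp only: times_differentiable.simps(2))
qed simp

lemma times_differentiable_affine:
  "times_differentiable k f \<Longrightarrow> times_differentiable k (\<lambda>t. f (a * t + b))"
proof (induction k arbitrary: f)
  case (Suc k)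
  then obtain f' where
    f: "\<And>t. (f has_real_derivative f' t) (at t)" "times_differentiable k f'" by auto
  have "((\<lambda>t. f (a * t + b)) has_real_derivative (a * f' (a * t + b))) (at t)" for t
  proof -
    have "((\<lambda>t. a * t + b) has_real_derivative a) (at t)" by (auto intro!: derivative_eq_intros)
    from DERIV_chain2[OF f(1) this] show ?thesis by (simp add: mult.commute)
  qed
  moreover have "times_differentiable k (\<lambda>t. a * f' (a * t + b))"
    by (intro times_differentiable_mult times_differentiable_const Suc.IH f)
  ultimately show ?case
    unfolding times_differentiable.simps(2) by (intro exI[of _ "\<lambda>t. a * f' (a * t + b)"]) blast
qed simp

lemma smooth1_const: "smooth1 (\<lambda>t. c)"
  and smooth1_add: "smooth1 f \<Longrightarrow> smooth1 g \<Longrightarrow> smooth1 (\<lambda>t. f t + g t)"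
  and smooth1_mult: "smooth1 f \<Longrightarrow> smooth1 g \<Longrightarrow> smooth1 (\<lambda>t. f t * g t)"
  and smooth1_affine: "smooth1 f \<Longrightarrow> smooth1 (\<lambda>t. f (a * t + b))"
  by (auto simp: smooth1_def times_differentiable_const times_differentiable_add
      times_differentiable_mult times_differentiable_affine)

lemma smooth1_diff: "smooth1 f \<Longrightarrow> smooth1 g \<Longrightarrow> smooth1 (\<lambda>t. f t - g t)"
  using smooth1_add[of f "\<lambda>t. -1 * g t"] smooth1_mult[OF smooth1_const[of "-1"]] by simp

lemma smooth1I:
  assumes "\<And>t. (f has_real_derivative f' t) (at t)" "smooth1 f'"
  shows "smooth1 f"
  unfolding smooth1_def
proof
  fix k show "times_differentiable k f"
    using assms by (cases k) (auto simp: smooth1_def)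
qed

lemma smooth1_id: "smooth1 (\<lambda>t. t)"
  by (rule smooth1I[of _ "\<lambda>_. 1"]) (auto intro: smooth1_const)

lemma smooth1_deriv:
  assumes "smooth1 f"
  obtains f' where "\<And>t. (f has_real_derivative f' t) (at t)" "smooth1 f'"
proof -
  obtain f' where f': "\<And>t. (f has_real_derivative f' t) (at t)"
    using assms[unfolded smooth1_def, rule_format, of 1] by auto
  have "times_differentiable k f'" for k
  proof -
    obtain g where "\<And>t. (f has_real_derivative g t) (at t)" "times_differentiable k g"
      using assms[unfolded smooth1_def, rule_format, of "Suc k"] by auto
    moreover have "g = f'" using calculation(1) f' DERIV_unique by blast
    ultimately show ?thesis by simp
  qed
  with f' that show ?thesis by (auto simp: smooth1_def)
qed

lemma smooth1_continuous: "smooth1 f \<Longrightarrow> continuous_on A f"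
  by (metis smooth1_deriv DERIV_isCont continuous_at_imp_continuous_on)

text \<open>The derivative of \<open>flat_exp n\<close> is \<open>flat_exp (n + 2) - n flat_exp (n + 1)\<close>, so the whole family
  is smooth at once; carrying the power of \<open>1 / t\<close> along is what makes the induction work.\<close>

definition flat_exp :: "nat \<Rightarrow> real \<Rightarrow> real" where
  "flat_exp n t = (if t > 0 then (1 / t) ^ n * exp (- (1 / t)) else 0)"

lemma flat_exp_tendsto_0: "(flat_exp n \<longlongrightarrow> 0) (at_right 0)"
proof -
  have "((\<lambda>t. inverse t ^ n / exp (inverse t)) \<longlongrightarrow> (0::real)) (at_right 0)"
    by (rule filterlim_compose[OF tendsto_power_div_exp_0 filterlim_inverse_at_top_right])
  moreover have "\<forall>\<^sub>F t in at_right 0. inverse t ^ n / exp (inverse t) = flat_exp n t"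
    by (auto simp: eventually_at_filter flat_exp_def exp_minus field_simps)
  ultimately show ?thesis by (rule Lim_transform_eventually)
qed

lemma flat_exp_deriv:
  "(flat_exp n has_real_derivative (- real n * flat_exp (n + 1) t + flat_exp (n + 2) t)) (at t)"
proof -
  consider "t > 0" | "t < 0" | "t = 0" by linarith
  then show ?thesis
  proof cases
    case 1
    have "((\<lambda>t. (1 / t) ^ n * exp (- (1 / t))) has_real_derivative
        (- real n * flat_exp (n + 1) t + flat_exp (n + 2) t)) (at t)"
    proof (cases n)
      case 0
      then show ?thesis using 1
        by (auto intro!: derivative_eq_intros simp: flat_exp_def field_simps power2_eq_square)
    next
      case (Suc m)
      have "((\<lambda>t. (1 / t) ^ n) has_real_derivative (real n * (- 1 / (t * t)) * (1 / t) ^ m)) (at t)"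
      proof -
        have "((\<lambda>t. 1 / t) has_real_derivative (- 1 / (t * t))) (at t)"
          using 1 by (auto intro!: derivative_eq_intros)
        from DERIV_power[OF this, of n] Suc show ?thesis by (simp add: mult.commute mult.assoc)
      qed
      moreover have "((\<lambda>t. exp (- (1 / t))) has_real_derivative exp (- (1 / t)) * (1 / (t * t))) (at t)"
        using 1 by (auto intro!: derivative_eq_intros)
      ultimately have "((\<lambda>t. (1 / t) ^ n * exp (- (1 / t))) has_real_derivative
          (real n * (- 1 / (t * t)) * (1 / t) ^ m * exp (- (1 / t)) +
           exp (- (1 / t)) * (1 / (t * t)) * (1 / t) ^ n)) (at t)"
        by (rule DERIV_mult)
      moreover have "real n * (- 1 / (t * t)) * (1 / t) ^ m * exp (- (1 / t)) +
           exp (- (1 / t)) * (1 / (t * t)) * (1 / t) ^ n =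
           - real n * flat_exp (n + 1) t + flat_exp (n + 2) t"
        using 1 Suc by (simp add: flat_exp_def field_simps)
      ultimately show ?thesis by simp
    qed
    then show ?thesis
      by (rule has_field_derivative_transform_within_open[where S="{0<..}"])
         (use 1 in \<open>auto simp: flat_exp_def\<close>)
  next
    case 2
    have "((\<lambda>t. 0) has_real_derivative 0) (at t)" by simp
    then have "(flat_exp n has_real_derivative 0) (at t)"
      by (rule has_field_derivative_transform_within_open[where S="{..<0}"])
         (use 2 in \<open>auto simp: flat_exp_def\<close>)
    then show ?thesis using 2 by (simp add: flat_exp_def)
  next
    case 3
    have "((\<lambda>x. (flat_exp n x - flat_exp n 0) / (x - 0)) \<longlongrightarrow> 0) (at 0)"
    proof (rule filterlim_split_at)
      show "((\<lambda>x. (flat_exp n x - flat_exp n 0) / (x - 0)) \<longlongrightarrow> 0) (at_left 0)"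
        by (rule Lim_transform_eventually[OF tendsto_const])
           (auto simp: eventually_at_filter flat_exp_def)
      show "((\<lambda>x. (flat_exp n x - flat_exp n 0) / (x - 0)) \<longlongrightarrow> 0) (at_right 0)"
        by (rule Lim_transform_eventually[OF flat_exp_tendsto_0[of "n + 1"]])
           (auto simp: eventually_at_filter flat_exp_def field_simps)
    qed
    then show ?thesis using 3
      by (simp add: has_field_derivative_iff flat_exp_def)
  qed
qed

lemma smooth1_flat_exp: "smooth1 (flat_exp n)"
proof -
  have "times_differentiable k (flat_exp n)" for k
  proof (induction k arbitrary: n)
    case (Suc k)
    have "times_differentiable k (\<lambda>t. - real n * flat_exp (n + 1) t + flat_exp (n + 2) t)"
      by (intro times_differentiable_add times_differentiable_mult times_differentiable_const Suc)
    with flat_exp_deriv show ?case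
      unfolding times_differentiable.simps(2)
      by (intro exI[of _ "\<lambda>t. - real n * flat_exp (n + 1) t + flat_exp (n + 2) t"]) blast
  qed simp
  then show ?thesis by (simp add: smooth1_def)
qed

section \<open>A smooth bump, its primitives and partitions of unity on the line\<close>

definition primitive :: "(real \<Rightarrow> real) \<Rightarrow> real \<Rightarrow> real" where
  "primitive f t = integral {-1..t} f"

lemma primitive_deriv:
  assumes c: "continuous_on UNIV f" and z: "\<And>t. t \<le> - 1 / 2 \<Longrightarrow> f t = 0"
  shows "(primitive f has_real_derivative f t) (at t)"
proof (cases "t > -1")
  case True
  have "((\<lambda>u. integral {-1..u} f) has_real_derivative f t) (at t within {-1..t+1})"
    by (rule integral_has_real_derivative) (use True c continuous_on_subset in auto)
  moreover have "at t within {-1..t+1} = at t"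
    using True by (intro at_within_interior) auto
  ultimately show ?thesis by (simp add: primitive_def[abs_def])
next
  case False
  have "((\<lambda>t. 0) has_real_derivative 0) (at t)" by simp
  then have "(primitive f has_real_derivative 0) (at t)"
  proof (rule has_field_derivative_transform_within_open[where S="{..<-1/2}"])
    fix x :: real assume "x \<in> {..<-1/2}"
    then have "integral {-1..x} f = integral {-1..x} (\<lambda>_. 0)"
      by (intro integral_cong) (auto intro: z)
    then show "0 = primitive f x" by (simp add: primitive_def)
  qed (use False in auto)
  then show ?thesis using False z by simp
qed

lemma primitive_eq_0:
  assumes z: "\<And>t. t \<le> - 1 / 2 \<Longrightarrow> f t = 0" and t: "t \<le> - 1 / 2"
  shows "primitive f t = 0"
proof -
  have "integral {-1..t} f = integral {-1..t} (\<lambda>_. 0)"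
    using t by (intro integral_cong) (auto intro: z)
  then show ?thesis by (simp add: primitive_def)
qed

definition bump0 :: "real \<Rightarrow> real" where
  "bump0 t = flat_exp 0 (1 * t + 1 / 2) * flat_exp 0 (-1 * t + 1 / 2)"

lemma smooth1_bump0: "smooth1 bump0"
  unfolding bump0_def[abs_def] by (intro smooth1_mult smooth1_affine[OF smooth1_flat_exp])

lemma bump0_nonneg: "bump0 t \<ge> 0" and bump0_pos: "\<bar>t\<bar> < 1 / 2 \<Longrightarrow> bump0 t > 0"
  and bump0_eq_0: "\<bar>t\<bar> \<ge> 1 / 2 \<Longrightarrow> bump0 t = 0"
  by (auto simp: bump0_def flat_exp_def)

lemma primitive_bump0_deriv: "(primitive bump0 has_real_derivative bump0 t) (at t)"
proof (rule primitive_deriv)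
  show "continuous_on UNIV bump0" by (rule smooth1_continuous[OF smooth1_bump0])
  show "\<And>t. t \<le> - 1 / 2 \<Longrightarrow> bump0 t = 0" by (rule bump0_eq_0) linarith
qed

lemma primitive_bump0_pos: "primitive bump0 (1 / 2) > 0"
proof -
  have "primitive bump0 (- 1 / 2) < primitive bump0 (1 / 2)"
  proof (rule DERIV_pos_imp_increasing_open[of "- 1 / 2" "1 / 2" "primitive bump0"])
    fix x :: real assume "-1/2 < x" "x < 1/2"
    then have "bump0 x > 0" by (intro bump0_pos) linarith
    then show "\<exists>y. (primitive bump0 has_real_derivative y) (at x) \<and> y > 0"
      by (intro exI[of _ "bump0 x"] conjI primitive_bump0_deriv)
  next
    show "continuous_on {- 1 / 2..1 / 2} (primitive bump0)"
      by (intro continuous_at_imp_continuous_on ballI DERIV_isCont[OF primitive_bump0_deriv])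
  qed simp
  moreover have "primitive bump0 (- 1 / 2) = 0"
    by (rule primitive_eq_0) (auto intro: bump0_eq_0)
  ultimately show ?thesis by simp
qed

definition bump :: "real \<Rightarrow> real" where
  "bump t = bump0 t / primitive bump0 (1 / 2)"

lemma smooth1_bump: "smooth1 bump"
  using smooth1_mult[OF smooth1_const[of "1 / primitive bump0 (1/2)"] smooth1_bump0]
  by (simp add: bump_def[abs_def])

lemma bump_nonneg: "bump t \<ge> 0"
  using bump0_nonneg primitive_bump0_pos by (simp add: bump_def)

lemma bump_eq_0: "\<bar>t\<bar> \<ge> 1 / 2 \<Longrightarrow> bump t = 0"
  by (simp add: bump_def bump0_eq_0)

definition step :: "real \<Rightarrow> real" where
  "step = primitive bump"

lemma step_deriv: "(step has_real_derivative bump t) (at t)"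
  unfolding step_def by (intro primitive_deriv smooth1_continuous smooth1_bump bump_eq_0) auto

lemma smooth1_step: "smooth1 step"
  by (rule smooth1I[OF step_deriv smooth1_bump])

lemma mono_step: "s \<le> t \<Longrightarrow> step s \<le> step t"
  by (erule DERIV_nonneg_imp_nondecreasing[of s t step])
     (rule exI, rule conjI, rule step_deriv, rule bump_nonneg)

lemma step_eq_0: "t \<le> - 1 / 2 \<Longrightarrow> step t = 0"
  unfolding step_def by (intro primitive_eq_0 bump_eq_0) auto

lemma step_eq_1: assumes "t \<ge> 1 / 2" shows "step t = 1"
proof -
  have "step (1/2) = 1"
    using primitive_bump0_pos by (simp add: step_def primitive_def bump_def[abs_def])
  moreover have "step t = step (1/2)"
  proof (rule DERIV_isconst2[of "1/2" "t+1"])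
    show "continuous_on {1/2..t+1} step" by (rule smooth1_continuous[OF smooth1_step])
    fix x assume "1/2 < x" "x < t+1"
    then show "(step has_real_derivative 0) (at x)"
      using step_deriv[of x] bump_eq_0[of x] by simp
  qed (use assms in auto)
  ultimately show ?thesis by simp
qed

definition ramp :: "real \<Rightarrow> real" where
  "ramp = primitive step"

lemma ramp_deriv: "(ramp has_real_derivative step t) (at t)"
  unfolding ramp_def by (intro primitive_deriv smooth1_continuous smooth1_step step_eq_0) auto

lemma ramp_eq_0: "t \<le> - 1 / 2 \<Longrightarrow> ramp t = 0"
  unfolding ramp_def by (intro primitive_eq_0 step_eq_0) auto

lemma ramp_diff: assumes "t \<ge> 1 / 2" shows "ramp (t + 1) - ramp t = 1"
proof -
  have "(\<lambda>t. ramp t - t) (t + 1) = (\<lambda>t. ramp t - t) t"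
  proof (rule DERIV_isconst2[of t "t+1" "\<lambda>t. ramp t - t"])
    show "continuous_on {t..t+1} (\<lambda>t. ramp t - t)"
      by (rule smooth1_continuous[OF smooth1_diff[OF smooth1I[OF ramp_deriv smooth1_step] smooth1_id]])
    fix x assume "t < x" "x < t+1"
    then show "((\<lambda>t. ramp t - t) has_real_derivative 0) (at x)"
      using DERIV_diff[OF ramp_deriv[of x] DERIV_ident] assms step_eq_1[of x] by simp
  qed auto
  then show ?thesis by simp
qed

text \<open>\<open>hat\<close> and \<open>slide\<close> are smooth versions of the indicator of \<open>[-1/2, 1/2]\<close> and of the
  tent on \<open>[-1/2, 3/2]\<close>. The integer translates of each sum to one, and
  \<open>slide' = hat - hat (\<sqdot> - 1)\<close>: a field interpolating with \<open>slide\<close> in its own direction and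
  with \<open>hat\<close> across has a divergence that involves only \<open>hat\<close>.\<close>

definition hat :: "real \<Rightarrow> real" where
  "hat t = step (t + 1 / 2) - step (t - 1 / 2)"

definition cumhat :: "real \<Rightarrow> real" where
  "cumhat t = ramp (t + 1 / 2) - ramp (t - 1 / 2)"

definition slide :: "real \<Rightarrow> real" where
  "slide t = cumhat t - cumhat (t - 1)"

lemma smooth1_shift: "smooth1 f \<Longrightarrow> smooth1 (\<lambda>t. f (t - c))"
  and smooth1_shift': "smooth1 f \<Longrightarrow> smooth1 (\<lambda>t. f (t + c))"
  using smooth1_affine[of f 1 "-c"] smooth1_affine[of f 1 c] by simp_all

lemma smooth1_hat: "smooth1 hat"
  unfolding hat_def[abs_def] by (intro smooth1_diff smooth1_shift[OF smooth1_step] smooth1_shift'[OF smooth1_step])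

lemma cumhat_deriv: "(cumhat has_real_derivative hat t) (at t)"
  unfolding cumhat_def[abs_def] hat_def
  using DERIV_diff[OF DERIV_shift[THEN iffD1, OF ramp_deriv[of "t + 1/2"]]
      DERIV_shift[THEN iffD1, OF ramp_deriv[of "t + - 1/2"]]] by simp

lemma smooth1_cumhat: "smooth1 cumhat"
  by (rule smooth1I[OF cumhat_deriv smooth1_hat])

lemma slide_deriv: "(slide has_real_derivative (hat t - hat (t - 1))) (at t)"
  unfolding slide_def[abs_def]
  using DERIV_diff[OF cumhat_deriv[of t] DERIV_shift[THEN iffD1, OF cumhat_deriv[of "t + - 1"]]] by simp

lemma smooth1_slide: "smooth1 slide"
  unfolding slide_def[abs_def] by (intro smooth1_diff smooth1_cumhat smooth1_shift[OF smooth1_cumhat])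

lemma hat_nonneg: "hat t \<ge> 0"
  using mono_step[of "t - 1/2" "t + 1/2"] by (simp add: hat_def)

lemma step_nonneg: "step t \<ge> 0" and step_le_1: "step t \<le> 1"
  using mono_step[of "min t (-1/2)" t] mono_step[of t "max t (1/2)"]
    step_eq_0[of "min t (-1/2)"] step_eq_1[of "max t (1/2)"] by auto

lemma hat_le_1: "hat t \<le> 1"
  using step_nonneg[of "t - 1/2"] step_le_1[of "t + 1/2"] by (simp add: hat_def)

lemma hat_eq_0: "\<bar>t\<bar> \<ge> 1 \<Longrightarrow> hat t = 0"
  by (cases "t \<ge> 0") (auto simp: hat_def step_eq_0 step_eq_1)

lemma mono_cumhat: "s \<le> t \<Longrightarrow> cumhat s \<le> cumhat t"
  by (erule DERIV_nonneg_imp_nondecreasing[of s t cumhat])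
     (rule exI, rule conjI, rule cumhat_deriv, rule hat_nonneg)

lemma cumhat_eq_0: "t \<le> -1 \<Longrightarrow> cumhat t = 0"
  by (simp add: cumhat_def ramp_eq_0)

lemma cumhat_eq_1: "t \<ge> 1 \<Longrightarrow> cumhat t = 1"
  using ramp_diff[of "t - 1/2"] by (simp add: cumhat_def add.commute)

lemma slide_nonneg: "slide t \<ge> 0"
  using mono_cumhat[of "t - 1" t] by (simp add: slide_def)

lemma slide_eq_0: "t \<le> -1 \<or> t \<ge> 2 \<Longrightarrow> slide t = 0"
  by (auto simp: slide_def cumhat_eq_0 cumhat_eq_1)

lemma sum_int_telescope:
  fixes A :: "real \<Rightarrow> real"
  shows "(\<Sum>k\<in>{-int N..int N}. A (s - of_int k) - A (s - of_int k - 1)) =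
    A (s + real N) - A (s - real N - 1)"
proof (induction N)
  case (Suc N)
  have "{-int (Suc N)..int (Suc N)} = insert (-int (Suc N)) (insert (int (Suc N)) {-int N..int N})"
    by auto
  then have "(\<Sum>k\<in>{-int (Suc N)..int (Suc N)}. A (s - of_int k) - A (s - of_int k - 1)) =
    (A (s + real N + 1) - A (s + real N)) + (A (s - real N - 1) - A (s - real N - 2)) +
    (\<Sum>k\<in>{-int N..int N}. A (s - of_int k) - A (s - of_int k - 1))"
    by (simp add: diff_diff_eq2 algebra_simps)
  then show ?case unfolding Suc by (simp add: algebra_simps)
qed simp

lemma sum_hat: assumes "\<bar>s\<bar> \<le> real N" shows "(\<Sum>k\<in>{-int N..int N}. hat (s - of_int k)) = 1"
proof -
  have "(\<Sum>k\<in>{-int N..int N}. hat (s - of_int k)) =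
    (\<Sum>k\<in>{-int N..int N}. step (s + 1/2 - of_int k) - step (s + 1/2 - of_int k - 1))"
    by (simp add: hat_def algebra_simps)
  also have "\<dots> = 1"
    unfolding sum_int_telescope using assms by (simp add: step_eq_0 step_eq_1)
  finally show ?thesis .
qed

lemma sum_slide: assumes "\<bar>s\<bar> + 1 \<le> real N" shows "(\<Sum>k\<in>{-int N..int N}. slide (s - of_int k)) = 1"
  unfolding slide_def sum_int_telescope using assms by (simp add: cumhat_eq_0 cumhat_eq_1)

lemma nn_integral_hat: "(\<integral>\<^sup>+t. ennreal (hat t) \<partial>lborel) = 1"
proof -
  have "(\<integral>\<^sup>+t. ennreal (hat t) \<partial>lborel) = (\<integral>\<^sup>+t. ennreal (hat t) * indicator {-1..1} t \<partial>lborel)"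
    by (intro nn_integral_cong) (auto simp: indicator_def hat_eq_0)
  also have "\<dots> = ennreal (cumhat 1 - cumhat (-1))"
    by (rule nn_integral_FTC_Icc)
       (auto intro!: cumhat_deriv hat_nonneg borel_measurable_continuous_onI smooth1_continuous smooth1_hat)
  finally show ?thesis by (simp add: cumhat_eq_0 cumhat_eq_1)
qed

lemma integrable_bump: "integrable lborel bump" and integral_bump: "(\<integral>t. bump t \<partial>lborel) = 1"
proof -
  have "has_bochner_integral lborel (\<lambda>t. bump t * indicator {-1/2..1/2} t) (step (1/2) - step (-1/2))"
    by (rule has_bochner_integral_FTC_Icc_nonneg)
       (auto intro!: step_deriv bump_nonneg borel_measurable_continuous_onI smooth1_continuous smooth1_bump)
  moreover have "(\<lambda>t. bump t * indicator {-1/2..1/2} t) = bump"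
  proof
    fix t show "bump t * indicator {-1/2..1/2} t = bump t"
      using bump_eq_0[of t] by (cases "\<bar>t\<bar> \<ge> 1/2") (auto simp: indicator_def)
  qed
  ultimately show "integrable lborel bump" "(\<integral>t. bump t \<partial>lborel) = 1"
    by (auto simp: has_bochner_integral_iff step_eq_0 step_eq_1)
qed

section \<open>Smooth functions of three variables\<close>

lemma Ck_on_cong:
  assumes "open U" "\<And>x. x \<in> U \<Longrightarrow> f x = g x" "Ck_on k U f"
  shows "Ck_on k U g"
  using assms(2,3)
proof (induction k arbitrary: f g)
  case 0
  then show ?case using continuous_on_cong[of U U f g] by simp
next
  case (Suc k)
  have d: "(g has_derivative frechet_derivative f (at x)) (at x)" if "x \<in> U" for x
    using Suc.prems that assms(1)
    by (intro has_derivative_transform_within_open[of f _ x UNIV U g])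
       (auto simp: frechet_derivative_works[symmetric])
  have "Ck_on k U (\<lambda>x. frechet_derivative g (at x) (axis i 1))" for i
  proof (rule Suc.IH[of "\<lambda>x. frechet_derivative f (at x) (axis i 1)"])
    fix x assume "x \<in> U"
    from frechet_derivative_at[OF d[OF this]]
    show "frechet_derivative f (at x) (axis i 1) = frechet_derivative g (at x) (axis i 1)" by simp
  qed (use Suc.prems in auto)
  then show ?case using d by (auto simp: differentiable_def)
qed

lemma Ck_on_SucI:
  assumes "open U" "\<And>x. x \<in> U \<Longrightarrow> (f has_derivative f' x) (at x)"
    "\<And>i. Ck_on k U (\<lambda>x. f' x (axis i 1))"
  shows "Ck_on (Suc k) U f"
proof -
  have "Ck_on k U (\<lambda>x. frechet_derivative f (at x) (axis i 1))" for i
    by (rule Ck_on_cong[OF assms(1) _ assms(3)[of i]])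
       (use frechet_derivative_at[OF assms(2)] in force)
  then show ?thesis using assms(2) by (auto simp: differentiable_def)
qed

text \<open>A family of differentiable functions that contains its own partial derivatives consists of
  smooth functions. All smoothness proofs below exhibit such a family.\<close>

lemma smooth_on_coinduct:
  assumes U: "open U" and f: "f \<in> \<F>"
    and step: "\<And>f. f \<in> \<F> \<Longrightarrow> \<exists>f'. (\<forall>x\<in>U. (f has_derivative f' x) (at x)) \<and>
      (\<forall>i. (\<lambda>x. f' x (axis i 1)) \<in> \<F>)"
  shows "smooth_on U f"
  unfolding smooth_on_def
proof
  fix k
  show "Ck_on k U f" using f
  proof (induction k arbitrary: f)
    case 0
    then have "f differentiable (at x)" if "x \<in> U" for x
      using step[OF 0] that by (auto simp: differentiable_def)
    then show ?case
      by (auto intro!: continuous_at_imp_continuous_on differentiable_imp_continuous_within)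
  next
    case (Suc k)
    from step[OF Suc.prems] obtain f' where
      "\<forall>x\<in>U. (f has_derivative f' x) (at x)" "\<And>i. (\<lambda>x. f' x (axis i 1)) \<in> \<F>" by blast
    then show ?case using Suc.IH U by (intro Ck_on_SucI[of U f f']) auto
  qed
qed

lemma smooth_on_cong:
  "open U \<Longrightarrow> (\<And>x. x \<in> U \<Longrightarrow> f x = g x) \<Longrightarrow> smooth_on U f \<Longrightarrow> smooth_on U g"
  unfolding smooth_on_def using Ck_on_cong by blast

lemma smooth_on_subset:
  assumes "smooth_on U f" "V \<subseteq> U" shows "smooth_on V f"
proof -
  have "Ck_on k U f \<Longrightarrow> Ck_on k V f" for k f
    using assms(2) by (induction k arbitrary: f) (auto intro: continuous_on_subset)
  then show ?thesis using assms(1) by (auto simp: smooth_on_def)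
qed

lemma smooth_on_differentiable: "smooth_on U f \<Longrightarrow> x \<in> U \<Longrightarrow> f differentiable (at x)"
  by (auto simp: smooth_on_def dest: spec[of _ "Suc 0"])

lemma smooth_on_partial: "smooth_on U f \<Longrightarrow> smooth_on U (partial_d i f)"
proof -
  assume f: "smooth_on U f"
  have "Ck_on k U (partial_d i f)" for k
    using f[unfolded smooth_on_def, rule_format, of "Suc k"] by simp
  then show ?thesis by (simp add: smooth_on_def)
qed

lemma smooth_on_continuous: "smooth_on U f \<Longrightarrow> continuous_on U f"
  by (auto simp: smooth_on_def dest: spec[of _ "0"])

lemma has_derivative_partials:
  fixes f :: "real^3 \<Rightarrow> real"
  assumes "f differentiable (at x)"
  shows "(f has_derivative (\<lambda>h. \<Sum>i\<in>UNIV. h $ i * partial_d i f x)) (at x)"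
proof -
  let ?D = "frechet_derivative f (at x)"
  have D: "(f has_derivative ?D) (at x)" using assms by (simp add: frechet_derivative_works)
  interpret bounded_linear ?D by (rule has_derivative_bounded_linear[OF D])
  have "?D h = (\<Sum>i\<in>UNIV. h $ i * ?D (axis i 1))" for h
  proof -
    have "?D h = ?D (\<Sum>i\<in>UNIV. h $ i *\<^sub>R axis i 1)" by (simp add: basis_expansion flip: scalar_mult_eq_scaleR)
    then show ?thesis by (simp add: sum scaleR)
  qed
  then have "?D = (\<lambda>h. \<Sum>i\<in>UNIV. h $ i * ?D (axis i 1))" by blast
  with D show ?thesis by simp
qed

lemma smooth_on_const: "open U \<Longrightarrow> smooth_on U (\<lambda>x. c)"
  by (rule smooth_on_coinduct[where \<F>="range (\<lambda>c x. c)"])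
     (auto intro!: exI[of _ "\<lambda>x h. 0"])

lemma smooth_on_linear_combination:
  assumes U: "open U" and f: "smooth_on U f" and g: "smooth_on U g"
  shows "smooth_on U (\<lambda>x. a * f x + b * g x)"
proof (rule smooth_on_coinduct[OF U, where \<F>="{\<lambda>x. a * f x + b * g x | f g. smooth_on U f \<and> smooth_on U g}"])
  fix h assume "h \<in> {\<lambda>x. a * f x + b * g x | f g. smooth_on U f \<and> smooth_on U g}"
  then obtain f g where h: "h = (\<lambda>x. a * f x + b * g x)" "smooth_on U f" "smooth_on U g" by blast
  let ?h' = "\<lambda>x v. a * frechet_derivative f (at x) v + b * frechet_derivative g (at x) v"
  have "(h has_derivative ?h' x) (at x)" if "x \<in> U" for x
    using smooth_on_differentiable[OF h(2) that] smooth_on_differentiable[OF h(3) that] h(1)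
    by (auto intro!: derivative_eq_intros simp: frechet_derivative_works)
  then show "\<exists>h'. (\<forall>x\<in>U. (h has_derivative h' x) (at x)) \<and>
      (\<forall>i. (\<lambda>x. h' x (axis i 1)) \<in> {\<lambda>x. a * f x + b * g x | f g. smooth_on U f \<and> smooth_on U g})"
    using smooth_on_partial[OF h(2)] smooth_on_partial[OF h(3)]
  proof (intro exI[of _ ?h'] conjI ballI allI CollectI)
    fix i show "\<exists>f' g'. (\<lambda>x. a * partial_d i f x + b * partial_d i g x) = (\<lambda>x. a * f' x + b * g' x) \<and>
        smooth_on U f' \<and> smooth_on U g'"
      by (intro exI[of _ "partial_d i f"] exI[of _ "partial_d i g"] conjI refl smooth_on_partial h)
  qed
qed (use f g in blast)

lemma smooth_on_cmult: "open U \<Longrightarrow> smooth_on U f \<Longrightarrow> smooth_on U (\<lambda>x. c * f x)"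
  using smooth_on_linear_combination[of U f f c 0] by simp

lemma smooth_on_add:
  "open U \<Longrightarrow> smooth_on U f \<Longrightarrow> smooth_on U g \<Longrightarrow> smooth_on U (\<lambda>x. f x + g x)"
  using smooth_on_linear_combination[of U f g 1 1] by simp

lemma smooth_on_sum:
  "open U \<Longrightarrow> (\<And>a. a \<in> A \<Longrightarrow> smooth_on U (f a)) \<Longrightarrow> smooth_on U (\<lambda>x. \<Sum>a\<in>A. f a x)"
  by (induction A rule: infinite_finite_induct) (auto intro: smooth_on_const smooth_on_add)

text \<open>Products of functions of one coordinate each are closed under partial derivatives.\<close>

definition tensor :: "(3 \<Rightarrow> real \<Rightarrow> real) \<Rightarrow> real^3 \<Rightarrow> real" where
  "tensor f x = (\<Prod>i\<in>UNIV. f i (x $ i))"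

lemma tensor_has_derivative:
  assumes "\<And>i t. (f i has_real_derivative f' i t) (at t)"
  shows "(tensor f has_derivative (\<lambda>h. \<Sum>i\<in>UNIV. h $ i * tensor (f(i := f' i)) x)) (at x)"
proof -
  have "((\<lambda>x. f i (x $ i)) has_derivative (\<lambda>h. f' i (x $ i) * (h $ i))) (at x)" for i
    using has_derivative_compose[of "\<lambda>x. x $ i" "\<lambda>h. h $ i" x UNIV "f i"] assms[of i "x $ i"]
      bounded_linear.has_derivative[OF bounded_linear_vec_nth has_derivative_ident]
    by (auto simp: has_field_derivative_def)
  then have "(tensor f has_derivative
      (\<lambda>h. \<Sum>i\<in>UNIV. f' i (x $ i) * h $ i * (\<Prod>j\<in>UNIV - {i}. f j (x $ j)))) (at x)"
    unfolding tensor_def[abs_def] by (rule has_derivative_prod)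
  moreover have "f' i (x $ i) * h * (\<Prod>j\<in>UNIV - {i}. f j (x $ j)) = h * tensor (f(i := f' i)) x" for i h
    by (simp add: tensor_def prod.remove[of UNIV i])
  ultimately show ?thesis by simp
qed

lemma smooth1_derivs:
  assumes "\<And>i. smooth1 (f i)"
  obtains f' where "\<And>i t. (f i has_real_derivative f' i t) (at t)" "\<And>i. smooth1 (f' i)"
proof -
  have "\<exists>f'. (\<forall>t. (f i has_real_derivative f' t) (at t)) \<and> smooth1 f'" for i
    using smooth1_deriv[OF assms] by metis
  then have "\<exists>f'. \<forall>i. (\<forall>t. (f i has_real_derivative f' i t) (at t)) \<and> smooth1 (f' i)"
    by (intro choice) blast
  then show ?thesis using that by blast
qed

lemma sum_axis: "(\<Sum>j\<in>UNIV. (axis i 1 :: real^3) $ j * c j) = c i"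
proof -
  have "(\<Sum>j\<in>UNIV. (axis i 1 :: real^3) $ j * c j) = (\<Sum>j\<in>UNIV. if j = i then c j else 0)"
    by (intro sum.cong) (auto simp: axis_def)
  then show ?thesis by simp
qed

lemma smooth_on_tensor:
  assumes "\<And>i. smooth1 (f i)"
  shows "smooth_on UNIV (tensor f)"
proof (rule smooth_on_coinduct[OF open_UNIV, where \<F>="{tensor f | f. \<forall>i. smooth1 (f i)}"])
  fix h assume "h \<in> {tensor f | f. \<forall>i. smooth1 (f i)}"
  then obtain f where h: "h = tensor f" "\<And>i. smooth1 (f i)" by blast
  obtain f' where d: "\<And>i t. (f i has_real_derivative f' i t) (at t)" and f': "\<And>i. smooth1 (f' i)"
    using smooth1_derivs[of f] h(2) by blast
  show "\<exists>h'. (\<forall>x\<in>UNIV. (h has_derivative h' x) (at x)) \<and>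
      (\<forall>i. (\<lambda>x. h' x (axis i 1)) \<in> {tensor f | f. \<forall>i. smooth1 (f i)})"
  proof (intro exI conjI ballI allI)
    fix i :: 3
    have "(\<lambda>x. \<Sum>j\<in>UNIV. axis i 1 $ j * tensor (f(j := f' j)) x) = tensor (f(i := f' i))"
      by (simp only: sum_axis)
    moreover have "\<forall>j. smooth1 ((f(i := f' i)) j)" using h(2) f' by simp
    ultimately show "(\<lambda>x. \<Sum>j\<in>UNIV. axis i 1 $ j * tensor (f(j := f' j)) x) \<in>
        {tensor f | f. \<forall>i. smooth1 (f i)}" by (intro CollectI exI[of _ "f(i := f' i)"] conjI)
  next
    fix x show "(h has_derivative (\<lambda>v. \<Sum>j\<in>UNIV. v $ j * tensor (f(j := f' j)) x)) (at x)"
      unfolding h(1) by (rule tensor_has_derivative[OF d])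
  qed
next
  show "tensor f \<in> {tensor f | f. \<forall>i. smooth1 (f i)}"
    by (intro CollectI exI[of _ f] conjI allI refl assms)
qed

lemma tensor_eq_0: "f i (x $ i) = 0 \<Longrightarrow> tensor f x = 0"
  unfolding tensor_def by (rule prod_zero) auto

lemma has_derivative_integral_parameter:
  fixes f :: "real^3 \<Rightarrow> real \<Rightarrow> real"
  assumes U: "open U" "convex U" "x0 \<in> U"
    and d: "\<And>x t. x \<in> U \<Longrightarrow> t \<in> {a..b} \<Longrightarrow>
      ((\<lambda>x. f x t) has_derivative (\<lambda>h. \<Sum>i\<in>UNIV. h $ i * g i x t)) (at x)"
    and cf: "\<And>x. x \<in> U \<Longrightarrow> continuous_on {a..b} (f x)"
    and cg: "\<And>i. continuous_on (U \<times> {a..b}) (\<lambda>(x, t). g i x t)"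
  shows "((\<lambda>x. integral {a..b} (f x)) has_derivative
    (\<lambda>h. \<Sum>i\<in>UNIV. h $ i * integral {a..b} (g i x0))) (at x0)"
proof -
  define G where "G x t = (\<Sum>i\<in>UNIV. g i x t *\<^sub>R blinfun_inner_right (axis i 1 :: real^3))" for x t
  have Gapp: "blinfun_apply (G x t) = (\<lambda>h. \<Sum>i\<in>UNIV. h $ i * g i x t)" for x t
    by (rule ext) (simp add: G_def blinfun.sum_left blinfun.scaleR_left inner_axis mult.commute inner_axis')
  have cG: "continuous_on (U \<times> {a..b}) (\<lambda>(x, t). G x t)"
    unfolding G_def split_beta using cg
    by (intro continuous_intros) (simp add: split_beta)
  have "((\<lambda>x. integral (cbox a b) (f x)) has_derivative integral (cbox a b) (G x0)) (at x0 within U)"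
  proof (rule leibniz_rule)
    show "((\<lambda>x. f x t) has_derivative blinfun_apply (G x t)) (at x within U)"
      if "x \<in> U" "t \<in> cbox a b" for x t
      unfolding Gapp using d[of x t] that by (auto intro: has_derivative_at_withinI)
    show "f x integrable_on cbox a b" if "x \<in> U" for x
      using cf[OF that] integrable_continuous[of a b "f x"] by simp
  qed (use cG U in auto)
  then have "((\<lambda>x. integral {a..b} (f x)) has_derivative blinfun_apply (integral {a..b} (G x0))) (at x0)"
    using at_within_open[OF U(3,1)] by simp
  moreover have "blinfun_apply (integral {a..b} (G x0)) = (\<lambda>h. \<Sum>i\<in>UNIV. h $ i * integral {a..b} (g i x0))"
  proof
    fix h
    have c: "continuous_on {a..b} (\<lambda>t. (x0, t))" by (intro continuous_intros)
    have sub: "(\<lambda>t. (x0, t)) ` {a..b} \<subseteq> U \<times> {a..b}" using U(3) by auto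
    have cG0: "continuous_on {a..b} (G x0)"
      using continuous_on_compose2[OF cG c sub] by simp
    have cg0: "continuous_on {a..b} (g i x0)" for i

      using continuous_on_compose2[OF cg c sub] by simp
    have "blinfun_apply (integral {a..b} (G x0)) h = integral {a..b} (\<lambda>t. blinfun_apply (G x0 t) h)"
      using integral_linear[OF integrable_continuous_interval[OF cG0] blinfun.bounded_linear_left[of h]]
      by (simp add: o_def)
    also have "\<dots> = (\<Sum>i\<in>UNIV. integral {a..b} (\<lambda>t. h $ i * g i x0 t))"
      unfolding Gapp by (intro integral_sum) (auto intro!: integrable_continuous_interval continuous_intros cg0)
    finally show "blinfun_apply (integral {a..b} (G x0)) h = (\<Sum>i\<in>UNIV. h $ i * integral {a..b} (g i x0))"
      by simp
  qed
  ultimately show ?thesis by simp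
qed

section \<open>Affine changes of variables\<close>

lemma nn_integral_affine:
  fixes f :: "'a::euclidean_space \<Rightarrow> ennreal"
  assumes [measurable]: "f \<in> borel_measurable borel" and c: "c \<noteq> 0"
  shows "(\<integral>\<^sup>+x. f x \<partial>lborel) = ennreal (\<bar>c\<bar> ^ DIM('a)) * (\<integral>\<^sup>+x. f (t + c *\<^sub>R x) \<partial>lborel)"
  by (subst lborel_affine[OF c, of t])
     (simp add: nn_integral_density nn_integral_distr nn_integral_cmult)

lemma nn_integral_shift:
  fixes f :: "'a::euclidean_space \<Rightarrow> ennreal"
  assumes [measurable]: "f \<in> borel_measurable borel"
  shows "(\<integral>\<^sup>+x. f (t + x) \<partial>lborel) = (\<integral>\<^sup>+x. f x \<partial>lborel)"
  using nn_integral_affine[of f 1 t] by simp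

lemma nn_integral_reflect:
  fixes f :: "'a::euclidean_space \<Rightarrow> ennreal"
  assumes [measurable]: "f \<in> borel_measurable borel"
  shows "(\<integral>\<^sup>+x. f (t - x) \<partial>lborel) = (\<integral>\<^sup>+x. f x \<partial>lborel)"
  using nn_integral_affine[of f "-1" t] by simp

lemma integral_affine:
  fixes f :: "'a::euclidean_space \<Rightarrow> real"
  assumes [measurable]: "f \<in> borel_measurable borel" and c: "c \<noteq> 0"
  shows "(\<integral>x. f x \<partial>lborel) = \<bar>c\<bar> ^ DIM('a) * (\<integral>x. f (t + c *\<^sub>R x) \<partial>lborel)"
  by (subst lborel_affine[OF c, of t]) (simp add: integral_density integral_distr)

lemma integrable_affine:
  fixes f :: "'a::euclidean_space \<Rightarrow> real"
  assumes [measurable]: "f \<in> borel_measurable borel" and c: "c \<noteq> 0"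
  shows "integrable lborel (\<lambda>x. f (t + c *\<^sub>R x)) \<longleftrightarrow> integrable lborel f"
proof -
  have "integrable lborel f \<longleftrightarrow> integrable lborel (\<lambda>x. \<bar>c\<bar> ^ DIM('a) * f (t + c *\<^sub>R x))"
    by (subst lborel_affine[OF c, of t]) (simp add: integrable_density integrable_distr_eq)
  then show ?thesis using c by simp
qed

lemma nn_integral_prod_vec:
  fixes f :: "3 \<Rightarrow> real \<Rightarrow> real"
  assumes [measurable]: "\<And>i. f i \<in> borel_measurable borel" and nn: "\<And>i t. f i t \<ge> 0"
  shows "(\<integral>\<^sup>+x. ennreal (tensor f x) \<partial>lborel) = (\<Prod>i\<in>UNIV. \<integral>\<^sup>+t. ennreal (f i t) \<partial>lborel)"
proof -
  have B: "(Basis :: (real^3) set) = (\<lambda>i. axis i 1) ` UNIV" by (auto simp: Basis_vec_def)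
  have inj: "inj (\<lambda>i::3. axis i (1::real))" by (auto simp: inj_def axis_eq_axis)
  define g where "g b = f (inv (\<lambda>i::3. axis i (1::real)) b)" for b
  have g: "g (axis i 1) = f i" for i using inv_f_f[OF inj] by (simp add: g_def)
  have "(\<integral>\<^sup>+x. ennreal (tensor f x) \<partial>lborel) = (\<integral>\<^sup>+x. (\<Prod>b\<in>Basis. ennreal (g b (x \<bullet> b))) \<partial>lborel)"
    unfolding B using inj nn
    by (simp add: prod.reindex inj_on_def inj_def g inner_axis prod_ennreal tensor_def axis_eq_axis)
  also have "\<dots> = (\<Prod>b\<in>Basis. \<integral>\<^sup>+t. ennreal (g b t) \<partial>lborel)"
    by (rule nn_integral_lborel_prod) (auto simp: g_def)
  also have "\<dots> = (\<Prod>i\<in>UNIV. \<integral>\<^sup>+t. ennreal (f i t) \<partial>lborel)"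
    unfolding B by (simp add: prod.reindex inj_on_def g axis_eq_axis)
  finally show ?thesis .
qed

section \<open>A field with a unit point source and a smooth sink\<close>

text \<open>If \<open>b\<close> has integral one, the field \<open>Z(x) = x \<integral>\<^sub>0\<^sup>1 s\<^sup>-\<^sup>4 b(x/s) ds\<close> has divergence
  \<open>\<delta>\<^sub>0 - b\<close>: it carries the mass of \<open>b\<close> along rays to the origin. It is supported in the support of \<open>b\<close>
  when that is star-shaped.\<close>

definition ray :: "nat \<Rightarrow> (real^3 \<Rightarrow> real) \<Rightarrow> real^3 \<Rightarrow> real" where
  "ray m c x = integral {0..1} (\<lambda>s. c ((1 / s) *\<^sub>R x) / s ^ m)"

definition supported1 :: "(3 \<Rightarrow> real \<Rightarrow> real) \<Rightarrow> bool" where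
  "supported1 f \<longleftrightarrow> (\<forall>i t. \<bar>t\<bar> > 1 \<longrightarrow> f i t = 0)"

lemma tensor_supported1: "supported1 f \<Longrightarrow> \<bar>x $ i\<bar> > 1 \<Longrightarrow> tensor f x = 0"
  by (rule tensor_eq_0[of f i]) (simp add: supported1_def)

lemma ray_integrand_eq_0:
  assumes "supported1 f" "0 \<le> s" "s < \<bar>x $ i\<bar>" "m > 0"
  shows "tensor f ((1 / s) *\<^sub>R x) / s ^ m = 0"
proof (cases "s = 0")
  case False
  then show ?thesis
    using assms tensor_supported1[of f "(1 / s) *\<^sub>R x" i] by (simp add: field_simps)
qed (use assms in simp)

lemma ray_eq_integral:
  assumes "supported1 f" "0 \<le> d" "d < \<bar>x $ i\<bar>" "m > 0"
  shows "ray m (tensor f) x = integral {d..1} (\<lambda>s. tensor f ((1 / s) *\<^sub>R x) / s ^ m)"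
proof -
  have "{s\<in>{0..1} - {d..1}. tensor f ((1 / s) *\<^sub>R x) / s ^ m \<noteq> 0} = {}"
    using ray_integrand_eq_0[OF assms(1) _ _ assms(4), of _ x i] assms(2,3) by force
  moreover have "{s\<in>{d..1} - {0..1}. tensor f ((1 / s) *\<^sub>R x) / s ^ m \<noteq> 0} = {}"
    using assms(2) by auto
  ultimately show ?thesis unfolding ray_def by (intro integral_spike_set) (simp_all only: negligible_empty)
qed

lemma ray_eq_0: assumes "supported1 f" "\<bar>x $ i\<bar> > 1" "m > 0" shows "ray m (tensor f) x = 0"
proof -
  have "{1..1::real} = {1}" by auto
  then show ?thesis using ray_eq_integral[of f 1 x i m] assms by simp
qed

lemma continuous_on_tensor: "(\<And>i. smooth1 (f i)) \<Longrightarrow> continuous_on A (tensor f)"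
  using smooth_on_continuous[OF smooth_on_tensor] continuous_on_subset by blast

lemma continuous_on_ray_integrand:
  assumes "\<And>i. smooth1 (f i)" "d > 0"
  shows "continuous_on (U \<times> {d..1}) (\<lambda>(x, s). tensor f ((1 / s) *\<^sub>R x) / s ^ m)"
  using assms unfolding split_beta
  by (intro continuous_intros continuous_on_compose2[OF continuous_on_tensor[of f UNIV]]) auto

lemma continuous_on_ray_integrand1:
  assumes "\<And>i. smooth1 (f i)" "d > 0"
  shows "continuous_on {d..1} (\<lambda>s. tensor f ((1 / s) *\<^sub>R x) / s ^ m)"
  using assms by (intro continuous_intros continuous_on_compose2[OF continuous_on_tensor[of f UNIV]]) auto

lemma supported1_deriv:
  assumes "supported1 f" "\<And>i t. (f i has_real_derivative f' i t) (at t)"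
  shows "supported1 f'"
  unfolding supported1_def
proof (intro allI impI)
  fix i and t :: real assume t: "\<bar>t\<bar> > 1"
  have "((\<lambda>_. 0) has_real_derivative f' i t) (at t)"
    by (rule has_field_derivative_transform_within_open[OF assms(2)[of i t], of "{..<-1} \<union> {1<..}"])
       (use t assms(1) in \<open>auto simp: supported1_def\<close>)
  then show "f' i t = 0" using DERIV_const DERIV_unique by blast
qed

lemma supported1_upd: "supported1 f \<Longrightarrow> supported1 g \<Longrightarrow> supported1 (f(i := g i))"
  by (simp add: supported1_def)

lemma ray_has_derivative:
  assumes f: "\<And>i. smooth1 (f i)" and s: "supported1 f" and m: "m > 0"
    and f': "\<And>i t. (f i has_real_derivative f' i t) (at t)" "\<And>i. smooth1 (f' i)"
    and x0: "x0 \<noteq> 0"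
  shows "(ray m (tensor f) has_derivative
    (\<lambda>h. \<Sum>i\<in>UNIV. h $ i * ray (Suc m) (tensor (f(i := f' i))) x0)) (at x0)"
proof -
  obtain k where k: "x0 $ k \<noteq> 0" using x0 by (auto simp: vec_eq_iff)
  define d where "d = \<bar>x0 $ k\<bar> / 2"
  define U where "U = {x. d < (sgn (x0 $ k) *\<^sub>R axis k 1) \<bullet> (x :: real^3)}"
  have d: "d > 0" using k by (simp add: d_def)
  have U: "d < \<bar>x $ k\<bar>" if "x \<in> U" for x
    using that by (auto simp: U_def inner_axis' sgn_if split: if_splits)
  have x0U: "x0 \<in> U" using k by (auto simp: U_def d_def inner_axis' sgn_if)
  have oU: "open U" unfolding U_def by (rule open_halfspace_gt)
  have cU: "convex U" unfolding U_def by (rule convex_halfspace_gt)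
  let ?f = "\<lambda>f m x s. tensor f ((1 / s) *\<^sub>R x) / s ^ m"
  have f'': "smooth1 ((f(i := f' i)) j)" for i j using f f' by simp
  have s'': "supported1 (f(i := f' i))" for i
    using s supported1_deriv[OF s f'(1)] by (rule supported1_upd)
  have "((\<lambda>x. integral {d..1} (?f f m x)) has_derivative
    (\<lambda>h. \<Sum>i\<in>UNIV. h $ i * integral {d..1} (?f (f(i := f' i)) (Suc m) x0))) (at x0)"
  proof (rule has_derivative_integral_parameter[OF oU cU x0U])
    fix x s assume s: "s \<in> {d..1}"
    have "((\<lambda>x::real^3. (1 / s) *\<^sub>R x) has_derivative (\<lambda>h. (1 / s) *\<^sub>R h)) (at x)"
      by (intro derivative_intros)
    from has_derivative_compose[OF this tensor_has_derivative[of f f' "(1 / s) *\<^sub>R x", OF f'(1)]]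
    have "((\<lambda>x. tensor f ((1 / s) *\<^sub>R x)) has_derivative
      (\<lambda>h. \<Sum>i\<in>UNIV. ((1 / s) *\<^sub>R h) $ i * tensor (f(i := f' i)) ((1 / s) *\<^sub>R x))) (at x)" .
    then have "((\<lambda>x. tensor f ((1 / s) *\<^sub>R x) * (1 / s ^ m)) has_derivative
      (\<lambda>h. (\<Sum>i\<in>UNIV. ((1 / s) *\<^sub>R h) $ i * tensor (f(i := f' i)) ((1 / s) *\<^sub>R x)) * (1 / s ^ m))) (at x)"
      by (rule has_derivative_mult_left)
    then show "((\<lambda>x. ?f f m x s) has_derivative
       (\<lambda>h. \<Sum>i\<in>UNIV. h $ i * ?f (f(i := f' i)) (Suc m) x s)) (at x)"
      by (simp add: sum_divide_distrib)
  next
    fix x show "continuous_on {d..1} (?f f m x)"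
      by (rule continuous_on_ray_integrand1[OF f d])
  next
    fix i show "continuous_on (U \<times> {d..1}) (\<lambda>(x, s). ?f (f(i := f' i)) (Suc m) x s)"
      by (rule continuous_on_ray_integrand[OF f'' d])
  qed
  then have "((\<lambda>x. integral {d..1} (?f f m x)) has_derivative
    (\<lambda>h. \<Sum>i\<in>UNIV. h $ i * ray (Suc m) (tensor (f(i := f' i))) x0)) (at x0)"
    using ray_eq_integral[OF s'' less_imp_le[OF d] U[OF x0U], of "Suc m"] by simp
  then show ?thesis
    by (rule has_derivative_transform_within_open[OF _ oU x0U])
       (use ray_eq_integral[OF s less_imp_le[OF d] U m] in simp)
qed

lemma smooth_on_ray:
  assumes "\<And>i. smooth1 (f i)" "supported1 f" "m > 0"
  shows "smooth_on (- {0}) (ray m (tensor f))"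
proof -
  let ?F = "{ray m (tensor f) | m f. (\<forall>i. smooth1 (f i)) \<and> supported1 f \<and> m > 0}"
  show ?thesis
  proof (rule smooth_on_coinduct[of _ _ ?F])
    fix h assume "h \<in> ?F"
    then obtain m f where h: "h = ray m (tensor f)" "\<And>i. smooth1 (f i)" "supported1 f" "m > 0" by blast
    obtain f' where f': "\<And>i t. (f i has_real_derivative f' i t) (at t)" "\<And>i. smooth1 (f' i)"
      using smooth1_derivs[of f] h(2) by blast
    show "\<exists>h'. (\<forall>x\<in>-{0}. (h has_derivative h' x) (at x)) \<and> (\<forall>i. (\<lambda>x. h' x (axis i 1)) \<in> ?F)"
    proof (intro exI conjI ballI allI)
      fix x :: "real^3" assume "x \<in> -{0}"
      then show "(h has_derivative (\<lambda>h. \<Sum>i\<in>UNIV. h $ i * ray (Suc m) (tensor (f(i := f' i))) x)) (at x)"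
        unfolding h(1) by (intro ray_has_derivative h f') auto
    next
      fix i :: 3
      have "(\<lambda>x. \<Sum>j\<in>UNIV. axis i 1 $ j * ray (Suc m) (tensor (f(j := f' j))) x) =
          ray (Suc m) (tensor (f(i := f' i)))"
        by (simp only: sum_axis)
      moreover have "\<forall>j. smooth1 ((f(i := f' i)) j)" using h(2) f'(2) by simp
      moreover have "supported1 (f(i := f' i))"
        using h(3) supported1_deriv[OF h(3) f'(1)] by (rule supported1_upd)
      ultimately show "(\<lambda>x. \<Sum>j\<in>UNIV. axis i 1 $ j * ray (Suc m) (tensor (f(j := f' j))) x) \<in> ?F"
        by (intro CollectI exI[of _ "Suc m"] exI[of _ "f(i := f' i)"] conjI) auto
    qed
  next
    show "ray m (tensor f) \<in> ?F" using assms by (intro CollectI exI[of _ m] exI[of _ f] conjI) auto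
  qed auto
qed

text \<open>\<open>Z\<close> with \<open>b\<close> the product of three copies of \<open>hat\<close>; the factor \<open>x\<close> is absorbed into \<open>b\<close>.\<close>

definition hat3 :: "real^3 \<Rightarrow> real" where
  "hat3 = tensor (\<lambda>_. hat)"

definition moment_hat :: "3 \<Rightarrow> 3 \<Rightarrow> real \<Rightarrow> real" where
  "moment_hat i = (\<lambda>_. hat)(i := \<lambda>t. t * hat t)"

definition point_source :: "real^3 \<Rightarrow> real^3" where
  "point_source x = (\<chi> i. ray 3 (tensor (moment_hat i)) x)"

lemma tensor_moment_hat: "tensor (moment_hat i) x = x $ i * hat3 x"
  by (simp add: tensor_def hat3_def moment_hat_def prod.remove[of UNIV i])

lemma smooth1_moment_hat: "smooth1 (moment_hat i j)"
  by (simp add: moment_hat_def smooth1_hat smooth1_mult[OF smooth1_id])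

lemma supported1_moment_hat: "supported1 (moment_hat i)"
  by (auto simp: supported1_def moment_hat_def intro: hat_eq_0)

lemma smooth_on_point_source: "smooth_on (- {0}) (\<lambda>x. point_source x $ i)"
  using smooth_on_ray[of "moment_hat i" 3, OF smooth1_moment_hat supported1_moment_hat]
  by (simp add: point_source_def)

lemma point_source_eq_0: "\<bar>x $ i\<bar> > 1 \<Longrightarrow> point_source x = 0"
  by (simp add: point_source_def vec_eq_iff ray_eq_0[OF supported1_moment_hat])

lemma hat3_nonneg: "hat3 x \<ge> 0"
  by (simp add: hat3_def tensor_def prod_nonneg hat_nonneg)

lemma hat3_le_1: "hat3 x \<le> 1"
  by (simp add: hat3_def tensor_def prod_le_1 hat_nonneg hat_le_1)

lemma hat3_eq_0: "\<bar>x $ i\<bar> \<ge> 1 \<Longrightarrow> hat3 x = 0"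
  unfolding hat3_def by (intro tensor_eq_0 hat_eq_0)

lemma continuous_on_hat3: "continuous_on A hat3"
  unfolding hat3_def by (rule continuous_on_tensor) (rule smooth1_hat)

lemma borel_measurable_hat[measurable]: "hat \<in> borel_measurable borel"
  by (rule borel_measurable_continuous_onI[OF smooth1_continuous[OF smooth1_hat]])

lemma borel_measurable_hat3[measurable]: "hat3 \<in> borel_measurable borel"
  by (rule borel_measurable_continuous_onI[OF continuous_on_hat3])

lemma nn_integral_hat3: "(\<integral>\<^sup>+x. ennreal (hat3 x) \<partial>lborel) = 1"
  unfolding hat3_def by (subst nn_integral_prod_vec) (auto simp: hat_nonneg nn_integral_hat)

lemma integral_hat3: "(\<integral>x. hat3 x \<partial>lborel) = 1"
  using nn_integral_hat3 hat3_nonneg by (subst integral_eq_nn_integral) auto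

lemma borel_measurable_vec_nth'[measurable]:
  "f \<in> borel_measurable M \<Longrightarrow> (\<lambda>x. (f x :: real^3) $ i) \<in> borel_measurable M"
  by (rule measurable_compose[of f M borel]) (auto intro!: borel_measurable_continuous_onI continuous_intros)

lemma borel_measurable_vecI:
  assumes "\<And>i. (\<lambda>x. (f x :: real^3) $ i) \<in> borel_measurable M"
  shows "f \<in> borel_measurable M"
  using assms by (subst borel_measurable_euclidean_space) (auto simp: Basis_vec_def inner_axis)

lemma borel_measurable_point_source[measurable]: "point_source \<in> borel_measurable borel"
proof (rule borel_measurable_vecI)
  fix i
  have "continuous_on (- {0}) (\<lambda>x. point_source x $ i)"
    by (rule smooth_on_continuous[OF smooth_on_point_source])
  then show "(\<lambda>x. point_source x $ i) \<in> borel_measurable borel"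
    by (rule borel_measurable_continuous_countable_exceptions[rotated]) simp
qed

lemma norm_point_source_le:
  assumes "x $ i \<noteq> 0"
  shows "\<bar>point_source x $ j\<bar> \<le> 1 / (x $ i)\<^sup>2"
proof (cases "\<bar>x $ i\<bar> > 1")
  case True
  then show ?thesis by (simp add: point_source_eq_0[OF True])
next
  case False
  define d where "d = \<bar>x $ i\<bar> / 2"
  have d: "0 < d" "d < 1" "d < \<bar>x $ i\<bar>" using assms False by (auto simp: d_def)
  let ?c = "tensor (moment_hat j)"
  have c_le: "\<bar>?c y\<bar> \<le> 1" for y
  proof (cases "\<bar>y $ j\<bar> \<ge> 1")
    case True then show ?thesis by (simp add: tensor_moment_hat hat3_eq_0[of y j])
  next
    case False then show ?thesis
      using mult_le_one[of "\<bar>y $ j\<bar>" "hat3 y"] hat3_nonneg[of y] hat3_le_1[of y]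
      by (simp add: tensor_moment_hat abs_mult)
  qed
  have int: "((\<lambda>s. 1 / s ^ 3) has_integral ((- 1 / (2 * 1\<^sup>2)) - (- 1 / (2 * \<bar>x $ i\<bar>\<^sup>2)))) {\<bar>x $ i\<bar>..1}"
  proof (rule fundamental_theorem_of_calculus)
    fix s assume s: "s \<in> {\<bar>x $ i\<bar>..1}"
    then have "s > 0" using assms by auto
    then have "((\<lambda>s. - 1 / (2 * s\<^sup>2)) has_real_derivative 1 / s ^ 3) (at s within {\<bar>x $ i\<bar>..1})"
      by (auto intro!: derivative_eq_intros simp: field_simps power2_eq_square power3_eq_cube)
    then show "((\<lambda>s. - 1 / (2 * s\<^sup>2)) has_vector_derivative 1 / s ^ 3) (at s within {\<bar>x $ i\<bar>..1})"
      by (simp add: has_real_derivative_iff_has_vector_derivative)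
  qed (use False in simp)
  have "integral {d..1} (\<lambda>s. ?c ((1 / s) *\<^sub>R x) / s ^ 3) = integral {\<bar>x $ i\<bar>..1} (\<lambda>s. ?c ((1 / s) *\<^sub>R x) / s ^ 3)"
  proof (rule integral_spike_set)
    have "{s\<in>{d..1} - {\<bar>x $ i\<bar>..1}. ?c ((1 / s) *\<^sub>R x) / s ^ 3 \<noteq> 0} = {}"
    proof (rule equals0I)
      fix s assume "s \<in> {s\<in>{d..1} - {\<bar>x $ i\<bar>..1}. ?c ((1 / s) *\<^sub>R x) / s ^ 3 \<noteq> 0}"
      then show False
        using ray_integrand_eq_0[OF supported1_moment_hat[of j], of s x i 3] d(1) by auto
    qed
    then show "negligible {s\<in>{d..1} - {\<bar>x $ i\<bar>..1}. ?c ((1 / s) *\<^sub>R x) / s ^ 3 \<noteq> 0}"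
      by (simp only: negligible_empty)
    have "{s\<in>{\<bar>x $ i\<bar>..1} - {d..1}. ?c ((1 / s) *\<^sub>R x) / s ^ 3 \<noteq> 0} = {}" using d by auto
    then show "negligible {s\<in>{\<bar>x $ i\<bar>..1} - {d..1}. ?c ((1 / s) *\<^sub>R x) / s ^ 3 \<noteq> 0}"
      by (simp only: negligible_empty)
  qed
  then have eq: "point_source x $ j = integral {\<bar>x $ i\<bar>..1} (\<lambda>s. ?c ((1 / s) *\<^sub>R x) / s ^ 3)"
    using ray_eq_integral[OF supported1_moment_hat less_imp_le[OF d(1)] d(3), of 3 j] by (simp add: point_source_def)
  have "norm (integral {\<bar>x $ i\<bar>..1} (\<lambda>s. ?c ((1 / s) *\<^sub>R x) / s ^ 3)) \<le>
      integral {\<bar>x $ i\<bar>..1} (\<lambda>s. 1 / s ^ 3)"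
  proof (rule integral_norm_bound_integral)
    have "continuous_on {\<bar>x $ i\<bar>..1} (\<lambda>s. ?c ((1 / s) *\<^sub>R x) / s ^ 3)"
      by (rule continuous_on_ray_integrand1[OF smooth1_moment_hat]) (use assms in simp)
    then show "(\<lambda>s. ?c ((1 / s) *\<^sub>R x) / s ^ 3) integrable_on {\<bar>x $ i\<bar>..1}"
      by (rule integrable_continuous_interval)
    show "(\<lambda>s. 1 / s ^ 3) integrable_on {\<bar>x $ i\<bar>..1}" using int by blast
    fix s assume s: "s \<in> {\<bar>x $ i\<bar>..1}"
    then show "norm (?c ((1 / s) *\<^sub>R x) / s ^ 3) \<le> 1 / s ^ 3"
      using c_le[of "(1 / s) *\<^sub>R x"] by (auto intro!: divide_right_mono simp: abs_divide)
  qed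
  also have "\<dots> = (- 1 / (2 * 1\<^sup>2)) - (- 1 / (2 * \<bar>x $ i\<bar>\<^sup>2))" by (rule integral_unique[OF int])
  also have "\<dots> \<le> 1 / (x $ i)\<^sup>2" using assms by (simp add: field_simps)
  finally show ?thesis by (simp add: eq)
qed

text \<open>Since \<open>x\<^sub>i\<^sup>2\<close> may be any of three coordinates in the previous bound, their geometric mean may be
  taken, which reduces the integrability of \<open>\<bar>x\<bar>\<close> to the power \<open>-2p\<close> to one variable.\<close>

lemma point_source_Lp:
  assumes p: "1 \<le> p" "p < 3 / 2"
  shows "(\<integral>\<^sup>+x. ennreal (\<bar>point_source x $ j\<bar> powr p) \<partial>lborel) < \<infinity>"
proof -
  define q where "q = 2 * p / 3"
  have q: "0 < q" "q < 1" using p by (auto simp: q_def)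
  define g where "g t = (if \<bar>t\<bar> \<le> 1 then \<bar>t\<bar> powr (- q) else 0)" for t :: real
  have [measurable]: "g \<in> borel_measurable borel" unfolding g_def[abs_def] by measurable
  have ae: "AE x in lborel. x \<noteq> 0 \<and> (\<forall>i. (x::real^3) $ i \<noteq> 0)"
  proof -
    have "AE x in lborel. (x::real^3) $ i \<noteq> 0" for i
    proof -
      have "negligible {x::real^3. axis i 1 \<bullet> x = 0}"
        by (rule negligible_hyperplane) (simp add: axis_eq_0_iff)
      then have "{x::real^3. x $ i = 0} \<in> null_sets lebesgue"
        by (simp add: negligible_iff_null_sets inner_axis')
      then show ?thesis by (intro AE_I'[of "{x::real^3. x $ i = 0}"]) (auto simp: null_sets_completion_iff)
    qed
    then have "AE x in lborel. \<forall>i. (x::real^3) $ i \<noteq> 0" by (intro AE_all_countable[THEN iffD2] allI)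
    then show ?thesis by eventually_elim auto
  qed
  have "(\<integral>\<^sup>+x. ennreal (\<bar>point_source x $ j\<bar> powr p) \<partial>lborel) \<le> (\<integral>\<^sup>+x. ennreal (tensor (\<lambda>_. g) x) \<partial>lborel)"
  proof (rule nn_integral_mono_AE, use ae in eventually_elim)
    fix x :: "real^3" assume x: "x \<noteq> 0 \<and> (\<forall>i. x $ i \<noteq> 0)"
    show "ennreal (\<bar>point_source x $ j\<bar> powr p) \<le> ennreal (tensor (\<lambda>_. g) x)"
    proof (cases "\<exists>i. \<bar>x $ i\<bar> > 1")
      case True
      then show ?thesis using point_source_eq_0 by fastforce
    next
      case False
      let ?m = "\<bar>point_source x $ j\<bar>"
      have "?m powr p = (\<Prod>i\<in>(UNIV :: 3 set). ?m powr (p / 3))"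
        using p by (cases "point_source x $ j = 0") (simp_all add: powr_power)
      also have "\<dots> \<le> (\<Prod>i\<in>UNIV. \<bar>x $ i\<bar> powr (- q))"
      proof (rule prod_mono, intro conjI)
        fix i :: 3
        have "?m powr (p / 3) \<le> (1 / (x $ i)\<^sup>2) powr (p / 3)"
          using norm_point_source_le[of x i j] x p by (intro powr_mono2) auto
        also have "1 / (x $ i)\<^sup>2 = \<bar>x $ i\<bar> powr (- 2)" using x by (simp add: powr_minus powr_numeral divide_inverse)
        also have "(\<bar>x $ i\<bar> powr (- 2)) powr (p / 3) = \<bar>x $ i\<bar> powr (- q)" by (simp add: powr_powr q_def)
        finally show "?m powr (p / 3) \<le> \<bar>x $ i\<bar> powr (- q)" .
      qed simp
      also have "\<dots> = tensor (\<lambda>_. g) x" using False by (auto simp: tensor_def g_def not_less)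
      finally show ?thesis by (rule ennreal_leI)
    qed
  qed
  also have "\<dots> = (\<integral>\<^sup>+t. ennreal (g t) \<partial>lborel) ^ 3"
    by (subst nn_integral_prod_vec) (auto simp: g_def)
  also have "\<dots> < \<infinity>"
  proof -
    have half: "(\<integral>\<^sup>+t. ennreal (t powr (-q)) * indicator {0..1} t \<partial>lborel) < \<infinity>"
    proof -
      have "(\<lambda>t. t powr (-q)) integrable_on {0..1}" by (rule integrable_on_powr_from_0) (use q in auto)
      then have "((\<lambda>t. t powr (-q)) has_integral integral {0..1} (\<lambda>t. t powr (-q))) {0..1}" by (rule integrable_integral)
      from nn_integral_has_integral_lebesgue[OF _ this]
      have "(\<integral>\<^sup>+t. ennreal (indicator {0..1} t * t powr (-q)) \<partial>lborel) < \<infinity>" by simp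
      moreover have "ennreal (indicator {0..1} t * t powr (-q)) = ennreal (t powr (-q)) * indicator {0..1} t" for t
        by (simp add: indicator_def)
      ultimately show ?thesis by simp
    qed
    have "(\<integral>\<^sup>+t. ennreal (g t) \<partial>lborel) \<le>
      (\<integral>\<^sup>+t. ennreal (t powr (-q)) * indicator {0..1} t + ennreal ((-t) powr (-q)) * indicator {0..1} (-t) \<partial>lborel)"
      by (intro nn_integral_mono) (auto simp: g_def indicator_def abs_if)
    also have "\<dots> = (\<integral>\<^sup>+t. ennreal (t powr (-q)) * indicator {0..1} t \<partial>lborel) +
        (\<integral>\<^sup>+t. ennreal ((-t) powr (-q)) * indicator {0..1} (-t) \<partial>lborel)"
      by (rule nn_integral_add) auto
    also have "(\<integral>\<^sup>+t. ennreal ((-t) powr (-q)) * indicator {0..1} (-t) \<partial>lborel) =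
        (\<integral>\<^sup>+t. ennreal (t powr (-q)) * indicator {0..1} t \<partial>lborel)"
      using nn_integral_reflect[of "\<lambda>t. ennreal (t powr (-q)) * indicator {0..1} t" 0] by simp
    finally have "(\<integral>\<^sup>+t. ennreal (g t) \<partial>lborel) < \<infinity>" using half by (auto simp: top_unique less_top[symmetric])
    then show ?thesis by (simp add: power_less_top_ennreal)
  qed
  finally show ?thesis .
qed

lemma integrable_continuous_bounded_support:
  fixes f :: "'a::euclidean_space \<Rightarrow> real"
  assumes c: "continuous_on UNIV f" and z: "\<And>x. norm x > R \<Longrightarrow> f x = 0"
  shows "integrable lborel f"
proof -
  have "integrable lborel (\<lambda>x. indicator (cball 0 R) x *\<^sub>R f x)"
    by (rule borel_integrable_compact) (use c continuous_on_subset in auto)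
  moreover have "(\<lambda>x. indicator (cball 0 R) x *\<^sub>R f x) = f"
    using z by (fastforce simp: indicator_def not_le)
  ultimately show ?thesis by simp
qed

lemma bounded_continuous_bounded_support:
  fixes f :: "'a::euclidean_space \<Rightarrow> real"
  assumes c: "continuous_on UNIV f" and z: "\<And>x. norm x > R \<Longrightarrow> f x = 0"
  obtains C where "C > 0" "\<And>x. \<bar>f x\<bar> \<le> C"
proof -
  have "compact (f ` cball 0 R)"
    by (rule compact_continuous_image) (use c continuous_on_subset in auto)
  then obtain C where C: "\<And>x. norm x \<le> R \<Longrightarrow> \<bar>f x\<bar> \<le> C"
    using compact_imp_bounded by (force simp: bounded_iff)
  show ?thesis
  proof (rule that[of "max C 1"])
    fix x show "\<bar>f x\<bar> \<le> max C 1" using C[of x] z[of x] by (cases "norm x \<le> R") auto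
  qed simp
qed

text \<open>Functions whose partial derivatives are continuous and vanish outside a ball.\<close>

locale test_function =
  fixes \<phi> :: "real^3 \<Rightarrow> real" and d\<phi> :: "3 \<Rightarrow> real^3 \<Rightarrow> real" and R :: real
  assumes has_derivative: "\<And>x. (\<phi> has_derivative (\<lambda>h. \<Sum>i\<in>UNIV. h $ i * d\<phi> i x)) (at x)"
    and continuous_partial: "\<And>i. continuous_on UNIV (d\<phi> i)"
    and support: "\<And>x. norm x > R \<Longrightarrow> \<phi> x = 0" "\<And>i x. norm x > R \<Longrightarrow> d\<phi> i x = 0"
begin

lemma continuous_phi: "continuous_on UNIV \<phi>"
  by (intro continuous_at_imp_continuous_on ballI has_derivative_continuous[OF has_derivative])

lemma measurable_phi[measurable]: "\<phi> \<in> borel_measurable borel" "d\<phi> i \<in> borel_measurable borel"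
  by (auto intro: borel_measurable_continuous_onI continuous_phi continuous_partial)

text \<open>Along a ray, \<open>x \<sqdot> \<nabla>\<phi>(s x)\<close> is the derivative of \<open>\<phi>(s x)\<close>.\<close>

lemma integral_along_ray:
  "((\<lambda>s. \<Sum>i\<in>UNIV. x $ i * d\<phi> i (s *\<^sub>R x)) has_integral \<phi> x - \<phi> 0) {0..1}"
proof -
  have "((\<lambda>s. \<Sum>i\<in>UNIV. x $ i * d\<phi> i (s *\<^sub>R x)) has_integral
      (\<phi> (1 *\<^sub>R x) - \<phi> (0 *\<^sub>R x))) {0..1}"
  proof (rule fundamental_theorem_of_calculus)
    fix s :: real
    have "((\<lambda>s. s *\<^sub>R x) has_derivative (\<lambda>h. h *\<^sub>R x)) (at s within {0..1})"
      by (intro derivative_intros)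
    from has_derivative_compose[OF this has_derivative]
    have "((\<lambda>s. \<phi> (s *\<^sub>R x)) has_derivative (\<lambda>h. \<Sum>i\<in>UNIV. (h *\<^sub>R x) $ i * d\<phi> i (s *\<^sub>R x))) (at s within {0..1})" .
    moreover have "(\<lambda>h. \<Sum>i\<in>UNIV. (h *\<^sub>R x) $ i * d\<phi> i (s *\<^sub>R x)) =
        (\<lambda>h. h *\<^sub>R (\<Sum>i\<in>UNIV. x $ i * d\<phi> i (s *\<^sub>R x)))"
      by (simp add: sum_distrib_left mult.assoc)
    ultimately show "((\<lambda>s. \<phi> (s *\<^sub>R x)) has_vector_derivative (\<Sum>i\<in>UNIV. x $ i * d\<phi> i (s *\<^sub>R x)))
        (at s within {0..1})"
      by (simp add: has_vector_derivative_def)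
  qed simp
  then show ?thesis by simp
qed

text \<open>Fubini for \<open>K(s, x) = s\<^sup>-\<^sup>3 \<Sum>\<^sub>i x\<^sub>i b(x / s) \<partial>\<^sub>i\<phi>(x) / s\<close>: integrated in \<open>s\<close> first it is
  \<open>Z \<sqdot> \<nabla>\<phi>\<close>, and integrated in \<open>x = s y\<close> first it is \<open>\<integral> b(y) y \<sqdot> \<nabla>\<phi>(s y) dy\<close>.\<close>

lemma point_source_divergence:
  "integrable lborel (\<lambda>x. \<Sum>i\<in>UNIV. point_source x $ i * d\<phi> i x)" (is ?A)
  "(\<integral>x. (\<Sum>i\<in>UNIV. point_source x $ i * d\<phi> i x) \<partial>lborel) = (\<integral>x. hat3 x * \<phi> x \<partial>lborel) - \<phi> 0" (is ?B)
proof -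
  define k where "k s y = (\<Sum>i\<in>UNIV. y $ i * hat3 y * d\<phi> i (s *\<^sub>R y))" for s and y :: "real^3"
  define K where "K s x = indicator {0<..1} s * ((1 / s ^ 3) * (\<Sum>i\<in>UNIV. tensor (moment_hat i) ((1 / s) *\<^sub>R x) * d\<phi> i x))"
    for s x
  have mh[measurable]: "tensor (moment_hat i) \<in> borel_measurable borel" for i
    by (intro borel_measurable_continuous_onI continuous_on_tensor smooth1_moment_hat)
  have [measurable]: "(\<lambda>(s, x). K s x) \<in> borel_measurable (lborel \<Otimes>\<^sub>M lborel)"
    unfolding K_def by measurable
  have ck: "continuous_on UNIV (\<lambda>(s, y). k s y)"
    unfolding k_def split_beta
    by (intro continuous_intros continuous_on_compose2[OF continuous_on_hat3[of UNIV]]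
        continuous_on_compose2[OF continuous_partial]) auto
  have k0: "k s y = 0" if "norm y > 3" for s y
  proof -
    have "\<exists>i. \<bar>y $ i\<bar> \<ge> 1"
    proof (rule ccontr)
      assume "\<not> ?thesis"
      then have "(\<Sum>i\<in>UNIV. \<bar>y $ i\<bar>) \<le> (\<Sum>i\<in>(UNIV::3 set). 1)" by (intro sum_mono) (simp add: not_le less_imp_le)
      with norm_le_l1_cart[of y] that show False by simp
    qed
    then show ?thesis using hat3_eq_0 by (auto simp: k_def)
  qed
  have cks: "continuous_on UNIV (k s)" for s
  proof -
    have "continuous_on UNIV (\<lambda>y. (s, y))" by (intro continuous_intros)
    from continuous_on_compose2[OF ck this] show ?thesis by simp
  qed
  have ik: "integrable lborel (k s)" for s
    by (rule integrable_continuous_bounded_support[OF cks k0])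
  have K_scale: "K s (s *\<^sub>R y) = k s y / s ^ 3" if "s \<in> {0<..1}" for s y
    using that by (simp add: K_def k_def tensor_moment_hat sum_divide_distrib)
  have Ks[measurable]: "K s \<in> borel_measurable borel" for s unfolding K_def by measurable
  have iK: "integrable lborel (K s)" and K_eq: "(\<integral>x. K s x \<partial>lborel) = indicator {0<..1} s * (\<integral>y. k s y \<partial>lborel)"
    and nK_eq: "(\<integral>x. norm (K s x) \<partial>lborel) = indicator {0<..1} s * (\<integral>y. norm (k s y) \<partial>lborel)" for s
  proof -
    show "integrable lborel (K s)"
    proof (cases "s \<in> {0<..1}")
      case True
      then show ?thesis using integrable_affine[of "K s" s 0] ik[of s] K_scale[OF True] by simp
    next
      case False
      then have "K s = (\<lambda>_. 0)" by (auto simp: K_def)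
      then show ?thesis by simp
    qed
    show "(\<integral>x. K s x \<partial>lborel) = indicator {0<..1} s * (\<integral>y. k s y \<partial>lborel)"
    proof (cases "s \<in> {0<..1}")
      case True
      then show ?thesis using integral_affine[of "K s" s 0] K_scale[OF True] by simp
    qed (simp add: K_def)
    show "(\<integral>x. norm (K s x) \<partial>lborel) = indicator {0<..1} s * (\<integral>y. norm (k s y) \<partial>lborel)"
    proof (cases "s \<in> {0<..1}")
      case True
      then show ?thesis using integral_affine[of "\<lambda>x. norm (K s x)" s 0] K_scale[OF True] by simp
    qed (simp add: K_def)
  qed
  define kk where "kk = (\<lambda>(s, y). indicator {0..1} s * k s y)"
  have ikk: "integrable (lborel \<Otimes>\<^sub>M lborel) kk"
  proof -
    have "integrable lborel (\<lambda>z. indicator ({0..1} \<times> cball 0 3) z *\<^sub>R (\<lambda>(s, y). k s y) z)"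
      by (rule borel_integrable_compact) (auto intro!: compact_Times continuous_on_subset[OF ck])
    moreover have "(\<lambda>z. indicator ({0..1} \<times> cball 0 3) z *\<^sub>R (\<lambda>(s, y). k s y) z) = kk"
      using k0 by (fastforce simp: kk_def indicator_def not_le)
    ultimately show ?thesis by (simp add: lborel_prod)
  qed
  have AE0: "AE s in lborel. s \<noteq> (0::real)" using AE_lborel_singleton by blast
  have IK: "integrable (lborel \<Otimes>\<^sub>M lborel) (\<lambda>(s, x). K s x)"
  proof (rule lborel_pair.Fubini_integrable)
    have "integrable lborel (\<lambda>s. \<integral>y. norm (kk (s, y)) \<partial>lborel)"
      using lborel_pair.integrable_fst'[OF integrable_norm[OF ikk]] by simp
    moreover have "AE s in lborel. (\<integral>y. norm (kk (s, y)) \<partial>lborel) = (\<integral>x. norm (K s x) \<partial>lborel)"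
      using AE0 by eventually_elim (auto simp: nK_eq kk_def indicator_def simp del: real_norm_def)
    ultimately show "integrable lborel (\<lambda>s. \<integral>x. norm ((\<lambda>(s, x). K s x) (s, x)) \<partial>lborel)"
      by (subst integrable_cong_AE[symmetric]) (auto simp: kk_def k_def)
  qed (simp_all add: iK)
  have Z: "AE x in lborel. (\<integral>s. K s x \<partial>lborel) = (\<Sum>i\<in>UNIV. point_source x $ i * d\<phi> i x)"
  proof (rule AE_mp[OF AE_lborel_singleton[of 0]], intro AE_I2 impI)
    fix x :: "real^3" assume "x \<noteq> 0"
    then obtain j where j: "x $ j \<noteq> 0" by (auto simp: vec_eq_iff)
    let ?d = "\<bar>x $ j\<bar> / 2"
    have d: "0 < ?d" "?d < \<bar>x $ j\<bar>" using j by auto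
    let ?f = "\<lambda>i s. tensor (moment_hat i) ((1 / s) *\<^sub>R x) / s ^ 3"
    have c: "continuous_on {?d..1} (?f i)" for i
      by (rule continuous_on_ray_integrand1[OF smooth1_moment_hat d(1)])
    have int: "set_integrable lborel {?d..1} (?f i)" for i
      by (rule borel_integrable_atLeastAtMost') (rule c)
    have "K s x = indicator {?d..1} s *\<^sub>R (\<Sum>i\<in>UNIV. ?f i s * d\<phi> i x)" for s
    proof -
      have "?f i s = 0" if "0 < s" "s < ?d" for i
        using ray_integrand_eq_0[OF supported1_moment_hat[of i], of s x j 3] that d(2) by simp
      then have "(\<Sum>i\<in>UNIV. ?f i s * d\<phi> i x) = 0" if "0 < s" "s < ?d"
        using that by (intro sum.neutral) simp
      moreover have "K s x = indicator {0<..1} s * (\<Sum>i\<in>UNIV. ?f i s * d\<phi> i x)"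
        by (simp add: K_def sum_distrib_left)
      ultimately show ?thesis using d(1) by (auto simp: indicator_def)
    qed
    then have "(\<integral>s. K s x \<partial>lborel) = (\<integral>s. (\<Sum>i\<in>UNIV. indicator {?d..1} s *\<^sub>R ?f i s * d\<phi> i x) \<partial>lborel)"
      by (simp add: sum_distrib_left mult.assoc)
    also have "\<dots> = (\<Sum>i\<in>UNIV. (\<integral>s. indicator {?d..1} s *\<^sub>R ?f i s \<partial>lborel) * d\<phi> i x)"
    proof -
      have "integrable lborel (\<lambda>s. indicator {?d..1} s *\<^sub>R ?f i s * d\<phi> i x)" for i
        using int[of i] unfolding set_integrable_def by (rule integrable_mult_left)
      then show ?thesis
        by (subst Bochner_Integration.integral_sum) (simp_all only: integral_mult_left_zero)
    qed
    also have "\<dots> = (\<Sum>i\<in>UNIV. point_source x $ i * d\<phi> i x)"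
    proof (rule sum.cong[OF refl])
      fix i :: 3
      have "(\<integral>s. indicator {?d..1} s *\<^sub>R ?f i s \<partial>lborel) = integral {?d..1} (?f i)"
        using set_borel_integral_eq_integral(2)[OF int[of i]] by (simp add: set_lebesgue_integral_def)
      also have "\<dots> = point_source x $ i"
        using ray_eq_integral[OF supported1_moment_hat[of i] less_imp_le[OF d(1)] d(2), of 3]
        by (simp add: point_source_def)
      finally show "(\<integral>s. indicator {?d..1} s *\<^sub>R ?f i s \<partial>lborel) * d\<phi> i x = point_source x $ i * d\<phi> i x" by simp
    qed
    finally show "(\<integral>s. K s x \<partial>lborel) = (\<Sum>i\<in>UNIV. point_source x $ i * d\<phi> i x)" .
  qed
  show ?A
    using lborel_pair.integrable_snd[OF IK] by (subst integrable_cong_AE[OF _ _ Z[THEN AE_symmetric]]) auto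
  have "(\<integral>x. (\<Sum>i\<in>UNIV. point_source x $ i * d\<phi> i x) \<partial>lborel) = (\<integral>x. (\<integral>s. K s x \<partial>lborel) \<partial>lborel)"
    by (rule integral_cong_AE[OF _ _ Z[THEN AE_symmetric]]) auto
  also have "\<dots> = (\<integral>s. (\<integral>x. K s x \<partial>lborel) \<partial>lborel)"
    by (rule lborel_pair.Fubini_integral[OF IK])
  also have "\<dots> = (\<integral>s. (\<integral>y. kk (s, y) \<partial>lborel) \<partial>lborel)"
  proof (rule integral_cong_AE)
    show "AE s in lborel. (\<integral>x. K s x \<partial>lborel) = (\<integral>y. kk (s, y) \<partial>lborel)"
      using AE0 by eventually_elim (auto simp: K_eq kk_def indicator_def)
  qed (auto simp: kk_def k_def)
  also have "\<dots> = (\<integral>y. (\<integral>s. kk (s, y) \<partial>lborel) \<partial>lborel)"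
    using lborel_pair.Fubini_integral[of "\<lambda>s y. kk (s, y)"] ikk by simp
  also have "\<dots> = (\<integral>y. hat3 y * \<phi> y - hat3 y * \<phi> 0 \<partial>lborel)"
  proof (rule Bochner_Integration.integral_cong[OF refl])
    fix y :: "real^3"
    let ?g = "\<lambda>s. \<Sum>i\<in>UNIV. y $ i * d\<phi> i (s *\<^sub>R y)"
    have c: "continuous_on {0..1} ?g"
      by (intro continuous_intros continuous_on_compose2[OF continuous_partial]) auto
    have "(\<integral>s. kk (s, y) \<partial>lborel) = hat3 y * (\<integral>s. indicator {0..1} s *\<^sub>R ?g s \<partial>lborel)"
      by (simp add: kk_def k_def sum_distrib_left mult_ac flip: integral_mult_right_zero)
    also have "(\<integral>s. indicator {0..1} s *\<^sub>R ?g s \<partial>lborel) = \<phi> y - \<phi> 0"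
      using set_borel_integral_eq_integral(2)[OF borel_integrable_atLeastAtMost'[OF c]]
        integral_unique[OF integral_along_ray[of y]] by (simp add: set_lebesgue_integral_def)
    finally show "(\<integral>s. kk (s, y) \<partial>lborel) = hat3 y * \<phi> y - hat3 y * \<phi> 0" by (simp add: algebra_simps)
  qed
  also have "\<dots> = (\<integral>y. hat3 y * \<phi> y \<partial>lborel) - (\<integral>y. hat3 y * \<phi> 0 \<partial>lborel)"
  proof (rule Bochner_Integration.integral_diff)
    show "integrable lborel (\<lambda>y. hat3 y * \<phi> y)"
      by (rule integrable_continuous_bounded_support[of _ R])
         (auto intro!: continuous_intros continuous_phi continuous_on_hat3 simp: support)
    show "integrable lborel (\<lambda>y. hat3 y * \<phi> 0)"
      by (intro integrable_mult_left) (use integral_hat3 not_integrable_integral_eq in fastforce)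
  qed
  finally show ?B using integral_hat3 by simp
qed

lemma integral_partial_eq_0: "(\<integral>x. d\<phi> i x \<partial>lborel) = 0"
proof -
  let ?e = "axis i 1 :: real^3"
  define h where "h = (\<lambda>(t, x). indicator {0..1} t * d\<phi> i (x + t *\<^sub>R ?e))"
  have ch: "continuous_on UNIV (\<lambda>(t, x). d\<phi> i (x + t *\<^sub>R ?e))"
    unfolding split_beta by (intro continuous_intros continuous_on_compose2[OF continuous_partial]) auto
  have h0: "d\<phi> i (x + t *\<^sub>R ?e) = 0" if "norm x > R + 1" "t \<in> {0..1}" for t x
  proof (rule support(2))
    have "norm (t *\<^sub>R ?e) \<le> 1" using that(2) by simp
    then show "norm (x + t *\<^sub>R ?e) > R" using that(1) norm_triangle_ineq4[of "x + t *\<^sub>R ?e" "t *\<^sub>R ?e"] by simp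
  qed
  have ih: "integrable (lborel \<Otimes>\<^sub>M lborel) h"
  proof -
    have "integrable lborel (\<lambda>z. indicator ({0..1} \<times> cball 0 (R + 1)) z *\<^sub>R (\<lambda>(t, x). d\<phi> i (x + t *\<^sub>R ?e)) z)"
      by (rule borel_integrable_compact) (auto intro!: compact_Times continuous_on_subset[OF ch])
    moreover have "(\<lambda>z. indicator ({0..1} \<times> cball 0 (R + 1)) z *\<^sub>R (\<lambda>(t, x). d\<phi> i (x + t *\<^sub>R ?e)) z) = h"
      using h0 by (fastforce simp: h_def indicator_def not_le)
    ultimately show ?thesis by (simp add: lborel_prod)
  qed
  have i\<phi>: "integrable lborel \<phi>"
    by (rule integrable_continuous_bounded_support[OF continuous_phi support(1)])
  have "(\<integral>x. d\<phi> i (x + t *\<^sub>R ?e) \<partial>lborel) = (\<integral>x. d\<phi> i x \<partial>lborel)" for t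
    using integral_affine[of "d\<phi> i" 1 "t *\<^sub>R ?e"] by (simp add: add.commute)
  then have "(\<integral>t. (\<integral>x. h (t, x) \<partial>lborel) \<partial>lborel) = (\<integral>t. indicator {0..1::real} t * (\<integral>x. d\<phi> i x \<partial>lborel) \<partial>lborel)"
    by (simp add: h_def)
  also have "\<dots> = (\<integral>x. d\<phi> i x \<partial>lborel)" by (simp add: content_real)
  finally have "(\<integral>x. d\<phi> i x \<partial>lborel) = (\<integral>t. (\<integral>x. h (t, x) \<partial>lborel) \<partial>lborel)" ..
  also have "\<dots> = (\<integral>x. (\<integral>t. h (t, x) \<partial>lborel) \<partial>lborel)"
    using lborel_pair.Fubini_integral[of "\<lambda>t x. h (t, x)"] ih by simp
  also have "\<dots> = (\<integral>x. \<phi> (?e + 1 *\<^sub>R x) - \<phi> x \<partial>lborel)"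
  proof (rule Bochner_Integration.integral_cong[OF refl])
    fix x :: "real^3"
    let ?g = "\<lambda>t. d\<phi> i (x + t *\<^sub>R ?e)"
    have c: "continuous_on {0..1} ?g"
      by (intro continuous_intros continuous_on_compose2[OF continuous_partial]) auto
    have "(?g has_integral (\<phi> (x + 1 *\<^sub>R ?e) - \<phi> (x + 0 *\<^sub>R ?e))) {0..1}"
    proof (rule fundamental_theorem_of_calculus)
      fix t :: real
      have "((\<lambda>t. x + t *\<^sub>R ?e) has_derivative (\<lambda>h. h *\<^sub>R ?e)) (at t within {0..1})"
        by (auto intro!: derivative_eq_intros)
      from has_derivative_compose[OF this has_derivative]
      have "((\<lambda>t. \<phi> (x + t *\<^sub>R ?e)) has_derivative
          (\<lambda>h. \<Sum>j\<in>UNIV. (h *\<^sub>R ?e) $ j * d\<phi> j (x + t *\<^sub>R ?e))) (at t within {0..1})" .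
      moreover have "(\<Sum>j\<in>UNIV. (h *\<^sub>R ?e) $ j * d\<phi> j (x + t *\<^sub>R ?e)) = h *\<^sub>R ?g t" for h
        using sum_axis[of i "\<lambda>j. h * d\<phi> j (x + t *\<^sub>R ?e)"] by (simp add: mult_ac)
      ultimately show "((\<lambda>t. \<phi> (x + t *\<^sub>R ?e)) has_vector_derivative ?g t) (at t within {0..1})"
        by (simp add: has_vector_derivative_def)
    qed simp
    then have "integral {0..1} ?g = \<phi> (x + ?e) - \<phi> x" by (simp add: integral_unique)
    moreover have "(\<integral>t. h (t, x) \<partial>lborel) = integral {0..1} ?g"
      using set_borel_integral_eq_integral(2)[OF borel_integrable_atLeastAtMost'[OF c]]
      by (simp add: set_lebesgue_integral_def h_def)
    ultimately show "(\<integral>t. h (t, x) \<partial>lborel) = \<phi> (?e + 1 *\<^sub>R x) - \<phi> x" by (simp add: add.commute)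
  qed
  also have "\<dots> = (\<integral>x. \<phi> (?e + 1 *\<^sub>R x) \<partial>lborel) - (\<integral>x. \<phi> x \<partial>lborel)"
    using integrable_affine[of \<phi> 1 ?e] i\<phi> by (intro Bochner_Integration.integral_diff) auto
  also have "\<dots> = 0" using integral_affine[of \<phi> 1 ?e] by simp
  finally show ?thesis .
qed

lemma test_function_mult_tensor:
  assumes f: "\<And>i. smooth1 (f i)" and f': "\<And>i t. (f i has_real_derivative f' i t) (at t)" "\<And>i. smooth1 (f' i)"
  shows "test_function (\<lambda>x. tensor f x * \<phi> x)
    (\<lambda>i x. tensor (f(i := f' i)) x * \<phi> x + tensor f x * d\<phi> i x) R"
proof
  fix x :: "real^3"
  have "((\<lambda>x. tensor f x * \<phi> x) has_derivative
     (\<lambda>h. tensor f x * (\<Sum>i\<in>UNIV. h $ i * d\<phi> i x) + (\<Sum>i\<in>UNIV. h $ i * tensor (f(i := f' i)) x) * \<phi> x)) (at x)"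
    by (rule has_derivative_mult[OF tensor_has_derivative[OF f'(1)] has_derivative])
  moreover have "(\<lambda>h. tensor f x * (\<Sum>i\<in>UNIV. h $ i * d\<phi> i x) + (\<Sum>i\<in>UNIV. h $ i * tensor (f(i := f' i)) x) * \<phi> x) =
     (\<lambda>h :: real^3. \<Sum>i\<in>UNIV. h $ i * (tensor (f(i := f' i)) x * \<phi> x + tensor f x * d\<phi> i x))"
  proof
    fix h :: "real^3"
    have "tensor f x * (\<Sum>i\<in>UNIV. h $ i * d\<phi> i x) + (\<Sum>i\<in>UNIV. h $ i * tensor (f(i := f' i)) x) * \<phi> x =
        (\<Sum>i\<in>UNIV. tensor f x * (h $ i * d\<phi> i x) + h $ i * tensor (f(i := f' i)) x * \<phi> x)"
      by (simp only: sum_distrib_left sum_distrib_right sum.distrib)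
    also have "\<dots> = (\<Sum>i\<in>UNIV. h $ i * (tensor (f(i := f' i)) x * \<phi> x + tensor f x * d\<phi> i x))"
      by (intro sum.cong refl) (simp add: algebra_simps)
    finally show "tensor f x * (\<Sum>i\<in>UNIV. h $ i * d\<phi> i x) + (\<Sum>i\<in>UNIV. h $ i * tensor (f(i := f' i)) x) * \<phi> x =
        (\<Sum>i\<in>UNIV. h $ i * (tensor (f(i := f' i)) x * \<phi> x + tensor f x * d\<phi> i x))" .
  qed
  ultimately show "((\<lambda>x. tensor f x * \<phi> x) has_derivative
     (\<lambda>h. \<Sum>i\<in>UNIV. h $ i * (tensor (f(i := f' i)) x * \<phi> x + tensor f x * d\<phi> i x))) (at x)" by simp
next
  fix i
  have "smooth1 ((f(i := f' i)) j)" for j using f f'(2) by simp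
  then show "continuous_on UNIV (\<lambda>x. tensor (f(i := f' i)) x * \<phi> x + tensor f x * d\<phi> i x)"
    by (intro continuous_intros continuous_phi continuous_partial continuous_on_tensor f)
qed (simp_all add: support)

lemma integral_by_parts:
  assumes f: "\<And>i. smooth1 (f i)" and f': "\<And>i t. (f i has_real_derivative f' i t) (at t)" "\<And>i. smooth1 (f' i)"
  shows "(\<integral>x. tensor f x * d\<phi> i x \<partial>lborel) = - (\<integral>x. tensor (f(i := f' i)) x * \<phi> x \<partial>lborel)"
    and "integrable lborel (\<lambda>x. tensor f x * d\<phi> i x)"
proof -
  have "smooth1 ((f(i := f' i)) j)" for j using f f'(2) by simp
  then have "integrable lborel (\<lambda>x. tensor (f(i := f' i)) x * \<phi> x)"
    by (intro integrable_continuous_bounded_support[of _ R])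
       (auto intro!: continuous_intros continuous_phi continuous_on_tensor simp: support)
  moreover show "integrable lborel (\<lambda>x. tensor f x * d\<phi> i x)"
    by (intro integrable_continuous_bounded_support[of _ R])
       (auto intro!: continuous_intros continuous_partial continuous_on_tensor f simp: support)
  ultimately show "(\<integral>x. tensor f x * d\<phi> i x \<partial>lborel) = - (\<integral>x. tensor (f(i := f' i)) x * \<phi> x \<partial>lborel)"
    using test_function.integral_partial_eq_0[OF test_function_mult_tensor[of f f', OF f f'], where i=i] by simp
qed

lemma test_function_affine:
  assumes "\<epsilon> > 0"
  shows "test_function (\<lambda>y. \<phi> (c + \<epsilon> *\<^sub>R y)) (\<lambda>i y. \<epsilon> * d\<phi> i (c + \<epsilon> *\<^sub>R y)) ((R + norm c) / \<epsilon>)"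
proof
  fix x
  have "((\<lambda>y. c + \<epsilon> *\<^sub>R y) has_derivative (\<lambda>h. \<epsilon> *\<^sub>R h)) (at x)" by (auto intro!: derivative_eq_intros)
  from has_derivative_compose[OF this has_derivative]
  have "((\<lambda>y. \<phi> (c + \<epsilon> *\<^sub>R y)) has_derivative (\<lambda>h. \<Sum>i\<in>UNIV. (\<epsilon> *\<^sub>R h) $ i * d\<phi> i (c + \<epsilon> *\<^sub>R x))) (at x)" .
  then show "((\<lambda>y. \<phi> (c + \<epsilon> *\<^sub>R y)) has_derivative (\<lambda>h. \<Sum>i\<in>UNIV. h $ i * (\<epsilon> * d\<phi> i (c + \<epsilon> *\<^sub>R x)))) (at x)"
    by (simp add: mult_ac)
next
  fix i show "continuous_on UNIV (\<lambda>y. \<epsilon> * d\<phi> i (c + \<epsilon> *\<^sub>R y))"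
    by (intro continuous_intros continuous_on_compose2[OF continuous_partial]) auto
next
  have far: "norm (c + \<epsilon> *\<^sub>R y) > R" if "norm y > (R + norm c) / \<epsilon>" for y
  proof -
    have "\<epsilon> * norm y > R + norm c" using that assms by (simp add: field_simps)
    then show ?thesis using norm_triangle_ineq4[of "c + \<epsilon> *\<^sub>R y" c] assms by simp
  qed
  show "\<phi> (c + \<epsilon> *\<^sub>R y) = 0" if "norm y > (R + norm c) / \<epsilon>" for y by (rule support(1)[OF far[OF that]])
  show "\<epsilon> * d\<phi> i (c + \<epsilon> *\<^sub>R y) = 0" if "norm y > (R + norm c) / \<epsilon>" for i y
    using support(2)[OF far[OF that]] by simp
qed

lemma scaled_point_source_divergence:
  assumes e: "\<epsilon> > 0"
  shows "integrable lborel (\<lambda>x. \<Sum>i\<in>UNIV. point_source ((1 / \<epsilon>) *\<^sub>R (x - c)) $ i / \<epsilon>\<^sup>2 * d\<phi> i x)" (is ?A)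
  "(\<integral>x. (\<Sum>i\<in>UNIV. point_source ((1 / \<epsilon>) *\<^sub>R (x - c)) $ i / \<epsilon>\<^sup>2 * d\<phi> i x) \<partial>lborel) =
    (\<integral>x. hat3 ((1 / \<epsilon>) *\<^sub>R (x - c)) * \<phi> x \<partial>lborel) / \<epsilon> ^ 3 - \<phi> c" (is ?B)
proof -
  interpret s: test_function "\<lambda>y. \<phi> (c + \<epsilon> *\<^sub>R y)" "\<lambda>i y. \<epsilon> * d\<phi> i (c + \<epsilon> *\<^sub>R y)" "(R + norm c) / \<epsilon>"
    by (rule test_function_affine[OF e])
  let ?f = "\<lambda>x. \<Sum>i\<in>UNIV. point_source ((1 / \<epsilon>) *\<^sub>R (x - c)) $ i / \<epsilon>\<^sup>2 * d\<phi> i x"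
  let ?g = "\<lambda>x. hat3 ((1 / \<epsilon>) *\<^sub>R (x - c)) * \<phi> x"
  have f: "?f (c + \<epsilon> *\<^sub>R y) = (1 / \<epsilon> ^ 3) * (\<Sum>i\<in>UNIV. point_source y $ i * (\<epsilon> * d\<phi> i (c + \<epsilon> *\<^sub>R y)))" for y
    using e by (simp add: sum_distrib_left power2_eq_square power3_eq_cube)
  have g: "?g (c + \<epsilon> *\<^sub>R y) = hat3 y * \<phi> (c + \<epsilon> *\<^sub>R y)" for y using e by simp
  have mf: "?f \<in> borel_measurable borel" "?g \<in> borel_measurable borel" by measurable
  have "integrable lborel (\<lambda>y. ?f (c + \<epsilon> *\<^sub>R y))"
    unfolding f using s.point_source_divergence(1) by simp
  then show ?A using integrable_affine[OF mf(1), of \<epsilon> c] e by simp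
  show ?B
    using integral_affine[OF mf(1), of \<epsilon> c] integral_affine[OF mf(2), of \<epsilon> c] s.point_source_divergence(2) e
    unfolding f g by simp
qed

end

lemma test_function_of_test_functions:
  assumes "\<phi> \<in> test_functions U"
  obtains R where "test_function \<phi> (\<lambda>i. partial_d i \<phi>) R"
proof -
  let ?S = "closure {x. \<phi> x \<noteq> 0}"
  have s: "smooth_on UNIV \<phi>" and c: "compact ?S" using assms by (auto simp: test_functions_def)
  obtain R where R: "\<And>x. x \<in> ?S \<Longrightarrow> norm x \<le> R" using compact_imp_bounded[OF c] by (auto simp: bounded_iff)
  have 0: "\<phi> x = 0" if "norm x > R" for x using R[of x] closure_subset[of "{x. \<phi> x \<noteq> 0}"] that by force
  have "test_function \<phi> (\<lambda>i. partial_d i \<phi>) R"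
  proof
    show "(\<phi> has_derivative (\<lambda>h. \<Sum>i\<in>UNIV. h $ i * partial_d i \<phi> x)) (at x)" for x
      by (rule has_derivative_partials[OF smooth_on_differentiable[OF s]]) simp
    show "continuous_on UNIV (partial_d i \<phi>)" for i
      by (rule smooth_on_continuous[OF smooth_on_partial[OF s]])
    fix i :: 3 and x :: "real^3" assume x: "norm x > R"
    have "(\<phi> has_derivative (\<lambda>h. 0)) (at x)"
    proof (rule has_derivative_transform_within_open[OF has_derivative_const[of 0]])
      show "open (- cball 0 R :: (real^3) set)" by auto
    qed (use x 0 in auto)
    from frechet_derivative_at[OF this, symmetric] show "partial_d i \<phi> x = 0" by (simp only:)
  qed (rule 0)
  then show ?thesis by (rule that)
qed

lemma partial_eq_0_outside:
  assumes "\<phi> \<in> test_functions U" "x \<notin> U"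
  shows "partial_d i \<phi> x = 0" "\<phi> x = 0"
proof -
  let ?S = "closure {x. \<phi> x \<noteq> 0}"
  have x: "x \<notin> ?S" using assms by (auto simp: test_functions_def)
  have out: "\<phi> y = 0" if "y \<notin> ?S" for y using closure_subset[of "{x. \<phi> x \<noteq> 0}"] that by auto
  then show "\<phi> x = 0" using x by blast
  have "(\<phi> has_derivative (\<lambda>h. 0)) (at x)"
  proof (rule has_derivative_transform_within_open[OF has_derivative_const[of 0]])
    show "open (- ?S)" by auto
    show "x \<in> - ?S" using x by blast
    show "0 = \<phi> y" if "y \<in> - ?S" for y
      by (rule out[symmetric]) (use that in blast)
  qed
  from frechet_derivative_at[OF this, symmetric] show "partial_d i \<phi> x = 0" by (simp only:)
qed

section \<open>Continuity of translations and dilations in \<open>L\<^sup>p\<close>\<close>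

definition Lpow :: "real \<Rightarrow> (real^3 \<Rightarrow> real) \<Rightarrow> ennreal" where
  "Lpow p f = (\<integral>\<^sup>+x. ennreal (\<bar>f x\<bar> powr p) \<partial>lborel)"

lemma powr_add_le:
  fixes a b :: real
  assumes "p \<ge> 0"
  shows "\<bar>a + b\<bar> powr p \<le> 2 powr p * (\<bar>a\<bar> powr p + \<bar>b\<bar> powr p)"
proof -
  have "\<bar>a + b\<bar> powr p \<le> (2 * max \<bar>a\<bar> \<bar>b\<bar>) powr p"
    using assms by (intro powr_mono2) auto
  also have "\<dots> = 2 powr p * (max \<bar>a\<bar> \<bar>b\<bar>) powr p" by (simp add: powr_mult)
  also have "(max \<bar>a\<bar> \<bar>b\<bar>) powr p \<le> \<bar>a\<bar> powr p + \<bar>b\<bar> powr p" by (simp add: max_def)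
  finally show ?thesis by simp
qed

lemma Lpow_add_le:
  assumes "p \<ge> 0" and [measurable]: "f \<in> borel_measurable borel" "g \<in> borel_measurable borel"
  shows "Lpow p (\<lambda>x. f x + g x) \<le> ennreal (2 powr p) * (Lpow p f + Lpow p g)"
proof -
  have "Lpow p (\<lambda>x. f x + g x) \<le>
      (\<integral>\<^sup>+x. ennreal (2 powr p) * (ennreal (\<bar>f x\<bar> powr p) + ennreal (\<bar>g x\<bar> powr p)) \<partial>lborel)"
    unfolding Lpow_def
    by (intro nn_integral_mono) (use powr_add_le[OF assms(1)] in \<open>simp flip: ennreal_plus ennreal_mult\<close>)
  also have "\<dots> = ennreal (2 powr p) * (Lpow p f + Lpow p g)"
    unfolding Lpow_def by (subst nn_integral_cmult) (auto simp: nn_integral_add)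
  finally show ?thesis .
qed

lemma Lpow_cmult:
  assumes [measurable]: "f \<in> borel_measurable borel"
  shows "Lpow p (\<lambda>x. c * f x) = ennreal (\<bar>c\<bar> powr p) * Lpow p f"
  unfolding Lpow_def by (subst nn_integral_cmult[symmetric]) (auto simp: abs_mult powr_mult ennreal_mult)

lemma Lpow_mono: "(\<And>x. \<bar>f x\<bar> \<le> \<bar>g x\<bar>) \<Longrightarrow> p \<ge> 0 \<Longrightarrow> Lpow p f \<le> Lpow p g"
  unfolding Lpow_def by (intro nn_integral_mono ennreal_leI powr_mono2) auto

lemma Lpow_minus: "Lpow p (\<lambda>x. - f x) = Lpow p f"
  by (simp add: Lpow_def)

lemma Lpow_affine:
  assumes [measurable]: "f \<in> borel_measurable borel" and c: "c \<noteq> 0"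
  shows "Lpow p f = ennreal (\<bar>c\<bar> ^ 3) * Lpow p (\<lambda>x. f (t + c *\<^sub>R x))"
  unfolding Lpow_def using nn_integral_affine[of "\<lambda>x. ennreal (\<bar>f x\<bar> powr p)" c t] c by simp

text \<open>Dominated convergence in the form used throughout: \<open>f\<^sub>n \<rightarrow> 0\<close> almost everywhere, below a fixed
  function with finite \<open>Lpow\<close>.\<close>

lemma Lpow_tendsto_0:
  assumes p: "p > 0" and [measurable]: "\<And>n. f n \<in> borel_measurable borel" "g \<in> borel_measurable borel"
    and g: "Lpow p g < \<infinity>" and le: "\<And>n x. \<bar>f n x\<bar> \<le> \<bar>g x\<bar>"
    and lim: "AE x in lborel. (\<lambda>n. f n x) \<longlonglongrightarrow> 0"
  shows "(\<lambda>n. Lpow p (f n)) \<longlonglongrightarrow> 0"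
proof -
  have "(\<lambda>n. \<integral>\<^sup>+x. ennreal (norm (0 - \<bar>f n x\<bar> powr p)) \<partial>lborel) \<longlonglongrightarrow> 0"
  proof (rule nn_integral_dominated_convergence_norm[where w="\<lambda>x. \<bar>g x\<bar> powr p"])
    show "(\<integral>\<^sup>+x. ennreal (\<bar>g x\<bar> powr p) \<partial>lborel) < \<infinity>" using g by (simp add: Lpow_def)
    show "AE x in lborel. norm (\<bar>f n x\<bar> powr p) \<le> \<bar>g x\<bar> powr p" for n
      using p le by (intro AE_I2) (simp add: powr_mono2)
    show "AE x in lborel. (\<lambda>n. \<bar>f n x\<bar> powr p) \<longlonglongrightarrow> 0"
      using lim
    proof eventually_elim
      case (elim x)
      have "(\<lambda>n. \<bar>f n x\<bar> powr p) \<longlonglongrightarrow> \<bar>0\<bar> powr p"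
        by (intro tendsto_powr' tendsto_rabs elim tendsto_const) (use p in auto)
      then show ?case using p by simp
    qed
  qed auto
  then show ?thesis by (simp add: Lpow_def)
qed

lemma tendsto_0_ennreal_less:
  fixes u :: "nat \<Rightarrow> ennreal"
  assumes "u \<longlonglongrightarrow> 0" "e > 0"
  obtains n where "u n < e"
  using order_tendstoD(2)[OF assms] that unfolding eventually_sequentially by blast

definition clamp1 :: "real \<Rightarrow> real \<Rightarrow> real" where
  "clamp1 M t = max (- M) (min M t)"

lemma abs_clamp1: "M \<ge> 0 \<Longrightarrow> \<bar>clamp1 M t\<bar> \<le> M" and clamp1_id: "\<bar>t\<bar> \<le> M \<Longrightarrow> clamp1 M t = t"
  and abs_diff_clamp1: "M \<ge> 0 \<Longrightarrow> \<bar>t - clamp1 M t\<bar> \<le> \<bar>t\<bar>"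
  by (auto simp: clamp1_def)

lemma Lpow_dense_bounded:
  fixes f :: "real^3 \<Rightarrow> real"
  assumes p: "p > 0" and [measurable]: "f \<in> borel_measurable borel" and fin: "Lpow p f < \<infinity>" and e: "e > 0"
  obtains n :: nat where "Lpow p (\<lambda>x. f x - (if norm x \<le> real n then clamp1 (real n) (f x) else 0)) < e"
proof -
  let ?F = "\<lambda>n x. if norm x \<le> real n then clamp1 (real n) (f x) else 0"
  have "(\<lambda>n. Lpow p (\<lambda>x. f x - ?F n x)) \<longlonglongrightarrow> 0"
  proof (rule Lpow_tendsto_0[OF p _ _ fin])
    show "(\<lambda>x. f x - ?F n x) \<in> borel_measurable borel" for n unfolding clamp1_def by measurable
    show "\<bar>f x - ?F n x\<bar> \<le> \<bar>f x\<bar>" for n x using abs_diff_clamp1[of "real n" "f x"] by auto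
    show "AE x in lborel. (\<lambda>n. f x - ?F n x) \<longlonglongrightarrow> 0"
    proof (rule AE_I2)
      fix x
      have "\<forall>\<^sub>F n in sequentially. max (norm x) \<bar>f x\<bar> \<le> real n"
        using eventually_ge_at_top[of "nat \<lceil>max (norm x) \<bar>f x\<bar>\<rceil>"] by eventually_elim linarith
      then have "\<forall>\<^sub>F n in sequentially. 0 = f x - ?F n x" by eventually_elim (simp add: clamp1_id)
      then show "(\<lambda>n. f x - ?F n x) \<longlonglongrightarrow> 0" by (rule Lim_transform_eventually[OF tendsto_const])
    qed
  qed auto
  from tendsto_0_ennreal_less[OF this e] that show ?thesis by metis
qed

lemma Lpow_indicator_cball:
  "p > 0 \<Longrightarrow> Lpow p (\<lambda>x. if norm x \<le> R then M else 0) = ennreal (\<bar>M\<bar> powr p) * emeasure lborel (cball 0 R :: (real^3) set)"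
proof -
  have "ennreal (\<bar>if norm x \<le> R then M else 0\<bar> powr p) = ennreal (\<bar>M\<bar> powr p) * indicator (cball 0 R) x"
    if "p > 0" for x :: "real^3" using that by (simp add: indicator_def)
  then show "p > 0 \<Longrightarrow> ?thesis" unfolding Lpow_def by (simp add: nn_integral_cmult_indicator)
qed

lemma Lpow_dense_continuous:
  fixes f :: "real^3 \<Rightarrow> real"
  assumes p: "p > 0" and f[measurable]: "f \<in> borel_measurable borel" and fin: "Lpow p f < \<infinity>" and e: "(e::real) > 0"
  obtains g R where "continuous_on UNIV g" "\<And>x. norm x > R \<Longrightarrow> g x = 0" "Lpow p (\<lambda>x. f x - g x) < ennreal e"
proof -
  define c where "c = 2 powr p"
  have c: "c > 0" by (simp add: c_def)
  define e' where "e' = ennreal (e / (4 * c))"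
  have e': "e' > 0" using e c by (simp add: e'_def)
  obtain n :: nat where n: "Lpow p (\<lambda>x. f x - (if norm x \<le> real n then clamp1 (real n) (f x) else 0)) < e'"
    by (rule Lpow_dense_bounded[OF p f fin e'])
  define F where "F x = (if norm x \<le> real n then clamp1 (real n) (f x) else 0)" for x
  have F[measurable]: "F \<in> borel_measurable borel" unfolding F_def clamp1_def by measurable
  have absF: "\<bar>F x\<bar> \<le> real n" and F0: "norm x > real n \<Longrightarrow> F x = 0" for x
    by (auto simp: F_def intro: abs_clamp1)
  have "F \<in> borel_measurable (lebesgue_on UNIV)"
    using measurable_completion[of F lborel borel] F by simp
  then have "F measurable_on UNIV" by (subst measurable_on_iff_borel_measurable) auto
  then obtain N g where N: "negligible N" and g: "\<And>k. continuous_on UNIV (g k)"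
    and lim: "\<And>x. x \<notin> N \<Longrightarrow> (\<lambda>k. g k x) \<longlonglongrightarrow> F x"
    by (auto simp: measurable_on_def)
  define G where "G k x = clamp1 (real n) (g k x) * max 0 (min 1 (real n + 1 - norm x))" for k x
  have cG: "continuous_on UNIV (G k)" for k
    unfolding G_def clamp1_def by (intro continuous_intros g)
  have [measurable]: "G k \<in> borel_measurable borel" for k by (rule borel_measurable_continuous_onI[OF cG])
  have absG: "\<bar>G k x\<bar> \<le> real n" for k x
  proof -
    have "\<bar>G k x\<bar> = \<bar>clamp1 (real n) (g k x)\<bar> * \<bar>max 0 (min 1 (real n + 1 - norm x))\<bar>" by (simp add: G_def abs_mult)
    also have "\<dots> \<le> real n * 1" by (intro mult_mono abs_clamp1) auto
    finally show ?thesis by simp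
  qed
  have G0: "G k x = 0" if "norm x > real n + 1" for k x using that by (simp add: G_def)
  have "(\<lambda>k. Lpow p (\<lambda>x. F x - G k x)) \<longlonglongrightarrow> 0"
  proof (rule Lpow_tendsto_0[OF p, where g="\<lambda>x. if norm x \<le> real n + 1 then 2 * real n else 0"])
    show "Lpow p (\<lambda>x. if norm x \<le> real n + 1 then 2 * real n else 0) < \<infinity>"
      using p emeasure_lborel_cball_finite[of "0 :: real^3" "real n + 1"]
      by (simp add: Lpow_indicator_cball ennreal_mult_less_top)
    show "\<bar>F x - G k x\<bar> \<le> \<bar>if norm x \<le> real n + 1 then 2 * real n else 0\<bar>" for k x
      using absF[of x] absG[of k x] F0[of x] G0[of x k] by auto
    have "N \<in> null_sets lebesgue" using N by (simp add: negligible_iff_null_sets)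
    then have "AE x in lborel. x \<notin> N"
      by (metis AE_not_in AE_completion_iff)
    then show "AE x in lborel. (\<lambda>k. F x - G k x) \<longlonglongrightarrow> 0"
    proof eventually_elim
      case (elim x)
      have "(\<lambda>k. G k x) \<longlonglongrightarrow> clamp1 (real n) (F x) * max 0 (min 1 (real n + 1 - norm x))"
        unfolding G_def clamp1_def by (intro tendsto_intros lim elim)
      moreover have "clamp1 (real n) (F x) * max 0 (min 1 (real n + 1 - norm x)) = F x"
        using absF[of x] F0[of x] by (cases "norm x \<le> real n") (auto simp: clamp1_id)
      ultimately have "(\<lambda>k. G k x) \<longlonglongrightarrow> F x" by simp
      from tendsto_diff[OF tendsto_const[of "F x"] this] show ?case by simp
    qed
  qed auto
  then obtain k where k: "Lpow p (\<lambda>x. F x - G k x) < e'"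
    using tendsto_0_ennreal_less[OF _ e'] by metis
  have "Lpow p (\<lambda>x. f x - G k x) = Lpow p (\<lambda>x. (f x - F x) + (F x - G k x))" by simp
  also have "\<dots> \<le> ennreal c * (Lpow p (\<lambda>x. f x - F x) + Lpow p (\<lambda>x. F x - G k x))"
    unfolding c_def by (rule Lpow_add_le) (use p in auto)
  also have "\<dots> \<le> ennreal c * (e' + e')"
    using n k by (intro mult_left_mono add_mono) (auto simp: F_def)
  also have "\<dots> = ennreal (e / 2)"
    using c e by (simp add: e'_def field_simps flip: ennreal_mult ennreal_plus)
  also have "\<dots> < ennreal e" using e by (simp add: ennreal_less_iff)
  finally show ?thesis using that[OF cG G0] by blast
qed

lemma Lpow_perturb_continuous:
  fixes g :: "real^3 \<Rightarrow> real"
  assumes p: "p \<ge> 1" and g: "continuous_on UNIV g" and g0: "\<And>x. norm x > R \<Longrightarrow> g x = 0" and e: "e > 0"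
  obtains d where "d > 0"
    "\<And>c v. \<bar>c - 1\<bar> < d \<Longrightarrow> norm v < d \<Longrightarrow> Lpow p (\<lambda>x. g (v + c *\<^sub>R x) - g x) \<le> ennreal e"
proof -
  define M where "M = 2 * (\<bar>R\<bar> + 1)"
  define V where "V = measure lborel (cball 0 M :: (real^3) set)"
  define \<eta> where "\<eta> = min 1 (e / (V + 1))"
  have V: "V \<ge> 0" by (simp add: V_def)
  have \<eta>: "\<eta> > 0" "\<eta> \<le> 1" using e V by (auto simp: \<eta>_def)
  have "uniformly_continuous_on (cball 0 (2 * M + 1)) g"
    by (rule compact_uniformly_continuous) (use g continuous_on_subset in auto)
  then obtain d where d: "d > 0" and dd: "\<And>x y. norm x \<le> 2 * M + 1 \<Longrightarrow> norm y \<le> 2 * M + 1 \<Longrightarrow> dist x y < d \<Longrightarrow> \<bar>g x - g y\<bar> < \<eta>"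
    using \<eta>(1) unfolding uniformly_continuous_on_def by (metis mem_cball_0 dist_real_def)
  define d' where "d' = min (1/2) (d / (M + 1))"
  have M: "M > 0" by (simp add: M_def)
  have d': "d' > 0" "d' \<le> 1/2" "d' * (M + 1) \<le> d"
  proof -
    show "d' > 0" using d M by (simp add: d'_def)
    show "d' \<le> 1/2" unfolding d'_def by (rule min.cobounded1)
    have "d' \<le> d / (M + 1)" by (simp add: d'_def)
    then show "d' * (M + 1) \<le> d" using M by (simp add: pos_le_divide_eq)
  qed
  show ?thesis
  proof (rule that[OF d'(1)])
    fix c :: real and v :: "real^3" assume c: "\<bar>c - 1\<bar> < d'" and v: "norm v < d'"
    have le: "\<bar>g (v + c *\<^sub>R x) - g x\<bar> \<le> \<bar>if norm x \<le> M then \<eta> else 0\<bar>" for x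
    proof (cases "norm x \<le> M")
      case True
      have "norm (v + c *\<^sub>R x - x) = norm (v + (c - 1) *\<^sub>R x)" by (simp add: algebra_simps)
      also have "\<dots> \<le> norm v + \<bar>c - 1\<bar> * norm x" using norm_triangle_ineq[of v "(c - 1) *\<^sub>R x"] by simp
      also have "\<dots> < d' + d' * M" using c v True M by (intro add_less_le_mono mult_mono) auto
      also have "\<dots> \<le> d" using d'(3) by (simp add: algebra_simps)
      finally have "norm (v + c *\<^sub>R x - x) < d" .
      moreover have "norm (v + c *\<^sub>R x) \<le> 1 + 2 * M"
      proof -
        have "norm (v + c *\<^sub>R x) \<le> norm v + \<bar>c\<bar> * norm x" using norm_triangle_ineq[of v "c *\<^sub>R x"] by simp
        also have "\<dots> \<le> 1 + 2 * M" using c v True d' M by (intro add_mono mult_mono) auto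
        finally show ?thesis .
      qed
      ultimately show ?thesis using dd[of "v + c *\<^sub>R x" x] True M \<eta> by (simp add: dist_norm)
    next
      case False
      have "\<bar>c\<bar> \<ge> 1/2" using c d'(2) by linarith
      then have "norm (c *\<^sub>R x) \<ge> (1/2) * norm x" unfolding norm_scaleR by (rule mult_right_mono) simp
      then have "norm (v + c *\<^sub>R x) > R"
        using False v d' norm_triangle_ineq2[of "c *\<^sub>R x" "- v"] by (simp add: M_def add.commute)
      moreover have "norm x > R" using False by (simp add: M_def)
      ultimately show ?thesis using g0 False by simp
    qed
    have "Lpow p (\<lambda>x. g (v + c *\<^sub>R x) - g x) \<le> Lpow p (\<lambda>x :: real^3. if norm x \<le> M then \<eta> else 0)"
      by (rule Lpow_mono[OF le]) (use p in simp)
    also have "\<dots> = ennreal (\<eta> powr p * V)"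
    proof -
      have "emeasure lborel (cball 0 M :: (real^3) set) = ennreal V"
        unfolding V_def using emeasure_lborel_cball_finite[of "0 :: real^3" M]
        by (intro emeasure_eq_ennreal_measure) auto
      then show ?thesis using p \<eta> V by (simp add: Lpow_indicator_cball ennreal_mult)
    qed
    also have "\<eta> powr p * V \<le> \<eta> * V"
      using \<eta> p V powr_mono'[of 1 p \<eta>] by (intro mult_right_mono) auto
    also have "\<dots> \<le> e / (V + 1) * (V + 1)" using \<eta> V e by (intro mult_mono) (auto simp: \<eta>_def)
    also have "\<dots> = e" using V by simp
    finally show "Lpow p (\<lambda>x. g (v + c *\<^sub>R x) - g x) \<le> ennreal e" by (simp add: ennreal_leI)
  qed
qed

text \<open>By approximation with continuous functions that vanish outside a ball, which are uniformly
  continuous.\<close>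

lemma Lpow_perturb:
  fixes f :: "real^3 \<Rightarrow> real"
  assumes p: "p \<ge> 1" and f[measurable]: "f \<in> borel_measurable borel" and fin: "Lpow p f < \<infinity>" and e: "e > 0"
  obtains d where "d > 0"
    "\<And>c v. \<bar>c - 1\<bar> < d \<Longrightarrow> norm v < d \<Longrightarrow> Lpow p (\<lambda>x. f (v + c *\<^sub>R x) - f x) \<le> ennreal e"
proof -
  define K where "K = 2 powr p"
  have K: "K > 0" by (simp add: K_def)
  define e' where "e' = e / (16 * K + 16 * K * K)"
  have e': "e' > 0" using e K by (simp add: e'_def add_pos_pos)
  obtain g R where g: "continuous_on UNIV g" "\<And>x. norm x > R \<Longrightarrow> g x = 0" "Lpow p (\<lambda>x. f x - g x) < ennreal e'"
    by (rule Lpow_dense_continuous[OF _ f fin e']) (use p in simp, rule that)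
  obtain d where d: "d > 0" and dd: "\<And>c v. \<bar>c - 1\<bar> < d \<Longrightarrow> norm v < d \<Longrightarrow> Lpow p (\<lambda>x. g (v + c *\<^sub>R x) - g x) \<le> ennreal e'"
    by (rule Lpow_perturb_continuous[OF p g(1) _ e', of R]) (rule g(2), assumption, rule that)
  have [measurable]: "g \<in> borel_measurable borel" by (rule borel_measurable_continuous_onI[OF g(1)])
  show ?thesis
  proof (rule that[of "min d (1/2)"])
    fix c :: real and v :: "real^3" assume c: "\<bar>c - 1\<bar> < min d (1/2)" and v: "norm v < min d (1/2)"
    have "\<bar>c - 1\<bar> < 1/2" using c by simp
    then have c2: "c \<ge> 1/2" by linarith
    have "ennreal (1/8) * Lpow p (\<lambda>x. f (v + c *\<^sub>R x) - g (v + c *\<^sub>R x)) \<le>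
        ennreal (\<bar>c\<bar> ^ 3) * Lpow p (\<lambda>x. f (v + c *\<^sub>R x) - g (v + c *\<^sub>R x))"
      using power_mono[of "1/2" c 3] c2 by (intro mult_right_mono ennreal_leI) (auto simp: power3_eq_cube)
    also have "\<dots> = Lpow p (\<lambda>x. f x - g x)"
      using Lpow_affine[of "\<lambda>x. f x - g x" c p v] c2 by simp
    also have "\<dots> \<le> ennreal e'" using g(3) by simp
    finally have "ennreal 8 * (ennreal (1/8) * Lpow p (\<lambda>x. f (v + c *\<^sub>R x) - g (v + c *\<^sub>R x))) \<le> ennreal 8 * ennreal e'"
      by (intro mult_left_mono) auto
    then have 1: "Lpow p (\<lambda>x. f (v + c *\<^sub>R x) - g (v + c *\<^sub>R x)) \<le> ennreal (8 * e')"
    proof -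
      have "ennreal 8 * ennreal (1/8) = 1" by (subst ennreal_mult[symmetric]) auto
      moreover have "ennreal 8 * ennreal e' = ennreal (8 * e')" by (rule ennreal_mult[symmetric]) (use e' in auto)
      ultimately show ?thesis
        using \<open>ennreal 8 * (ennreal (1/8) * _) \<le> _\<close> by (simp only: mult.assoc[symmetric] mult_1)
    qed
    have 2: "Lpow p (\<lambda>x. g (v + c *\<^sub>R x) - g x) \<le> ennreal e'" using dd c v by simp
    have 3: "Lpow p (\<lambda>x. g x - f x) \<le> ennreal e'"
      using g(3) Lpow_minus[of p "\<lambda>x. f x - g x"] by simp
    have "Lpow p (\<lambda>x. f (v + c *\<^sub>R x) - f x) =
        Lpow p (\<lambda>x. (f (v + c *\<^sub>R x) - g (v + c *\<^sub>R x)) + ((g (v + c *\<^sub>R x) - g x) + (g x - f x)))" by simp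
    also have "\<dots> \<le> ennreal K * (Lpow p (\<lambda>x. f (v + c *\<^sub>R x) - g (v + c *\<^sub>R x)) +
        Lpow p (\<lambda>x. (g (v + c *\<^sub>R x) - g x) + (g x - f x)))"
      unfolding K_def by (rule Lpow_add_le) (use p in auto)
    also have "\<dots> \<le> ennreal K * (ennreal (8 * e') + ennreal K * (ennreal e' + ennreal e'))"
    proof (intro mult_left_mono add_mono 1)
      have "Lpow p (\<lambda>x. (g (v + c *\<^sub>R x) - g x) + (g x - f x)) \<le>
          ennreal K * (Lpow p (\<lambda>x. g (v + c *\<^sub>R x) - g x) + Lpow p (\<lambda>x. g x - f x))"
        unfolding K_def by (rule Lpow_add_le) (use p in auto)
      also have "\<dots> \<le> ennreal K * (ennreal e' + ennreal e')" by (intro mult_left_mono add_mono 2 3) simp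
      finally show "Lpow p (\<lambda>x. (g (v + c *\<^sub>R x) - g x) + (g x - f x)) \<le> \<dots>" .
    qed simp
    also have "\<dots> = ennreal ((8 * K + 2 * K * K) * e')"
      using e' K by (simp add: algebra_simps flip: ennreal_mult ennreal_plus)
    also have "\<dots> \<le> ennreal e"
    proof (rule ennreal_leI)
      have "(8 * K + 2 * K * K) * e' \<le> (16 * K + 16 * K * K) * e'" using K e' by (intro mult_right_mono) auto
      also have "\<dots> = e"
      proof -
        have "16 * K + 16 * K * K > 0" using K by (intro add_pos_pos mult_pos_pos) auto
        then show ?thesis by (simp add: e'_def)
      qed
      finally show "(8 * K + 2 * K * K) * e' \<le> e" .
    qed
    finally show "Lpow p (\<lambda>x. f (v + c *\<^sub>R x) - f x) \<le> ennreal e" .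
  qed (use d in auto)
qed

section \<open>Slicing into faces of cubes\<close>

lemma exhaust_index: "k = i \<or> k = i + 1 \<or> k = i + 2" for i k :: 3
  using exhaust_3[of i] exhaust_3[of k] by auto

lemma UNIV_index: "(UNIV :: 3 set) = {i, i + 1, i + 2}"
  using exhaust_index[of _ i] by blast

lemma sum_index: "(\<Sum>k\<in>UNIV. g k) = g i + g (i + 1) + g (i + 2)" for g :: "3 \<Rightarrow> 'a::comm_monoid_add"
  by (subst UNIV_index[of i]) (simp add: add.assoc)

lemma prod_index: "(\<Prod>k\<in>UNIV. g k) = g i * g (i + 1) * g (i + 2)" for g :: "3 \<Rightarrow> 'a::comm_monoid_mult"
  by (subst UNIV_index[of i]) (simp add: mult.assoc)

definition in_plane :: "3 \<Rightarrow> real \<times> real \<Rightarrow> real^3" where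
  "in_plane i u = (\<chi> k. if k = i then 0 else if k = i + 1 then fst u else snd u)"

lemma face_point_eq: "face_point x0 r i s y = x0 + (s * (r / 2)) *\<^sub>R axis i 1 + in_plane i y"
  by (auto simp: face_point_def in_plane_def vec_eq_iff axis_def)

lemma continuous_on_in_plane[continuous_intros]:
  "continuous_on A f \<Longrightarrow> continuous_on A (\<lambda>x. in_plane i (f x))"
  unfolding in_plane_def
proof (rule continuous_on_vec_lambda)
  fix k assume "continuous_on A f"
  then show "continuous_on A (\<lambda>x. if k = i then 0 else if k = i + 1 then fst (f x) else snd (f x))"
    by (cases "k = i"; cases "k = i + 1") (auto intro!: continuous_intros)
qed

lemma measurable_in_plane[measurable]: "in_plane i \<in> borel \<rightarrow>\<^sub>M borel"
  by (intro borel_measurable_continuous_onI continuous_intros)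

lemma norm_in_plane_le: "norm (in_plane i u) \<le> \<bar>fst u\<bar> + \<bar>snd u\<bar>"
proof -
  have "norm (in_plane i u) \<le> (\<Sum>k\<in>UNIV. \<bar>in_plane i u $ k\<bar>)" by (rule norm_le_l1_cart)
  also have "\<dots> = \<bar>fst u\<bar> + \<bar>snd u\<bar>" by (subst sum_index[of _ i]) (simp add: in_plane_def)
  finally show ?thesis .
qed

lemma lborel_slice:
  "distr (lborel :: (real \<times> real \<times> real) measure) borel (\<lambda>(t, u). t *\<^sub>R axis i 1 + in_plane i u) = lborel"
proof (rule lborel_eqI[symmetric])
  let ?T = "\<lambda>(t, u). t *\<^sub>R axis i 1 + in_plane i u"
  have m: "?T \<in> borel \<rightarrow>\<^sub>M borel"
    unfolding split_beta by (intro borel_measurable_continuous_onI continuous_intros)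
  fix l u :: "real^3" assume le: "\<And>b. b \<in> Basis \<Longrightarrow> l \<bullet> b \<le> u \<bullet> b"
  have le': "l $ k \<le> u $ k" for k using le[of "axis k 1"] by (simp add: inner_axis)
  have v: "?T -` box l u = box (l $ i, l $ (i + 1), l $ (i + 2)) (u $ i, u $ (i + 1), u $ (i + 2))"
  proof (intro set_eqI)
    fix z :: "real \<times> real \<times> real"
    obtain t a b where z: "z = (t, a, b)" by (cases z) auto
    have all: "(\<forall>k. P k) \<longleftrightarrow> P i \<and> P (i + 1) \<and> P (i + 2)" for P
      using exhaust_index[of _ i] by metis
    show "z \<in> ?T -` box l u \<longleftrightarrow> z \<in> box (l $ i, l $ (i + 1), l $ (i + 2)) (u $ i, u $ (i + 1), u $ (i + 2))"
      unfolding z by (auto simp: mem_box_cart all in_plane_def axis_def mem_box Basis_prod_def)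
  qed
  have "emeasure (distr lborel borel ?T) (box l u) = emeasure lborel (?T -` box l u)"
    using m by (subst emeasure_distr) auto
  also have "\<dots> = ennreal ((u $ i - l $ i) * ((u $ (i + 1) - l $ (i + 1)) * (u $ (i + 2) - l $ (i + 2))))"
    unfolding v using le' by (subst emeasure_lborel_box) (auto simp: Basis_prod_def prod.union_disjoint prod.reindex inj_on_def)
  also have "\<dots> = (\<Prod>b\<in>Basis. (u - l) \<bullet> b)"
  proof -
    have B: "(Basis :: (real^3) set) = (\<lambda>i. axis i 1) ` UNIV" by (auto simp: Basis_vec_def)
    have "(\<Prod>b\<in>Basis. (u - l) \<bullet> b) = (\<Prod>k\<in>UNIV. u $ k - l $ k)"
      unfolding B by (subst prod.reindex) (auto simp: inj_on_def axis_eq_axis inner_axis)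
    also have "\<dots> = (u $ i - l $ i) * (u $ (i + 1) - l $ (i + 1)) * (u $ (i + 2) - l $ (i + 2))"
      by (rule prod_index)
    finally show ?thesis by (simp add: mult.assoc)
  qed
  finally show "emeasure (distr lborel borel ?T) (box l u) = (\<Prod>b\<in>Basis. (u - l) \<bullet> b)" .
qed simp

lemma measurable_slice[measurable]:
  "(\<lambda>(t, u). c + t *\<^sub>R axis i 1 + in_plane i u) \<in> (borel :: (real \<times> real \<times> real) measure) \<rightarrow>\<^sub>M borel"
  unfolding split_beta by (intro borel_measurable_continuous_onI continuous_intros)

lemma nn_integral_slice:
  fixes f :: "real^3 \<Rightarrow> ennreal"
  assumes [measurable]: "f \<in> borel_measurable borel"
  shows "(\<integral>\<^sup>+x. f x \<partial>lborel) =
    (\<integral>\<^sup>+t. (\<integral>\<^sup>+u. f (c + t *\<^sub>R axis i 1 + in_plane i u) \<partial>lborel) \<partial>lborel)"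
proof -
  have m: "(\<lambda>(t, u). t *\<^sub>R axis i 1 + in_plane i u) \<in> (borel :: (real \<times> real \<times> real) measure) \<rightarrow>\<^sub>M borel"
    using measurable_slice[of 0 i] by simp
  have "(\<integral>\<^sup>+x. f x \<partial>lborel) = (\<integral>\<^sup>+x. f (c + x) \<partial>lborel)" by (rule nn_integral_shift[symmetric]) fact
  also have "\<dots> = (\<integral>\<^sup>+z. f (c + (\<lambda>(t, u). t *\<^sub>R axis i 1 + in_plane i u) z) \<partial>lborel)"
    by (subst lborel_slice[of i, symmetric], subst nn_integral_distr) (use m in auto)
  also have "\<dots> = (\<integral>\<^sup>+t. (\<integral>\<^sup>+u. f (c + t *\<^sub>R axis i 1 + in_plane i u) \<partial>lborel) \<partial>lborel)"
  proof -
    have "(\<integral>\<^sup>+z. f (c + (\<lambda>(t, u). t *\<^sub>R axis i 1 + in_plane i u) z) \<partial>lborel) =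
      (\<integral>\<^sup>+z. f (c + (\<lambda>(t, u). t *\<^sub>R axis i 1 + in_plane i u) z)
        \<partial>((lborel :: real measure) \<Otimes>\<^sub>M (lborel :: (real \<times> real) measure)))"
      by (simp only: lborel_prod)
    also have "\<dots> = (\<integral>\<^sup>+t. (\<integral>\<^sup>+u. f (c + (\<lambda>(t, u). t *\<^sub>R axis i 1 + in_plane i u) (t, u)) \<partial>lborel) \<partial>lborel)"
      using m by (subst lborel.nn_integral_fst[symmetric]) (auto simp: lborel_prod)
    finally show ?thesis by (simp add: add.assoc)
  qed
  finally show ?thesis .
qed

text \<open>The union of the faces \<open>\<plusminus>e\<^sub>i\<close> of all cubes about \<open>c\<close>, whose distance from \<open>c\<close> is half the side.\<close>

lemma nn_integral_faces:
  fixes f :: "real^3 \<Rightarrow> ennreal"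
  assumes [measurable]: "f \<in> borel_measurable borel" and s: "s \<in> {-1, 1}"
  shows "(\<integral>\<^sup>+r. (\<integral>\<^sup>+u. f (c + (s * (r / 2)) *\<^sub>R axis i 1 + in_plane i u) \<partial>lborel) \<partial>lborel) =
    2 * (\<integral>\<^sup>+x. f x \<partial>lborel)"
proof -
  let ?g = "\<lambda>t. \<integral>\<^sup>+u. f (c + t *\<^sub>R axis i 1 + in_plane i u) \<partial>lborel"
  have [measurable]: "?g \<in> borel_measurable borel" by measurable
  have "(\<integral>\<^sup>+x. f x \<partial>lborel) = (\<integral>\<^sup>+t. ?g t \<partial>lborel)" by (rule nn_integral_slice) fact
  also have "\<dots> = ennreal (1/2) * (\<integral>\<^sup>+r. ?g (s * (r / 2)) \<partial>lborel)"
    using nn_integral_affine[of ?g "s / 2" 0] s by auto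
  finally have "2 * (\<integral>\<^sup>+x. f x \<partial>lborel) = (ennreal 2 * ennreal (1/2)) * (\<integral>\<^sup>+r. ?g (s * (r / 2)) \<partial>lborel)"
    by (simp add: mult.assoc)
  also have "ennreal 2 * ennreal (1/2) = 1" by (subst ennreal_mult[symmetric]) auto
  finally show ?thesis by simp
qed

lemma AE_faces:
  assumes P: "AE x in lborel. P x" and s: "s \<in> {-1, 1}"
  shows "AE r in lborel. AE u in lborel. P (c + (s * (r / 2)) *\<^sub>R axis i 1 + in_plane i u)"
proof -
  obtain N where N: "N \<in> sets lborel" "emeasure lborel N = 0" "{x. \<not> P x} \<subseteq> N"
    using P by (auto elim!: AE_E)
  have [measurable]: "N \<in> sets borel" using N by simp
  have "(\<integral>\<^sup>+r. (\<integral>\<^sup>+u. indicator N (c + (s * (r / 2)) *\<^sub>R axis i 1 + in_plane i u) \<partial>lborel) \<partial>lborel) = 0"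
    using nn_integral_faces[of "indicator N" s c i] s N by simp
  then have "AE r in lborel. (\<integral>\<^sup>+u. indicator N (c + (s * (r / 2)) *\<^sub>R axis i 1 + in_plane i u) \<partial>lborel) = (0::ennreal)"
    by (subst (asm) nn_integral_0_iff_AE) auto
  then show ?thesis
  proof eventually_elim
    case (elim r)
    then have "AE u in lborel. indicator N (c + (s * (r / 2)) *\<^sub>R axis i 1 + in_plane i u) = (0::ennreal)"
      by (subst (asm) nn_integral_0_iff_AE) auto
    then show ?case
      by eventually_elim (use N(3) in \<open>auto simp: indicator_def split: if_splits\<close>)
  qed
qed

section \<open>Flux of a vector field through the boundary of a cube\<close>

definition sup2 :: "real \<times> real \<Rightarrow> real" where
  "sup2 u = max \<bar>fst u\<bar> \<bar>snd u\<bar>"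

lemma measurable_sup2[measurable]: "sup2 \<in> borel_measurable borel"
  unfolding sup2_def[abs_def] by (intro borel_measurable_continuous_onI continuous_intros)

definition face_integral :: "(real^3 \<Rightarrow> real^3) \<Rightarrow> 3 \<Rightarrow> real^3 \<Rightarrow> real \<Rightarrow> real" where
  "face_integral X i c r = (\<integral>u. (if sup2 u < r / 2 then X (c + in_plane i u) $ i else 0) \<partial>lborel)"

definition field_flux :: "(real^3 \<Rightarrow> real^3) \<Rightarrow> real^3 \<Rightarrow> real \<Rightarrow> real" where
  "field_flux X x0 r = 1 / (2 * pi) * (\<Sum>i\<in>UNIV.
     face_integral X i (x0 + (r / 2) *\<^sub>R axis i 1) r - face_integral X i (x0 - (r / 2) *\<^sub>R axis i 1) r)"

lemma measurable_face_integral[measurable]: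
  assumes [measurable]: "X \<in> borel_measurable borel" "f \<in> borel_measurable M" "g \<in> borel_measurable M"
  shows "(\<lambda>z. face_integral X i (f z) (g z)) \<in> borel_measurable M"
  unfolding face_integral_def by measurable

lemma measurable_field_flux[measurable]:
  assumes [measurable]: "X \<in> borel_measurable borel" "f \<in> borel_measurable M" "g \<in> borel_measurable M"
  shows "(\<lambda>z. field_flux X (f z) (g z)) \<in> borel_measurable M"
  unfolding field_flux_def by measurable

definition field_of :: "two_form \<Rightarrow> real^3 \<Rightarrow> real^3" where
  "field_of F x = (\<chi> i. F x $ (i + 1) $ (i + 2))"

lemma field_of_nth:
  "field_of F x $ 1 = F x $ 2 $ 3" "field_of F x $ 2 = F x $ 3 $ 1" "field_of F x $ 3 = F x $ 1 $ 2"
proof -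
  have "(1 :: 3) + 1 = 2" "(1 :: 3) + 2 = 3" "(2 :: 3) + 1 = 3" "(2 :: 3) + 2 = 1"
    "(3 :: 3) + 1 = 1" "(3 :: 3) + 2 = 2" by simp_all
  then show "field_of F x $ 1 = F x $ 2 $ 3" "field_of F x $ 2 = F x $ 3 $ 1" "field_of F x $ 3 = F x $ 1 $ 2"
    by (simp_all only: field_of_def vec_lambda_beta)
qed

lemma infnorm_eq_component:
  fixes v :: "real^3"
  assumes "\<And>k. \<bar>v $ k\<bar> \<le> \<bar>v $ i\<bar>"
  shows "infnorm v = \<bar>v $ i\<bar>"
proof (rule antisym)
  show "infnorm v \<le> \<bar>v $ i\<bar>"
    unfolding infnorm_Max using assms by (subst Max_le_iff) (auto simp: Basis_vec_def inner_axis)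
  show "\<bar>v $ i\<bar> \<le> infnorm v" by (rule component_le_infnorm_cart)
qed

lemma star_wedge_on_face:
  assumes s: "s \<in> {-1, 1}" and y: "\<bar>fst y\<bar> < r / 2" "\<bar>snd y\<bar> < r / 2"
    and alt: "F (face_point x0 r i s y) $ 1 $ 3 = - F (face_point x0 r i s y) $ 3 $ 1"
  shows "star_wedge_d F (cube_norm x0) (face_point x0 r i s y) = s * field_of F (face_point x0 r i s y) $ i"
proof -
  let ?p = "face_point x0 r i s y"
  define U where "U = (\<Inter>k\<in>UNIV - {i}. {x. \<bar>(x - x0) $ k\<bar> < s * (x - x0) $ i})"
  have oU: "open U" unfolding U_def
    by (intro open_INT finite_Diff finite ballI open_Collect_less continuous_intros)
  have pU: "?p \<in> U"
    using s y by (auto simp: U_def face_point_def)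
  have eq: "s * (x - x0) $ i = cube_norm x0 x" if "x \<in> U" for x
  proof -
    have lt: "\<bar>(x - x0) $ k\<bar> < s * (x - x0) $ i" if "k \<noteq> i" for k using \<open>x \<in> U\<close> that by (auto simp: U_def)
    have pos: "s * (x - x0) $ i > 0" using lt[of "i + 1"] by simp
    then have abs: "s * (x - x0) $ i = \<bar>(x - x0) $ i\<bar>" using s by auto
    show ?thesis
      unfolding cube_norm_def abs
      by (rule infnorm_eq_component[symmetric]) (use lt abs in \<open>force intro: less_imp_le\<close>)
  qed
  have "((\<lambda>x. s * (x - x0) $ i) has_derivative (\<lambda>h. s * h $ i)) (at ?p)"
    by (auto intro!: derivative_eq_intros bounded_linear.has_derivative[OF bounded_linear_vec_nth])
  then have "(cube_norm x0 has_derivative (\<lambda>h. s * h $ i)) (at ?p)"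
    by (rule has_derivative_transform_within_open[OF _ oU pU eq])
  from frechet_derivative_at[OF this, symmetric]
  have "frechet_derivative (cube_norm x0) (at ?p) = (\<lambda>h. s * h $ i)" .
  then show ?thesis
    using exhaust_3[of i] alt by (auto simp: star_wedge_d_def Let_def axis_def field_of_nth)
qed

text \<open>The restriction of an \<open>L\<^sup>p\<close> form to faces sees only a Borel representative, for almost every
  side length.\<close>

definition represents :: "(real^3 \<Rightarrow> real^3) \<Rightarrow> two_form \<Rightarrow> bool" where
  "represents X F \<longleftrightarrow> X \<in> borel_measurable borel \<and> (\<forall>x. x \<notin> B3 \<longrightarrow> X x = 0) \<and>
     (AE x in lborel. x \<in> B3 \<longrightarrow> X x = field_of F x)"

definition max_side :: "real^3 \<Rightarrow> real" where
  "max_side x0 = 1 / sqrt 3 * infdist x0 (frontier B3)"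

lemma infdist_frontier_ball:
  fixes x0 :: "real^3"
  assumes "x0 \<in> B3" shows "infdist x0 (frontier B3) = 1 - norm x0"
proof -
  have fr: "frontier B3 = sphere (0 :: real^3) 1" by (simp add: frontier_ball)
  obtain e :: "real^3" where e: "norm e = 1" "norm x0 *\<^sub>R e = x0"
  proof (cases "x0 = 0")
    case True then show ?thesis using that[of "axis 1 1"] by simp
  next
    case False then show ?thesis using that[of "x0 /\<^sub>R norm x0"] by simp
  qed
  have ne: "sphere (0 :: real^3) 1 \<noteq> {}" using e(1) by auto
  have "infdist x0 (sphere 0 1) \<le> dist x0 e" by (rule infdist_le) (use e in simp)
  also have "dist x0 e = norm ((norm x0 - 1) *\<^sub>R e)" by (simp add: dist_norm scaleR_diff_left e(2))
  also have "\<dots> = 1 - norm x0" using assms e(1) by simp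
  finally have 1: "infdist x0 (sphere 0 1) \<le> 1 - norm x0" .
  have "1 - norm x0 \<le> infdist x0 (sphere 0 1)"
    unfolding infdist_notempty[OF ne]
  proof (rule cINF_greatest[OF ne])
    fix y :: "real^3" assume "y \<in> sphere 0 1"
    then show "1 - norm x0 \<le> dist x0 y" using norm_triangle_ineq2[of y x0] by (simp add: dist_norm norm_minus_commute)
  qed
  with 1 show ?thesis unfolding fr by simp
qed

lemma face_point_in_ball:
  assumes x0: "x0 \<in> B3" and r: "0 < r" "r < max_side x0" and s: "s \<in> {-1, 1}"
    and y: "\<bar>fst y\<bar> < r / 2" "\<bar>snd y\<bar> < r / 2"
  shows "face_point x0 r i s y \<in> B3"
proof -
  let ?v = "(s * (r / 2)) *\<^sub>R axis i 1 + in_plane i y :: real^3"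
  have "(norm ?v)\<^sup>2 = (\<Sum>k\<in>UNIV. (?v $ k)\<^sup>2)"
    by (simp add: norm_vec_def L2_set_def sum_nonneg)
  also have "\<dots> = (s * (r / 2))\<^sup>2 + (fst y)\<^sup>2 + (snd y)\<^sup>2"
    by (subst sum_index[of _ i]) (simp add: in_plane_def axis_def)
  also have "\<dots> \<le> (r / 2)\<^sup>2 + (r / 2)\<^sup>2 + (r / 2)\<^sup>2"
    using s y r by (intro add_mono) (auto simp: abs_le_square_iff[symmetric])
  also have "\<dots> \<le> (sqrt 3 * r)\<^sup>2" by (simp add: power_mult_distrib power_divide)
  finally have "norm ?v \<le> sqrt 3 * r" by (rule power2_le_imp_le) (use r in simp)
  also have "\<dots> < 1 - norm x0"
    using r(2) infdist_frontier_ball[OF x0] by (simp add: max_side_def field_simps)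
  finally have "norm (x0 + ?v) < 1" using norm_triangle_ineq[of x0 ?v] by simp
  then show ?thesis by (simp add: face_point_eq add.assoc)
qed

lemma flux_eq_field_flux:
  assumes F: "alternating_on B3 F" and X: "represents X F" and x0: "x0 \<in> B3"
  shows "AE r in lborel. r \<in> {0<..<max_side x0} \<longrightarrow> flux F x0 r = field_flux X x0 r"
proof -
  have [measurable]: "X \<in> borel_measurable borel" using X by (simp add: represents_def)
  have "AE r in lborel. AE u in lborel.
      x0 + (s * (r / 2)) *\<^sub>R axis i 1 + in_plane i u \<in> B3 \<longrightarrow>
      X (x0 + (s * (r / 2)) *\<^sub>R axis i 1 + in_plane i u) = field_of F (x0 + (s * (r / 2)) *\<^sub>R axis i 1 + in_plane i u)"
    if "s \<in> {-1, 1}" for s i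
    by (rule AE_faces[OF _ that]) (use X in \<open>simp add: represents_def\<close>)
  then have "AE r in lborel. \<forall>i. \<forall>s\<in>{-1,1}. AE u in lborel.
      face_point x0 r i s u \<in> B3 \<longrightarrow> X (face_point x0 r i s u) = field_of F (face_point x0 r i s u)"
    unfolding face_point_eq by (intro AE_all_countable[THEN iffD2] allI AE_finite_allI) auto
  then show ?thesis
  proof (eventually_elim, intro impI)
    fix r assume ae: "\<forall>i. \<forall>s\<in>{-1,1}. AE u in lborel.
      face_point x0 r i s u \<in> B3 \<longrightarrow> X (face_point x0 r i s u) = field_of F (face_point x0 r i s u)"
      and r: "r \<in> {0<..<max_side x0}"
    let ?S = "{-r/2<..<r/2} \<times> {-r/2<..<r/2}"
    have *: "(\<integral>y. star_wedge_d F (cube_norm x0) (face_point x0 r i s y) \<partial>lebesgue_on ?S) =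
        s * face_integral X i (x0 + (s * (r / 2)) *\<^sub>R axis i 1) r" if s: "s \<in> {-1, 1}" for i s
    proof -
      let ?f = "\<lambda>y. indicator ?S y *\<^sub>R star_wedge_d F (cube_norm x0) (face_point x0 r i s y)"
      let ?g = "\<lambda>u. s * (if sup2 u < r / 2
          then X (x0 + (s * (r / 2)) *\<^sub>R axis i 1 + in_plane i u) $ i else 0)"
      have g[measurable]: "?g \<in> borel_measurable lborel" by measurable
      then have g': "?g \<in> borel_measurable lebesgue" by (rule measurable_completion)
      have "AE u in lborel. ?g u = ?f u"
        using ae[THEN spec, THEN bspec, OF s, of i]
      proof eventually_elim
        case (elim u)
        have S: "u \<in> ?S \<longleftrightarrow> sup2 u < r / 2" by (cases u) (auto simp: sup2_def)
        show ?case
        proof (cases "u \<in> ?S")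
          case True
          then have u: "\<bar>fst u\<bar> < r / 2" "\<bar>snd u\<bar> < r / 2" using S by (auto simp: sup2_def)
          have B: "face_point x0 r i s u \<in> B3" using face_point_in_ball[OF x0 _ _ s u] r by simp
          have "F (face_point x0 r i s u) $ 1 $ 3 = - F (face_point x0 r i s u) $ 3 $ 1"
            using F B unfolding alternating_on_def by blast
          from star_wedge_on_face[where F=F and i=i and y=u and r=r and ?x0.0=x0, OF s u this] elim B S True show ?thesis
            by (simp add: face_point_eq)
        qed (use S in auto)
      qed
      then have fg: "AE u in lebesgue. ?g u = ?f u" by (simp add: AE_completion)
      have f': "?f \<in> borel_measurable lebesgue" by (rule borel_measurable_AE[OF g' fg])
      have "(\<integral>y. star_wedge_d F (cube_norm x0) (face_point x0 r i s y) \<partial>lebesgue_on ?S) = (\<integral>y. ?f y \<partial>lebesgue)"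
      proof (rule integral_restrict_space)
        have "?S \<in> sets lborel" unfolding sets_lborel by (intro borel_open open_Times) auto
        then show "?S \<inter> space lebesgue \<in> sets lebesgue" by simp
      qed
      also have "\<dots> = (\<integral>y. ?g y \<partial>lebesgue)"
        by (rule integral_cong_AE[OF f' g']) (use fg in eventually_elim, simp)
      also have "\<dots> = (\<integral>y. ?g y \<partial>lborel)" by (rule integral_completion[OF g])
      also have "\<dots> = s * face_integral X i (x0 + (s * (r / 2)) *\<^sub>R axis i 1) r"
        unfolding face_integral_def by (rule integral_mult_right_zero)
      finally show ?thesis .
    qed
    have "flux F x0 r = 1 / (2 * pi) * (\<Sum>i\<in>UNIV. \<Sum>s\<in>{-1, 1}. s * face_integral X i (x0 + (s * (r / 2)) *\<^sub>R axis i 1) r)"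
      unfolding flux_def cube_boundary_integral_def using * by simp
    then show "flux F x0 r = field_flux X x0 r" by (simp add: field_flux_def)
  qed
qed

lemma AE_face_integrable:
  fixes X :: "real^3 \<Rightarrow> real^3"
  assumes [measurable]: "X \<in> borel_measurable borel" and fin: "\<And>i. Lpow 1 (\<lambda>x. X x $ i) < \<infinity>" and s: "s \<in> {-1, 1}"
  shows "AE r in lborel. integrable lborel (\<lambda>u. if sup2 u < r / 2
     then X (x0 + (s * (r / 2)) *\<^sub>R axis i 1 + in_plane i u) $ i else 0)"
proof -
  let ?h = "\<lambda>r. \<integral>\<^sup>+u. ennreal \<bar>X (x0 + (s * (r / 2)) *\<^sub>R axis i 1 + in_plane i u) $ i\<bar> \<partial>lborel"
  have "(\<integral>\<^sup>+r. ?h r \<partial>lborel) < \<infinity>"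
    using fin[of i] nn_integral_faces[of "\<lambda>x. ennreal \<bar>X x $ i\<bar>" s x0 i] s
    by (auto simp: Lpow_def ennreal_mult_less_top)
  then have "AE r in lborel. ?h r \<noteq> \<infinity>" by (intro nn_integral_PInf_AE) auto
  then show ?thesis
  proof eventually_elim
    case (elim r)
    show ?case
    proof (rule integrableI_bounded)
      have "(\<integral>\<^sup>+u. ennreal (norm (if sup2 u < r / 2
          then X (x0 + (s * (r / 2)) *\<^sub>R axis i 1 + in_plane i u) $ i else 0)) \<partial>lborel) \<le> ?h r"
        by (intro nn_integral_mono) auto
      also have "\<dots> < \<infinity>" using elim by (simp add: less_top)
      finally show "(\<integral>\<^sup>+u. ennreal (norm (if sup2 u < r / 2
          then X (x0 + (s * (r / 2)) *\<^sub>R axis i 1 + in_plane i u) $ i else 0)) \<partial>lborel) < \<infinity>" .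
    qed measurable
  qed
qed

text \<open>Fluxes through the cubes about a fixed centre depend continuously on the field, in \<open>L\<^sup>1\<close> of the
  side length.\<close>

lemma field_flux_L1:
  fixes X Y :: "real^3 \<Rightarrow> real^3"
  assumes X[measurable]: "X \<in> borel_measurable borel" and finX: "\<And>i. Lpow 1 (\<lambda>x. X x $ i) < \<infinity>"
    and Y[measurable]: "Y \<in> borel_measurable borel" and finY: "\<And>i. Lpow 1 (\<lambda>x. Y x $ i) < \<infinity>"
  shows "(\<integral>\<^sup>+r. ennreal \<bar>field_flux X x0 r - field_flux Y x0 r\<bar> \<partial>lborel) \<le>
    4 * (\<Sum>i\<in>UNIV. Lpow 1 (\<lambda>x. X x $ i - Y x $ i))"
proof -
  let ?sq = "\<lambda>r u. sup2 u < r / 2"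
  let ?c = "\<lambda>r s i. x0 + (s * (r / 2)) *\<^sub>R axis i 1 :: real^3"
  let ?h = "\<lambda>r s i. \<integral>\<^sup>+u. ennreal \<bar>X (?c r s i + in_plane i u) $ i - Y (?c r s i + in_plane i u) $ i\<bar> \<partial>lborel"
  have "AE r in lborel. \<forall>i. \<forall>s\<in>{-1,1}.
      integrable lborel (\<lambda>u. if ?sq r u then X (?c r s i + in_plane i u) $ i else 0) \<and>
      integrable lborel (\<lambda>u. if ?sq r u then Y (?c r s i + in_plane i u) $ i else 0)"
    by (intro AE_all_countable[THEN iffD2] allI AE_finite_allI AE_conjI AE_face_integrable X Y finX finY) auto
  then have "AE r in lborel. ennreal \<bar>field_flux X x0 r - field_flux Y x0 r\<bar> \<le> (\<Sum>i\<in>UNIV. ?h r 1 i + ?h r (-1) i)"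
  proof eventually_elim
    case (elim r)
    have *: "ennreal \<bar>face_integral X i (?c r s i) r - face_integral Y i (?c r s i) r\<bar> \<le> ?h r s i"
      if s: "s \<in> {-1, 1}" for s i
    proof -
      have iX: "integrable lborel (\<lambda>u. if ?sq r u then X (?c r s i + in_plane i u) $ i else 0)"
        and iY: "integrable lborel (\<lambda>u. if ?sq r u then Y (?c r s i + in_plane i u) $ i else 0)"
        using elim[THEN spec, THEN bspec, OF s] by blast+
      have eq: "face_integral X i (?c r s i) r - face_integral Y i (?c r s i) r =
        (\<integral>u. (if ?sq r u then X (?c r s i + in_plane i u) $ i else 0) -
             (if ?sq r u then Y (?c r s i + in_plane i u) $ i else 0) \<partial>lborel)"
        unfolding face_integral_def by (rule Bochner_Integration.integral_diff[OF iX iY, symmetric])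
      have "ennreal \<bar>face_integral X i (?c r s i) r - face_integral Y i (?c r s i) r\<bar> \<le>
          (\<integral>\<^sup>+u. ennreal (norm ((if ?sq r u then X (?c r s i + in_plane i u) $ i else 0) -
             (if ?sq r u then Y (?c r s i + in_plane i u) $ i else 0))) \<partial>lborel)"
        unfolding eq real_norm_def[symmetric]
        by (rule integral_norm_bound_ennreal[OF Bochner_Integration.integrable_diff[OF iX iY]])
      also have "\<dots> \<le> ?h r s i"
      proof (rule nn_integral_mono)
        fix u show "ennreal (norm ((if ?sq r u then X (?c r s i + in_plane i u) $ i else 0) -
             (if ?sq r u then Y (?c r s i + in_plane i u) $ i else 0))) \<le>
             ennreal \<bar>X (?c r s i + in_plane i u) $ i - Y (?c r s i + in_plane i u) $ i\<bar>"
          by (cases "?sq r u") (simp_all only: if_True if_False real_norm_def order_refl diff_self abs_zero ennreal_0 zero_le)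
      qed
      finally show ?thesis .
    qed
    let ?d = "\<lambda>s i. face_integral X i (?c r s i) r - face_integral Y i (?c r s i) r"
    have "field_flux X x0 r - field_flux Y x0 r = 1 / (2 * pi) * (\<Sum>i\<in>UNIV. ?d 1 i - ?d (-1) i)"
      by (simp add: field_flux_def sum_subtractf sum.distrib algebra_simps)
    then have "\<bar>field_flux X x0 r - field_flux Y x0 r\<bar> = 1 / (2 * pi) * \<bar>\<Sum>i\<in>UNIV. ?d 1 i - ?d (-1) i\<bar>"
      by (simp add: abs_mult)
    also have "\<dots> \<le> 1 * \<bar>\<Sum>i\<in>UNIV. ?d 1 i - ?d (-1) i\<bar>"
      using pi_gt3 by (intro mult_right_mono) (auto simp: field_simps)
    also have "\<dots> \<le> (\<Sum>i\<in>UNIV. \<bar>?d 1 i\<bar> + \<bar>?d (-1) i\<bar>)"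
      using sum_abs[of "\<lambda>i. ?d 1 i - ?d (-1) i" UNIV]
      by (auto intro: order_trans sum_mono abs_triangle_ineq4)
    finally have "ennreal \<bar>field_flux X x0 r - field_flux Y x0 r\<bar> \<le> ennreal (\<Sum>i\<in>UNIV. \<bar>?d 1 i\<bar> + \<bar>?d (-1) i\<bar>)"
      by (rule ennreal_leI)
    also have "\<dots> = (\<Sum>i\<in>UNIV. ennreal \<bar>?d 1 i\<bar> + ennreal \<bar>?d (-1) i\<bar>)"
      by (subst sum_ennreal[symmetric]) (auto simp: ennreal_plus)
    also have "\<dots> \<le> (\<Sum>i\<in>UNIV. ?h r 1 i + ?h r (-1) i)"
      by (intro sum_mono add_mono *) auto
    finally show ?case .
  qed
  then have "(\<integral>\<^sup>+r. ennreal \<bar>field_flux X x0 r - field_flux Y x0 r\<bar> \<partial>lborel) \<le>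
      (\<integral>\<^sup>+r. (\<Sum>i\<in>UNIV. ?h r 1 i + ?h r (-1) i) \<partial>lborel)"
    by (rule nn_integral_mono_AE)
  also have "\<dots> = (\<Sum>i\<in>UNIV. (\<integral>\<^sup>+r. ?h r 1 i \<partial>lborel) + (\<integral>\<^sup>+r. ?h r (-1) i \<partial>lborel))"
    by (subst nn_integral_sum) (auto simp: nn_integral_add)
  also have "\<dots> = (\<Sum>i\<in>UNIV. 2 * Lpow 1 (\<lambda>x. X x $ i - Y x $ i) + 2 * Lpow 1 (\<lambda>x. X x $ i - Y x $ i))"
  proof (intro sum.cong refl)
    fix i :: 3
    have "(\<integral>\<^sup>+r. ?h r s i \<partial>lborel) = 2 * Lpow 1 (\<lambda>x. X x $ i - Y x $ i)" if "s \<in> {-1, 1}" for s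
      using nn_integral_faces[of "\<lambda>x. ennreal \<bar>X x $ i - Y x $ i\<bar>" s x0 i] that by (simp add: Lpow_def)
    then show "(\<integral>\<^sup>+r. ?h r 1 i \<partial>lborel) + (\<integral>\<^sup>+r. ?h r (-1) i \<partial>lborel) =
      2 * Lpow 1 (\<lambda>x. X x $ i - Y x $ i) + 2 * Lpow 1 (\<lambda>x. X x $ i - Y x $ i)"
      by (intro arg_cong2[where f="(+)"]) blast+
  qed
  also have "\<dots> = 4 * (\<Sum>i\<in>UNIV. Lpow 1 (\<lambda>x. X x $ i - Y x $ i))"
    by (simp add: sum_distrib_left flip: distrib_right)
  finally show ?thesis .
qed

section \<open>Almost every point is a Lebesgue point\<close>

lemma set_integrable_abs_diff:
  fixes H :: "real \<Rightarrow> real"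
  assumes "integrable lborel H"
  shows "set_integrable lborel {a..b} (\<lambda>t. \<bar>H t - q\<bar>)"
proof -
  have "set_integrable lborel {a..b} H" unfolding set_integrable_def
    by (rule integrable_mult_indicator[OF _ assms]) simp
  moreover have "set_integrable lborel {a..b} (\<lambda>t. q)"
    by (rule borel_integrable_atLeastAtMost') (rule continuous_on_const)
  ultimately have "set_integrable lborel {a..b} (\<lambda>t. H t - q)" by (rule set_integral_diff(1))
  then show ?thesis by (rule set_integrable_abs)
qed

lemma right_averages:
  fixes H :: "real \<Rightarrow> real"
  assumes H: "integrable lborel H"
  obtains N where "negligible N" "\<And>x q e. x \<notin> N \<Longrightarrow> q \<in> \<rat> \<Longrightarrow> e > 0 \<Longrightarrow>
    \<exists>d>0. \<forall>h. 0 < h \<and> h < d \<longrightarrow> integral {x..x+h} (\<lambda>t. \<bar>H t - q\<bar>) \<le> h * (\<bar>H x - q\<bar> + e)"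
proof -
  have "\<exists>N. negligible N \<and> (\<forall>x e. x \<notin> N \<longrightarrow> e > 0 \<longrightarrow>
    (\<exists>d>0. \<forall>h. 0 < h \<and> h < d \<longrightarrow> integral {x..x+h} (\<lambda>t. \<bar>H t - q\<bar>) \<le> h * (\<bar>H x - q\<bar> + e)))" for q
  proof -
    have "(\<lambda>t. \<bar>H t - q\<bar>) integrable_on cbox a b" for a b
      using set_borel_integral_eq_integral(1)[OF set_integrable_abs_diff[OF H]] by simp
    then obtain N where N: "negligible N" and lim: "\<And>x e. x \<notin> N \<Longrightarrow> 0 < e \<Longrightarrow>
        \<exists>d>0. \<forall>h. 0 < h \<and> h < d \<longrightarrow>
          norm (integral (cbox x (x + h *\<^sub>R One)) (\<lambda>t. \<bar>H t - q\<bar>) /\<^sub>R h ^ DIM(real) - \<bar>H x - q\<bar>) < e"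
      using integrable_ccontinuous_explicit[of "\<lambda>t. \<bar>H t - q\<bar>"] by (metis (no_types, lifting))
    have "\<exists>d>0. \<forall>h. 0 < h \<and> h < d \<longrightarrow> integral {x..x+h} (\<lambda>t. \<bar>H t - q\<bar>) \<le> h * (\<bar>H x - q\<bar> + e)"
      if x: "x \<notin> N" and e: "e > 0" for x e
    proof -
      obtain d where d: "d > 0" "\<And>h. 0 < h \<and> h < d \<Longrightarrow>
          norm (integral (cbox x (x + h *\<^sub>R One)) (\<lambda>t. \<bar>H t - q\<bar>) /\<^sub>R h ^ DIM(real) - \<bar>H x - q\<bar>) < e"
        using lim[OF x e] by blast
      have "integral {x..x+h} (\<lambda>t. \<bar>H t - q\<bar>) \<le> h * (\<bar>H x - q\<bar> + e)" if h: "0 < h \<and> h < d" for h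
      proof -
        have "integral {x..x+h} (\<lambda>t. \<bar>H t - q\<bar>) / h \<le> \<bar>H x - q\<bar> + e"
          using d(2)[OF h] by (simp add: divide_inverse mult.commute abs_diff_less_iff)
        then show ?thesis using h by (simp add: field_simps)
      qed
      with d(1) show ?thesis by blast
    qed
    with N show ?thesis by blast
  qed
  then obtain N where N: "\<And>q. negligible (N q)" and lim: "\<And>q x e. x \<notin> N q \<Longrightarrow> e > 0 \<Longrightarrow>
    (\<exists>d>0. \<forall>h. 0 < h \<and> h < d \<longrightarrow> integral {x..x+h} (\<lambda>t. \<bar>H t - q\<bar>) \<le> h * (\<bar>H x - q\<bar> + e))"
    by metis
  show ?thesis
  proof (rule that[of "\<Union>q\<in>\<rat>. N q"])
    show "negligible (\<Union>q\<in>\<rat>. N q)"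
      using N countable_rat by (intro negligible_countable_Union) auto
  qed (use lim in blast)
qed

lemma AE_averages_tendsto_0:
  fixes H :: "real \<Rightarrow> real"
  assumes H: "integrable lborel H"
  shows "AE x in lborel. ((\<lambda>h. 1 / (2 * h) * integral {x-h..x+h} (\<lambda>t. \<bar>H t - H x\<bar>)) \<longlongrightarrow> 0) (at_right 0)"
proof -
  obtain N1 where N1: "negligible N1" and right: "\<And>x q e. x \<notin> N1 \<Longrightarrow> q \<in> \<rat> \<Longrightarrow> e > 0 \<Longrightarrow>
    \<exists>d>0. \<forall>h. 0 < h \<and> h < d \<longrightarrow> integral {x..x+h} (\<lambda>t. \<bar>H t - q\<bar>) \<le> h * (\<bar>H x - q\<bar> + e)"
    by (rule right_averages[OF H]) (rule that)
  have H': "integrable lborel (\<lambda>t. H (- t))"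
    using integrable_affine[of H "-1" 0] H borel_measurable_integrable[OF H] by simp
  obtain N2 where N2: "negligible N2" and left: "\<And>x q e. x \<notin> N2 \<Longrightarrow> q \<in> \<rat> \<Longrightarrow> e > 0 \<Longrightarrow>
    \<exists>d>0. \<forall>h. 0 < h \<and> h < d \<longrightarrow> integral {x..x+h} (\<lambda>t. \<bar>H (- t) - q\<bar>) \<le> h * (\<bar>H (- x) - q\<bar> + e)"
    by (rule right_averages[OF H']) (rule that)
  have "negligible (N1 \<union> uminus ` N2)"
    by (intro negligible_Un N1 negligible_differentiable_image_negligible[OF _ N2])
       (auto intro!: differentiable_on_minus differentiable_on_ident)
  then have "N1 \<union> uminus ` N2 \<in> null_sets lebesgue" by (simp add: negligible_iff_null_sets)
  then have "AE x in lebesgue. x \<notin> N1 \<union> uminus ` N2" by (rule AE_not_in)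
  then have "AE x in lborel. x \<notin> N1 \<union> uminus ` N2" by (simp only: AE_completion_iff)
  then show ?thesis
  proof (rule AE_mp, intro AE_I2 impI)
    fix x assume x: "x \<notin> N1 \<union> uminus ` N2"
    then have x1: "x \<notin> N1" and x2: "- x \<notin> N2" by (auto simp: image_iff)
    show "((\<lambda>h. 1 / (2 * h) * integral {x-h..x+h} (\<lambda>t. \<bar>H t - H x\<bar>)) \<longlongrightarrow> 0) (at_right 0)"
    proof (rule tendstoI)
      fix e :: real assume e: "e > 0"
      obtain q where q0: "q \<in> \<rat>" "H x - e / 4 < q" "q < H x + e / 4"
        using Rats_dense_in_real[of "H x - e / 4" "H x + e / 4"] e by auto
      have q: "q \<in> \<rat>" "\<bar>H x - q\<bar> < e / 4" using q0 by linarith+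
      obtain d1 where d1: "d1 > 0" "\<And>h. 0 < h \<Longrightarrow> h < d1 \<Longrightarrow>
          integral {x..x+h} (\<lambda>t. \<bar>H t - q\<bar>) \<le> h * (\<bar>H x - q\<bar> + e / 4)"
        using right[OF x1 q(1), of "e / 4"] e by auto
      obtain d2 where d2: "d2 > 0" "\<And>h. 0 < h \<Longrightarrow> h < d2 \<Longrightarrow>
          integral {-x..-x+h} (\<lambda>t. \<bar>H (- t) - q\<bar>) \<le> h * (\<bar>H x - q\<bar> + e / 4)"
        using left[OF x2 q(1), of "e / 4"] e by auto
      have "\<bar>1 / (2 * h) * integral {x-h..x+h} (\<lambda>t. \<bar>H t - H x\<bar>)\<bar> < e" if h: "0 < h" "h < min d1 d2" for h
      proof -
        let ?I = "\<lambda>a b f. integral {a..b::real} (f :: real \<Rightarrow> real)"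
        have int: "(\<lambda>t. \<bar>H t - c\<bar>) integrable_on {a..b}" for a b c
          by (rule set_borel_integral_eq_integral(1)[OF set_integrable_abs_diff[OF H]])
        have "?I (x-h) (x+h) (\<lambda>t. \<bar>H t - H x\<bar>) \<le> ?I (x-h) (x+h) (\<lambda>t. \<bar>H t - q\<bar> + \<bar>H x - q\<bar>)"
          by (intro integral_le int integrable_add integrable_const_ivl) linarith
        also have "\<dots> = ?I (x-h) (x+h) (\<lambda>t. \<bar>H t - q\<bar>) + 2 * h * \<bar>H x - q\<bar>"
          using h by (subst Henstock_Kurzweil_Integration.integral_add[OF int integrable_const_ivl]) simp
        also have "?I (x-h) (x+h) (\<lambda>t. \<bar>H t - q\<bar>) = ?I (x-h) x (\<lambda>t. \<bar>H t - q\<bar>) + ?I x (x+h) (\<lambda>t. \<bar>H t - q\<bar>)"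
          using h by (intro Henstock_Kurzweil_Integration.integral_combine[symmetric] int) auto
        also have "?I (x-h) x (\<lambda>t. \<bar>H t - q\<bar>) = ?I (-x) (-x+h) (\<lambda>t. \<bar>H (- t) - q\<bar>)"
          using Henstock_Kurzweil_Integration.integral_reflect_real[of x "x-h" "\<lambda>t. \<bar>H t - q\<bar>"] by simp
        finally have "?I (x-h) (x+h) (\<lambda>t. \<bar>H t - H x\<bar>) \<le>
            h * (\<bar>H x - q\<bar> + e / 4) + h * (\<bar>H x - q\<bar> + e / 4) + 2 * h * \<bar>H x - q\<bar>"
          using d1(2)[of h] d2(2)[of h] h by simp
        also have "\<dots> < 2 * h * e"
        proof -
          have "h * (4 * \<bar>H x - q\<bar> + e / 2) < h * (2 * e)" using q(2) h e by (intro mult_strict_left_mono) auto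
          then show ?thesis by (simp add: algebra_simps)
        qed
        finally have "1 / (2 * h) * ?I (x-h) (x+h) (\<lambda>t. \<bar>H t - H x\<bar>) < e" using h by (simp add: field_simps)
        moreover have "0 \<le> ?I (x-h) (x+h) (\<lambda>t. \<bar>H t - H x\<bar>)" by (intro integral_nonneg int) simp
        ultimately show ?thesis using h by simp
      qed
      moreover have "min d1 d2 > 0" using d1 d2 by simp
      ultimately show "\<forall>\<^sub>F h in at_right 0. dist (1 / (2 * h) * integral {x-h..x+h} (\<lambda>t. \<bar>H t - H x\<bar>)) 0 < e"
        unfolding eventually_at_right_field by (intro exI[of _ "min d1 d2"]) (simp add: dist_real_def)
    qed
  qed
qed

lemma AE_lebesgue_point:
  assumes H: "integrable lborel H" and gH: "AE r in lborel. r \<in> {0<..<R} \<longrightarrow> g r = H r"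
  shows "AE r in lborel. r \<in> {0<..<R} \<longrightarrow> lebesgue_point g r"
  using AE_averages_tendsto_0[OF H] gH
proof eventually_elim
  case (elim x)
  have [measurable]: "H \<in> borel_measurable borel" using borel_measurable_integrable[OF H] by simp
  show ?case
  proof
    assume x: "x \<in> {0<..<R}"
    then have gx: "g x = H x" using elim by blast
    define d where "d = min x (R - x)"
    have d: "d > 0" using x by (simp add: d_def)
    have sub: "{x-h<..<x+h} \<subseteq> {0<..<R}" if "h \<le> d" for h using that by (auto simp: d_def)
    have AE1: "AE t in lebesgue. t \<in> {0<..<R} \<longrightarrow> g t = H t" using gH by (rule AE_completion)
    have "integrable lebesgue (\<lambda>t. indicator {x-d<..<x+d} t *\<^sub>R g t)"
    proof -
      have m: "(\<lambda>t. indicator {x-d<..<x+d} t *\<^sub>R H t) \<in> borel_measurable lborel" by measurable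
      have "integrable lborel (\<lambda>t. indicator {x-d<..<x+d} t *\<^sub>R H t)"
        by (rule integrable_mult_indicator[OF _ H]) simp
      then have I: "integrable lebesgue (\<lambda>t. indicator {x-d<..<x+d} t *\<^sub>R H t)"
        using integrable_completion[OF m] by blast
      have eq: "AE t in lebesgue. indicator {x-d<..<x+d} t *\<^sub>R H t = indicator {x-d<..<x+d} t *\<^sub>R g t"
        using AE1 by eventually_elim (use sub[of d] in \<open>auto simp: indicator_def\<close>)
      show ?thesis
        by (rule integrable_cong_AE[THEN iffD1, OF measurable_completion[OF m]
              borel_measurable_AE[OF measurable_completion[OF m] eq] eq I])
    qed
    then have 1: "integrable (lebesgue_on {x-d<..<x+d}) g"
      by (subst integrable_restrict_space) auto
    have eq: "(\<integral>t. \<bar>g t - g x\<bar> \<partial>lebesgue_on {x-h<..<x+h}) = integral {x-h..x+h} (\<lambda>t. \<bar>H t - H x\<bar>)" if h: "h \<le> d" for h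
    proof -
      have m: "(\<lambda>t. indicator {x-h..x+h} t *\<^sub>R \<bar>H t - H x\<bar>) \<in> borel_measurable lborel" by measurable
      have "AE t in lborel. t \<noteq> x - h \<and> t \<noteq> x + h" by (intro AE_conjI AE_lborel_singleton)
      then have "AE t in lebesgue. t \<noteq> x - h \<and> t \<noteq> x + h" by (rule AE_completion)
      with AE1 have ae: "AE t in lebesgue. indicator {x-h..x+h} t *\<^sub>R \<bar>H t - H x\<bar> = indicator {x-h<..<x+h} t *\<^sub>R \<bar>g t - g x\<bar>"
        by eventually_elim (use sub[OF h] gx in \<open>auto simp: indicator_def\<close>)
      have "(\<integral>t. \<bar>g t - g x\<bar> \<partial>lebesgue_on {x-h<..<x+h}) = (\<integral>t. indicator {x-h<..<x+h} t *\<^sub>R \<bar>g t - g x\<bar> \<partial>lebesgue)"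
        by (rule integral_restrict_space) auto
      also have "\<dots> = (\<integral>t. indicator {x-h..x+h} t *\<^sub>R \<bar>H t - H x\<bar> \<partial>lebesgue)"
        by (rule integral_cong_AE[OF borel_measurable_AE[OF measurable_completion[OF m] ae] measurable_completion[OF m]])
           (use ae in \<open>eventually_elim, simp\<close>)
      also have "\<dots> = (\<integral>t. indicator {x-h..x+h} t *\<^sub>R \<bar>H t - H x\<bar> \<partial>lborel)" by (rule integral_completion[OF m])
      also have "\<dots> = integral {x-h..x+h} (\<lambda>t. \<bar>H t - H x\<bar>)"
        using set_borel_integral_eq_integral(2)[OF set_integrable_abs_diff[OF H]] by (simp add: set_lebesgue_integral_def)
      finally show ?thesis .
    qed
    have "((\<lambda>h. 1 / (2 * h) * (\<integral>t. \<bar>g t - g x\<bar> \<partial>lebesgue_on {x-h<..<x+h})) \<longlongrightarrow> 0) (at_right 0)"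
    proof (rule Lim_transform_eventually[OF elim(1)])
      show "\<forall>\<^sub>F h in at_right 0. 1 / (2 * h) * integral {x-h..x+h} (\<lambda>t. \<bar>H t - H x\<bar>) =
          1 / (2 * h) * (\<integral>t. \<bar>g t - g x\<bar> \<partial>lebesgue_on {x-h<..<x+h})"
        unfolding eventually_at_right_field using d eq by (intro exI[of _ d]) simp
    qed
    with 1 d show "lebesgue_point g x" unfolding lebesgue_point_def by blast
  qed
qed

section \<open>Forms, their Borel representatives and distances\<close>

definition form_of :: "real^3 \<Rightarrow> real^3^3" where
  "form_of v = (\<chi> i j. if j = i + 1 then v $ (i + 2) else if j = i + 2 then - v $ (i + 1) else 0)"

lemma form_of_diff: "form_of (v - w) = form_of v - form_of w"
  by (simp add: form_of_def vec_eq_iff)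

lemma index_shift: "(i :: 3) + 2 + 1 = i" "(i :: 3) + 1 + 2 = i" "(i :: 3) + 2 + 2 = i + 1" "(i :: 3) + 1 + 1 = i + 2"
  using exhaust_3[of i] by auto

lemma form_of_nth: "form_of v $ (i + 1) $ (i + 2) = v $ i"
  by (simp add: form_of_def index_shift)

lemma field_of_form_of: "field_of (\<lambda>x. form_of (X x)) = X"
  by (simp add: field_of_def form_of_nth vec_eq_iff fun_eq_iff)

lemma alternating_form_of: "alternating_on U (\<lambda>x. form_of (X x))"
  unfolding alternating_on_def
proof (intro ballI allI)
  fix x i j show "form_of (X x) $ j $ i = - (form_of (X x) $ i $ j)"
    using exhaust_index[of j i] by (auto simp: form_of_def index_shift)
qed

lemma form_of_field_of:
  assumes "alternating_on U F" "x \<in> U"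
  shows "form_of (field_of F x) = F x"
proof -
  have alt: "F x $ j $ i = - (F x $ i $ j)" for i j
    using assms unfolding alternating_on_def by blast
  have diag: "F x $ i $ i = 0" for i using alt[of i i] by linarith
  have flipped: "F x $ i $ (i + 2) = - F x $ (i + 2) $ i" for i by (rule alt)
  have "form_of (field_of F x) $ i $ j = F x $ i $ j" for i j
    using exhaust_index[of j i] by (auto simp: form_of_def field_of_def index_shift diag flipped)
  then show ?thesis by (simp add: vec_eq_iff)
qed

lemma abs_le_norm_form_of: "\<bar>v $ i\<bar> \<le> norm (form_of v)"
proof -
  have "\<bar>form_of v $ (i + 1) $ (i + 2)\<bar> \<le> norm (form_of v $ (i + 1))" by (rule component_le_norm_cart)
  also have "\<dots> \<le> norm (form_of v)" by (rule Finite_Cartesian_Product.norm_nth_le)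
  finally show ?thesis by (simp add: form_of_nth)
qed

lemma norm_form_of_le: "norm (form_of v) \<le> 2 * (\<Sum>i\<in>UNIV. \<bar>v $ i\<bar>)"
proof -
  have "norm (form_of v) \<le> (\<Sum>i\<in>UNIV. norm (form_of v $ i))"
    unfolding norm_vec_def by (rule L2_set_le_sum) simp
  also have "\<dots> \<le> (\<Sum>i\<in>UNIV. \<Sum>j\<in>UNIV. \<bar>form_of v $ i $ j\<bar>)" by (intro sum_mono norm_le_l1_cart)
  also have "\<dots> = (\<Sum>i\<in>UNIV. \<bar>v $ (i + 2)\<bar> + \<bar>v $ (i + 1)\<bar>)"
  proof (rule sum.cong[OF refl])
    fix i show "(\<Sum>j\<in>UNIV. \<bar>form_of v $ i $ j\<bar>) = \<bar>v $ (i + 2)\<bar> + \<bar>v $ (i + 1)\<bar>"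
      by (subst sum_index[of _ i]) (simp add: form_of_def)
  qed
  also have "\<dots> = 2 * (\<Sum>i\<in>UNIV. \<bar>v $ i\<bar>)"
  proof -
    have "(\<Sum>i\<in>UNIV. \<bar>v $ (i + 2)\<bar>) = (\<Sum>i\<in>UNIV. \<bar>v $ i\<bar>)"
      by (rule sum.reindex_bij_witness[of _ "\<lambda>i. i + 1" "\<lambda>i. i + 2"]) (auto simp: index_shift)
    moreover have "(\<Sum>i\<in>UNIV. \<bar>v $ (i + 1)\<bar>) = (\<Sum>i\<in>UNIV. \<bar>v $ i\<bar>)"
      by (rule sum.reindex_bij_witness[of _ "\<lambda>i. i + 2" "\<lambda>i. i + 1"]) (auto simp: index_shift)
    ultimately show ?thesis by (simp add: sum.distrib)
  qed
  finally show ?thesis .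
qed

lemma measurable_form_of[measurable]: "form_of \<in> borel \<rightarrow>\<^sub>M borel"
proof (rule borel_measurable_continuous_onI)
  have "linear form_of" by (intro linearI) (simp_all add: form_of_def vec_eq_iff)
  then show "continuous_on UNIV form_of" by (simp add: linear_continuous_on linear_linear)
qed

lemma representative:
  assumes p: "p \<ge> 1" and F: "F \<in> Omega2_Lp p"
  obtains X where "represents X F" "\<And>i. Lpow p (\<lambda>x. X x $ i) < \<infinity>"
proof -
  let ?f = "\<lambda>i x. indicator B3 x *\<^sub>R field_of F x $ i"
  have B: "B3 \<inter> space lebesgue \<in> sets (lebesgue :: (real^3) measure)" by simp
  have m: "?f i \<in> borel_measurable lebesgue" for i
    using F borel_measurable_restrict_space_iff[OF B, of "\<lambda>x. field_of F x $ i"]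
    by (simp add: Omega2_Lp_def Lp_on_def field_of_def)
  then have "\<exists>g\<in>borel_measurable lborel. AE x in lborel. ?f i x = g x" for i
    by (rule completion_ex_borel_measurable_real)
  then have "\<forall>i. \<exists>g. g \<in> borel_measurable borel \<and> (AE x in lborel. ?f i x = g x)"
    unfolding Bex_def measurable_lborel2 by (rule allI)
  from choice[OF this] obtain g where "\<forall>i. g i \<in> borel_measurable borel \<and> (AE x in lborel. ?f i x = g i x)" ..
  then have g: "\<And>i. g i \<in> borel_measurable borel" "\<And>i. AE x in lborel. ?f i x = g i x"
    by blast+
  note [measurable] = g(1)
  define X where "X x = (if x \<in> B3 then (\<chi> i. g i x) else 0)" for x
  have X[measurable]: "X \<in> borel_measurable borel"
  proof (rule borel_measurable_vecI)
    fix i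
    have "(\<lambda>x. X x $ i) = (\<lambda>x. if x \<in> B3 then g i x else 0)" by (auto simp: X_def)
    then show "(\<lambda>x. X x $ i) \<in> borel_measurable borel" by simp
  qed
  have eq: "AE x in lborel. \<forall>i. ?f i x = g i x" using g(2) by (intro AE_all_countable[THEN iffD2] allI)
  have "represents X F"
    unfolding represents_def
  proof (intro conjI X allI impI)
    show "AE x in lborel. x \<in> B3 \<longrightarrow> X x = field_of F x"
      using eq by eventually_elim (auto simp: X_def vec_eq_iff)
  qed (simp add: X_def)
  moreover have "Lpow p (\<lambda>x. X x $ i) < \<infinity>" for i
  proof -
    have int: "integrable lebesgue (\<lambda>x. indicator B3 x *\<^sub>R \<bar>field_of F x $ i\<bar> powr p)"
      using F by (subst integrable_restrict_space[symmetric]) (auto simp: Omega2_Lp_def Lp_on_def field_of_def)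
    have "Lpow p (\<lambda>x. X x $ i) = (\<integral>\<^sup>+x. ennreal (\<bar>X x $ i\<bar> powr p) \<partial>lebesgue)"
      unfolding Lpow_def by (rule nn_integral_completion[symmetric])
    also have "\<dots> = (\<integral>\<^sup>+x. ennreal (norm (indicator B3 x *\<^sub>R \<bar>field_of F x $ i\<bar> powr p)) \<partial>lebesgue)"
    proof (rule nn_integral_cong_AE)
      from eq have "AE x in lebesgue. \<forall>i. ?f i x = g i x" by (rule AE_completion)
      then show "AE x in lebesgue. ennreal (\<bar>X x $ i\<bar> powr p) = ennreal (norm (indicator B3 x *\<^sub>R \<bar>field_of F x $ i\<bar> powr p))"
        by eventually_elim (auto simp: X_def indicator_def)
    qed
    also have "\<dots> < \<infinity>" using int unfolding integrable_iff_bounded by blast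
    finally show ?thesis .
  qed
  ultimately show ?thesis by (rule that)
qed

lemma Lpow_1_le:
  assumes p: "p \<ge> 1" and [measurable]: "f \<in> borel_measurable borel" and f0: "\<And>x. x \<notin> B3 \<Longrightarrow> f x = 0" and d: "d > 0"
  shows "Lpow 1 f \<le> ennreal d * emeasure lborel B3 + ennreal (d powr (1 - p)) * Lpow p f"
proof -
  have [measurable]: "B3 \<in> sets (borel :: (real^3) measure)" by simp
  have "ennreal (\<bar>f x\<bar> powr 1) \<le> ennreal d * indicator B3 x + ennreal (d powr (1 - p)) * ennreal (\<bar>f x\<bar> powr p)" for x
  proof (cases "\<bar>f x\<bar> \<le> d")
    case True
    then have "ennreal (\<bar>f x\<bar> powr 1) \<le> ennreal d * indicator B3 x" using f0[of x] by (auto simp: indicator_def ennreal_leI)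
    then show ?thesis by (rule order_trans) simp
  next
    case False
    then have "\<bar>f x\<bar> powr (1 - p) \<le> d powr (1 - p)" using d p by (intro powr_mono2') auto
    then have "\<bar>f x\<bar> powr (1 - p) * \<bar>f x\<bar> powr p \<le> d powr (1 - p) * \<bar>f x\<bar> powr p" by (intro mult_right_mono) auto
    then have "\<bar>f x\<bar> powr 1 \<le> d powr (1 - p) * \<bar>f x\<bar> powr p" by (simp add: powr_add[symmetric])
    then have "ennreal (\<bar>f x\<bar> powr 1) \<le> ennreal (d powr (1 - p)) * ennreal (\<bar>f x\<bar> powr p)"
      by (simp add: ennreal_leI flip: ennreal_mult)
    then show ?thesis by (rule order_trans) simp
  qed
  then have "Lpow 1 f \<le> (\<integral>\<^sup>+x. ennreal d * indicator B3 x + ennreal (d powr (1 - p)) * ennreal (\<bar>f x\<bar> powr p) \<partial>lborel)"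
    unfolding Lpow_def by (rule nn_integral_mono)
  also have "\<dots> = ennreal d * emeasure lborel B3 + ennreal (d powr (1 - p)) * Lpow p f"
    unfolding Lpow_def by (subst nn_integral_add) (auto simp: nn_integral_cmult nn_integral_cmult_indicator)
  finally show ?thesis .
qed

lemma emeasure_ball_finite: "emeasure lborel B3 < \<infinity>"
  using emeasure_lborel_ball_finite[of "0 :: real^3" 1] by (simp add: less_top)

lemma Lpow_1_finite:
  assumes "p \<ge> 1" "f \<in> borel_measurable borel" "\<And>x. x \<notin> B3 \<Longrightarrow> f x = 0" "Lpow p f < \<infinity>"
  shows "Lpow 1 f < \<infinity>"
  using Lpow_1_le[OF assms(1-3), of 1] assms(4) emeasure_ball_finite
  by (auto simp: ennreal_mult_less_top order.strict_trans1)

lemma Lpow_diff_finite: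
  assumes "p \<ge> 1" "f \<in> borel_measurable borel" "g \<in> borel_measurable borel" "Lpow p f < \<infinity>" "Lpow p g < \<infinity>"
  shows "Lpow p (\<lambda>x. f x - g x) < \<infinity>"
  using Lpow_add_le[of p f "\<lambda>x. - g x"] assms
  by (auto simp: Lpow_minus ennreal_mult_less_top order.strict_trans1)

lemma sum_ennreal_less_top: "(\<And>i. f i < (\<infinity> :: ennreal)) \<Longrightarrow> (\<Sum>i\<in>A. f i) < \<infinity>"
  by (induction A rule: infinite_finite_induct) (auto simp: less_top)

lemma Lp_dist_bounds:
  assumes p: "p \<ge> 1" and alt: "alternating_on B3 F" "alternating_on B3 G"
    and X: "represents X F" "\<And>i. Lpow p (\<lambda>x. X x $ i) < \<infinity>" and Y: "represents Y G" "\<And>i. Lpow p (\<lambda>x. Y x $ i) < \<infinity>"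
  shows "Lpow p (\<lambda>x. X x $ i - Y x $ i) \<le> ennreal (Lp_dist p F G powr p)"
    and "ennreal (Lp_dist p F G powr p) \<le> ennreal (6 powr p) * (\<Sum>i\<in>UNIV. Lpow p (\<lambda>x. X x $ i - Y x $ i))"
proof -
  have [measurable]: "X \<in> borel_measurable borel" "Y \<in> borel_measurable borel"
    using X(1) Y(1) by (simp_all add: represents_def)
  have out: "x \<notin> B3 \<Longrightarrow> X x = 0" "x \<notin> B3 \<Longrightarrow> Y x = 0" for x using X(1) Y(1) by (simp_all add: represents_def)
  let ?n = "\<lambda>x. norm (form_of (X x - Y x)) powr p"
  have n_le: "?n x \<le> 6 powr p * (\<Sum>i\<in>UNIV. \<bar>X x $ i - Y x $ i\<bar> powr p)" for x
  proof -
    obtain k where k: "\<And>i. \<bar>X x $ i - Y x $ i\<bar> \<le> \<bar>X x $ k - Y x $ k\<bar>"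
    proof -
      have "Max (range (\<lambda>i. \<bar>X x $ i - Y x $ i\<bar>)) \<in> range (\<lambda>i. \<bar>X x $ i - Y x $ i\<bar>)" by (intro Max_in) auto
      then obtain k where "Max (range (\<lambda>i. \<bar>X x $ i - Y x $ i\<bar>)) = \<bar>X x $ k - Y x $ k\<bar>" by (elim rangeE)
      then show ?thesis using that[of k] Max_ge[of "range (\<lambda>i. \<bar>X x $ i - Y x $ i\<bar>)"] by simp
    qed
    have "norm (form_of (X x - Y x)) \<le> 2 * (\<Sum>i\<in>UNIV. \<bar>X x $ i - Y x $ i\<bar>)" using norm_form_of_le[of "X x - Y x"] by simp
    also have "(\<Sum>i\<in>UNIV. \<bar>X x $ i - Y x $ i\<bar>) \<le> (\<Sum>i\<in>(UNIV :: 3 set). \<bar>X x $ k - Y x $ k\<bar>)" by (intro sum_mono k)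
    finally have "?n x \<le> (6 * \<bar>X x $ k - Y x $ k\<bar>) powr p" using p by (intro powr_mono2) auto
    also have "\<dots> = 6 powr p * \<bar>X x $ k - Y x $ k\<bar> powr p" by (simp add: powr_mult)
    also have "\<bar>X x $ k - Y x $ k\<bar> powr p \<le> (\<Sum>i\<in>UNIV. \<bar>X x $ i - Y x $ i\<bar> powr p)"
      by (intro member_le_sum) auto
    finally show ?thesis by simp
  qed
  have "(\<integral>\<^sup>+x. ennreal (?n x) \<partial>lborel) \<le> (\<integral>\<^sup>+x. ennreal (6 powr p) * (\<Sum>i\<in>UNIV. ennreal (\<bar>X x $ i - Y x $ i\<bar> powr p)) \<partial>lborel)"
  proof (rule nn_integral_mono)
    fix x
    have "ennreal (?n x) \<le> ennreal (6 powr p * (\<Sum>i\<in>UNIV. \<bar>X x $ i - Y x $ i\<bar> powr p))"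
      by (rule ennreal_leI[OF n_le])
    also have "\<dots> = ennreal (6 powr p) * (\<Sum>i\<in>UNIV. ennreal (\<bar>X x $ i - Y x $ i\<bar> powr p))"
      by (simp add: ennreal_mult sum_nonneg)
    finally show "ennreal (?n x) \<le> ennreal (6 powr p) * (\<Sum>i\<in>UNIV. ennreal (\<bar>X x $ i - Y x $ i\<bar> powr p))" .
  qed
  also have "\<dots> = ennreal (6 powr p) * (\<Sum>i\<in>UNIV. Lpow p (\<lambda>x. X x $ i - Y x $ i))"
    unfolding Lpow_def by (subst nn_integral_cmult, measurable) (subst nn_integral_sum, auto)
  finally have upper: "(\<integral>\<^sup>+x. ennreal (?n x) \<partial>lborel) \<le> ennreal (6 powr p) * (\<Sum>i\<in>UNIV. Lpow p (\<lambda>x. X x $ i - Y x $ i))" .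
  also have "\<dots> < \<infinity>"
  proof -
    have "Lpow p (\<lambda>x. X x $ i - Y x $ i) < \<infinity>" for i by (rule Lpow_diff_finite) (use p X Y in auto)
    then show ?thesis by (simp add: ennreal_mult_less_top sum_ennreal_less_top)
  qed
  finally have fin: "(\<integral>\<^sup>+x. ennreal (?n x) \<partial>lborel) < \<infinity>" .
  have int: "integrable lborel ?n" by (rule integrableI_bounded) (use fin in simp_all)
  have "(\<integral>x. norm (F x - G x) powr p \<partial>lebesgue_on B3) = (\<integral>x. indicator B3 x *\<^sub>R norm (F x - G x) powr p \<partial>lebesgue)"
    by (rule integral_restrict_space) simp
  also have "\<dots> = (\<integral>x. ?n x \<partial>lebesgue)"
  proof -
    have m: "?n \<in> borel_measurable lebesgue" by (rule measurable_completion) measurable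
    have "AE x in lborel. ?n x = indicator B3 x *\<^sub>R norm (F x - G x) powr p"
    proof -
      have "AE x in lborel. (x \<in> B3 \<longrightarrow> X x = field_of F x) \<and> (x \<in> B3 \<longrightarrow> Y x = field_of G x)"
        using X(1) Y(1) by (auto simp: represents_def intro: AE_conjI)
      then show ?thesis
      proof eventually_elim
        case (elim x)
        show ?case
        proof (cases "x \<in> B3")
          case True
          then show ?thesis using elim form_of_field_of[OF alt(1) True] form_of_field_of[OF alt(2) True]
            by (simp add: form_of_diff)
        next
          case False
          then show ?thesis using out[OF False] form_of_diff[of 0 0] p by simp
        qed
      qed
    qed
    then have ae: "AE x in lebesgue. ?n x = indicator B3 x *\<^sub>R norm (F x - G x) powr p" by (rule AE_completion)
    show ?thesis
      by (rule integral_cong_AE[OF borel_measurable_AE[OF m ae] m]) (use ae in \<open>eventually_elim, simp\<close>)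
  qed
  also have "\<dots> = (\<integral>x. ?n x \<partial>lborel)" by (rule integral_completion) measurable
  finally have "Lp_dist p F G powr p = (\<integral>x. ?n x \<partial>lborel)"
    using p by (simp add: Lp_dist_def powr_powr)
  then have dist: "ennreal (Lp_dist p F G powr p) = (\<integral>\<^sup>+x. ennreal (?n x) \<partial>lborel)"
    using nn_integral_eq_integral[OF int] by simp
  show "ennreal (Lp_dist p F G powr p) \<le> ennreal (6 powr p) * (\<Sum>i\<in>UNIV. Lpow p (\<lambda>x. X x $ i - Y x $ i))"
    unfolding dist by (rule upper)
  show "Lpow p (\<lambda>x. X x $ i - Y x $ i) \<le> ennreal (Lp_dist p F G powr p)"
    unfolding dist Lpow_def using abs_le_norm_form_of[of "X _ - Y _" i] p
    by (intro nn_integral_mono ennreal_leI powr_mono2) auto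
qed

section \<open>Integrality of fluxes is a closed condition\<close>

lemma Omega2_Z_iff:
  assumes p: "p \<ge> 1" and F: "F \<in> Omega2_Lp p" and X: "represents X F" "\<And>i. Lpow p (\<lambda>x. X x $ i) < \<infinity>"
  shows "F \<in> Omega2_Z p \<longleftrightarrow> (\<forall>x0\<in>B3. AE r in lborel. r \<in> {0<..<max_side x0} \<longrightarrow> field_flux X x0 r \<in> \<int>)"
proof -
  have alt: "alternating_on B3 F" using F by (simp add: Omega2_Lp_def)
  have Xm[measurable]: "X \<in> borel_measurable borel" using X(1) by (simp add: represents_def)
  have X1: "Lpow 1 (\<lambda>x. X x $ i) < \<infinity>" for i
    by (rule Lpow_1_finite[OF p]) (use X in \<open>auto simp: represents_def\<close>)
  have "(AE r in lebesgue. r \<in> {0<..<max_side x0} \<longrightarrow> lebesgue_point (flux F x0) r \<longrightarrow> flux F x0 r \<in> \<int>) \<longleftrightarrow>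
      (AE r in lborel. r \<in> {0<..<max_side x0} \<longrightarrow> field_flux X x0 r \<in> \<int>)" if x0: "x0 \<in> B3" for x0
  proof -
    have "Lpow 1 (\<lambda>x. 0) = 0" by (simp add: Lpow_def)
    then have "(\<integral>\<^sup>+r. ennreal \<bar>field_flux X x0 r\<bar> \<partial>lborel) \<le> 4 * (\<Sum>i\<in>UNIV. Lpow 1 (\<lambda>x. X x $ i))"
      using field_flux_L1[OF Xm X1, of "\<lambda>_. 0" x0] by (simp add: field_flux_def face_integral_def)
    also have "\<dots> < \<infinity>" using X1 by (simp add: ennreal_mult_less_top sum_ennreal_less_top)
    finally have H: "integrable lborel (field_flux X x0)" by (intro integrableI_bounded) simp_all
    have eq: "AE r in lborel. r \<in> {0<..<max_side x0} \<longrightarrow> flux F x0 r = field_flux X x0 r"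
      by (rule flux_eq_field_flux[OF alt X(1) x0])
    have lp: "AE r in lborel. r \<in> {0<..<max_side x0} \<longrightarrow> lebesgue_point (flux F x0) r"
      by (rule AE_lebesgue_point[OF H eq])
    show ?thesis
      unfolding AE_completion_iff
    proof
      assume "AE r in lborel. r \<in> {0<..<max_side x0} \<longrightarrow> lebesgue_point (flux F x0) r \<longrightarrow> flux F x0 r \<in> \<int>"
      with eq lp show "AE r in lborel. r \<in> {0<..<max_side x0} \<longrightarrow> field_flux X x0 r \<in> \<int>"
        by eventually_elim auto
    next
      assume "AE r in lborel. r \<in> {0<..<max_side x0} \<longrightarrow> field_flux X x0 r \<in> \<int>"
      with eq show "AE r in lborel. r \<in> {0<..<max_side x0} \<longrightarrow> lebesgue_point (flux F x0) r \<longrightarrow> flux F x0 r \<in> \<int>"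
        by eventually_elim auto
    qed
  qed
  then show ?thesis using F unfolding Omega2_Z_def max_side_def by auto
qed

definition dist_int :: "real \<Rightarrow> real" where
  "dist_int t = \<bar>t - of_int (round t)\<bar>"

lemma dist_int_le: "n \<in> \<int> \<Longrightarrow> dist_int t \<le> \<bar>t - n\<bar>"
  by (auto simp: dist_int_def elim!: Ints_cases intro: round_diff_minimal)

lemma dist_int_triangle: "dist_int t \<le> dist_int u + \<bar>t - u\<bar>"
  using dist_int_le[of "of_int (round u)" t] by (simp add: dist_int_def)

lemma dist_int_eq_0: "dist_int t = 0 \<longleftrightarrow> t \<in> \<int>"
  by (auto simp: dist_int_def elim!: Ints_cases) (metis Ints_of_int)

lemma dist_int_nonneg: "dist_int t \<ge> 0"
  by (simp add: dist_int_def)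

lemma measurable_dist_int[measurable]: "dist_int \<in> borel_measurable borel"
  unfolding dist_int_def[abs_def] round_def by measurable

lemma AE_Ints_of_small:
  fixes f :: "real \<Rightarrow> real"
  assumes [measurable]: "f \<in> borel_measurable borel" "A \<in> sets borel"
    and small: "\<And>e. e > 0 \<Longrightarrow> (\<integral>\<^sup>+r. ennreal (dist_int (f r)) * indicator A r \<partial>lborel) \<le> ennreal e"
  shows "AE r in lborel. r \<in> A \<longrightarrow> f r \<in> \<int>"
proof -
  have "(\<integral>\<^sup>+r. ennreal (dist_int (f r)) * indicator A r \<partial>lborel) \<le> 0"
    by (rule ennreal_le_epsilon) (use small in simp)
  then have "AE r in lborel. ennreal (dist_int (f r)) * indicator A r = 0"
    by (subst (asm) le_zero_eq, subst (asm) nn_integral_0_iff_AE) auto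
  then show ?thesis
    by eventually_elim (auto simp: indicator_def dist_int_eq_0[symmetric] antisym[OF _ dist_int_nonneg] ennreal_eq_0_iff split: if_splits)
qed

text \<open>By the \<open>L\<^sup>1\<close> continuity of fluxes, the distance of the fluxes of a limit to the integers has an
  arbitrarily small integral over the side lengths.\<close>

lemma Omega2_Z_closed:
  assumes p: "p \<ge> 1" and F: "F \<in> Omega2_Lp p"
    and near: "\<And>e. e > 0 \<Longrightarrow> \<exists>G\<in>Omega2_Z p. Lp_dist p F G < e"
  shows "F \<in> Omega2_Z p"
proof -
  obtain X where X: "represents X F" "\<And>i. Lpow p (\<lambda>x. X x $ i) < \<infinity>" by (rule representative[OF p F]) (rule that)
  have Xm[measurable]: "X \<in> borel_measurable borel" using X(1) by (simp add: represents_def)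
  have X1: "Lpow 1 (\<lambda>x. X x $ i) < \<infinity>" for i
    by (rule Lpow_1_finite[OF p]) (use X in \<open>auto simp: represents_def\<close>)
  define V where "V = measure lborel B3"
  have V: "emeasure lborel B3 = ennreal V"
    unfolding V_def by (rule emeasure_eq_ennreal_measure) (use emeasure_ball_finite in simp)
  have V0: "V \<ge> 0" by (simp add: V_def)
  have "AE r in lborel. r \<in> {0<..<max_side x0} \<longrightarrow> field_flux X x0 r \<in> \<int>" if x0: "x0 \<in> B3" for x0
  proof (rule AE_Ints_of_small)
    fix e :: real assume e: "e > 0"
    \<comment> \<open>\<open>d\<close> controls the part of the difference below the threshold, \<open>d'\<close> the part above it.\<close>
    define d where "d = e / (24 * (V + 1))"
    define d' where "d' = (e / (24 * d powr (1 - p))) powr (1 / p)"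
    have d: "d > 0" using e V0 by (simp add: d_def)
    have d': "d' > 0" using e d by (simp add: d'_def)
    obtain G where G: "G \<in> Omega2_Z p" "Lp_dist p F G < d'" using near[OF d'] by blast
    have GL: "G \<in> Omega2_Lp p" using G(1) by (simp add: Omega2_Z_def)
    obtain Y where Y: "represents Y G" "\<And>i. Lpow p (\<lambda>x. Y x $ i) < \<infinity>" by (rule representative[OF p GL]) (rule that)
    have Ym[measurable]: "Y \<in> borel_measurable borel" using Y(1) by (simp add: represents_def)
    have Y1: "Lpow 1 (\<lambda>x. Y x $ i) < \<infinity>" for i
      by (rule Lpow_1_finite[OF p]) (use Y in \<open>auto simp: represents_def\<close>)
    have YZ: "AE r in lborel. r \<in> {0<..<max_side x0} \<longrightarrow> field_flux Y x0 r \<in> \<int>"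
      using Omega2_Z_iff[OF p GL Y] G(1) x0 by blast
    have "Lpow 1 (\<lambda>x. X x $ i - Y x $ i) \<le> ennreal (e / 12)" for i
    proof -
      have "Lpow p (\<lambda>x. X x $ i - Y x $ i) \<le> ennreal (Lp_dist p F G powr p)"
        by (rule Lp_dist_bounds(1)[OF p _ _ X Y]) (use F GL in \<open>auto simp: Omega2_Lp_def\<close>)
      also have "\<dots> \<le> ennreal (d' powr p)"
        using G(2) p by (intro ennreal_leI powr_mono2) (auto simp: Lp_dist_def)
      also have "d' powr p = e / (24 * d powr (1 - p))" using p e d by (simp add: d'_def powr_powr)
      finally have Lp: "Lpow p (\<lambda>x. X x $ i - Y x $ i) \<le> ennreal (e / (24 * d powr (1 - p)))" .
      have "Lpow 1 (\<lambda>x. X x $ i - Y x $ i) \<le>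
          ennreal d * emeasure lborel B3 + ennreal (d powr (1 - p)) * Lpow p (\<lambda>x. X x $ i - Y x $ i)"
        by (rule Lpow_1_le[OF p _ _ d]) (use X(1) Y(1) in \<open>auto simp: represents_def\<close>)
      also have "\<dots> \<le> ennreal d * ennreal V + ennreal (d powr (1 - p)) * ennreal (e / (24 * d powr (1 - p)))"
        unfolding V by (intro add_mono mult_left_mono Lp) auto
      also have "\<dots> = ennreal (d * V + e / 24)"
        using d e V0 by (simp flip: ennreal_mult ennreal_plus)
      also have "d * V \<le> e / 24" using V0 e by (simp add: d_def field_simps)
      then have "ennreal (d * V + e / 24) \<le> ennreal (e / 12)" by (intro ennreal_leI) simp
      finally show ?thesis .
    qed
    then have S: "(\<Sum>i\<in>UNIV. Lpow 1 (\<lambda>x. X x $ i - Y x $ i)) \<le> (\<Sum>i\<in>(UNIV :: 3 set). ennreal (e / 12))"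
      by (intro sum_mono)
    have "(\<integral>\<^sup>+r. ennreal (dist_int (field_flux X x0 r)) * indicator {0<..<max_side x0} r \<partial>lborel) \<le>
        (\<integral>\<^sup>+r. ennreal \<bar>field_flux X x0 r - field_flux Y x0 r\<bar> \<partial>lborel)"
      by (rule nn_integral_mono_AE, use YZ in eventually_elim)
         (auto simp: indicator_def intro: ennreal_leI dist_int_le)
    also have "\<dots> \<le> 4 * (\<Sum>i\<in>UNIV. Lpow 1 (\<lambda>x. X x $ i - Y x $ i))" by (rule field_flux_L1[OF Xm X1 Ym Y1])
    also have "\<dots> \<le> 4 * (\<Sum>i\<in>(UNIV :: 3 set). ennreal (e / 12))" by (rule mult_left_mono[OF S]) simp
    also have "\<dots> = ennreal 4 * ennreal (3 * (e / 12))" using e by (subst sum_ennreal) auto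
    also have "\<dots> = ennreal e" using e by (subst ennreal_mult[symmetric]) auto
    finally show "(\<integral>\<^sup>+r. ennreal (dist_int (field_flux X x0 r)) * indicator {0<..<max_side x0} r \<partial>lborel) \<le> ennreal e" .
  qed measurable
  then show ?thesis using Omega2_Z_iff[OF p F X] by blast
qed

section \<open>Forms with finitely many integer singularities have integer fluxes\<close>

lemma integrable_product:
  fixes f :: "'a::euclidean_space \<Rightarrow> real" and g :: "'b::euclidean_space \<Rightarrow> real"
  assumes f: "integrable lborel f" and g: "integrable lborel g"
  shows "integrable (lborel \<Otimes>\<^sub>M lborel) (\<lambda>(x, y). f x * g y)"
proof (rule lborel_pair.Fubini_integrable)
  have [measurable]: "f \<in> borel_measurable borel" "g \<in> borel_measurable borel"
    using f g borel_measurable_integrable by fastforce+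
  show "(\<lambda>(x, y). f x * g y) \<in> borel_measurable (lborel \<Otimes>\<^sub>M lborel)" by measurable
  have "integrable lborel (\<lambda>x. \<bar>f x\<bar> * (\<integral>y. \<bar>g y\<bar> \<partial>lborel))"
    by (intro integrable_mult_left integrable_abs f)
  then show "integrable lborel (\<lambda>x. \<integral>y. norm (case (x, y) of (x, y) \<Rightarrow> f x * g y) \<partial>lborel)"
    by (simp add: abs_mult)
  show "AE x in lborel. integrable lborel (\<lambda>y. case (x, y) of (x, y) \<Rightarrow> f x * g y)"
    using g by simp
qed

lemma integral_product:
  fixes f g :: "real \<Rightarrow> real"
  assumes f: "integrable lborel f" and g: "integrable lborel g"
  shows "(\<integral>u. f (fst u) * g (snd u) \<partial>lborel) = (\<integral>x. f x \<partial>lborel) * (\<integral>y. g y \<partial>lborel)"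
proof -
  have "(\<integral>u. f (fst u) * g (snd u) \<partial>lborel) = (\<integral>u. (\<lambda>(x, y). f x * g y) u \<partial>(lborel \<Otimes>\<^sub>M lborel))"
    by (simp add: lborel_prod split_beta)
  also have "\<dots> = (\<integral>x. (\<integral>y. f x * g y \<partial>lborel) \<partial>lborel)"
    using lborel_pair.integral_fst'[OF integrable_product[OF f g]] by simp
  finally show ?thesis by simp
qed

definition bump3 :: "real^3 \<Rightarrow> real" where
  "bump3 = tensor (\<lambda>_. bump)"

lemma bump3_nonneg: "bump3 x \<ge> 0"
  by (simp add: bump3_def tensor_def prod_nonneg bump_nonneg)

lemma bump3_eq_0: "\<bar>x $ i\<bar> \<ge> 1 / 2 \<Longrightarrow> bump3 x = 0"
  unfolding bump3_def by (intro tensor_eq_0 bump_eq_0)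

lemma continuous_on_bump3: "continuous_on A bump3"
  unfolding bump3_def by (rule continuous_on_tensor) (rule smooth1_bump)

lemma measurable_bump3[measurable]: "bump3 \<in> borel_measurable borel"
  by (rule borel_measurable_continuous_onI[OF continuous_on_bump3])

lemma measurable_bump[measurable]: "bump \<in> borel_measurable borel"
  by (rule borel_measurable_continuous_onI[OF smooth1_continuous[OF smooth1_bump]])

lemma measurable_step[measurable]: "step \<in> borel_measurable borel"
  by (rule borel_measurable_continuous_onI[OF smooth1_continuous[OF smooth1_step]])

lemma norm_le_3: "(\<And>i. \<bar>x $ i\<bar> \<le> b) \<Longrightarrow> norm (x :: real^3) \<le> 3 * b"
proof -
  assume b: "\<And>i. \<bar>x $ i\<bar> \<le> b"
  have "norm x \<le> (\<Sum>i\<in>UNIV. \<bar>x $ i\<bar>)" by (rule norm_le_l1_cart)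
  also have "\<dots> \<le> (\<Sum>i\<in>(UNIV :: 3 set). b)" by (intro sum_mono b)
  finally show "norm x \<le> 3 * b" by simp
qed

lemma bump3_support: "norm x > 3 / 2 \<Longrightarrow> bump3 x = 0"
proof -
  assume "norm x > 3 / 2"
  then have "\<exists>i. \<bar>x $ i\<bar> > 1 / 2" using norm_le_3[of x "1/2"] by (force simp: not_less)
  then show "bump3 x = 0" using bump3_eq_0[of x] by (metis less_imp_le)
qed

lemma bump3_bounded: obtains C where "C > 0" "\<And>x. \<bar>bump3 x\<bar> \<le> C"
  by (rule bounded_continuous_bounded_support[OF continuous_on_bump3, of "3/2"]) (rule bump3_support, assumption, rule that)

lemma nn_integral_bump3: "(\<integral>\<^sup>+x. ennreal (bump3 x) \<partial>lborel) = 1"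
proof -
  have "(\<integral>\<^sup>+t. ennreal (bump t) \<partial>lborel) = 1"
    using nn_integral_eq_integral[OF integrable_bump] integral_bump by (simp add: bump_nonneg)
  then show ?thesis unfolding bump3_def by (subst nn_integral_prod_vec) (auto simp: bump_nonneg)
qed

lemma integrable_bump3: "integrable lborel bump3"
  by (rule integrable_continuous_bounded_support[OF continuous_on_bump3 bump3_support])

lemma integral_bump3: "(\<integral>x. bump3 x \<partial>lborel) = 1"
  using nn_integral_bump3 bump3_nonneg by (subst integral_eq_nn_integral) auto

text \<open>The indicator of \<open>[-r/2, r/2]\<close>, mollified at scale \<open>\<eta>\<close>.\<close>

definition cutoff :: "real \<Rightarrow> real \<Rightarrow> real \<Rightarrow> real" where
  "cutoff \<eta> r t = step ((t + r / 2) / \<eta>) - step ((t - r / 2) / \<eta>)"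

lemma cutoff_eq_integral:
  assumes "\<eta> > 0" "r > 0"
  shows "(\<integral>w. (if \<bar>w\<bar> < r / 2 then bump ((t - w) / \<eta>) / \<eta> else 0) \<partial>lborel) = cutoff \<eta> r t"
    and "integrable lborel (\<lambda>w. if \<bar>w\<bar> < r / 2 then bump ((t - w) / \<eta>) / \<eta> else 0)"
proof -
  have H: "has_bochner_integral lborel (\<lambda>w. (bump ((t - w) / \<eta>) / \<eta>) * indicator {- (r / 2)..r / 2} w)
      ((- step ((t - r / 2) / \<eta>)) - (- step ((t - - (r / 2)) / \<eta>)))"
  proof (rule has_bochner_integral_FTC_Icc_nonneg)
    fix w :: real
    have "((\<lambda>w. (t - w) / \<eta>) has_real_derivative (- 1 / \<eta>)) (at w)"
      using assms by (auto intro!: derivative_eq_intros)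
    from DERIV_chain2[OF step_deriv this]
    have "((\<lambda>w. step ((t - w) / \<eta>)) has_real_derivative bump ((t - w) / \<eta>) * (- 1 / \<eta>)) (at w)" .
    from DERIV_minus[OF this]
    show "((\<lambda>w. - step ((t - w) / \<eta>)) has_real_derivative bump ((t - w) / \<eta>) / \<eta>) (at w)" by simp
  qed (use assms bump_nonneg in auto)
  have ae: "AE w in lborel. (bump ((t - w) / \<eta>) / \<eta>) * indicator {- (r / 2)..r / 2} w =
      (if \<bar>w\<bar> < r / 2 then bump ((t - w) / \<eta>) / \<eta> else 0)"
    using AE_lborel_singleton[of "r / 2"] AE_lborel_singleton[of "- (r / 2)"]
    by eventually_elim (auto simp: indicator_def)
  have "has_bochner_integral lborel (\<lambda>w. if \<bar>w\<bar> < r / 2 then bump ((t - w) / \<eta>) / \<eta> else 0) (cutoff \<eta> r t)"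
    using H by (subst has_bochner_integral_cong_AE[OF _ _ ae, symmetric]) (auto simp: cutoff_def)
  then show "(\<integral>w. (if \<bar>w\<bar> < r / 2 then bump ((t - w) / \<eta>) / \<eta> else 0) \<partial>lborel) = cutoff \<eta> r t"
    "integrable lborel (\<lambda>w. if \<bar>w\<bar> < r / 2 then bump ((t - w) / \<eta>) / \<eta> else 0)"
    by (simp_all add: has_bochner_integral_iff)
qed

lemma cutoff_Ints:
  assumes "\<eta> > 0" "r > 0" "\<eta> \<le> 2 * \<bar>\<bar>t\<bar> - r / 2\<bar>"
  shows "cutoff \<eta> r t \<in> \<int>"
proof -
  have "step (y / \<eta>) \<in> \<int>" if "\<bar>y\<bar> \<ge> \<bar>\<bar>t\<bar> - r / 2\<bar>" for y
  proof -
    have "y / \<eta> \<ge> 1 / 2 \<or> y / \<eta> \<le> - 1 / 2" using that assms by (auto simp: field_simps abs_if split: if_splits)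
    then show ?thesis using step_eq_0[of "y / \<eta>"] step_eq_1[of "y / \<eta>"] by auto
  qed
  moreover have "\<bar>t + r / 2\<bar> \<ge> \<bar>\<bar>t\<bar> - r / 2\<bar>" "\<bar>t - r / 2\<bar> \<ge> \<bar>\<bar>t\<bar> - r / 2\<bar>" using assms(2) by linarith+
  ultimately show ?thesis unfolding cutoff_def by (intro Ints_diff) blast+
qed

lemma cutoff_eq_0: "\<eta> > 0 \<Longrightarrow> r > 0 \<Longrightarrow> \<bar>t\<bar> \<ge> (r + \<eta>) / 2 \<Longrightarrow> cutoff \<eta> r t = 0"
proof -
  assume a: "\<eta> > 0" "r > 0" "\<bar>t\<bar> \<ge> (r + \<eta>) / 2"
  show ?thesis
  proof (cases "t \<ge> 0")
    case True
    then have "(t + r / 2) / \<eta> \<ge> 1 / 2" "(t - r / 2) / \<eta> \<ge> 1 / 2" using a by (auto simp: field_simps)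
    then show ?thesis by (simp add: cutoff_def step_eq_1)
  next
    case False
    then have "(t + r / 2) / \<eta> \<le> - 1 / 2" "(t - r / 2) / \<eta> \<le> - 1 / 2" using a by (auto simp: field_simps)
    then show ?thesis by (simp add: cutoff_def step_eq_0)
  qed
qed

definition mollified_face :: "(real^3 \<Rightarrow> real^3) \<Rightarrow> 3 \<Rightarrow> real \<Rightarrow> real^3 \<Rightarrow> real \<Rightarrow> real" where
  "mollified_face X i \<eta> c r = (\<integral>u. (if sup2 u < r / 2
     then (\<integral>v. bump3 v * X (c + in_plane i u + \<eta> *\<^sub>R v) $ i \<partial>lborel) else 0) \<partial>lborel)"

definition mollified_flux :: "(real^3 \<Rightarrow> real^3) \<Rightarrow> real \<Rightarrow> real^3 \<Rightarrow> real \<Rightarrow> real" where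
  "mollified_flux X \<eta> x0 r = 1 / (2 * pi) * (\<Sum>i\<in>UNIV.
     mollified_face X i \<eta> (x0 + (r / 2) *\<^sub>R axis i 1) r - mollified_face X i \<eta> (x0 - (r / 2) *\<^sub>R axis i 1) r)"

lemma integrable_of_Lpow_1:
  assumes "f \<in> borel_measurable borel" "Lpow 1 f < \<infinity>"
  shows "integrable lborel f"
  using assms by (intro integrableI_bounded) (auto simp: Lpow_def)

lemma mollified_face_eq:
  fixes X :: "real^3 \<Rightarrow> real^3"
  assumes [measurable]: "X \<in> borel_measurable borel" and fin: "Lpow 1 (\<lambda>x. X x $ i) < \<infinity>" and \<eta>: "\<eta> > 0" and r: "r > 0"
  shows "(\<integral>x. X x $ i * (bump ((x - c) $ i / \<eta>) / \<eta> * (cutoff \<eta> r ((x - c) $ (i + 1)) * cutoff \<eta> r ((x - c) $ (i + 2)))) \<partial>lborel) =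
      mollified_face X i \<eta> c r" (is ?A)
    and "integrable lborel (\<lambda>u. if sup2 u < r / 2 then (\<integral>v. bump3 v * X (c + in_plane i u + \<eta> *\<^sub>R v) $ i \<partial>lborel) else 0)" (is ?B)
proof -
  define k where "k x u = (if sup2 u < r / 2 then bump3 ((1 / \<eta>) *\<^sub>R (x - c - in_plane i u)) / \<eta> ^ 3 else 0)" for x u
  have km[measurable]: "(\<lambda>(x, u). k x u) \<in> borel_measurable (lborel \<Otimes>\<^sub>M lborel)" unfolding k_def by measurable
  have k_eq: "(\<integral>u. k x u \<partial>lborel) = bump ((x - c) $ i / \<eta>) / \<eta> * (cutoff \<eta> r ((x - c) $ (i + 1)) * cutoff \<eta> r ((x - c) $ (i + 2)))" for x
  proof -
    let ?g = "\<lambda>t w. if \<bar>w\<bar> < r / 2 then bump ((t - w) / \<eta>) / \<eta> else 0"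
    have "k x u = bump ((x - c) $ i / \<eta>) / \<eta> * (?g ((x - c) $ (i + 1)) (fst u) * ?g ((x - c) $ (i + 2)) (snd u))" for u
    proof -
      have "sup2 u < r / 2 \<longleftrightarrow> \<bar>fst u\<bar> < r / 2 \<and> \<bar>snd u\<bar> < r / 2" by (auto simp: sup2_def)
      then show ?thesis
        using \<eta> by (simp add: k_def bump3_def tensor_def prod_index[of _ i] in_plane_def power3_eq_cube)
    qed
    then have "(\<integral>u. k x u \<partial>lborel) = bump ((x - c) $ i / \<eta>) / \<eta> *
        (\<integral>u. ?g ((x - c) $ (i + 1)) (fst u) * ?g ((x - c) $ (i + 2)) (snd u) \<partial>lborel)"
      by (simp only: integral_mult_right_zero)
    also have "(\<integral>u. ?g ((x - c) $ (i + 1)) (fst u) * ?g ((x - c) $ (i + 2)) (snd u) \<partial>lborel) =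
        cutoff \<eta> r ((x - c) $ (i + 1)) * cutoff \<eta> r ((x - c) $ (i + 2))"
      unfolding integral_product[OF cutoff_eq_integral(2)[OF \<eta> r] cutoff_eq_integral(2)[OF \<eta> r]]
      by (simp only: cutoff_eq_integral(1)[OF \<eta> r])
    finally show ?thesis .
  qed
  have f: "integrable lborel (\<lambda>x. X x $ i)" by (rule integrable_of_Lpow_1[OF _ fin]) measurable
  obtain C where C: "C > 0" "\<And>x. \<bar>bump3 x\<bar> \<le> C" by (rule bump3_bounded) (rule that)
  define g where "g u = (if sup2 u < r / 2 then C / \<eta> ^ 3 else 0)" for u
  have g: "integrable lborel g"
  proof -
    have "integrable lborel (\<lambda>u. indicator ({-r/2<..<r/2} \<times> {-r/2<..<r/2}) u *\<^sub>R (C / \<eta> ^ 3) :: real)"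
    proof (rule integrable_real_indicator[THEN integrable_scaleR_left])
      show "{-r/2<..<r/2} \<times> {-r/2<..<r/2} \<in> sets (lborel :: (real \<times> real) measure)"
        unfolding sets_lborel by (intro borel_open open_Times) auto
      have "bounded ({-r/2<..<r/2} \<times> {-r/2<..<r/2})" 
        by (intro bounded_Times bounded_subset[OF bounded_cball[of 0 "r / 2"]]) (auto simp: dist_real_def)
      then show "emeasure lborel ({-r/2<..<r/2} \<times> {-r/2<..<r/2}) < \<infinity>" by (rule emeasure_bounded_finite)
    qed
    moreover have "(\<lambda>u. indicator ({-r/2<..<r/2} \<times> {-r/2<..<r/2}) u *\<^sub>R (C / \<eta> ^ 3)) = g"
      by (auto simp: g_def sup2_def indicator_def fun_eq_iff)
    ultimately show ?thesis by simp
  qed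
  have I: "integrable (lborel \<Otimes>\<^sub>M lborel) (\<lambda>(x, u). X x $ i * k x u)"
  proof (rule Bochner_Integration.integrable_bound[OF integrable_product[OF f g]])
    show "AE z in lborel \<Otimes>\<^sub>M lborel. norm (case z of (x, u) \<Rightarrow> X x $ i * k x u) \<le> norm (case z of (x, u) \<Rightarrow> X x $ i * g u)"
    proof (rule AE_I2)
      fix z :: "(real^3) \<times> real \<times> real"
      obtain x u where z: "z = (x, u)" by (cases z)
      have "\<bar>k x u\<bar> \<le> \<bar>g u\<bar>" using C \<eta> by (auto simp: k_def g_def intro!: divide_right_mono)
      then show "norm (case z of (x, u) \<Rightarrow> X x $ i * k x u) \<le> norm (case z of (x, u) \<Rightarrow> X x $ i * g u)"
        unfolding z by (simp add: abs_mult mult_left_mono)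
    qed
  qed measurable
  have inner: "(\<integral>x. X x $ i * k x u \<partial>lborel) =
      (if sup2 u < r / 2 then (\<integral>v. bump3 v * X (c + in_plane i u + \<eta> *\<^sub>R v) $ i \<partial>lborel) else 0)" for u
  proof (cases "sup2 u < r / 2")
    case True
    have "(\<integral>x. X x $ i * k x u \<partial>lborel) = \<bar>\<eta>\<bar> ^ DIM(real^3) *
        (\<integral>v. X ((c + in_plane i u) + \<eta> *\<^sub>R v) $ i * k ((c + in_plane i u) + \<eta> *\<^sub>R v) u \<partial>lborel)"
      by (rule integral_affine) (use \<eta> in \<open>simp_all add: k_def\<close>)
    also have "\<dots> = \<eta> ^ 3 * (\<integral>v. (1 / \<eta> ^ 3) * (bump3 v * X (c + in_plane i u + \<eta> *\<^sub>R v) $ i) \<partial>lborel)"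
    proof -
      have "X ((c + in_plane i u) + \<eta> *\<^sub>R v) $ i * k ((c + in_plane i u) + \<eta> *\<^sub>R v) u =
          (1 / \<eta> ^ 3) * (bump3 v * X (c + in_plane i u + \<eta> *\<^sub>R v) $ i)" for v
        using \<eta> True by (simp add: k_def)
      then show ?thesis using \<eta> by simp
    qed
    also have "\<dots> = (\<integral>v. bump3 v * X (c + in_plane i u + \<eta> *\<^sub>R v) $ i \<partial>lborel)"
      using \<eta> by (simp only: integral_mult_right_zero) simp
    finally show ?thesis using True by simp
  next
    case False
    then show ?thesis by (simp add: k_def)
  qed
  have "(\<integral>x. X x $ i * (bump ((x - c) $ i / \<eta>) / \<eta> * (cutoff \<eta> r ((x - c) $ (i + 1)) * cutoff \<eta> r ((x - c) $ (i + 2)))) \<partial>lborel) =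
      (\<integral>x. (\<integral>u. X x $ i * k x u \<partial>lborel) \<partial>lborel)"
    by (simp only: k_eq integral_mult_right_zero)
  also have "\<dots> = (\<integral>u. (\<integral>x. X x $ i * k x u \<partial>lborel) \<partial>lborel)"
    by (rule lborel_pair.Fubini_integral[OF I, symmetric])
  finally show ?A unfolding inner mollified_face_def .
  show ?B using lborel_pair.integrable_snd[OF I] unfolding inner .
qed

lemma mollified_face_close:
  fixes X :: "real^3 \<Rightarrow> real^3"
  assumes [measurable]: "X \<in> borel_measurable borel" and fin: "\<And>i. Lpow 1 (\<lambda>x. X x $ i) < \<infinity>" and \<eta>: "\<eta> > 0"
    and s: "s \<in> {-1, 1}"
    and near: "\<And>v. norm v \<le> 2 * \<eta> \<Longrightarrow> Lpow 1 (\<lambda>x. X (v + x) $ i - X x $ i) \<le> ennreal e"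
  shows "(\<integral>\<^sup>+r. ennreal \<bar>mollified_face X i \<eta> (x0 + (s * (r / 2)) *\<^sub>R axis i 1) r -
      face_integral X i (x0 + (s * (r / 2)) *\<^sub>R axis i 1) r\<bar> * indicator {0<..} r \<partial>lborel) \<le> 2 * ennreal e"
proof -
  define D where "D x = (\<integral>\<^sup>+v. ennreal (bump3 v * \<bar>X (x + \<eta> *\<^sub>R v) $ i - X x $ i\<bar>) \<partial>lborel)" for x
  have [measurable]: "D \<in> borel_measurable borel" unfolding D_def by measurable
  let ?c = "\<lambda>r. x0 + (s * (r / 2)) *\<^sub>R axis i 1 :: real^3"
  have intX: "integrable lborel (\<lambda>x. X x $ i)" by (rule integrable_of_Lpow_1[OF _ fin]) measurable
  have int1: "integrable lborel (\<lambda>v. bump3 v * X (y + \<eta> *\<^sub>R v) $ i)" for y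
  proof -
    obtain C where C: "C > 0" "\<And>x. \<bar>bump3 x\<bar> \<le> C" by (rule bump3_bounded) (rule that)
    have "integrable lborel (\<lambda>v. X (y + \<eta> *\<^sub>R v) $ i)"
      using integrable_affine[of "\<lambda>x. X x $ i" \<eta> y] intX \<eta> by simp
    then have "integrable lborel (\<lambda>v. C * X (y + \<eta> *\<^sub>R v) $ i)" by (rule integrable_mult_right)
    then show ?thesis
    proof (rule Bochner_Integration.integrable_bound)
      show "AE v in lborel. norm (bump3 v * X (y + \<eta> *\<^sub>R v) $ i) \<le> norm (C * X (y + \<eta> *\<^sub>R v) $ i)"
        using C by (intro AE_I2) (simp add: abs_mult mult_right_mono)
    qed measurable
  qed
  have point: "ennreal \<bar>(\<integral>v. bump3 v * X (y + \<eta> *\<^sub>R v) $ i \<partial>lborel) - X y $ i\<bar> \<le> D y" for y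
  proof -
    have i2: "integrable lborel (\<lambda>v. bump3 v * X y $ i)" by (rule integrable_mult_left[OF integrable_bump3])
    have "X y $ i = (\<integral>v. bump3 v * X y $ i \<partial>lborel)" by (simp only: integral_mult_left_zero integral_bump3 mult_1)
    then have eq: "(\<integral>v. bump3 v * X (y + \<eta> *\<^sub>R v) $ i \<partial>lborel) - X y $ i =
        (\<integral>v. bump3 v * X (y + \<eta> *\<^sub>R v) $ i - bump3 v * X y $ i \<partial>lborel)"
      using Bochner_Integration.integral_diff[OF int1[of y] i2] by simp
    have "ennreal (norm (\<integral>v. bump3 v * X (y + \<eta> *\<^sub>R v) $ i - bump3 v * X y $ i \<partial>lborel)) \<le>
        (\<integral>\<^sup>+v. ennreal (norm (bump3 v * X (y + \<eta> *\<^sub>R v) $ i - bump3 v * X y $ i)) \<partial>lborel)"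
      by (rule integral_norm_bound_ennreal[OF Bochner_Integration.integrable_diff[OF int1 i2]])
    also have "\<dots> = D y"
      unfolding D_def using bump3_nonneg
      by (intro nn_integral_cong) (simp add: abs_mult flip: right_diff_distrib)
    finally show ?thesis unfolding eq by simp
  qed
  have "AE r in lborel. ennreal \<bar>mollified_face X i \<eta> (?c r) r - face_integral X i (?c r) r\<bar> * indicator {0<..} r \<le>
      (\<integral>\<^sup>+u. D (?c r + in_plane i u) \<partial>lborel)"
    using AE_face_integrable[OF _ fin s, of x0 i, simplified]
  proof (eventually_elim)
    case (elim r)
    show ?case
    proof (cases "r > 0")
      case True
      let ?M = "\<lambda>u. if sup2 u < r / 2 then (\<integral>v. bump3 v * X (?c r + in_plane i u + \<eta> *\<^sub>R v) $ i \<partial>lborel) else 0"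
      let ?P = "\<lambda>u. if sup2 u < r / 2 then X (?c r + in_plane i u) $ i else 0"
      have iM: "integrable lborel ?M" by (rule mollified_face_eq(2)[OF _ fin \<eta> True]) measurable
      have iP: "integrable lborel ?P" using elim by simp
      have eq: "mollified_face X i \<eta> (?c r) r - face_integral X i (?c r) r = (\<integral>u. ?M u - ?P u \<partial>lborel)"
        unfolding mollified_face_def face_integral_def by (rule Bochner_Integration.integral_diff[OF iM iP, symmetric])
      have "ennreal (norm (\<integral>u. ?M u - ?P u \<partial>lborel)) \<le> (\<integral>\<^sup>+u. ennreal (norm (?M u - ?P u)) \<partial>lborel)"
        by (rule integral_norm_bound_ennreal[OF Bochner_Integration.integrable_diff[OF iM iP]])
      also have "\<dots> \<le> (\<integral>\<^sup>+u. D (?c r + in_plane i u) \<partial>lborel)"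
      proof (rule nn_integral_mono)
        fix u show "ennreal (norm (?M u - ?P u)) \<le> D (?c r + in_plane i u)"
          using point[of "?c r + in_plane i u"] by (cases "sup2 u < r / 2") auto
      qed
      finally show ?thesis unfolding eq using True by simp
    qed simp
  qed
  then have "(\<integral>\<^sup>+r. ennreal \<bar>mollified_face X i \<eta> (?c r) r - face_integral X i (?c r) r\<bar> * indicator {0<..} r \<partial>lborel) \<le>
      (\<integral>\<^sup>+r. (\<integral>\<^sup>+u. D (?c r + in_plane i u) \<partial>lborel) \<partial>lborel)"
    by (rule nn_integral_mono_AE)
  also have "\<dots> = 2 * (\<integral>\<^sup>+x. D x \<partial>lborel)" by (rule nn_integral_faces[OF _ s]) measurable
  also have "(\<integral>\<^sup>+x. D x \<partial>lborel) =
      (\<integral>\<^sup>+v. (\<integral>\<^sup>+x. ennreal (bump3 v * \<bar>X (x + \<eta> *\<^sub>R v) $ i - X x $ i\<bar>) \<partial>lborel) \<partial>lborel)"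
    unfolding D_def by (rule lborel_pair.Fubini') measurable
  also have "\<dots> \<le> (\<integral>\<^sup>+v. ennreal (bump3 v) * ennreal e \<partial>lborel)"
  proof (rule nn_integral_mono)
    fix v :: "real^3"
    show "(\<integral>\<^sup>+x. ennreal (bump3 v * \<bar>X (x + \<eta> *\<^sub>R v) $ i - X x $ i\<bar>) \<partial>lborel) \<le> ennreal (bump3 v) * ennreal e"
    proof (cases "norm v \<le> 3 / 2")
      case True
      then have "norm (\<eta> *\<^sub>R v) \<le> 2 * \<eta>" using \<eta> mult_left_mono[OF True, of \<eta>] by simp
      from near[OF this]
      have L: "(\<integral>\<^sup>+x. ennreal \<bar>X (x + \<eta> *\<^sub>R v) $ i - X x $ i\<bar> \<partial>lborel) \<le> ennreal e"
        by (simp add: Lpow_def add.commute)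
      have "(\<integral>\<^sup>+x. ennreal (bump3 v * \<bar>X (x + \<eta> *\<^sub>R v) $ i - X x $ i\<bar>) \<partial>lborel) =
          ennreal (bump3 v) * (\<integral>\<^sup>+x. ennreal \<bar>X (x + \<eta> *\<^sub>R v) $ i - X x $ i\<bar> \<partial>lborel)"
        by (subst nn_integral_cmult[symmetric]) (auto simp: ennreal_mult bump3_nonneg)
      also have "\<dots> \<le> ennreal (bump3 v) * ennreal e" by (rule mult_left_mono[OF L]) simp
      finally show ?thesis .
    next
      case False
      then show ?thesis using bump3_support[of v] by simp
    qed
  qed
  also have "\<dots> = ennreal e" by (simp add: nn_integral_multc nn_integral_bump3)
  finally show ?thesis by (simp add: mult_left_mono)
qed

lemma distr_d_eq:
  assumes F: "alternating_on B3 F" and X: "represents X F" and \<phi>: "\<phi> \<in> test_functions B3"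
  shows "distr_d F \<phi> = - (\<integral>x. (\<Sum>i\<in>UNIV. X x $ i * partial_d i \<phi> x) \<partial>lborel)"
proof -
  have [measurable]: "X \<in> borel_measurable borel" using X by (simp add: represents_def)
  have s: "smooth_on UNIV \<phi>" using \<phi> by (simp add: test_functions_def)
  have [measurable]: "partial_d i \<phi> \<in> borel_measurable borel" for i
    by (rule borel_measurable_continuous_onI[OF smooth_on_continuous[OF smooth_on_partial[OF s]]])
  let ?g = "\<lambda>x. \<Sum>i\<in>UNIV. X x $ i * partial_d i \<phi> x"
  let ?h = "\<lambda>x. F x $ 2 $ 3 * partial_d 1 \<phi> x - F x $ 1 $ 3 * partial_d 2 \<phi> x + F x $ 1 $ 2 * partial_d 3 \<phi> x"
  have g: "?g \<in> borel_measurable lborel" by measurable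
  have "AE x in lborel. x \<in> B3 \<longrightarrow> X x = field_of F x" using X by (simp add: represents_def)
  then have "AE x in lborel. ?g x = indicator B3 x *\<^sub>R ?h x"
  proof eventually_elim
    case (elim x)
    show ?case
    proof (cases "x \<in> B3")
      case True
      then have "F x $ 1 $ 3 = - F x $ 3 $ 1" using F unfolding alternating_on_def by blast
      then show ?thesis using True elim by (simp add: sum_3 field_of_nth)
    next
      case False
      then have "X x = 0" using X by (simp add: represents_def)
      then show ?thesis using False by simp
    qed
  qed
  then have ae: "AE x in lebesgue. ?g x = indicator B3 x *\<^sub>R ?h x" by (rule AE_completion)
  have "(\<integral>x. ?h x \<partial>lebesgue_on B3) = (\<integral>x. indicator B3 x *\<^sub>R ?h x \<partial>lebesgue)"
    by (rule integral_restrict_space) simp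
  also have "\<dots> = (\<integral>x. ?g x \<partial>lebesgue)"
    by (rule integral_cong_AE[OF borel_measurable_AE[OF measurable_completion[OF g] ae] measurable_completion[OF g]])
       (use ae in \<open>eventually_elim, simp\<close>)
  also have "\<dots> = (\<integral>x. ?g x \<partial>lborel)" by (rule integral_completion[OF g])
  finally show ?thesis by (simp add: distr_d_def)
qed

lemma mollified_flux_eq_sum:
  assumes F: "alternating_on B3 F" and X: "represents X F" "\<And>i. Lpow 1 (\<lambda>x. X x $ i) < \<infinity>"
    and div: "\<And>\<phi>. \<phi> \<in> test_functions B3 \<Longrightarrow> distr_d F \<phi> = (\<Sum>a\<in>S. 2 * pi * of_int (h a) * \<phi> a)"
    and x0: "x0 \<in> B3" and r: "0 < r" "r < max_side x0" and \<eta>: "0 < \<eta>" "\<eta> \<le> r"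
  shows "mollified_flux X \<eta> x0 r = (\<Sum>a\<in>S. of_int (h a) * (\<Prod>j\<in>UNIV. cutoff \<eta> r ((a - x0) $ j)))"
proof -
  have Xm[measurable]: "X \<in> borel_measurable borel" using X(1) by (simp add: represents_def)
  define f where "f j t = cutoff \<eta> r (t - x0 $ j)" for j :: 3 and t
  define f' where "f' j t = (bump ((t - x0 $ j + r / 2) / \<eta>) - bump ((t - x0 $ j - r / 2) / \<eta>)) / \<eta>" for j :: 3 and t
  have f': "(f j has_real_derivative f' j t) (at t)" for j t
  proof -
    have "((\<lambda>t. (t - x0 $ j + r / 2) / \<eta>) has_real_derivative 1 / \<eta>) (at t)"
      "((\<lambda>t. (t - x0 $ j - r / 2) / \<eta>) has_real_derivative 1 / \<eta>) (at t)"
      using \<eta> by (auto intro!: derivative_eq_intros)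
    from DERIV_diff[OF DERIV_chain2[OF step_deriv this(1)] DERIV_chain2[OF step_deriv this(2)]]
    show ?thesis using \<eta> unfolding f_def[abs_def] f'_def cutoff_def by (simp add: diff_divide_distrib)
  qed
  have sf: "smooth1 (f j)" for j
  proof -
    have "f j = (\<lambda>t. step ((1 / \<eta>) * t + (r / 2 - x0 $ j) / \<eta>) - step ((1 / \<eta>) * t + (- r / 2 - x0 $ j) / \<eta>))"
      by (auto simp: f_def cutoff_def fun_eq_iff add_divide_distrib diff_divide_distrib algebra_simps)
    then show ?thesis using smooth1_diff[OF smooth1_affine[OF smooth1_step] smooth1_affine[OF smooth1_step]] by metis
  qed
  let ?\<phi> = "tensor f"
  have \<phi>: "?\<phi> \<in> test_functions B3"
  proof -
    let ?K = "{x. \<forall>j. \<bar>(x - x0) $ j\<bar> \<le> (r + \<eta>) / 2}"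
    have sub: "{x. ?\<phi> x \<noteq> 0} \<subseteq> ?K"
    proof (intro subsetI CollectI allI)
      fix x j assume "x \<in> {x. ?\<phi> x \<noteq> 0}"
      then have "f j (x $ j) \<noteq> 0" using tensor_eq_0[of f j x] by auto
      then show "\<bar>(x - x0) $ j\<bar> \<le> (r + \<eta>) / 2"
        using cutoff_eq_0[OF \<eta>(1) r(1), of "(x - x0) $ j"] by (force simp: f_def)
    qed
    have "closed ?K" by (intro closed_Collect_all closed_Collect_le continuous_intros)
    then have cl: "closure {x. ?\<phi> x \<noteq> 0} \<subseteq> ?K" using sub by (rule closure_minimal[rotated])
    have KB: "?K \<subseteq> B3"
    proof
      fix x assume "x \<in> ?K"
      then have j: "\<bar>(x - x0) $ j\<bar> \<le> r" for j using \<eta> by (auto intro: order_trans[of _ "(r + \<eta>) / 2"])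
      have "(norm (x - x0))\<^sup>2 = (\<Sum>j\<in>UNIV. ((x - x0) $ j)\<^sup>2)" by (simp add: norm_vec_def L2_set_def sum_nonneg)
      also have "\<dots> \<le> (\<Sum>j\<in>(UNIV :: 3 set). r\<^sup>2)" using j r by (intro sum_mono) (simp add: abs_le_square_iff[symmetric])
      also have "\<dots> = (sqrt 3 * r)\<^sup>2" by (simp add: power_mult_distrib)
      finally have "norm (x - x0) \<le> sqrt 3 * r" by (rule power2_le_imp_le) (use r in simp)
      also have "\<dots> < 1 - norm x0"
        using r(2) infdist_frontier_ball[OF x0] by (simp add: max_side_def field_simps)
      finally show "x \<in> B3" using norm_triangle_ineq[of "x - x0" x0] by simp
    qed
    then have "bounded (closure {x. ?\<phi> x \<noteq> 0})" using cl bounded_subset[OF bounded_ball[of 0 1]] by blast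
    then have "compact (closure {x. ?\<phi> x \<noteq> 0})" by (simp add: compact_eq_bounded_closed)
    then show ?thesis using smooth_on_tensor[OF sf] cl KB by (auto simp: test_functions_def)
  qed
  have partial: "partial_d i ?\<phi> x = tensor (f(i := f' i)) x" for i x
  proof -
    have "frechet_derivative ?\<phi> (at x) = (\<lambda>h. \<Sum>i\<in>UNIV. h $ i * tensor (f(i := f' i)) x)"
      by (rule frechet_derivative_at[OF tensor_has_derivative[OF f'], symmetric])
    then show ?thesis by (simp only: sum_axis)
  qed
  have face: "(\<integral>x. X x $ i * partial_d i ?\<phi> x \<partial>lborel) =
      mollified_face X i \<eta> (x0 - (r / 2) *\<^sub>R axis i 1) r - mollified_face X i \<eta> (x0 + (r / 2) *\<^sub>R axis i 1) r"
    and int: "integrable lborel (\<lambda>x. X x $ i * partial_d i ?\<phi> x)" for i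
  proof -
    let ?w = "\<lambda>c x. bump ((x - c) $ i / \<eta>) / \<eta> * (cutoff \<eta> r ((x - c) $ (i + 1)) * cutoff \<eta> r ((x - c) $ (i + 2)))"
    have [measurable]: "cutoff \<eta> r \<in> borel_measurable borel" unfolding cutoff_def[abs_def] by measurable
    have cu: "\<bar>cutoff \<eta> r t\<bar> \<le> 1" for t
      using step_nonneg[of "(t + r / 2) / \<eta>"] step_le_1[of "(t + r / 2) / \<eta>"]
        step_nonneg[of "(t - r / 2) / \<eta>"] step_le_1[of "(t - r / 2) / \<eta>"] by (simp add: cutoff_def)
    have "continuous_on UNIV bump" by (rule smooth1_continuous[OF smooth1_bump])
    then obtain C where C: "C > 0" "\<And>t. \<bar>bump t\<bar> \<le> C"
      by (rule bounded_continuous_bounded_support[of bump "1/2"]) (use bump_eq_0 in auto)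
    have iw: "integrable lborel (\<lambda>x. X x $ i * ?w c x)" for c
    proof (rule Bochner_Integration.integrable_bound)
      show "integrable lborel (\<lambda>x. X x $ i * (C / \<eta>))"
        by (intro integrable_mult_left integrable_of_Lpow_1 X(2)) measurable
      have wC: "\<bar>?w c x\<bar> \<le> C / \<eta> * (1 * 1)" for x
        unfolding abs_mult using C \<eta> cu by (intro mult_mono) (auto intro: divide_right_mono)
      then have "\<bar>?w c x\<bar> \<le> \<bar>C / \<eta>\<bar>" for x
        using order_trans[OF wC[of x] abs_ge_self[of "C / \<eta> * (1 * 1)"]] by (simp only: mult_1_right)
      then show "AE x in lborel. norm (X x $ i * ?w c x) \<le> norm (X x $ i * (C / \<eta>))"
        unfolding real_norm_def abs_mult[of "X _ $ i"] by (intro AE_I2 mult_left_mono) auto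
    qed measurable
    have "tensor (f(i := f' i)) x = ?w (x0 - (r / 2) *\<^sub>R axis i 1) x - ?w (x0 + (r / 2) *\<^sub>R axis i 1) x" for x
      by (simp add: tensor_def prod_index[of _ i] f_def f'_def axis_def algebra_simps diff_divide_distrib)
    then have eq: "X x $ i * partial_d i ?\<phi> x =
        X x $ i * ?w (x0 - (r / 2) *\<^sub>R axis i 1) x - X x $ i * ?w (x0 + (r / 2) *\<^sub>R axis i 1) x" for x
      unfolding partial by (simp only: right_diff_distrib)
    show "integrable lborel (\<lambda>x. X x $ i * partial_d i ?\<phi> x)"
      unfolding eq by (intro Bochner_Integration.integrable_diff iw)
    show "(\<integral>x. X x $ i * partial_d i ?\<phi> x \<partial>lborel) =
      mollified_face X i \<eta> (x0 - (r / 2) *\<^sub>R axis i 1) r - mollified_face X i \<eta> (x0 + (r / 2) *\<^sub>R axis i 1) r"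
      unfolding eq Bochner_Integration.integral_diff[OF iw iw]
      by (simp only: mollified_face_eq(1)[OF Xm X(2) \<eta>(1) r(1)])
  qed
  have "(\<Sum>a\<in>S. 2 * pi * of_int (h a) * ?\<phi> a) = - (\<integral>x. (\<Sum>i\<in>UNIV. X x $ i * partial_d i ?\<phi> x) \<partial>lborel)"
    using div[OF \<phi>] distr_d_eq[OF F X(1) \<phi>] by simp
  also have "\<dots> = - (\<Sum>i\<in>UNIV. \<integral>x. X x $ i * partial_d i ?\<phi> x \<partial>lborel)"
    by (subst Bochner_Integration.integral_sum[OF int]) simp
  also have "\<dots> = 2 * pi * mollified_flux X \<eta> x0 r"
    unfolding face mollified_flux_def by (simp add: sum_subtractf)
  finally have "2 * pi * mollified_flux X \<eta> x0 r = 2 * pi * (\<Sum>a\<in>S. of_int (h a) * ?\<phi> a)"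
    by (simp add: sum_distrib_left mult.assoc)
  then show ?thesis by (simp add: tensor_def f_def)
qed

lemma mollified_flux_close:
  fixes X :: "real^3 \<Rightarrow> real^3"
  assumes Xm[measurable]: "X \<in> borel_measurable borel" and fin: "\<And>i. Lpow 1 (\<lambda>x. X x $ i) < \<infinity>" and e: "e > 0"
  obtains d where "d > 0" "\<And>\<eta>. 0 < \<eta> \<Longrightarrow> \<eta> < d \<Longrightarrow>
    (\<integral>\<^sup>+r. ennreal \<bar>mollified_flux X \<eta> x0 r - field_flux X x0 r\<bar> * indicator {0<..} r \<partial>lborel) \<le> ennreal e"
proof -
  have "\<exists>d>0. \<forall>c v. \<bar>c - 1\<bar> < d \<longrightarrow> norm v < d \<longrightarrow> Lpow 1 (\<lambda>x. X (v + c *\<^sub>R x) $ i - X x $ i) \<le> ennreal (e / 12)" for i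
  proof -
    have m: "(\<lambda>x. X x $ i) \<in> borel_measurable borel" by measurable
    have "e / 12 > 0" using e by simp
    then obtain d where "d > 0" "\<And>c v. \<bar>c - 1\<bar> < d \<Longrightarrow> norm v < d \<Longrightarrow> Lpow 1 (\<lambda>x. X (v + c *\<^sub>R x) $ i - X x $ i) \<le> ennreal (e / 12)"
      by (rule Lpow_perturb[OF order_refl m fin]) (rule that)
    then show ?thesis by (intro exI[of _ d]) simp
  qed
  then have "\<forall>i. \<exists>d. d > 0 \<and> (\<forall>c v. \<bar>c - 1\<bar> < d \<longrightarrow> norm v < d \<longrightarrow> Lpow 1 (\<lambda>x. X (v + c *\<^sub>R x) $ i - X x $ i) \<le> ennreal (e / 12))"
    by (rule allI)
  from choice[OF this] obtain d where d: "\<forall>i. d i > 0 \<and> (\<forall>c v. \<bar>c - 1\<bar> < d i \<longrightarrow> norm v < d i \<longrightarrow>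
      Lpow 1 (\<lambda>x. X (v + c *\<^sub>R x) $ i - X x $ i) \<le> ennreal (e / 12))" ..
  define d' where "d' = Min (range d) / 2"
  have d'0: "d' > 0" using d by (simp add: d'_def)
  have d'le: "2 * d' \<le> d i" for i by (simp add: d'_def)
  show ?thesis
  proof (rule that[OF d'0])
    fix \<eta> assume \<eta>: "0 < \<eta>" "\<eta> < d'"
    let ?c = "\<lambda>r s i. x0 + (s * (r / 2)) *\<^sub>R axis i 1 :: real^3"
    let ?d = "\<lambda>s i r. mollified_face X i \<eta> (?c r s i) r - face_integral X i (?c r s i) r"
    have [measurable]: "(\<lambda>r. mollified_face X i \<eta> (?c r s i) r) \<in> borel_measurable borel" for s i
      unfolding mollified_face_def by measurable
    have close: "(\<integral>\<^sup>+r. ennreal \<bar>?d s i r\<bar> * indicator {0<..} r \<partial>lborel) \<le> 2 * ennreal (e / 12)" if s: "s \<in> {-1, 1}" for s i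
    proof (rule mollified_face_close[OF Xm fin \<eta>(1) s])
      fix v :: "real^3" assume "norm v \<le> 2 * \<eta>"
      then have "norm v < d i" using \<eta> d'le[of i] by simp
      then show "Lpow 1 (\<lambda>x. X (v + x) $ i - X x $ i) \<le> ennreal (e / 12)"
        using d[THEN spec, of i, THEN conjunct2, THEN spec, of 1, THEN spec, of v] d by simp
    qed
    have "ennreal \<bar>mollified_flux X \<eta> x0 r - field_flux X x0 r\<bar> * indicator {0<..} r \<le>
        (\<Sum>i\<in>UNIV. ennreal \<bar>?d 1 i r\<bar> * indicator {0<..} r + ennreal \<bar>?d (-1) i r\<bar> * indicator {0<..} r)" for r
    proof -
      have "mollified_flux X \<eta> x0 r - field_flux X x0 r = 1 / (2 * pi) * (\<Sum>i\<in>UNIV. ?d 1 i r - ?d (-1) i r)"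
        by (simp add: mollified_flux_def field_flux_def sum_subtractf sum.distrib algebra_simps)
      then have "\<bar>mollified_flux X \<eta> x0 r - field_flux X x0 r\<bar> = 1 / (2 * pi) * \<bar>\<Sum>i\<in>UNIV. ?d 1 i r - ?d (-1) i r\<bar>"
        by (simp add: abs_mult)
      also have "\<dots> \<le> 1 * \<bar>\<Sum>i\<in>UNIV. ?d 1 i r - ?d (-1) i r\<bar>"
        using pi_gt3 by (intro mult_right_mono) (auto simp: field_simps)
      also have "\<dots> \<le> (\<Sum>i\<in>UNIV. \<bar>?d 1 i r\<bar> + \<bar>?d (-1) i r\<bar>)"
        using sum_abs[of "\<lambda>i. ?d 1 i r - ?d (-1) i r" UNIV]
        by (auto intro: order_trans sum_mono abs_triangle_ineq4)
      finally have "ennreal \<bar>mollified_flux X \<eta> x0 r - field_flux X x0 r\<bar> \<le> ennreal (\<Sum>i\<in>UNIV. \<bar>?d 1 i r\<bar> + \<bar>?d (-1) i r\<bar>)"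
        by (rule ennreal_leI)
      also have "\<dots> = (\<Sum>i\<in>UNIV. ennreal \<bar>?d 1 i r\<bar> + ennreal \<bar>?d (-1) i r\<bar>)"
        by (subst sum_ennreal[symmetric]) (auto simp: ennreal_plus)
      finally show ?thesis by (cases "r > 0") auto
    qed
    then have "(\<integral>\<^sup>+r. ennreal \<bar>mollified_flux X \<eta> x0 r - field_flux X x0 r\<bar> * indicator {0<..} r \<partial>lborel) \<le>
        (\<integral>\<^sup>+r. (\<Sum>i\<in>UNIV. ennreal \<bar>?d 1 i r\<bar> * indicator {0<..} r + ennreal \<bar>?d (-1) i r\<bar> * indicator {0<..} r) \<partial>lborel)"
      by (rule nn_integral_mono)
    also have "\<dots> = (\<Sum>i\<in>UNIV. (\<integral>\<^sup>+r. ennreal \<bar>?d 1 i r\<bar> * indicator {0<..} r \<partial>lborel) +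
        (\<integral>\<^sup>+r. ennreal \<bar>?d (-1) i r\<bar> * indicator {0<..} r \<partial>lborel))"
    proof -
      have m: "(\<lambda>r. ennreal \<bar>?d s i r\<bar> * indicator {0<..} r) \<in> borel_measurable lborel" for s i by measurable
      show ?thesis
        by (subst nn_integral_sum) (intro borel_measurable_add m, intro sum.cong refl nn_integral_add m)
    qed
    also have "\<dots> \<le> (\<Sum>i\<in>(UNIV :: 3 set). 2 * ennreal (e / 12) + 2 * ennreal (e / 12))"
      by (intro sum_mono add_mono close) auto
    also have "\<dots> = ennreal e"
    proof -
      have "2 * ennreal (e / 12) = ennreal (e / 6)"
        using e ennreal_mult[of 2 "e / 12"] by simp
      then show ?thesis using e by (simp add: mult_2[symmetric] flip: ennreal_plus) (simp flip: ennreal_mult ennreal_numeral)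
    qed
    finally show "(\<integral>\<^sup>+r. ennreal \<bar>mollified_flux X \<eta> x0 r - field_flux X x0 r\<bar> * indicator {0<..} r \<partial>lborel) \<le> ennreal e" .
  qed
qed

lemma dist_int_le_half: "dist_int t \<le> 1 / 2"
  using of_int_round_abs_le[of t] by (simp add: dist_int_def abs_minus_commute)

text \<open>The flux through a generic cube is the charge inside. With the indicator of the cube replaced by
  smooth cut-offs this is the definition of the distributional divergence, and both sides
  converge as the cut-offs become sharp.\<close>

lemma Omega2_R_subset_Z:
  assumes p: "p \<ge> 1"
  shows "Omega2_R p \<subseteq> Omega2_Z p"
proof
  fix F assume "F \<in> Omega2_R p"
  then obtain S h where F: "F \<in> Omega2_Lp p" and S: "finite S" and
    div: "\<And>\<phi>. \<phi> \<in> test_functions B3 \<Longrightarrow> distr_d F \<phi> = (\<Sum>a\<in>S. 2 * pi * of_int (h a) * \<phi> a)"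
    unfolding Omega2_R_def by blast
  have alt: "alternating_on B3 F" using F by (simp add: Omega2_Lp_def)
  obtain X where X: "represents X F" "\<And>i. Lpow p (\<lambda>x. X x $ i) < \<infinity>" by (rule representative[OF p F]) (rule that)
  have Xm[measurable]: "X \<in> borel_measurable borel" using X(1) by (simp add: represents_def)
  have X1: "Lpow 1 (\<lambda>x. X x $ i) < \<infinity>" for i
    by (rule Lpow_1_finite[OF p]) (use X in \<open>auto simp: represents_def\<close>)
  have "AE r in lborel. r \<in> {0<..<max_side x0} \<longrightarrow> field_flux X x0 r \<in> \<int>" if x0: "x0 \<in> B3" for x0
  proof -
    define q where "q n r = (\<Sum>a\<in>S. of_int (h a) * (\<Prod>j\<in>UNIV. cutoff (1 / Suc n) r ((a - x0) $ j)))" for n :: nat and r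
    have [measurable]: "q n \<in> borel_measurable borel" for n unfolding q_def cutoff_def by measurable
    have "AE r in lborel. r \<in> {\<rho><..<max_side x0} \<longrightarrow> field_flux X x0 r \<in> \<int>" if \<rho>: "\<rho> > 0" for \<rho>
    proof (rule AE_Ints_of_small)
      fix e :: real assume e: "e > 0"
      let ?A = "{\<rho><..<max_side x0}"
      have "(\<lambda>n. \<integral>\<^sup>+r. ennreal (norm (0 - dist_int (q n r) * indicator ?A r)) \<partial>lborel) \<longlonglongrightarrow> 0"
      proof (rule nn_integral_dominated_convergence_norm[where w="indicator ?A"])
        show "AE r in lborel. norm (dist_int (q n r) * indicator ?A r) \<le> indicator ?A r" for n
        proof (rule AE_I2)
          fix r show "norm (dist_int (q n r) * indicator ?A r) \<le> indicator ?A r"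
            using dist_int_le_half[of "q n r"] dist_int_nonneg[of "q n r"] by (cases "r \<in> ?A") auto
        qed
        show "(\<integral>\<^sup>+r. ennreal (indicator ?A r) \<partial>lborel) < \<infinity>"
          by (cases "\<rho> \<le> max_side x0") (auto simp: ennreal_indicator)
        have "AE r in lborel. \<forall>a\<in>S. \<forall>j. r \<noteq> 2 * \<bar>(a - x0) $ j\<bar>"
          using S by (intro AE_finite_allI AE_all_countable[THEN iffD2] allI AE_lborel_singleton)
        then show "AE r in lborel. (\<lambda>n. dist_int (q n r) * indicator ?A r) \<longlonglongrightarrow> 0"
        proof eventually_elim
          case (elim r)
          show ?case
          proof (cases "r \<in> ?A")
            case True
            then have r: "r > 0" using \<rho> by auto
            have "\<forall>\<^sub>F n in sequentially. \<forall>a\<in>S. \<forall>j\<in>UNIV. 1 / Suc n \<le> 2 * \<bar>\<bar>(a - x0) $ j\<bar> - r / 2\<bar>"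
            proof (intro eventually_ball_finite S ballI finite_UNIV)
              fix a and j :: 3 assume "a \<in> S"
              then have "2 * \<bar>\<bar>(a - x0) $ j\<bar> - r / 2\<bar> > 0" using elim by (auto simp: field_simps)
              with LIMSEQ_inverse_real_of_nat have "\<forall>\<^sub>F n in sequentially. inverse (real (Suc n)) < 2 * \<bar>\<bar>(a - x0) $ j\<bar> - r / 2\<bar>"
                by (rule order_tendstoD(2))
              then show "\<forall>\<^sub>F n in sequentially. 1 / Suc n \<le> 2 * \<bar>\<bar>(a - x0) $ j\<bar> - r / 2\<bar>"
                by eventually_elim (simp add: inverse_eq_divide)
            qed simp
            then have "\<forall>\<^sub>F n in sequentially. 0 = dist_int (q n r) * indicator ?A r"
            proof eventually_elim
              case (elim n)
              have "q n r \<in> \<int>" unfolding q_def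
                by (intro Ints_sum Ints_mult Ints_of_int Ints_prod cutoff_Ints r) (use elim in auto)
              then show ?case by (simp add: dist_int_eq_0[THEN iffD2])
            qed
            then show ?thesis by (rule Lim_transform_eventually[OF tendsto_const])
          qed simp
        qed
      qed measurable
      from order_tendstoD(2)[OF this, of "ennreal (e / 2)"]
      have ev1: "\<forall>\<^sub>F n in sequentially. (\<integral>\<^sup>+r. ennreal (norm (0 - dist_int (q n r) * indicator ?A r)) \<partial>lborel) < ennreal (e / 2)"
        using e by simp
      have "e / 2 > 0" using e by simp
      then obtain d where d: "d > 0" "\<And>\<eta>. 0 < \<eta> \<Longrightarrow> \<eta> < d \<Longrightarrow>
        (\<integral>\<^sup>+r. ennreal \<bar>mollified_flux X \<eta> x0 r - field_flux X x0 r\<bar> * indicator {0<..} r \<partial>lborel) \<le> ennreal (e / 2)"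
        by (rule mollified_flux_close[OF Xm X1]) (rule that)
      have "min d \<rho> > 0" using d \<rho> by simp
      with LIMSEQ_inverse_real_of_nat have ev2: "\<forall>\<^sub>F n in sequentially. inverse (real (Suc n)) < min d \<rho>"
        by (rule order_tendstoD(2))
      obtain n where n: "(\<integral>\<^sup>+r. ennreal (norm (0 - dist_int (q n r) * indicator ?A r)) \<partial>lborel) < ennreal (e / 2)"
        "inverse (real (Suc n)) < min d \<rho>"
        using eventually_happens[OF eventually_conj[OF ev1 ev2]] by auto
      let ?\<eta> = "1 / real (Suc n)"
      have \<eta>: "0 < ?\<eta>" "?\<eta> < d" "?\<eta> < \<rho>" using n(2) by (auto simp: inverse_eq_divide)
      have [measurable]: "(\<lambda>r. mollified_face X i ?\<eta> (x0 + (r / 2) *\<^sub>R axis i 1) r) \<in> borel_measurable borel"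
        "(\<lambda>r. mollified_face X i ?\<eta> (x0 - (r / 2) *\<^sub>R axis i 1) r) \<in> borel_measurable borel" for i
        unfolding mollified_face_def by measurable
      have [measurable]: "mollified_flux X ?\<eta> x0 \<in> borel_measurable borel"
        unfolding mollified_flux_def[abs_def] by measurable
      have "(\<integral>\<^sup>+r. ennreal (dist_int (field_flux X x0 r)) * indicator ?A r \<partial>lborel) \<le>
          (\<integral>\<^sup>+r. ennreal (norm (0 - dist_int (q n r) * indicator ?A r)) +
              ennreal \<bar>mollified_flux X ?\<eta> x0 r - field_flux X x0 r\<bar> * indicator {0<..} r \<partial>lborel)"
      proof (rule nn_integral_mono)
        fix r
        show "ennreal (dist_int (field_flux X x0 r)) * indicator ?A r \<le> ennreal (norm (0 - dist_int (q n r) * indicator ?A r)) +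
              ennreal \<bar>mollified_flux X ?\<eta> x0 r - field_flux X x0 r\<bar> * indicator {0<..} r"
        proof (cases "r \<in> ?A")
          case True
          then have "\<rho> < r" "r < max_side x0" by auto
          then have r: "0 < r" "r < max_side x0" "?\<eta> \<le> r" using less_trans[OF \<rho>] less_trans[OF \<eta>(3)] by (auto simp: less_imp_le)
          have q: "mollified_flux X ?\<eta> x0 r = q n r"
            unfolding q_def using mollified_flux_eq_sum[OF alt X(1) X1 div x0 r(1,2) \<eta>(1) r(3)] by simp
          have "dist_int (field_flux X x0 r) \<le> dist_int (q n r) + \<bar>mollified_flux X ?\<eta> x0 r - field_flux X x0 r\<bar>"
            using dist_int_triangle[of "field_flux X x0 r" "q n r"]
            unfolding q abs_minus_commute[of "q n r"] .
          then have "ennreal (dist_int (field_flux X x0 r)) \<le>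
              ennreal (dist_int (q n r)) + ennreal \<bar>mollified_flux X ?\<eta> x0 r - field_flux X x0 r\<bar>"
            using dist_int_nonneg by (simp add: ennreal_leI flip: ennreal_plus)
          then show ?thesis using True r dist_int_nonneg[of "q n r"] by simp
        qed simp
      qed
      also have "\<dots> = (\<integral>\<^sup>+r. ennreal (norm (0 - dist_int (q n r) * indicator ?A r)) \<partial>lborel) +
          (\<integral>\<^sup>+r. ennreal \<bar>mollified_flux X ?\<eta> x0 r - field_flux X x0 r\<bar> * indicator {0<..} r \<partial>lborel)"
        by (rule nn_integral_add) measurable
      also have "\<dots> \<le> ennreal (e / 2) + ennreal (e / 2)"
        using n(1) d(2)[OF \<eta>(1,2)] by (intro add_mono) auto
      also have "\<dots> = ennreal e" using e by (simp flip: ennreal_plus)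
      finally show "(\<integral>\<^sup>+r. ennreal (dist_int (field_flux X x0 r)) * indicator ?A r \<partial>lborel) \<le> ennreal e" .
    qed measurable
    then have "AE r in lborel. \<forall>n. r \<in> {1 / real (Suc n)<..<max_side x0} \<longrightarrow> field_flux X x0 r \<in> \<int>"
      by (intro AE_all_countable[THEN iffD2] allI) simp
    then show ?thesis
    proof eventually_elim
      case (elim r)
      show ?case
      proof
        assume r: "r \<in> {0<..<max_side x0}"
        then obtain n where "inverse (real (Suc n)) < r" using reals_Archimedean[of r] by auto
        then show "field_flux X x0 r \<in> \<int>" using elim r by (auto simp: inverse_eq_divide)
      qed
    qed
  qed
  then show "F \<in> Omega2_Z p" using Omega2_Z_iff[OF p F X] by blast
qed

section \<open>Averages over faces of a random lattice\<close>

definition square :: "real \<Rightarrow> (real \<times> real) set" where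
  "square r = {u. sup2 u < r / 2}"

lemma mem_square[simp]: "u \<in> square r \<longleftrightarrow> sup2 u < r / 2"
  by (simp add: square_def)

lemma emeasure_square:
  assumes "r > 0"
  shows "square r \<in> sets borel" "emeasure lborel (square r) = ennreal (r\<^sup>2)"
proof -
  have eq: "square r = {-(r/2)<..<r/2} \<times> {-(r/2)<..<r/2}" unfolding square_def by (auto simp: sup2_def)
  show "square r \<in> sets borel" unfolding eq by (intro borel_open open_Times) auto
  have "emeasure (lborel \<Otimes>\<^sub>M lborel) ({-(r/2)<..<r/2} \<times> {-(r/2)<..<r/2}) = ennreal r * ennreal r"
    using assms by (subst lborel.emeasure_pair_measure_Times) auto
  then show "emeasure lborel (square r) = ennreal (r\<^sup>2)"
    using assms unfolding eq by (simp add: lborel_prod power2_eq_square ennreal_mult)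
qed

text \<open>A weak form of Jensen's inequality, from \<open>t \<le> d + d\<^sup>1\<^sup>-\<^sup>p t\<^sup>p\<close> with \<open>d\<close> the \<open>p\<close>-mean.\<close>

lemma square_average_bound:
  fixes T :: "real \<times> real \<Rightarrow> real"
  assumes p: "p \<ge> 1" and r: "r > 0" and [measurable]: "T \<in> borel_measurable borel"
  defines "A \<equiv> \<integral>\<^sup>+u. ennreal (\<bar>T u\<bar> powr p) * indicator (square r) u \<partial>lborel"
  assumes fin: "A < \<infinity>"
  shows "integrable lborel (\<lambda>u. if sup2 u < r / 2 then T u else 0)"
    and "ennreal (\<bar>(\<integral>u. (if sup2 u < r / 2 then T u else 0) \<partial>lborel) / r\<^sup>2\<bar> powr p) \<le> ennreal (2 powr p / r\<^sup>2) * A"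
proof -
  note [measurable] = emeasure_square(1)[OF r]
  have bound: "(\<integral>\<^sup>+u. ennreal \<bar>if sup2 u < r / 2 then T u else 0\<bar> \<partial>lborel) \<le> ennreal (d * r\<^sup>2) + ennreal (d powr (1 - p)) * A"
    if d: "d > 0" for d
  proof -
    have "ennreal \<bar>if sup2 u < r / 2 then T u else 0\<bar> \<le> ennreal d * indicator (square r) u +
        ennreal (d powr (1 - p)) * (ennreal (\<bar>T u\<bar> powr p) * indicator (square r) u)" for u
    proof (cases "sup2 u < r / 2")
      case True
      have "\<bar>T u\<bar> \<le> d + d powr (1 - p) * \<bar>T u\<bar> powr p"
      proof (cases "\<bar>T u\<bar> \<le> d")
        case False
        then have "\<bar>T u\<bar> powr (1 - p) * \<bar>T u\<bar> powr p \<le> d powr (1 - p) * \<bar>T u\<bar> powr p"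
          using d p by (intro mult_right_mono powr_mono2') auto
        moreover have "\<bar>T u\<bar> powr (1 - p) * \<bar>T u\<bar> powr p = \<bar>T u\<bar>" using False d by (simp add: powr_add[symmetric])
        ultimately show ?thesis using d by linarith
      qed (simp add: add_increasing2)
      then have "ennreal \<bar>T u\<bar> \<le> ennreal d + ennreal (d powr (1 - p)) * ennreal (\<bar>T u\<bar> powr p)"
        using d by (simp add: ennreal_leI flip: ennreal_mult ennreal_plus)
      then show ?thesis using True by simp
    qed simp
    then have "(\<integral>\<^sup>+u. ennreal \<bar>if sup2 u < r / 2 then T u else 0\<bar> \<partial>lborel) \<le>
        (\<integral>\<^sup>+u. ennreal d * indicator (square r) u +
        ennreal (d powr (1 - p)) * (ennreal (\<bar>T u\<bar> powr p) * indicator (square r) u) \<partial>lborel)"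
      by (rule nn_integral_mono)
    also have "\<dots> = ennreal d * ennreal (r\<^sup>2) + ennreal (d powr (1 - p)) * A"
      unfolding A_def by (subst nn_integral_add) (auto simp: nn_integral_cmult emeasure_square[OF r] nn_integral_cmult_indicator)
    finally show ?thesis using d by (simp add: ennreal_mult)
  qed
  have m: "(\<lambda>u. if sup2 u < r / 2 then T u else 0) \<in> borel_measurable lborel" by measurable
  have "(\<integral>\<^sup>+u. ennreal \<bar>if sup2 u < r / 2 then T u else 0\<bar> \<partial>lborel) < \<infinity>"
    using bound[of 1] fin by (auto simp: order.strict_trans1 ennreal_mult_less_top)
  with m show int: "integrable lborel (\<lambda>u. if sup2 u < r / 2 then T u else 0)"
    by (intro integrableI_bounded) (simp_all only: real_norm_def)
  obtain B where B: "A = ennreal B" "B \<ge> 0" using fin by (cases A) auto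
  let ?I = "\<bar>\<integral>u. (if sup2 u < r / 2 then T u else 0) \<partial>lborel\<bar>"
  have I: "?I \<le> d * r\<^sup>2 + d powr (1 - p) * B" if d: "d > 0" for d
  proof -
    have "ennreal ?I \<le> (\<integral>\<^sup>+u. ennreal (norm (if sup2 u < r / 2 then T u else 0)) \<partial>lborel)"
      using integral_norm_bound_ennreal[OF int] by simp
    also have "\<dots> \<le> ennreal (d * r\<^sup>2 + d powr (1 - p) * B)"
      using bound[OF d] d B by (simp flip: ennreal_mult ennreal_plus)
    finally show ?thesis using d B by (subst (asm) ennreal_le_iff) auto
  qed
  have "(?I / r\<^sup>2) powr p \<le> 2 powr p / r\<^sup>2 * B"
  proof (cases "B = 0")
    case True
    have "?I \<le> 0"
    proof (rule field_le_epsilon)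
      fix e :: real assume "e > 0"
      then show "?I \<le> 0 + e" using I[of "e / r\<^sup>2"] r True by simp
    qed
    then show ?thesis using True p by simp
  next
    case False
    define d where "d = (B / r\<^sup>2) powr (1 / p)"
    have Bp: "B / r\<^sup>2 > 0" using B False r by simp
    have d: "d > 0" using B False r by (simp add: d_def)
    have dp: "d powr p = B / r\<^sup>2" using p B by (simp add: d_def powr_powr)
    have "d powr (1 - p) * B = d powr (1 - p) * (d powr p * r\<^sup>2)" using dp r by simp
    also have "\<dots> = d * r\<^sup>2" using d by (simp add: powr_add[symmetric] mult.assoc[symmetric])
    finally have "?I \<le> 2 * d * r\<^sup>2" using I[OF d] by simp
    then have "?I / r\<^sup>2 \<le> 2 * d" using r by (simp add: field_simps)
    then have "(?I / r\<^sup>2) powr p \<le> (2 * d) powr p" using p by (intro powr_mono2) auto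
    also have "\<dots> = 2 powr p / r\<^sup>2 * B" using d dp by (simp add: powr_mult)
    finally show ?thesis .
  qed
  then show "ennreal (\<bar>(\<integral>u. (if sup2 u < r / 2 then T u else 0) \<partial>lborel) / r\<^sup>2\<bar> powr p) \<le> ennreal (2 powr p / r\<^sup>2) * A"
    using B r by (simp add: abs_divide ennreal_leI flip: ennreal_mult)
qed

locale lattice =
  fixes X :: "real^3 \<Rightarrow> real^3" and p \<epsilon> :: real
  assumes measurable_X[measurable]: "X \<in> borel_measurable borel"
    and p: "p \<ge> 1" and X_Lp: "\<And>i. Lpow p (\<lambda>x. X x $ i) < \<infinity>"
    and X_support: "\<And>x. norm x \<ge> 2 \<Longrightarrow> X x = 0"
    and \<epsilon>: "0 < \<epsilon>" "\<epsilon> \<le> 1"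
begin

text \<open>The mean of the normal component over the face of \<open>C\<^sub>\<epsilon>(c)\<close> with outward normal \<open>e\<^sub>i\<close>; the
  opposite face is that of the neighbouring cube.\<close>

definition face_mean :: "3 \<Rightarrow> real^3 \<Rightarrow> real" where
  "face_mean i c = face_integral X i (c + (\<epsilon> / 2) *\<^sub>R axis i 1) \<epsilon> / \<epsilon>\<^sup>2"

lemma measurable_face_mean[measurable]:
  assumes [measurable]: "f \<in> borel_measurable M" shows "(\<lambda>z. face_mean i (f z)) \<in> borel_measurable M"
  unfolding face_mean_def by measurable

lemma field_flux_eq_face_mean:
  "2 * pi * field_flux X c \<epsilon> = \<epsilon>\<^sup>2 * (\<Sum>i\<in>UNIV. face_mean i c - face_mean i (c - \<epsilon> *\<^sub>R axis i 1))"
proof -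
  have "c - \<epsilon> *\<^sub>R axis i 1 + (\<epsilon> / 2) *\<^sub>R axis i 1 = c - (\<epsilon> / 2) *\<^sub>R axis i 1" for i :: 3
    by (simp add: vec_eq_iff)
  then have fm: "face_mean i (c - \<epsilon> *\<^sub>R axis i 1) = face_integral X i (c - (\<epsilon> / 2) *\<^sub>R axis i 1) \<epsilon> / \<epsilon>\<^sup>2" for i
    by (simp only: face_mean_def)
  show ?thesis
    unfolding field_flux_def fm unfolding face_mean_def
    using \<epsilon> by (simp add: sum_distrib_left right_diff_distrib)
qed

lemma norm_face_offset: "sup2 u < \<epsilon> / 2 \<Longrightarrow> norm ((\<epsilon> / 2) *\<^sub>R axis i 1 + in_plane i u) \<le> 2 * \<epsilon>"
proof -
  assume u: "sup2 u < \<epsilon> / 2"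
  have "norm ((\<epsilon> / 2) *\<^sub>R axis i 1 + in_plane i u) \<le> \<epsilon> / 2 + (\<bar>fst u\<bar> + \<bar>snd u\<bar>)"
    using norm_triangle_ineq[of "(\<epsilon> / 2) *\<^sub>R axis i 1" "in_plane i u"] norm_in_plane_le[of i u] \<epsilon> by simp
  then show ?thesis using u by (simp add: sup2_def)
qed

lemma face_mean_eq_0: assumes "norm c \<ge> 4" shows "face_mean i c = 0"
proof -
  have "X (c + (\<epsilon> / 2) *\<^sub>R axis i 1 + in_plane i u) = 0" if u: "sup2 u < \<epsilon> / 2" for u
  proof -
    let ?w = "(\<epsilon> / 2) *\<^sub>R axis i 1 + in_plane i u :: real^3"
    have "norm c \<le> norm (c + ?w) + norm ?w" using norm_triangle_ineq4[of "c + ?w" ?w] by simp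
    then have "norm (c + ?w) \<ge> 2" using norm_face_offset[OF u, of i] assms \<epsilon> by linarith
    then show ?thesis unfolding add.assoc by (rule X_support)
  qed
  then have "(\<lambda>u. if sup2 u < \<epsilon> / 2 then X (c + (\<epsilon> / 2) *\<^sub>R axis i 1 + in_plane i u) $ i else 0) = (\<lambda>u. 0)" by auto
  then show ?thesis unfolding face_mean_def face_integral_def by simp
qed

lemma face_mean_diff_bound:
  "ennreal (\<bar>face_mean i c - y\<bar> powr p) \<le> ennreal (2 powr p / \<epsilon>\<^sup>2) *
    (\<integral>\<^sup>+u. ennreal (\<bar>X (c + (\<epsilon> / 2) *\<^sub>R axis i 1 + in_plane i u) $ i - y\<bar> powr p) * indicator (square \<epsilon>) u \<partial>lborel)"
  (is "_ \<le> _ * ?A")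
proof (cases "?A < \<infinity>")
  case True
  let ?T = "\<lambda>u. X (c + (\<epsilon> / 2) *\<^sub>R axis i 1 + in_plane i u) $ i - y"
  note avg = square_average_bound[of p \<epsilon> ?T, OF p \<epsilon>(1) _ True]
  have Tm: "?T \<in> borel_measurable borel" by measurable
  have c: "integrable lborel (\<lambda>u. if sup2 u < \<epsilon> / 2 then y else 0)"
    and ci: "(\<integral>u. (if sup2 u < \<epsilon> / 2 then y else 0) \<partial>lborel) = \<epsilon>\<^sup>2 * y"
  proof -
    have eq: "(\<lambda>u. if sup2 u < \<epsilon> / 2 then y else 0) = (\<lambda>u. indicator (square \<epsilon>) u *\<^sub>R y)" by auto
    have s: "square \<epsilon> \<in> sets lborel" using emeasure_square(1)[OF \<epsilon>(1)] by simp
    show "integrable lborel (\<lambda>u. if sup2 u < \<epsilon> / 2 then y else 0)"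
      unfolding eq by (intro integrable_scaleR_left integrable_real_indicator s) (simp add: emeasure_square[OF \<epsilon>(1)])
    have "measure lborel (square \<epsilon>) = \<epsilon>\<^sup>2"
      by (rule measure_eq_emeasure_eq_ennreal) (simp_all add: emeasure_square[OF \<epsilon>(1)])
    then show "(\<integral>u. (if sup2 u < \<epsilon> / 2 then y else 0) \<partial>lborel) = \<epsilon>\<^sup>2 * y" unfolding eq by simp
  qed
  have "(\<lambda>u. if sup2 u < \<epsilon> / 2 then X (c + (\<epsilon> / 2) *\<^sub>R axis i 1 + in_plane i u) $ i else 0) =
      (\<lambda>u. (if sup2 u < \<epsilon> / 2 then ?T u else 0) + (if sup2 u < \<epsilon> / 2 then y else 0))" by auto
  then have "face_integral X i (c + (\<epsilon> / 2) *\<^sub>R axis i 1) \<epsilon> = (\<integral>u. (if sup2 u < \<epsilon> / 2 then ?T u else 0) \<partial>lborel) + \<epsilon>\<^sup>2 * y"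
    unfolding face_integral_def using Bochner_Integration.integral_add[OF avg(1)[OF Tm] c] ci by simp
  then have "face_mean i c - y = (\<integral>u. (if sup2 u < \<epsilon> / 2 then ?T u else 0) \<partial>lborel) / \<epsilon>\<^sup>2"
    using \<epsilon> by (simp add: face_mean_def add_divide_distrib)
  then show ?thesis using avg(2)[OF Tm] by simp
next
  case False
  then have "?A = \<infinity>" by (simp add: not_less top_unique)
  then show ?thesis using \<epsilon> by (simp add: ennreal_mult_eq_top_iff)
qed

definition near_set :: "(real^3) set" where
  "near_set = {z. \<forall>j. \<bar>z $ j\<bar> < 2 * \<epsilon>}"

definition interp_error :: "3 \<Rightarrow> real^3 \<Rightarrow> ennreal" where
  "interp_error i c = (\<integral>\<^sup>+x. ennreal (\<bar>face_mean i c - X x $ i\<bar> powr p) * indicator near_set (c - x) \<partial>lborel)"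

lemma near_set_measurable[measurable]: "near_set \<in> sets borel"
proof -
  have "{z. \<bar>(z :: real^3) $ j\<bar> < 2 * \<epsilon>} \<in> sets borel" for j by measurable
  moreover have "near_set = (\<Inter>j. {z. \<bar>z $ j\<bar> < 2 * \<epsilon>})" by (auto simp: near_set_def)
  ultimately show ?thesis by auto
qed

lemma emeasure_near_set: "emeasure lborel near_set = ennreal ((4 * \<epsilon>) ^ 3)"
proof -
  have abs: "\<bar>t\<bar> < 2 * \<epsilon> \<longleftrightarrow> - (2 * \<epsilon>) < t \<and> t < 2 * \<epsilon>" for t by linarith
  have eq: "near_set = box (\<chi> j. - (2 * \<epsilon>)) (\<chi> j. 2 * \<epsilon>)"
    unfolding near_set_def by (rule set_eqI) (simp only: mem_box_cart abs mem_Collect_eq vec_lambda_beta)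
  have B: "(Basis :: (real^3) set) = (\<lambda>i. axis i 1) ` UNIV" by (auto simp: Basis_vec_def)
  show ?thesis unfolding eq
    by (subst emeasure_lborel_box) (use \<epsilon> in \<open>auto simp: B prod.reindex inj_on_def axis_eq_axis inner_axis\<close>)
qed

text \<open>A cube with nonzero integer flux has a face where the mean is at least of order \<open>\<epsilon>\<^sup>-\<^sup>2\<close>. Since
  the means are close to \<open>X\<close> in \<open>L\<^sup>p\<close>, such cubes carry little of the \<open>L\<^sup>p\<close> norm.\<close>

definition face_total :: "real^3 \<Rightarrow> real" where
  "face_total c = (\<Sum>i\<in>UNIV. \<bar>face_mean i c\<bar> + \<bar>face_mean i (c - \<epsilon> *\<^sub>R axis i 1)\<bar>)"

definition bad_error :: "real^3 \<Rightarrow> ennreal" where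
  "bad_error c = (if face_total c \<ge> 2 * pi / \<epsilon>\<^sup>2 then ennreal (face_total c powr p) else 0)"

lemma measurable_face_total[measurable]: "face_total \<in> borel_measurable borel"
  unfolding face_total_def[abs_def] by measurable

lemma measurable_bad_error[measurable]: "bad_error \<in> borel_measurable borel"
  unfolding bad_error_def[abs_def] by measurable

lemma measurable_interp_error[measurable]: "interp_error i \<in> borel_measurable borel"
  unfolding interp_error_def[abs_def] by measurable

context
  fixes \<tau> :: real
  assumes \<tau>: "\<tau> > 0" and trans: "\<And>v i. norm v \<le> 9 * \<epsilon> \<Longrightarrow> Lpow p (\<lambda>x. X (v + x) $ i - X x $ i) \<le> ennreal \<tau>"
begin

lemma face_mean_close:
  assumes z: "norm z \<le> 7 * \<epsilon>"
  shows "Lpow p (\<lambda>x. face_mean i (z + x) - X x $ i) \<le> ennreal (2 powr p * \<tau>)"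
proof -
  note [measurable] = emeasure_square(1)[OF \<epsilon>(1)]
  let ?o = "\<lambda>u. z + ((\<epsilon> / 2) *\<^sub>R axis i 1 + in_plane i u)"
  let ?g = "\<lambda>x u. ennreal (\<bar>X (?o u + x) $ i - X x $ i\<bar> powr p) * indicator (square \<epsilon>) u"
  have "Lpow p (\<lambda>x. face_mean i (z + x) - X x $ i) \<le> (\<integral>\<^sup>+x. ennreal (2 powr p / \<epsilon>\<^sup>2) * (\<integral>\<^sup>+u. ?g x u \<partial>lborel) \<partial>lborel)"
    unfolding Lpow_def
    by (intro nn_integral_mono order_trans[OF face_mean_diff_bound]) (simp add: add_ac)
  also have "\<dots> = ennreal (2 powr p / \<epsilon>\<^sup>2) * (\<integral>\<^sup>+x. (\<integral>\<^sup>+u. ?g x u \<partial>lborel) \<partial>lborel)"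
    by (rule nn_integral_cmult) measurable
  also have "(\<integral>\<^sup>+x. (\<integral>\<^sup>+u. ?g x u \<partial>lborel) \<partial>lborel) = (\<integral>\<^sup>+u. (\<integral>\<^sup>+x. ?g x u \<partial>lborel) \<partial>lborel)"
    by (rule lborel_pair.Fubini'[symmetric]) measurable
  also have "\<dots> \<le> (\<integral>\<^sup>+u. ennreal \<tau> * indicator (square \<epsilon>) u \<partial>lborel)"
  proof (rule nn_integral_mono)
    fix u
    show "(\<integral>\<^sup>+x. ?g x u \<partial>lborel) \<le> ennreal \<tau> * indicator (square \<epsilon>) u"
    proof (cases "sup2 u < \<epsilon> / 2")
      case True
      have "norm (?o u) \<le> 9 * \<epsilon>"
        using norm_triangle_ineq[of z "(\<epsilon> / 2) *\<^sub>R axis i 1 + in_plane i u"] norm_face_offset[OF True, of i] z by simp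
      then show ?thesis using trans[of "?o u" i] True by (simp add: Lpow_def)
    qed simp
  qed
  also have "\<dots> = ennreal \<tau> * ennreal (\<epsilon>\<^sup>2)"
    by (simp add: nn_integral_cmult_indicator emeasure_square[OF \<epsilon>(1)])
  finally have "Lpow p (\<lambda>x. face_mean i (z + x) - X x $ i) \<le> ennreal (2 powr p / \<epsilon>\<^sup>2) * (ennreal \<tau> * ennreal (\<epsilon>\<^sup>2))"
    by (simp add: mult_left_mono)
  also have "\<dots> = ennreal (2 powr p * \<tau>)" using \<epsilon> \<tau> by (simp flip: ennreal_mult)
  finally show ?thesis .
qed

text \<open>Averaged over all positions of the cube, the error compares \<open>X\<close> with its translates by vectors
  of length at most \<open>9\<epsilon>\<close>.\<close>

lemma interp_error_integral: "(\<integral>\<^sup>+c. interp_error i c \<partial>lborel) \<le> ennreal (64 * 2 powr p * \<tau> * \<epsilon> ^ 3)"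
proof -
  have "(\<integral>\<^sup>+c. interp_error i c \<partial>lborel) =
      (\<integral>\<^sup>+x. (\<integral>\<^sup>+c. ennreal (\<bar>face_mean i c - X x $ i\<bar> powr p) * indicator near_set (c - x) \<partial>lborel) \<partial>lborel)"
    unfolding interp_error_def by (rule lborel_pair.Fubini'[symmetric]) measurable
  also have "\<dots> = (\<integral>\<^sup>+x. (\<integral>\<^sup>+z. ennreal (\<bar>face_mean i (x + z) - X x $ i\<bar> powr p) * indicator near_set z \<partial>lborel) \<partial>lborel)"
  proof (rule nn_integral_cong)
    fix x
    show "(\<integral>\<^sup>+c. ennreal (\<bar>face_mean i c - X x $ i\<bar> powr p) * indicator near_set (c - x) \<partial>lborel) =
        (\<integral>\<^sup>+z. ennreal (\<bar>face_mean i (x + z) - X x $ i\<bar> powr p) * indicator near_set z \<partial>lborel)"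
      by (subst nn_integral_shift[of _ x, symmetric]) simp_all
  qed
  also have "\<dots> = (\<integral>\<^sup>+z. (\<integral>\<^sup>+x. ennreal (\<bar>face_mean i (x + z) - X x $ i\<bar> powr p) * indicator near_set z \<partial>lborel) \<partial>lborel)"
    by (rule lborel_pair.Fubini'[symmetric]) measurable
  also have "\<dots> \<le> (\<integral>\<^sup>+z. ennreal (2 powr p * \<tau>) * indicator near_set z \<partial>lborel)"
  proof (rule nn_integral_mono)
    fix z
    show "(\<integral>\<^sup>+x. ennreal (\<bar>face_mean i (x + z) - X x $ i\<bar> powr p) * indicator near_set z \<partial>lborel) \<le>
        ennreal (2 powr p * \<tau>) * indicator near_set z"
    proof (cases "z \<in> near_set")
      case True
      then have "norm z \<le> 3 * (2 * \<epsilon>)" by (intro norm_le_3) (auto simp: near_set_def less_imp_le)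
      then have "norm z \<le> 7 * \<epsilon>" using \<epsilon> by simp
      from face_mean_close[OF this, of i] True show ?thesis by (simp add: Lpow_def add.commute)
    qed simp
  qed
  also have "\<dots> = ennreal (2 powr p * \<tau>) * ennreal ((4 * \<epsilon>) ^ 3)"
    by (simp add: nn_integral_cmult_indicator emeasure_near_set)
  also have "\<dots> = ennreal (64 * 2 powr p * \<tau> * \<epsilon> ^ 3)"
    using \<epsilon> \<tau> by (simp add: power_mult_distrib algebra_simps flip: ennreal_mult)
  finally show ?thesis .
qed

text \<open>Face means of order \<open>\<epsilon>\<^sup>-\<^sup>2\<close> come from values of \<open>X\<close> of that order or differ from the nearby
  values by a comparable amount. The first contribution is small by integrability, the second one by
  continuity of translations.\<close>

lemma bad_error_integral:
  assumes big: "(\<integral>\<^sup>+x. (if (\<Sum>i\<in>UNIV. \<bar>X x $ i\<bar>) \<ge> pi / (2 * \<epsilon>\<^sup>2) then ennreal ((\<Sum>i\<in>UNIV. \<bar>X x $ i\<bar>) powr p) else 0) \<partial>lborel) \<le> ennreal \<tau>"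
  shows "(\<integral>\<^sup>+c. bad_error c \<partial>lborel) \<le> ennreal ((2 powr p * (6 powr p * 6 * 2 powr p) + 4 powr p) * \<tau>)"
proof -
  let ?d = "\<lambda>s i c. face_mean i (c - (s * \<epsilon>) *\<^sub>R axis i 1) - X c $ i"
  let ?s = "\<lambda>c. \<Sum>i\<in>UNIV. \<bar>X c $ i\<bar>"
  let ?b = "\<lambda>c. (if ?s c \<ge> pi / (2 * \<epsilon>\<^sup>2) then ennreal (?s c powr p) else 0)"
  let ?e = "\<lambda>c. \<Sum>i\<in>UNIV. ennreal (\<bar>?d 0 i c\<bar> powr p) + ennreal (\<bar>?d 1 i c\<bar> powr p)"
  have "bad_error c \<le> ennreal (2 powr p * 6 powr p) * ?e c + ennreal (4 powr p) * ?b c" for c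
  proof (cases "face_total c \<ge> 2 * pi / \<epsilon>\<^sup>2")
    case True
    define m where "m = Max ((\<lambda>(s, i). \<bar>?d s i c\<bar>) ` ({0, 1} \<times> UNIV))"
    have m_ge: "\<bar>?d s i c\<bar> \<le> m" if "s \<in> {0, 1}" for s i
      unfolding m_def using that by (intro Max_ge) auto
    have "m \<in> (\<lambda>(s, i). \<bar>?d s i c\<bar>) ` ({0, 1} \<times> UNIV)" unfolding m_def by (intro Max_in) auto
    then obtain s k where m: "s = 0 \<or> s = 1" "m = \<bar>?d s k c\<bar>" by auto
    have "face_total c \<le> (\<Sum>i\<in>(UNIV :: 3 set). (m + \<bar>X c $ i\<bar>) + (m + \<bar>X c $ i\<bar>))"
      unfolding face_total_def
    proof (intro sum_mono add_mono)
      fix i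
      show "\<bar>face_mean i c\<bar> \<le> m + \<bar>X c $ i\<bar>" using m_ge[of 0 i] by simp
      show "\<bar>face_mean i (c - \<epsilon> *\<^sub>R axis i 1)\<bar> \<le> m + \<bar>X c $ i\<bar>" using m_ge[of 1 i] by simp
    qed
    also have "\<dots> = 6 * m + 2 * ?s c" by (simp add: sum.distrib sum_distrib_left)
    finally have tot: "face_total c \<le> 6 * m + 2 * ?s c" .
    have tot0: "face_total c \<ge> 0" by (simp add: face_total_def sum_nonneg)
    show ?thesis
    proof (cases "face_total c \<le> 2 * (6 * m)")
      case small: True
      have "face_total c powr p \<le> (2 * (6 * m)) powr p" using small tot0 p by (intro powr_mono2) auto
      also have "\<dots> = 2 powr p * 6 powr p * \<bar>?d s k c\<bar> powr p" by (simp only: powr_mult m(2) mult.assoc)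
      finally have "ennreal (face_total c powr p) \<le> ennreal (2 powr p * 6 powr p) * ennreal (\<bar>?d s k c\<bar> powr p)"
        by (simp add: ennreal_leI flip: ennreal_mult)
      also have "ennreal (\<bar>?d s k c\<bar> powr p) \<le> ennreal (\<bar>?d 0 k c\<bar> powr p) + ennreal (\<bar>?d 1 k c\<bar> powr p)"
        using m(1) by (elim disjE) (simp_all add: add_increasing add_increasing2)
      also have "\<dots> \<le> ?e c"
        by (rule member_le_sum[of k UNIV "\<lambda>i. ennreal (\<bar>?d 0 i c\<bar> powr p) + ennreal (\<bar>?d 1 i c\<bar> powr p)"]) auto
      finally have "ennreal (face_total c powr p) \<le> ennreal (2 powr p * 6 powr p) * ?e c" by (simp add: mult_left_mono)
      then show ?thesis using True by (simp add: bad_error_def add_increasing2)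
    next
      case large: False
      then have le: "face_total c \<le> 4 * ?s c" using tot by linarith
      have "2 * pi / \<epsilon>\<^sup>2 \<le> 4 * ?s c" using True le by (rule order_trans)
      moreover have "pi / (2 * \<epsilon>\<^sup>2) = (2 * pi / \<epsilon>\<^sup>2) / 4" by simp
      ultimately have "?s c \<ge> pi / (2 * \<epsilon>\<^sup>2)" by linarith
      moreover have "face_total c powr p \<le> (4 * ?s c) powr p" using le tot0 p by (intro powr_mono2) auto
      then have "ennreal (face_total c powr p) \<le> ennreal (4 powr p) * ennreal (?s c powr p)"
        by (simp add: powr_mult ennreal_leI sum_nonneg flip: ennreal_mult)
      ultimately show ?thesis using True by (simp add: bad_error_def add_increasing)
    qed
  qed (simp add: bad_error_def)
  then have "(\<integral>\<^sup>+c. bad_error c \<partial>lborel) \<le> (\<integral>\<^sup>+c. ennreal (2 powr p * 6 powr p) * ?e c + ennreal (4 powr p) * ?b c \<partial>lborel)"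
    by (rule nn_integral_mono)
  also have "\<dots> = ennreal (2 powr p * 6 powr p) * (\<integral>\<^sup>+c. ?e c \<partial>lborel) + ennreal (4 powr p) * (\<integral>\<^sup>+c. ?b c \<partial>lborel)"
    by (subst nn_integral_add) (auto simp: nn_integral_cmult)
  also have "(\<integral>\<^sup>+c. ?e c \<partial>lborel) = (\<Sum>i\<in>UNIV. Lpow p (?d 0 i) + Lpow p (?d 1 i))"
    unfolding Lpow_def by (subst nn_integral_sum) (auto simp: nn_integral_add)
  also have "\<dots> \<le> (\<Sum>i\<in>(UNIV :: 3 set). ennreal (2 powr p * \<tau>) + ennreal (2 powr p * \<tau>))"
  proof (intro sum_mono add_mono)
    fix i :: 3
    show "Lpow p (?d 0 i) \<le> ennreal (2 powr p * \<tau>)" using face_mean_close[of 0 i] \<epsilon> by simp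
    have "norm (- (\<epsilon> *\<^sub>R axis i 1) :: real^3) \<le> 7 * \<epsilon>" using \<epsilon> by simp
    from face_mean_close[OF this, of i] show "Lpow p (?d 1 i) \<le> ennreal (2 powr p * \<tau>)" by simp
  qed
  also have "\<dots> = ennreal (6 * (2 powr p * \<tau>))"
  proof -
    have "(\<Sum>i\<in>(UNIV :: 3 set). ennreal (2 powr p * \<tau>) + ennreal (2 powr p * \<tau>)) =
        (\<Sum>i\<in>(UNIV :: 3 set). ennreal (2 * (2 powr p * \<tau>)))"
      unfolding mult_2 using \<tau> by (intro sum.cong refl ennreal_plus[symmetric]) auto
    also have "\<dots> = ennreal (\<Sum>i\<in>(UNIV :: 3 set). 2 * (2 powr p * \<tau>))" using \<tau> by (subst sum_ennreal) auto
    finally show ?thesis by simp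
  qed
  finally have "(\<integral>\<^sup>+c. bad_error c \<partial>lborel) \<le>
      ennreal (2 powr p * 6 powr p) * ennreal (6 * (2 powr p * \<tau>)) + ennreal (4 powr p) * ennreal \<tau>"
    using big by (simp add: mult_left_mono add_mono order_trans)
  also have "\<dots> = ennreal ((2 powr p * (6 powr p * 6 * 2 powr p) + 4 powr p) * \<tau>)"
    using \<tau> by (simp add: algebra_simps flip: ennreal_mult ennreal_plus)
  finally show ?thesis .
qed

end

definition node :: "real^3 \<Rightarrow> (3 \<Rightarrow> int) \<Rightarrow> real^3" where
  "node a g = a + \<epsilon> *\<^sub>R (\<chi> j. of_int (g j))"

definition indices :: "(3 \<Rightarrow> int) set" where
  "indices = {g. \<forall>j. \<bar>g j\<bar> \<le> int (nat \<lceil>8 / \<epsilon>\<rceil>)}"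

definition cell :: "(real^3) set" where
  "cell = {a. \<forall>j. 0 \<le> a $ j \<and> a $ j < \<epsilon>}"

lemma cell_measurable[measurable]: "cell \<in> sets borel"
proof -
  have "{a. 0 \<le> (a :: real^3) $ j \<and> a $ j < \<epsilon>} \<in> sets borel" for j by measurable
  moreover have "cell = (\<Inter>j. {a. 0 \<le> a $ j \<and> a $ j < \<epsilon>})" by (auto simp: cell_def)
  ultimately show ?thesis by auto
qed

lemma indices_PiE: "indices = PiE UNIV (\<lambda>_. {- int (nat \<lceil>8 / \<epsilon>\<rceil>)..int (nat \<lceil>8 / \<epsilon>\<rceil>)})"
proof -
  have abs: "\<bar>k\<bar> \<le> n \<longleftrightarrow> k \<in> {- n..n}" for k n :: int by auto
  show ?thesis unfolding indices_def abs PiE_UNIV_domain Pi_def by simp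
qed

lemma finite_indices: "finite indices"
  unfolding indices_PiE by (intro finite_PiE) auto

lemma node_in_indices:
  assumes a: "a \<in> cell" and n: "norm (node a g) < 6"
  shows "g \<in> indices"
  unfolding indices_def
proof (intro CollectI allI)
  fix j
  have "\<bar>node a g $ j\<bar> < 6" using component_le_norm_cart[of "node a g" j] n by simp
  moreover have "0 \<le> a $ j" "a $ j < 1" using a \<epsilon> by (auto simp: cell_def intro: less_le_trans)
  ultimately have "\<epsilon> * \<bar>of_int (g j)\<bar> \<le> 8" using \<epsilon> by (simp add: node_def abs_mult[symmetric])
  then have "of_int \<bar>g j\<bar> \<le> 8 / \<epsilon>" using \<epsilon> by (simp add: field_simps)
  then have "\<bar>g j\<bar> \<le> \<lceil>8 / \<epsilon>\<rceil>" by linarith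
  then show "\<bar>g j\<bar> \<le> int (nat \<lceil>8 / \<epsilon>\<rceil>)" by linarith
qed

lemma node_inj: "node a g = node a g' \<Longrightarrow> g = g'"
  using \<epsilon> by (auto simp: node_def vec_eq_iff fun_eq_iff)

text \<open>Every point lies in exactly one cell of the lattice, so summing over the nodes and integrating
  over the offset \<open>a\<close> amounts to integrating over all of space.\<close>

lemma unfold_cells:
  assumes [measurable]: "f \<in> borel_measurable borel"
  shows "(\<integral>\<^sup>+a. (\<Sum>g\<in>indices. f (node a g)) * indicator cell a \<partial>lborel) \<le> (\<integral>\<^sup>+c. f c \<partial>lborel)"
proof -
  let ?v = "\<lambda>g. \<epsilon> *\<^sub>R (\<chi> j. of_int (g j)) :: real^3"
  have "(\<integral>\<^sup>+a. (\<Sum>g\<in>indices. f (node a g)) * indicator cell a \<partial>lborel) =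
      (\<integral>\<^sup>+a. (\<Sum>g\<in>indices. f (?v g + a) * indicator cell a) \<partial>lborel)"
    by (simp add: sum_distrib_right node_def add.commute)
  also have "\<dots> = (\<Sum>g\<in>indices. \<integral>\<^sup>+a. f (?v g + a) * indicator cell a \<partial>lborel)"
    by (rule nn_integral_sum) measurable
  also have "\<dots> = (\<Sum>g\<in>indices. \<integral>\<^sup>+c. f c * indicator cell (c - ?v g) \<partial>lborel)"
  proof (rule sum.cong[OF refl])
    fix g
    show "(\<integral>\<^sup>+a. f (?v g + a) * indicator cell a \<partial>lborel) = (\<integral>\<^sup>+c. f c * indicator cell (c - ?v g) \<partial>lborel)"
      using nn_integral_shift[of "\<lambda>c. f c * indicator cell (c - ?v g)" "?v g"] by simp
  qed
  also have "\<dots> = (\<integral>\<^sup>+c. (\<Sum>g\<in>indices. f c * indicator cell (c - ?v g)) \<partial>lborel)"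
    by (rule nn_integral_sum[symmetric]) measurable
  also have "\<dots> \<le> (\<integral>\<^sup>+c. f c \<partial>lborel)"
  proof (rule nn_integral_mono)
    fix c :: "real^3"
    define g0 where "g0 j = \<lfloor>c $ j / \<epsilon>\<rfloor>" for j
    have unique: "g = g0" if "c - ?v g \<in> cell" for g
    proof
      fix j
      have "0 \<le> c $ j - \<epsilon> * of_int (g j)" "c $ j - \<epsilon> * of_int (g j) < \<epsilon>" using that by (auto simp: cell_def)
      then have "of_int (g j) \<le> c $ j / \<epsilon>" "c $ j / \<epsilon> < of_int (g j) + 1" using \<epsilon> by (auto simp: field_simps)
      then show "g j = g0 j" unfolding g0_def by (intro floor_unique[symmetric])
    qed
    have "(\<Sum>g\<in>indices. f c * indicator cell (c - ?v g)) \<le> (\<Sum>g\<in>indices. if g = g0 then f c else 0)"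
    proof (rule sum_mono)
      fix g
      show "f c * indicator cell (c - ?v g) \<le> (if g = g0 then f c else 0)"
      proof (cases "c - ?v g \<in> cell")
        case True
        from unique[OF this] have "g = g0" .
        then show ?thesis using True by (simp only: indicator_simps if_True mult_1_right order_refl simp_thms)
      next
        case False
        then have "indicator cell (c - ?v g) = (0 :: ennreal)" by (rule indicator_simps(2))
        then show ?thesis by (simp only: mult_zero_right zero_le)
      qed
    qed
    also have "\<dots> \<le> f c" using finite_indices by (simp add: sum.delta)
    finally show "(\<Sum>g\<in>indices. f c * indicator cell (c - ?v g)) \<le> f c" .
  qed
  finally show ?thesis .
qed

lemma emeasure_cell_pos: "emeasure lborel cell \<ge> ennreal (\<epsilon> ^ 3)"
proof -
  have B: "(Basis :: (real^3) set) = (\<lambda>i. axis i 1) ` UNIV" by (auto simp: Basis_vec_def)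
  have "emeasure lborel (box 0 (\<chi> j. \<epsilon>) :: (real^3) set) = ennreal (\<epsilon> ^ 3)"
    by (subst emeasure_lborel_box) (use \<epsilon> in \<open>auto simp: B prod.reindex inj_on_def axis_eq_axis inner_axis\<close>)
  moreover have "box 0 (\<chi> j. \<epsilon>) \<subseteq> cell" by (auto simp: cell_def mem_box_cart less_imp_le)
  ultimately show ?thesis using emeasure_mono[of "box 0 (\<chi> j. \<epsilon>)" cell lborel] by simp
qed

lemma good_offset:
  assumes [measurable]: "f \<in> borel_measurable borel" and f: "(\<integral>\<^sup>+c. f c \<partial>lborel) \<le> ennreal (C * \<epsilon> ^ 3)" and C: "C > 0"
    and P: "AE c in lborel. P c"
  obtains a where "a \<in> cell" "\<And>g. P (node a g)" "(\<Sum>g\<in>indices. f (node a g)) \<le> ennreal (2 * C)"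
proof -
  have shift: "AE a in lborel. P (node a g)" for g
  proof -
    obtain N where N: "N \<in> sets lborel" "emeasure lborel N = 0" "{x. \<not> P x} \<subseteq> N"
      using P by (auto elim!: AE_E)
    have [measurable]: "N \<in> sets borel" using N by simp
    have "(\<integral>\<^sup>+a. indicator N (node a g) \<partial>lborel) = 0"
      using nn_integral_shift[of "indicator N" "\<epsilon> *\<^sub>R (\<chi> j. of_int (g j))"] N by (simp add: node_def add.commute)
    then have "AE a in lborel. indicator N (node a g) = (0::ennreal)"
      by (subst (asm) nn_integral_0_iff_AE) (auto simp: node_def)
    then show ?thesis by eventually_elim (use N(3) in \<open>auto simp: indicator_def split: if_splits\<close>)
  qed
  have Pg: "AE a in lborel. \<forall>g. P (node a g)" by (intro AE_all_countable[THEN iffD2] allI shift)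
  have "\<not> (AE a in lborel. a \<in> cell \<longrightarrow> \<not> ((\<forall>g. P (node a g)) \<and> (\<Sum>g\<in>indices. f (node a g)) \<le> ennreal (2 * C)))"
  proof
    assume "AE a in lborel. a \<in> cell \<longrightarrow> \<not> ((\<forall>g. P (node a g)) \<and> (\<Sum>g\<in>indices. f (node a g)) \<le> ennreal (2 * C))"
    with Pg have "AE a in lborel. ennreal (2 * C) * indicator cell a \<le> (\<Sum>g\<in>indices. f (node a g)) * indicator cell a"
      by eventually_elim (auto simp: indicator_def not_le less_imp_le)
    then have "(\<integral>\<^sup>+a. ennreal (2 * C) * indicator cell a \<partial>lborel) \<le> (\<integral>\<^sup>+a. (\<Sum>g\<in>indices. f (node a g)) * indicator cell a \<partial>lborel)"
      by (rule nn_integral_mono_AE)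
    also have "\<dots> \<le> ennreal (C * \<epsilon> ^ 3)" using unfold_cells[of f] f by simp
    finally have le: "ennreal (2 * C) * emeasure lborel cell \<le> ennreal (C * \<epsilon> ^ 3)"
      by (simp add: nn_integral_cmult_indicator)
    have "ennreal (2 * C * \<epsilon> ^ 3) = ennreal (2 * C) * ennreal (\<epsilon> ^ 3)" using C \<epsilon> by (intro ennreal_mult) auto
    also have "\<dots> \<le> ennreal (2 * C) * emeasure lborel cell" by (intro mult_left_mono emeasure_cell_pos) simp
    also note le
    finally have "2 * C * \<epsilon> ^ 3 \<le> C * \<epsilon> ^ 3" using C \<epsilon> by (subst (asm) ennreal_le_iff) auto
    then show False using C \<epsilon> by simp
  qed
  moreover have "AE a in lborel. a \<in> cell \<longrightarrow> \<not> ((\<forall>g. P (node a g)) \<and> (\<Sum>g\<in>indices. f (node a g)) \<le> ennreal (2 * C))"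
    if "\<not> (\<exists>a. a \<in> cell \<and> (\<forall>g. P (node a g)) \<and> (\<Sum>g\<in>indices. f (node a g)) \<le> ennreal (2 * C))"
  proof (rule AE_I2, intro impI notI)
    fix a assume "a \<in> cell" "(\<forall>g. P (node a g)) \<and> (\<Sum>g\<in>indices. f (node a g)) \<le> ennreal (2 * C)"
    then have "\<exists>a. a \<in> cell \<and> (\<forall>g. P (node a g)) \<and> (\<Sum>g\<in>indices. f (node a g)) \<le> ennreal (2 * C)"
      by (intro exI[of _ a] conjI) simp_all
    with that show False ..
  qed
  ultimately have "\<exists>a. a \<in> cell \<and> (\<forall>g. P (node a g)) \<and> (\<Sum>g\<in>indices. f (node a g)) \<le> ennreal (2 * C)"
    by argo
  then show ?thesis using that by blast
qed

end

section \<open>Interpolation on the lattice\<close>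

context lattice
begin

text \<open>In direction \<open>i\<close> the weight is \<open>slide\<close>, and across it is \<open>hat\<close>, so that the means over the
  faces with normal \<open>e\<^sub>i\<close> are interpolated by a partition of unity.\<close>

definition weight :: "3 \<Rightarrow> real^3 \<Rightarrow> real" where
  "weight i = tensor ((\<lambda>_. hat)(i := slide))"

definition interpolant :: "real^3 \<Rightarrow> real^3 \<Rightarrow> real^3" where
  "interpolant a x = (\<chi> i. \<Sum>g\<in>indices. face_mean i (node a g) * weight i ((1 / \<epsilon>) *\<^sub>R (x - node a g)))"

lemma tensor_rescale:
  "tensor f ((1 / \<epsilon>) *\<^sub>R (x - c)) = tensor (\<lambda>j t. f j ((1 / \<epsilon>) * t + - c $ j / \<epsilon>)) x"
  by (simp add: tensor_def diff_divide_distrib)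

lemma smooth1_weight: "smooth1 (((\<lambda>_. hat)(i := slide)) j)"
  by (simp add: smooth1_hat smooth1_slide)

lemma weight_nonneg: "weight i y \<ge> 0"
  unfolding weight_def tensor_def by (intro prod_nonneg) (simp add: hat_nonneg slide_nonneg)

lemma weight_eq_0: "\<bar>y $ j\<bar> \<ge> 2 \<Longrightarrow> weight i y = 0"
  unfolding weight_def by (rule tensor_eq_0[of _ j]) (auto simp: hat_eq_0 slide_eq_0 abs_if split: if_splits)

lemma continuous_on_weight: "continuous_on A (weight i)"
  unfolding weight_def by (rule continuous_on_tensor) (rule smooth1_weight)

lemma measurable_weight[measurable]: "weight i \<in> borel_measurable borel"
  by (rule borel_measurable_continuous_onI[OF continuous_on_weight])

lemma measurable_interpolant[measurable]: "interpolant a \<in> borel_measurable borel"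
  by (rule borel_measurable_vecI) (simp add: interpolant_def)

lemma sum_weight:
  assumes a: "a \<in> cell" and x: "x \<in> B3"
  shows "(\<Sum>g\<in>indices. weight i ((1 / \<epsilon>) *\<^sub>R (x - node a g))) = 1"
proof -
  define N where "N = nat \<lceil>8 / \<epsilon>\<rceil>"
  define s where "s j = (x $ j - a $ j) / \<epsilon>" for j
  let ?W = "\<lambda>j. ((\<lambda>_. hat)(i := slide)) j"
  have N: "\<bar>s j\<bar> + 1 \<le> real N" for j
  proof -
    have "\<bar>x $ j\<bar> \<le> 1" using component_le_norm_cart[of x j] x by simp
    moreover have "0 \<le> a $ j" "a $ j < 1" using a \<epsilon> by (auto simp: cell_def intro: less_le_trans)
    ultimately have "\<bar>x $ j - a $ j\<bar> \<le> 2" by linarith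
    then have "\<bar>s j\<bar> \<le> 2 / \<epsilon>" using \<epsilon> by (simp add: s_def abs_divide divide_right_mono)
    moreover have "1 \<le> 1 / \<epsilon>" using \<epsilon> by simp
    then have "2 / \<epsilon> + 1 \<le> 8 / \<epsilon>" using \<epsilon> by (simp add: field_simps)
    moreover have "8 / \<epsilon> \<le> real N" unfolding N_def by linarith
    ultimately show ?thesis by linarith
  qed
  have one: "(\<Sum>k\<in>{- int N..int N}. ?W j (s j - of_int k)) = 1" for j
    using sum_hat[of "s j" N] sum_slide[of "s j" N] N[of j] by (cases "j = i") auto
  have "(\<Sum>g\<in>indices. weight i ((1 / \<epsilon>) *\<^sub>R (x - node a g))) =
      (\<Sum>g\<in>PiE UNIV (\<lambda>_. {- int N..int N}). \<Prod>j\<in>UNIV. ?W j (s j - of_int (g j)))"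
  proof (rule sum.cong)
    show "indices = PiE UNIV (\<lambda>_. {- int N..int N})" by (simp only: indices_PiE N_def)
    fix g
    have "((1 / \<epsilon>) *\<^sub>R (x - node a g)) $ j = s j - of_int (g j)" for j
      using \<epsilon> by (simp add: node_def s_def field_simps)
    then show "weight i ((1 / \<epsilon>) *\<^sub>R (x - node a g)) = (\<Prod>j\<in>UNIV. ?W j (s j - of_int (g j)))"
      by (simp only: weight_def tensor_def)
  qed
  also have "\<dots> = (\<Prod>j\<in>UNIV. \<Sum>k\<in>{- int N..int N}. ?W j (s j - of_int k))"
    by (rule prod_sum_PiE[symmetric]) auto
  also have "\<dots> = 1" by (simp only: one prod.neutral_const)
  finally show ?thesis .
qed

lemma interpolant_error:
  assumes a: "a \<in> cell"
  shows "(\<integral>\<^sup>+x. ennreal (\<bar>interpolant a x $ i - X x $ i\<bar> powr p) * indicator B3 x \<partial>lborel) \<le> (\<Sum>g\<in>indices. interp_error i (node a g))"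
proof -
  let ?t = "\<lambda>x g. face_mean i (node a g) - X x $ i"
  let ?w = "\<lambda>x g. weight i ((1 / \<epsilon>) *\<^sub>R (x - node a g))"
  have "ennreal (\<bar>interpolant a x $ i - X x $ i\<bar> powr p) * indicator B3 x \<le>
      (\<Sum>g\<in>indices. ennreal (\<bar>?t x g\<bar> powr p) * indicator near_set (node a g - x))" for x
  proof (cases "x \<in> B3")
    case True
    have one: "(\<Sum>g\<in>indices. ?w x g) = 1" by (rule sum_weight[OF a True])
    define A where "A = {g \<in> indices. ?w x g \<noteq> 0}"
    have A: "finite A" "A \<noteq> {}"
      using finite_indices one by (auto simp: A_def) (metis (mono_tags, lifting) sum.neutral zero_neq_one)
    define m where "m = Max ((\<lambda>g. \<bar>?t x g\<bar>) ` A)"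
    have "m \<in> (\<lambda>g. \<bar>?t x g\<bar>) ` A" unfolding m_def using A by (intro Max_in) auto
    then obtain k where k: "k \<in> A" "m = \<bar>?t x k\<bar>" by auto
    have m: "\<bar>?t x g\<bar> \<le> m" if "g \<in> A" for g unfolding m_def using A that by (intro Max_ge) auto
    have "interpolant a x $ i - X x $ i = (\<Sum>g\<in>indices. face_mean i (node a g) * ?w x g) - (\<Sum>g\<in>indices. ?w x g) * X x $ i"
      by (simp add: interpolant_def one)
    also have "\<dots> = (\<Sum>g\<in>indices. ?w x g * ?t x g)"
      unfolding sum_distrib_right sum_subtractf[symmetric] by (intro sum.cong refl) (simp add: algebra_simps)
    finally have "\<bar>interpolant a x $ i - X x $ i\<bar> \<le> (\<Sum>g\<in>indices. \<bar>?w x g * ?t x g\<bar>)" using sum_abs by simp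
    also have "\<dots> \<le> (\<Sum>g\<in>indices. ?w x g * m)"
    proof (rule sum_mono)
      fix g assume "g \<in> indices"
      then show "\<bar>?w x g * ?t x g\<bar> \<le> ?w x g * m"
        using m[of g] weight_nonneg[of i "(1 / \<epsilon>) *\<^sub>R (x - node a g)"]
        by (cases "?w x g = 0") (auto simp: A_def abs_mult mult_left_mono)
    qed
    also have "\<dots> = m" using one by (simp flip: sum_distrib_right)
    finally have "ennreal (\<bar>interpolant a x $ i - X x $ i\<bar> powr p) \<le> ennreal (\<bar>?t x k\<bar> powr p)"
      using p k(2) by (intro ennreal_leI powr_mono2) auto
    also have "\<dots> = ennreal (\<bar>?t x k\<bar> powr p) * indicator near_set (node a k - x)"
    proof -
      have "\<bar>(node a k - x) $ j\<bar> < 2 * \<epsilon>" for j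
      proof (rule ccontr)
        assume "\<not> ?thesis"
        then have "\<bar>((1 / \<epsilon>) *\<^sub>R (x - node a k)) $ j\<bar> \<ge> 2" using \<epsilon> by (simp add: abs_divide field_simps)
        from weight_eq_0[OF this, of i] k(1) show False by (simp add: A_def)
      qed
      then have "node a k - x \<in> near_set" unfolding near_set_def by blast
      then show ?thesis by simp
    qed
    also have "\<dots> \<le> (\<Sum>g\<in>indices. ennreal (\<bar>?t x g\<bar> powr p) * indicator near_set (node a g - x))"
      by (rule member_le_sum[of k indices "\<lambda>g. ennreal (\<bar>?t x g\<bar> powr p) * indicator near_set (node a g - x)"])
         (use k finite_indices in \<open>auto simp: A_def\<close>)
    finally show ?thesis using True by simp
  qed simp
  then have "(\<integral>\<^sup>+x. ennreal (\<bar>interpolant a x $ i - X x $ i\<bar> powr p) * indicator B3 x \<partial>lborel) \<le>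
      (\<integral>\<^sup>+x. (\<Sum>g\<in>indices. ennreal (\<bar>?t x g\<bar> powr p) * indicator near_set (node a g - x)) \<partial>lborel)"
    by (rule nn_integral_mono)
  also have "\<dots> = (\<Sum>g\<in>indices. interp_error i (node a g))"
    unfolding interp_error_def by (rule nn_integral_sum) measurable
  finally show ?thesis .
qed

text \<open>The divergence of the interpolant: since \<open>slide' = hat - hat (\<sqdot> - 1)\<close>, summation by parts turns
  the face means into fluxes of cubes.\<close>

definition cube_hat :: "(real^3 \<Rightarrow> real) \<Rightarrow> real^3 \<Rightarrow> real" where
  "cube_hat \<phi> c = (\<integral>x. hat3 ((1 / \<epsilon>) *\<^sub>R (x - c)) * \<phi> x \<partial>lborel)"

lemma weight_by_parts:
  assumes "test_function \<phi> d\<phi> R"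
  shows "(\<integral>x. weight i ((1 / \<epsilon>) *\<^sub>R (x - c)) * d\<phi> i x \<partial>lborel) = - (cube_hat \<phi> c - cube_hat \<phi> (c + \<epsilon> *\<^sub>R axis i 1)) / \<epsilon>"
    and "integrable lborel (\<lambda>x. weight i ((1 / \<epsilon>) *\<^sub>R (x - c)) * d\<phi> i x)"
proof -
  interpret test_function \<phi> d\<phi> R by fact
  let ?W = "(\<lambda>_. hat)(i := slide)"
  define f where "f j t = ?W j ((1 / \<epsilon>) * t + - c $ j / \<epsilon>)" for j t
  have sf: "smooth1 (f j)" for j unfolding f_def[abs_def] by (rule smooth1_affine[OF smooth1_weight])
  obtain f' where f': "\<And>j t. (f j has_real_derivative f' j t) (at t)" "\<And>j. smooth1 (f' j)"
    using smooth1_derivs[of f] sf by blast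
  have w: "weight i ((1 / \<epsilon>) *\<^sub>R (x - c)) = tensor f x" for x
    unfolding weight_def tensor_rescale f_def ..
  have fi: "f' i t = (hat ((1 / \<epsilon>) * t + - c $ i / \<epsilon>) - hat ((1 / \<epsilon>) * t + - c $ i / \<epsilon> - 1)) * (1 / \<epsilon>)" for t
  proof -
    have "((\<lambda>t. (1 / \<epsilon>) * t + - c $ i / \<epsilon>) has_real_derivative 1 / \<epsilon>) (at t)"
      using \<epsilon> by (auto intro!: derivative_eq_intros)
    from DERIV_chain2[OF slide_deriv this] show ?thesis
      using DERIV_unique[OF f'(1)[of i t]] unfolding f_def[abs_def] by simp
  qed
  have t: "tensor (f(i := f' i)) x = (1 / \<epsilon>) * (hat3 ((1 / \<epsilon>) *\<^sub>R (x - c)) - hat3 ((1 / \<epsilon>) *\<^sub>R (x - (c + \<epsilon> *\<^sub>R axis i 1))))" for x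
  proof -
    let ?h1 = "hat ((x $ (i + 1) - c $ (i + 1)) / \<epsilon>)" and ?h2 = "hat ((x $ (i + 2) - c $ (i + 2)) / \<epsilon>)"
    have F: "f (i + 1) (x $ (i + 1)) = ?h1" "f (i + 2) (x $ (i + 2)) = ?h2"
      by (simp_all add: f_def diff_divide_distrib)
    have F': "f' i (x $ i) = (hat ((x $ i - c $ i) / \<epsilon>) - hat ((x $ i - (c $ i + \<epsilon>)) / \<epsilon>)) * (1 / \<epsilon>)"
      using \<epsilon> by (simp add: fi diff_divide_distrib add_divide_distrib algebra_simps)
    have T: "tensor (f(i := f' i)) x = f' i (x $ i) * f (i + 1) (x $ (i + 1)) * f (i + 2) (x $ (i + 2))"
      by (simp add: tensor_def prod_index[of _ i])
    have H: "hat3 ((1 / \<epsilon>) *\<^sub>R (x - c)) = hat ((x $ i - c $ i) / \<epsilon>) * ?h1 * ?h2"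
      "hat3 ((1 / \<epsilon>) *\<^sub>R (x - (c + \<epsilon> *\<^sub>R axis i 1))) = hat ((x $ i - (c $ i + \<epsilon>)) / \<epsilon>) * ?h1 * ?h2"
      by (simp_all add: hat3_def tensor_def prod_index[of _ i] axis_def)
    have "(A - B) * (1 / \<epsilon>) * y * z = (1 / \<epsilon>) * (A * y * z - B * y * z)" for A B y z :: real
      by (simp add: algebra_simps diff_divide_distrib)
    then show ?thesis unfolding T F F' H .
  qed
  have ih: "integrable lborel (\<lambda>x. hat3 ((1 / \<epsilon>) *\<^sub>R (x - c')) * \<phi> x)" for c'
    by (rule integrable_continuous_bounded_support[of _ R])
       (auto intro!: continuous_intros continuous_on_compose2[OF continuous_on_hat3[of UNIV]] continuous_phi simp: support)
  show "integrable lborel (\<lambda>x. weight i ((1 / \<epsilon>) *\<^sub>R (x - c)) * d\<phi> i x)"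
    unfolding w by (rule integral_by_parts(2)[OF sf f'])
  have "(\<integral>x. weight i ((1 / \<epsilon>) *\<^sub>R (x - c)) * d\<phi> i x \<partial>lborel) = - (\<integral>x. tensor (f(i := f' i)) x * \<phi> x \<partial>lborel)"
    unfolding w by (rule integral_by_parts(1)[OF sf f'])
  also have "(\<integral>x. tensor (f(i := f' i)) x * \<phi> x \<partial>lborel) =
      (\<integral>x. (1 / \<epsilon>) * (hat3 ((1 / \<epsilon>) *\<^sub>R (x - c)) * \<phi> x - hat3 ((1 / \<epsilon>) *\<^sub>R (x - (c + \<epsilon> *\<^sub>R axis i 1))) * \<phi> x) \<partial>lborel)"
    unfolding t by (simp only: left_diff_distrib mult.assoc)
  also have "\<dots> = (1 / \<epsilon>) * (cube_hat \<phi> c - cube_hat \<phi> (c + \<epsilon> *\<^sub>R axis i 1))"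
    unfolding integral_mult_right_zero cube_hat_def by (subst Bochner_Integration.integral_diff[OF ih ih]) simp
  finally show "(\<integral>x. weight i ((1 / \<epsilon>) *\<^sub>R (x - c)) * d\<phi> i x \<partial>lborel) = - (cube_hat \<phi> c - cube_hat \<phi> (c + \<epsilon> *\<^sub>R axis i 1)) / \<epsilon>"
    by (simp add: diff_divide_distrib)
qed

lemma node_upd: "node a (g(i := g i + k)) = node a g + (\<epsilon> * of_int k) *\<^sub>R axis i 1"
  by (simp add: node_def vec_eq_iff axis_def algebra_simps)

lemma summation_by_parts:
  assumes a: "a \<in> cell"
  shows "(\<Sum>g\<in>indices. face_mean i (node a g) * \<beta> (node a g + \<epsilon> *\<^sub>R axis i 1)) =
    (\<Sum>g\<in>indices. face_mean i (node a g - \<epsilon> *\<^sub>R axis i 1) * \<beta> (node a g))"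
proof -
  have up: "node a (g(i := g i + 1)) = node a g + \<epsilon> *\<^sub>R axis i 1" for g using node_upd[of a g i 1] by simp
  have down: "node a (g(i := g i - 1)) = node a g - \<epsilon> *\<^sub>R axis i 1" for g using node_upd[of a g i "-1"] by simp
  have e1: "norm (\<epsilon> *\<^sub>R axis i 1 :: real^3) \<le> 1" using \<epsilon> by simp
  show ?thesis
  proof (rule sum.reindex_bij_witness_not_neutral[where i="\<lambda>g. g(i := g i - 1)" and j="\<lambda>g. g(i := g i + 1)"
        and S'="{g \<in> indices. face_mean i (node a g) = 0}" and T'="{g \<in> indices. face_mean i (node a g - \<epsilon> *\<^sub>R axis i 1) = 0}"])
    fix g assume g: "g \<in> indices - {g \<in> indices. face_mean i (node a g) = 0}"
    show "(g(i := g i + 1))(i := (g(i := g i + 1)) i - 1) = g" by simp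
    have "norm (node a g) < 4" using g face_mean_eq_0[of "node a g" i] by (auto simp: not_le[symmetric])
    then have "norm (node a (g(i := g i + 1))) < 6"
      unfolding up using norm_triangle_ineq[of "node a g" "\<epsilon> *\<^sub>R axis i 1"] e1 by linarith
    from node_in_indices[OF a this] show "g(i := g i + 1) \<in> indices - {g \<in> indices. face_mean i (node a g - \<epsilon> *\<^sub>R axis i 1) = 0}"
      using g by (simp add: up)
  next
    fix g assume g: "g \<in> indices - {g \<in> indices. face_mean i (node a g - \<epsilon> *\<^sub>R axis i 1) = 0}"
    show "(g(i := g i - 1))(i := (g(i := g i - 1)) i + 1) = g" by simp
    have "norm (node a (g(i := g i - 1))) < 4"
      unfolding down using g face_mean_eq_0[of "node a g - \<epsilon> *\<^sub>R axis i 1" i] by (auto simp: not_le[symmetric])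
    then have "norm (node a (g(i := g i - 1))) < 6" by simp
    from node_in_indices[OF a this] show "g(i := g i - 1) \<in> indices - {g \<in> indices. face_mean i (node a g) = 0}"
      using g by (simp add: down)
  next
    fix g assume "g \<in> indices"
    show "face_mean i (node a (g(i := g i + 1)) - \<epsilon> *\<^sub>R axis i 1) * \<beta> (node a (g(i := g i + 1))) =
        face_mean i (node a g) * \<beta> (node a g + \<epsilon> *\<^sub>R axis i 1)" by (simp add: up)
  qed (use finite_indices in auto)
qed

lemma interpolant_divergence:
  assumes a: "a \<in> cell" and \<phi>: "test_function \<phi> d\<phi> R"
  shows "integrable lborel (\<lambda>x. \<Sum>i\<in>UNIV. interpolant a x $ i * d\<phi> i x)"
    and "(\<integral>x. (\<Sum>i\<in>UNIV. interpolant a x $ i * d\<phi> i x) \<partial>lborel) =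
      - (\<Sum>g\<in>indices. 2 * pi * field_flux X (node a g) \<epsilon> * (cube_hat \<phi> (node a g) / \<epsilon> ^ 3))"
proof -
  let ?t = "\<lambda>i g x. face_mean i (node a g) * (weight i ((1 / \<epsilon>) *\<^sub>R (x - node a g)) * d\<phi> i x)"
  have eq: "(\<Sum>i\<in>UNIV. interpolant a x $ i * d\<phi> i x) = (\<Sum>i\<in>UNIV. \<Sum>g\<in>indices. ?t i g x)" for x
    by (simp add: interpolant_def sum_distrib_right mult.assoc)
  have int: "integrable lborel (?t i g)" for i g
    by (rule integrable_mult_right[OF weight_by_parts(2)[OF \<phi>]])
  show "integrable lborel (\<lambda>x. \<Sum>i\<in>UNIV. interpolant a x $ i * d\<phi> i x)"
    unfolding eq by (intro Bochner_Integration.integrable_sum int)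
  have "(\<integral>x. (\<Sum>i\<in>UNIV. interpolant a x $ i * d\<phi> i x) \<partial>lborel) = (\<Sum>i\<in>UNIV. \<Sum>g\<in>indices. \<integral>x. ?t i g x \<partial>lborel)"
    unfolding eq by (subst Bochner_Integration.integral_sum, intro Bochner_Integration.integrable_sum int)
      (intro sum.cong refl Bochner_Integration.integral_sum int)
  also have "\<dots> = (\<Sum>i\<in>UNIV. - (1 / \<epsilon>) * ((\<Sum>g\<in>indices. face_mean i (node a g) * cube_hat \<phi> (node a g)) -
      (\<Sum>g\<in>indices. face_mean i (node a g) * cube_hat \<phi> (node a g + \<epsilon> *\<^sub>R axis i 1))))"
    unfolding integral_mult_right_zero weight_by_parts(1)[OF \<phi>] sum_subtractf[symmetric] sum_distrib_left
    by (intro sum.cong refl) (simp add: algebra_simps diff_divide_distrib)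
  also have "\<dots> = (\<Sum>i\<in>UNIV. - (1 / \<epsilon>) * (\<Sum>g\<in>indices. (face_mean i (node a g) - face_mean i (node a g - \<epsilon> *\<^sub>R axis i 1)) * cube_hat \<phi> (node a g)))"
    unfolding summation_by_parts[OF a, of _ "cube_hat \<phi>"] sum_subtractf[symmetric] left_diff_distrib ..
  also have "\<dots> = - (\<Sum>g\<in>indices. (1 / \<epsilon>) * (\<Sum>i\<in>UNIV. face_mean i (node a g) - face_mean i (node a g - \<epsilon> *\<^sub>R axis i 1)) * cube_hat \<phi> (node a g))"
    unfolding sum_distrib_left sum_distrib_right
    by (subst sum.swap) (simp add: sum_negf)
  also have "\<dots> = - (\<Sum>g\<in>indices. 2 * pi * field_flux X (node a g) \<epsilon> * (cube_hat \<phi> (node a g) / \<epsilon> ^ 3))"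
    unfolding field_flux_eq_face_mean using \<epsilon> by (simp add: power2_eq_square power3_eq_cube)
  finally show "(\<integral>x. (\<Sum>i\<in>UNIV. interpolant a x $ i * d\<phi> i x) \<partial>lborel) =
      - (\<Sum>g\<in>indices. 2 * pi * field_flux X (node a g) \<epsilon> * (cube_hat \<phi> (node a g) / \<epsilon> ^ 3))" .
qed

text \<open>The smooth divergence of the interpolant in each cube of nonzero flux is concentrated at the
  centre by adding a multiple of the point source field.\<close>

definition bad :: "real^3 \<Rightarrow> (3 \<Rightarrow> int) set" where
  "bad a = {g \<in> indices. field_flux X (node a g) \<epsilon> \<noteq> 0 \<and> norm (node a g) < 1 + 3 * \<epsilon>}"

definition correction :: "real^3 \<Rightarrow> real^3 \<Rightarrow> real^3" where
  "correction a x = (\<Sum>g\<in>bad a. (2 * pi * field_flux X (node a g) \<epsilon> / \<epsilon>\<^sup>2) *\<^sub>R point_source ((1 / \<epsilon>) *\<^sub>R (x - node a g)))"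

lemma bad_subset: "bad a \<subseteq> indices"
  by (auto simp: bad_def)

lemma finite_bad: "finite (bad a)"
  using finite_indices by (simp add: bad_def)

lemma measurable_correction[measurable]: "correction a \<in> borel_measurable borel"
  unfolding correction_def[abs_def] by measurable

lemma correction_divergence:
  assumes \<phi>: "test_function \<phi> d\<phi> R"
  shows "integrable lborel (\<lambda>x. \<Sum>i\<in>UNIV. correction a x $ i * d\<phi> i x)"
    and "(\<integral>x. (\<Sum>i\<in>UNIV. correction a x $ i * d\<phi> i x) \<partial>lborel) =
      (\<Sum>g\<in>bad a. 2 * pi * field_flux X (node a g) \<epsilon> * (cube_hat \<phi> (node a g) / \<epsilon> ^ 3 - \<phi> (node a g)))"
proof -
  interpret test_function \<phi> d\<phi> R by fact
  let ?t = "\<lambda>g x. 2 * pi * field_flux X (node a g) \<epsilon> * (\<Sum>i\<in>UNIV. point_source ((1 / \<epsilon>) *\<^sub>R (x - node a g)) $ i / \<epsilon>\<^sup>2 * d\<phi> i x)"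
  have eq: "(\<Sum>i\<in>UNIV. correction a x $ i * d\<phi> i x) = (\<Sum>g\<in>bad a. ?t g x)" for x
    unfolding correction_def sum_component sum_distrib_right sum_distrib_left
    by (subst sum.swap) (simp add: mult.assoc)
  have int: "integrable lborel (?t g)" for g
    by (rule integrable_mult_right[OF scaled_point_source_divergence(1)[OF \<epsilon>(1)]])
  show "integrable lborel (\<lambda>x. \<Sum>i\<in>UNIV. correction a x $ i * d\<phi> i x)"
    unfolding eq by (intro Bochner_Integration.integrable_sum int)
  show "(\<integral>x. (\<Sum>i\<in>UNIV. correction a x $ i * d\<phi> i x) \<partial>lborel) =
      (\<Sum>g\<in>bad a. 2 * pi * field_flux X (node a g) \<epsilon> * (cube_hat \<phi> (node a g) / \<epsilon> ^ 3 - \<phi> (node a g)))"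
    unfolding eq Bochner_Integration.integral_sum[OF int] integral_mult_right_zero
      scaled_point_source_divergence(2)[OF \<epsilon>(1)] cube_hat_def ..
qed

lemma total_divergence:
  assumes a: "a \<in> cell" and \<phi>: "test_function \<phi> d\<phi> R" and out: "\<And>x. x \<notin> B3 \<Longrightarrow> \<phi> x = 0"
  shows "(\<integral>x. (\<Sum>i\<in>UNIV. (interpolant a x + correction a x) $ i * d\<phi> i x) \<partial>lborel) =
    - (\<Sum>g\<in>bad a. 2 * pi * field_flux X (node a g) \<epsilon> * \<phi> (node a g))"
proof -
  let ?h = "\<lambda>g. 2 * pi * field_flux X (node a g) \<epsilon>"
  have zero: "cube_hat \<phi> c = 0" if c: "norm c \<ge> 1 + 3 * \<epsilon>" for c
  proof -
    have "hat3 ((1 / \<epsilon>) *\<^sub>R (x - c)) * \<phi> x = 0" for x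
    proof (cases "x \<in> B3 \<and> hat3 ((1 / \<epsilon>) *\<^sub>R (x - c)) \<noteq> 0")
      case True
      have "\<bar>(x - c) $ j\<bar> \<le> \<epsilon>" for j
      proof (rule ccontr)
        assume "\<not> ?thesis"
        then have "\<bar>((1 / \<epsilon>) *\<^sub>R (x - c)) $ j\<bar> \<ge> 1" using \<epsilon> by (simp add: abs_divide field_simps)
        from hat3_eq_0[OF this] True show False by simp
      qed
      then have "norm (x - c) \<le> 3 * \<epsilon>" by (rule norm_le_3)
      then have "norm c \<le> norm x + 3 * \<epsilon>" using norm_triangle_ineq4[of x "x - c"] by simp
      then show ?thesis using True c by simp
    qed (use out in auto)
    then show ?thesis unfolding cube_hat_def by (simp only: Bochner_Integration.integral_zero)
  qed
  have "(\<Sum>g\<in>indices. ?h g * (cube_hat \<phi> (node a g) / \<epsilon> ^ 3)) = (\<Sum>g\<in>bad a. ?h g * (cube_hat \<phi> (node a g) / \<epsilon> ^ 3))"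
  proof (rule sum.mono_neutral_right[OF finite_indices], blast intro: bad_subset[THEN subsetD], intro ballI)
    fix g assume g: "g \<in> indices - bad a"
    show "?h g * (cube_hat \<phi> (node a g) / \<epsilon> ^ 3) = 0"
    proof (cases "field_flux X (node a g) \<epsilon> = 0")
      case False
      then have "norm (node a g) \<ge> 1 + 3 * \<epsilon>" using g by (auto simp: bad_def not_less)
      from zero[OF this] show ?thesis by simp
    qed simp
  qed
  moreover have "(\<integral>x. (\<Sum>i\<in>UNIV. (interpolant a x + correction a x) $ i * d\<phi> i x) \<partial>lborel) =
      (\<integral>x. (\<Sum>i\<in>UNIV. interpolant a x $ i * d\<phi> i x) + (\<Sum>i\<in>UNIV. correction a x $ i * d\<phi> i x) \<partial>lborel)"
    by (simp add: distrib_right sum.distrib)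
  moreover have "\<dots> = (\<integral>x. (\<Sum>i\<in>UNIV. interpolant a x $ i * d\<phi> i x) \<partial>lborel) + (\<integral>x. (\<Sum>i\<in>UNIV. correction a x $ i * d\<phi> i x) \<partial>lborel)"
    by (rule Bochner_Integration.integral_add[OF interpolant_divergence(1)[OF a \<phi>] correction_divergence(1)[OF \<phi>]])
  ultimately show ?thesis
    unfolding interpolant_divergence(2)[OF a \<phi>] correction_divergence(2)[OF \<phi>]
    by (simp add: right_diff_distrib sum_subtractf)
qed

lemma smooth_on_rescaled_point_source:
  "smooth_on (- {c}) (\<lambda>x. point_source ((1 / \<epsilon>) *\<^sub>R (x - c)) $ i)"
proof -
  let ?F = "{\<lambda>x. k * f ((1 / \<epsilon>) *\<^sub>R (x - c)) | k f. smooth_on (- {0}) f}"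
  have "(\<lambda>x. 1 * point_source ((1 / \<epsilon>) *\<^sub>R (x - c)) $ i) \<in> ?F"
    by (intro CollectI exI[of _ 1] exI[of _ "\<lambda>y. point_source y $ i"] conjI refl smooth_on_point_source)
  then have "smooth_on (- {c}) (\<lambda>x. 1 * point_source ((1 / \<epsilon>) *\<^sub>R (x - c)) $ i)"
  proof (rule smooth_on_coinduct[rotated])
    show "open (- {c})" by auto
    fix h assume "h \<in> ?F"
    then obtain k f where h: "h = (\<lambda>x. k * f ((1 / \<epsilon>) *\<^sub>R (x - c)))" "smooth_on (- {0}) f" by blast
    show "\<exists>h'. (\<forall>x\<in>- {c}. (h has_derivative h' x) (at x)) \<and> (\<forall>i. (\<lambda>x. h' x (axis i 1)) \<in> ?F)"
    proof (intro exI[of _ "\<lambda>x v. \<Sum>j\<in>UNIV. v $ j * (k / \<epsilon> * partial_d j f ((1 / \<epsilon>) *\<^sub>R (x - c)))"] conjI ballI allI)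
      fix x assume x: "x \<in> - {c}"
      then have "(1 / \<epsilon>) *\<^sub>R (x - c) \<in> - {0}" using \<epsilon> by simp
      note D = has_derivative_partials[OF smooth_on_differentiable[OF h(2) this]]
      have "((\<lambda>x. (1 / \<epsilon>) *\<^sub>R (x - c)) has_derivative (\<lambda>v. (1 / \<epsilon>) *\<^sub>R v)) (at x)"
        by (auto intro!: derivative_eq_intros)
      from has_derivative_mult_right[OF has_derivative_compose[OF this D], of k]
      show "(h has_derivative (\<lambda>v. \<Sum>j\<in>UNIV. v $ j * (k / \<epsilon> * partial_d j f ((1 / \<epsilon>) *\<^sub>R (x - c))))) (at x)"
        unfolding h(1) by (simp add: sum_distrib_left mult_ac)
    next
      fix i
      show "(\<lambda>x. \<Sum>j\<in>UNIV. axis i 1 $ j * (k / \<epsilon> * partial_d j f ((1 / \<epsilon>) *\<^sub>R (x - c)))) \<in> ?F"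
        unfolding sum_axis
        by (intro CollectI exI[of _ "k / \<epsilon>"] exI[of _ "partial_d i f"] conjI refl smooth_on_partial h(2))
    qed
  qed
  then show ?thesis by simp
qed

lemma smooth_on_approximation:
  "smooth_on (- (node a ` bad a)) (\<lambda>x. (interpolant a x + correction a x) $ i)"
proof -
  have o: "open (- (node a ` bad a))" using finite_bad by (intro open_Compl finite_imp_closed finite_imageI)
  have w: "smooth_on UNIV (\<lambda>x. weight i ((1 / \<epsilon>) *\<^sub>R (x - c)))" for c
    unfolding weight_def tensor_rescale by (rule smooth_on_tensor) (rule smooth1_affine[OF smooth1_weight])
  have 1: "smooth_on (- (node a ` bad a)) (\<lambda>x. face_mean i (node a g) * weight i ((1 / \<epsilon>) *\<^sub>R (x - node a g)))" for g
    by (rule smooth_on_cmult[OF o smooth_on_subset[OF w subset_UNIV]])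
  have 2: "smooth_on (- (node a ` bad a)) (\<lambda>x. (2 * pi * field_flux X (node a g) \<epsilon> / \<epsilon>\<^sup>2) * point_source ((1 / \<epsilon>) *\<^sub>R (x - node a g)) $ i)"
    if "g \<in> bad a" for g
    by (rule smooth_on_cmult[OF o smooth_on_subset[OF smooth_on_rescaled_point_source]]) (use that in auto)
  have "smooth_on (- (node a ` bad a)) (\<lambda>x. (\<Sum>g\<in>indices. face_mean i (node a g) * weight i ((1 / \<epsilon>) *\<^sub>R (x - node a g))) +
      (\<Sum>g\<in>bad a. (2 * pi * field_flux X (node a g) \<epsilon> / \<epsilon>\<^sup>2) * point_source ((1 / \<epsilon>) *\<^sub>R (x - node a g)) $ i))"
    by (rule smooth_on_add[OF o smooth_on_sum[OF o 1] smooth_on_sum[OF o 2]]) (use finite_indices finite_bad in auto)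
  then show ?thesis by (simp add: interpolant_def correction_def)
qed

lemma card_near_nodes:
  "card {g \<in> A. \<forall>j. \<bar>(x - node a g) $ j\<bar> \<le> \<epsilon>} \<le> 64"
proof -
  define s where "s j = (x $ j - a $ j) / \<epsilon>" for j
  let ?P = "PiE UNIV (\<lambda>j :: 3. {\<lfloor>s j\<rfloor> - 1..\<lfloor>s j\<rfloor> + 2})"
  have sub: "{g \<in> A. \<forall>j. \<bar>(x - node a g) $ j\<bar> \<le> \<epsilon>} \<subseteq> ?P"
  proof
    fix g assume g: "g \<in> {g \<in> A. \<forall>j. \<bar>(x - node a g) $ j\<bar> \<le> \<epsilon>}"
    have "g j \<in> {\<lfloor>s j\<rfloor> - 1..\<lfloor>s j\<rfloor> + 2}" for j
    proof -
      have "\<bar>x $ j - (a $ j + \<epsilon> * of_int (g j))\<bar> \<le> \<epsilon>" using g by (simp add: node_def)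
      moreover have "x $ j - (a $ j + \<epsilon> * of_int (g j)) = \<epsilon> * (s j - of_int (g j))" using \<epsilon> by (simp add: s_def field_simps)
      ultimately have "\<epsilon> * \<bar>s j - of_int (g j)\<bar> \<le> \<epsilon> * 1" using \<epsilon> by (simp add: abs_mult)
      then have "\<bar>s j - of_int (g j)\<bar> \<le> 1" using \<epsilon> by (simp only: mult_le_cancel_left_pos)
      then show ?thesis unfolding atLeastAtMost_iff by linarith
    qed
    then show "g \<in> ?P" by (simp add: PiE_UNIV_domain Pi_def)
  qed
  have fin: "finite ?P" by (intro finite_PiE) auto
  have card: "card ?P = 64" by (simp add: card_PiE)
  from card_mono[OF fin sub] show ?thesis unfolding card .
qed

text \<open>The point sources of the bad cubes overlap at most 64 times, so the correction is bounded by a sum over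
  these cubes. Each of them has face means of order \<open>\<epsilon>\<^sup>-\<^sup>2\<close>, because its flux is a nonzero integer. For
  \<open>p \<ge> 3/2\<close> a single one contributes at least \<open>\<epsilon>\<^sup>3\<^sup>-\<^sup>2\<^sup>p \<ge> 1\<close>.\<close>

lemma correction_error:
  assumes a: "a \<in> cell" and int: "\<And>g. norm (node a g) < 1 + 3 * \<epsilon> \<Longrightarrow> field_flux X (node a g) \<epsilon> \<in> \<int>"
  shows "Lpow p (\<lambda>x. correction a x $ i) \<le>
      ennreal (64 powr p) * (Lpow p (\<lambda>y. point_source y $ i) * (ennreal (\<epsilon> ^ 3) * (\<Sum>g\<in>indices. bad_error (node a g))))"
    and "ennreal (\<epsilon> ^ 3) * (\<Sum>g\<in>indices. bad_error (node a g)) < 1 \<Longrightarrow> p \<ge> 3 / 2 \<Longrightarrow> bad a = {}"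
proof -
  let ?h = "\<lambda>g. 2 * pi * field_flux X (node a g) \<epsilon>"
  have h_le: "\<bar>?h g\<bar> / \<epsilon>\<^sup>2 \<le> face_total (node a g)" for g
  proof -
    have "\<bar>?h g\<bar> = \<epsilon>\<^sup>2 * \<bar>\<Sum>i\<in>UNIV. face_mean i (node a g) - face_mean i (node a g - \<epsilon> *\<^sub>R axis i 1)\<bar>"
      unfolding field_flux_eq_face_mean by (simp add: abs_mult)
    also have "\<dots> \<le> \<epsilon>\<^sup>2 * face_total (node a g)"
      unfolding face_total_def by (intro mult_left_mono order_trans[OF sum_abs] sum_mono abs_triangle_ineq4) auto
    finally show ?thesis using \<epsilon> by (simp add: field_simps)
  qed
  have ft: "face_total (node a g) \<ge> 2 * pi / \<epsilon>\<^sup>2" if "g \<in> bad a" for g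
  proof -
    have "field_flux X (node a g) \<epsilon> \<in> \<int>" "field_flux X (node a g) \<epsilon> \<noteq> 0" using int that by (auto simp: bad_def)
    then have "\<bar>field_flux X (node a g) \<epsilon>\<bar> \<ge> 1" by (rule Ints_nonzero_abs_ge1)
    then have "\<bar>?h g\<bar> \<ge> 2 * pi" by (simp add: abs_mult)
    then have "2 * pi / \<epsilon>\<^sup>2 \<le> \<bar>?h g\<bar> / \<epsilon>\<^sup>2" by (rule divide_right_mono) simp
    then show ?thesis using h_le[of g] by linarith
  qed
  then have be: "bad_error (node a g) = ennreal (face_total (node a g) powr p)" if "g \<in> bad a" for g
    using that by (simp add: bad_error_def)
  show "bad a = {}" if small: "ennreal (\<epsilon> ^ 3) * (\<Sum>g\<in>indices. bad_error (node a g)) < 1" and p32: "p \<ge> 3 / 2"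
  proof (rule equals0I)
    fix g assume g: "g \<in> bad a"
    have "1 \<le> \<epsilon> powr (3 - 2 * p)" using \<epsilon> p32 powr_mono'[of "3 - 2 * p" 0 \<epsilon>] by simp
    also have "\<dots> = \<epsilon> ^ 3 * (1 / \<epsilon>\<^sup>2) powr p"
    proof -
      have "1 / \<epsilon>\<^sup>2 = \<epsilon> powr (- 2)" using \<epsilon> by (simp add: powr_minus powr_numeral divide_inverse)
      moreover have "\<epsilon> ^ 3 = \<epsilon> powr 3" using \<epsilon> by (simp add: powr_numeral)
      ultimately show ?thesis by (simp add: powr_powr powr_add[symmetric])
    qed
    also have "\<dots> \<le> \<epsilon> ^ 3 * face_total (node a g) powr p"
    proof -
      have "1 / \<epsilon>\<^sup>2 \<le> 2 * pi / \<epsilon>\<^sup>2" using pi_gt3 by (intro divide_right_mono) auto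
      then have "1 / \<epsilon>\<^sup>2 \<le> face_total (node a g)" using ft[OF g] by linarith
      then show ?thesis using \<epsilon> p by (intro mult_left_mono powr_mono2) auto
    qed
    finally have "1 \<le> ennreal (\<epsilon> ^ 3) * bad_error (node a g)"
      unfolding be[OF g] using \<epsilon> by (simp flip: ennreal_mult add: ennreal_leI[of 1, simplified])
    also have "\<dots> \<le> ennreal (\<epsilon> ^ 3) * (\<Sum>g\<in>indices. bad_error (node a g))"
      using g finite_indices by (intro mult_left_mono member_le_sum) (auto simp: bad_def)
    finally show False using small by simp
  qed
  let ?t = "\<lambda>g x. (?h g / \<epsilon>\<^sup>2) * point_source ((1 / \<epsilon>) *\<^sub>R (x - node a g)) $ i"
  have "ennreal (\<bar>correction a x $ i\<bar> powr p) \<le> ennreal (64 powr p) * (\<Sum>g\<in>bad a. ennreal (\<bar>?t g x\<bar> powr p))" for x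
  proof (cases "bad a = {}")
    case True
    then show ?thesis using p by (simp add: correction_def)
  next
    case False
    define m where "m = Max ((\<lambda>g. \<bar>?t g x\<bar>) ` bad a)"
    have "m \<in> (\<lambda>g. \<bar>?t g x\<bar>) ` bad a" unfolding m_def using False finite_bad by (intro Max_in) auto
    then obtain k where k: "k \<in> bad a" "m = \<bar>?t k x\<bar>" by auto
    have m: "\<bar>?t g x\<bar> \<le> m" if "g \<in> bad a" for g unfolding m_def using finite_bad that by (intro Max_ge) auto
    let ?A = "{g \<in> bad a. \<forall>j. \<bar>(x - node a g) $ j\<bar> \<le> \<epsilon>}"
    have far: "?t g x = 0" if "g \<in> bad a - ?A" for g
    proof -
      have "\<not> (\<forall>j. \<bar>(x - node a g) $ j\<bar> \<le> \<epsilon>)" using that by blast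
      then obtain j where "\<not> \<bar>(x - node a g) $ j\<bar> \<le> \<epsilon>" by blast
      then have "\<bar>(x - node a g) $ j\<bar> > \<epsilon>" by linarith
      then have "\<bar>((1 / \<epsilon>) *\<^sub>R (x - node a g)) $ j\<bar> > 1" using \<epsilon> by (simp add: abs_divide field_simps)
      from point_source_eq_0[OF this] show ?thesis by simp
    qed
    have "correction a x $ i = (\<Sum>g\<in>bad a. ?t g x)" by (simp add: correction_def)
    also have "\<dots> = (\<Sum>g\<in>?A. ?t g x)"
      by (rule sum.mono_neutral_right[OF finite_bad]) (use far in auto)
    finally have "\<bar>correction a x $ i\<bar> \<le> (\<Sum>g\<in>?A. \<bar>?t g x\<bar>)" by (simp only: sum_abs)
    also have "\<dots> \<le> (\<Sum>g\<in>?A. m)" by (intro sum_mono m) auto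
    also have "\<dots> = real (card ?A) * m" by simp
    also have "\<dots> \<le> 64 * m" using card_near_nodes[of "bad a" x a] k(2) by (intro mult_right_mono) auto
    finally have "\<bar>correction a x $ i\<bar> powr p \<le> (64 * m) powr p" using p by (intro powr_mono2) auto
    also have "\<dots> = 64 powr p * \<bar>?t k x\<bar> powr p" unfolding k(2) by (rule powr_mult)
    finally have "ennreal (\<bar>correction a x $ i\<bar> powr p) \<le> ennreal (64 powr p) * ennreal (\<bar>?t k x\<bar> powr p)"
      by (simp only: ennreal_leI ennreal_mult[symmetric] powr_ge_zero)
    also have "\<dots> \<le> ennreal (64 powr p) * (\<Sum>g\<in>bad a. ennreal (\<bar>?t g x\<bar> powr p))"
      by (rule mult_left_mono[OF member_le_sum[of k "bad a" "\<lambda>g. ennreal (\<bar>?t g x\<bar> powr p)"]])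
         (use k finite_bad in auto)
    finally show ?thesis .
  qed
  then have "Lpow p (\<lambda>x. correction a x $ i) \<le> (\<integral>\<^sup>+x. ennreal (64 powr p) * (\<Sum>g\<in>bad a. ennreal (\<bar>?t g x\<bar> powr p)) \<partial>lborel)"
    unfolding Lpow_def by (rule nn_integral_mono)
  also have "\<dots> = ennreal (64 powr p) * (\<Sum>g\<in>bad a. Lpow p (?t g))"
    unfolding Lpow_def by (subst nn_integral_cmult, measurable) (subst nn_integral_sum, measurable)
  also have "\<dots> \<le> ennreal (64 powr p) * (\<Sum>g\<in>bad a. bad_error (node a g) * (ennreal (\<epsilon> ^ 3) * Lpow p (\<lambda>y. point_source y $ i)))"
  proof (intro mult_left_mono sum_mono)
    fix g assume g: "g \<in> bad a"
    have "Lpow p (?t g) = ennreal (\<bar>?h g / \<epsilon>\<^sup>2\<bar> powr p) * Lpow p (\<lambda>x. point_source ((1 / \<epsilon>) *\<^sub>R (x - node a g)) $ i)"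
      by (rule Lpow_cmult) measurable
    also have "Lpow p (\<lambda>x. point_source ((1 / \<epsilon>) *\<^sub>R (x - node a g)) $ i) = ennreal (\<epsilon> ^ 3) * Lpow p (\<lambda>y. point_source y $ i)"
      using Lpow_affine[of "\<lambda>x. point_source ((1 / \<epsilon>) *\<^sub>R (x - node a g)) $ i" \<epsilon> p "node a g"] \<epsilon> by simp
    also have "ennreal (\<bar>?h g / \<epsilon>\<^sup>2\<bar> powr p) \<le> bad_error (node a g)"
      unfolding be[OF g] using h_le[of g] p by (intro ennreal_leI powr_mono2) (auto simp: abs_divide)
    finally show "Lpow p (?t g) \<le> bad_error (node a g) * (ennreal (\<epsilon> ^ 3) * Lpow p (\<lambda>y. point_source y $ i))"
      by (simp add: mult_right_mono)
  qed simp
  also have "\<dots> = ennreal (64 powr p) * (Lpow p (\<lambda>y. point_source y $ i) * (ennreal (\<epsilon> ^ 3) * (\<Sum>g\<in>bad a. bad_error (node a g))))"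
    by (simp add: sum_distrib_left mult_ac)
  also have "\<dots> \<le> ennreal (64 powr p) * (Lpow p (\<lambda>y. point_source y $ i) * (ennreal (\<epsilon> ^ 3) * (\<Sum>g\<in>indices. bad_error (node a g))))"
    by (intro mult_left_mono sum_mono2 finite_indices) (auto simp: bad_def)
  finally show "Lpow p (\<lambda>x. correction a x $ i) \<le>
      ennreal (64 powr p) * (Lpow p (\<lambda>y. point_source y $ i) * (ennreal (\<epsilon> ^ 3) * (\<Sum>g\<in>indices. bad_error (node a g))))" .
qed

end

section \<open>Dilations and generic scales\<close>

lemma Lpow_sum_finite:
  assumes "finite A" and "p \<ge> 1" and [measurable]: "\<And>i. f i \<in> borel_measurable borel"
    and "\<And>i. Lpow p (f i) < \<infinity>"
  shows "Lpow p (\<lambda>x. \<Sum>i\<in>A. f i x) < \<infinity>"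
  using assms(1)
proof induction
  case empty
  then show ?case by (simp add: Lpow_def)
next
  case (insert i A)
  have "Lpow p (\<lambda>x. f i x + (\<Sum>i\<in>A. f i x)) \<le> ennreal (2 powr p) * (Lpow p (f i) + Lpow p (\<lambda>x. \<Sum>i\<in>A. f i x))"
    using assms(2) by (intro Lpow_add_le) auto
  also have "\<dots> < \<infinity>" using insert.IH assms(4)[of i] by (simp add: ennreal_mult_less_top)
  finally show ?case using insert.hyps by simp
qed

lemma large_values_small:
  fixes s :: "real^3 \<Rightarrow> real"
  assumes p: "p \<ge> 1" and [measurable]: "s \<in> borel_measurable borel" and s: "\<And>x. s x \<ge> 0" "Lpow p s < \<infinity>" and t: "\<tau> > 0"
  obtains N where "\<And>M. M \<ge> N \<Longrightarrow> (\<integral>\<^sup>+x. (if s x \<ge> M then ennreal (s x powr p) else 0) \<partial>lborel) \<le> ennreal \<tau>"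
proof -
  let ?f = "\<lambda>n x. if s x \<ge> real n then s x else 0"
  have ev: "eventually (\<lambda>n. ?f n x = 0) sequentially" for x
  proof -
    obtain m where "s x < real m" using reals_Archimedean2 by blast
    then show ?thesis by (intro eventually_sequentiallyI[of m]) auto
  qed
  have "(\<lambda>n. Lpow p (?f n)) \<longlonglongrightarrow> 0"
    by (rule Lpow_tendsto_0[where g = s]) (use p s in \<open>auto intro!: tendsto_eventually ev\<close>)
  then obtain n where n: "Lpow p (?f n) < ennreal \<tau>"
    by (rule tendsto_0_ennreal_less) (use t in auto)
  show ?thesis
  proof (rule that[of "real n"])
    fix M assume M: "M \<ge> real n"
    have "(\<integral>\<^sup>+x. (if s x \<ge> M then ennreal (s x powr p) else 0) \<partial>lborel) \<le> Lpow p (?f n)"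
      unfolding Lpow_def by (rule nn_integral_mono) (use M s(1) in auto)
    then show "(\<integral>\<^sup>+x. (if s x \<ge> M then ennreal (s x powr p) else 0) \<partial>lborel) \<le> ennreal \<tau>" using n by simp
  qed
qed

text \<open>The pullback of a 2-form under \<open>x \<mapsto> l x\<close>, in terms of the associated vector field.
  Pulling back preserves fluxes, so a contraction turns a field on the unit ball with integer fluxes
  into one with integer fluxes through cubes that may reach slightly beyond the ball.\<close>

definition dilate :: "real \<Rightarrow> (real^3 \<Rightarrow> real^3) \<Rightarrow> real^3 \<Rightarrow> real^3" where
  "dilate l X x = l\<^sup>2 *\<^sub>R X (l *\<^sub>R x)"

lemma measurable_dilate[measurable]:
  assumes [measurable]: "X \<in> borel_measurable borel" shows "dilate l X \<in> borel_measurable borel"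
  unfolding dilate_def by measurable

lemma face_integral_dilate:
  assumes [measurable]: "X \<in> borel_measurable borel" and l: "l > 0"
  shows "face_integral (dilate l X) i c r = face_integral X i (l *\<^sub>R c) (l * r)"
proof -
  let ?G = "\<lambda>u. if sup2 u < (l * r) / 2 then X (l *\<^sub>R c + in_plane i u) $ i else 0"
  have s: "sup2 (l *\<^sub>R u) = l * sup2 u" for u
    using l by (simp add: sup2_def abs_mult max_mult_distrib_left)
  have q: "in_plane i (l *\<^sub>R u) = l *\<^sub>R in_plane i u" for u
    by (simp add: in_plane_def vec_eq_iff)
  have "(\<integral>u. ?G u \<partial>lborel) = \<bar>l\<bar> ^ DIM(real \<times> real) * (\<integral>u. ?G (0 + l *\<^sub>R u) \<partial>lborel)"
    by (rule integral_affine) (use l in auto)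
  also have "\<bar>l\<bar> ^ DIM(real \<times> real) = l\<^sup>2" by (simp add: power2_eq_square)
  also have "l\<^sup>2 * (\<integral>u. ?G (0 + l *\<^sub>R u) \<partial>lborel) = (\<integral>u. l\<^sup>2 * ?G (0 + l *\<^sub>R u) \<partial>lborel)"
    by simp
  also have "(\<lambda>u. l\<^sup>2 * ?G (0 + l *\<^sub>R u)) = (\<lambda>u. if sup2 u < r / 2 then dilate l X (c + in_plane i u) $ i else 0)"
  proof
    fix u
    have "l * sup2 u < l * r / 2 \<longleftrightarrow> sup2 u < r / 2" using l by (simp add: mult_less_cancel_left_pos flip: times_divide_eq_right)
    then show "l\<^sup>2 * ?G (0 + l *\<^sub>R u) = (if sup2 u < r / 2 then dilate l X (c + in_plane i u) $ i else 0)"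
      by (simp only: add_0 s q dilate_def scaleR_add_right vector_scaleR_component real_scaleR_def if_distrib[of "(*) (l\<^sup>2)"] mult_zero_right)
  qed
  finally show ?thesis by (simp only: face_integral_def)
qed

lemma field_flux_dilate:
  assumes "X \<in> borel_measurable borel" "l > 0"
  shows "field_flux (dilate l X) c r = field_flux X (l *\<^sub>R c) (l * r)"
  unfolding field_flux_def face_integral_dilate[OF assms] by (simp add: scaleR_add_right scaleR_diff_right)

lemma dilate_near:
  assumes p: "p \<ge> 1" and [measurable]: "X \<in> borel_measurable borel" and fin: "\<And>i. Lpow p (\<lambda>x. X x $ i) < \<infinity>"
    and e: "e > 0"
  obtains l where "1 / 2 < l" "l < 1" "\<And>i. Lpow p (\<lambda>x. dilate l X x $ i - X x $ i) \<le> ennreal e"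
proof -
  have "eventually (\<lambda>l. Lpow p (\<lambda>x. dilate l X x $ i - X x $ i) \<le> ennreal e) (at_left 1)" for i
  proof -
    define K where "K = enn2real (Lpow p (\<lambda>x. X x $ i))"
    have K: "Lpow p (\<lambda>x. X x $ i) = ennreal K" "K \<ge> 0" using fin[of i] by (auto simp: K_def)
    let ?\<eta> = "e / (2 * 2 powr p)"
    have "?\<eta> > 0" using e by simp
    then obtain d where d: "d > 0" "\<And>c v. \<bar>c - 1\<bar> < d \<Longrightarrow> norm v < d \<Longrightarrow>
        Lpow p (\<lambda>x. X (v + c *\<^sub>R x) $ i - X x $ i) \<le> ennreal ?\<eta>"
      using Lpow_perturb[of p "\<lambda>x. X x $ i" ?\<eta>, OF p _ fin] by auto
    define b where "b = max (1 / 2) (max (1 - d) (1 - e / (4 * 2 powr p * (K + 1))))"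
    have b1: "b < 1" using d(1) e K(2) by (simp add: b_def)
    have "Lpow p (\<lambda>x. dilate l X x $ i - X x $ i) \<le> ennreal e" if l: "l \<in> {b<..<1}" for l
    proof -
      have l': "1 / 2 < l" "l < 1" "\<bar>l - 1\<bar> < d" "1 - l < e / (4 * 2 powr p * (K + 1))" using l by (auto simp: b_def)
      have "(\<lambda>x. dilate l X x $ i - X x $ i) = (\<lambda>x. l\<^sup>2 * (X (0 + l *\<^sub>R x) $ i - X x $ i) + (l\<^sup>2 - 1) * (X x $ i))"
        by (simp add: dilate_def algebra_simps)
      then have "Lpow p (\<lambda>x. dilate l X x $ i - X x $ i) \<le>
          ennreal (2 powr p) * (Lpow p (\<lambda>x. l\<^sup>2 * (X (0 + l *\<^sub>R x) $ i - X x $ i)) + Lpow p (\<lambda>x. (l\<^sup>2 - 1) * (X x $ i)))"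
        by (simp only:) (rule Lpow_add_le; (use p in simp)?; measurable)
      also have "\<dots> \<le> ennreal (2 powr p) * (ennreal ?\<eta> + ennreal (2 * (1 - l)) * ennreal K)"
      proof (intro mult_left_mono add_mono)
        have "Lpow p (\<lambda>x. l\<^sup>2 * (X (0 + l *\<^sub>R x) $ i - X x $ i)) \<le> Lpow p (\<lambda>x. X (0 + l *\<^sub>R x) $ i - X x $ i)"
        proof (rule Lpow_mono)
          show "\<bar>l\<^sup>2 * (X (0 + l *\<^sub>R x) $ i - X x $ i)\<bar> \<le> \<bar>X (0 + l *\<^sub>R x) $ i - X x $ i\<bar>" for x
            using l' by (simp add: abs_mult mult_left_le_one_le power_le_one)
        qed (use p in simp)
        also have "\<dots> \<le> ennreal ?\<eta>" by (rule d(2)) (use l' d(1) in auto)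
        finally show "Lpow p (\<lambda>x. l\<^sup>2 * (X (0 + l *\<^sub>R x) $ i - X x $ i)) \<le> ennreal ?\<eta>" .
        have q: "\<bar>l\<^sup>2 - 1\<bar> \<le> 2 * (1 - l)" "\<bar>l\<^sup>2 - 1\<bar> \<le> 1"
        proof -
          have "\<bar>l\<^sup>2 - 1\<bar> = (1 - l) * (1 + l)" using l' power_le_one[of l 2] by (simp add: power2_eq_square algebra_simps)
          also have "\<dots> \<le> (1 - l) * 2" using l' by (intro mult_left_mono) auto
          finally show "\<bar>l\<^sup>2 - 1\<bar> \<le> 2 * (1 - l)" by simp
          have "l\<^sup>2 \<le> 1" using l' by (simp add: power_le_one)
          then show "\<bar>l\<^sup>2 - 1\<bar> \<le> 1" using zero_le_power2[of l] by linarith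
        qed
        have "\<bar>l\<^sup>2 - 1\<bar> powr p \<le> \<bar>l\<^sup>2 - 1\<bar> powr 1" using q(2) p by (intro powr_mono') auto
        then have "\<bar>l\<^sup>2 - 1\<bar> powr p \<le> 2 * (1 - l)" using q(1) by simp
        moreover have "Lpow p (\<lambda>x. (l\<^sup>2 - 1) * (X x $ i)) = ennreal (\<bar>l\<^sup>2 - 1\<bar> powr p) * ennreal K"
          unfolding K(1)[symmetric] by (rule Lpow_cmult) measurable
        ultimately show "Lpow p (\<lambda>x. (l\<^sup>2 - 1) * (X x $ i)) \<le> ennreal (2 * (1 - l)) * ennreal K"
          by (simp only:) (intro mult_right_mono ennreal_leI; simp)
      qed simp
      also have "\<dots> = ennreal (2 powr p * (?\<eta> + 2 * (1 - l) * K))"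
        using l' K(2) e by (simp add: ennreal_mult ennreal_plus)
      also have "\<dots> \<le> ennreal e"
      proof (rule ennreal_leI)
        have "(1 - l) * K \<le> (1 - l) * (K + 1)" using l' by (intro mult_left_mono) auto
        also have "\<dots> \<le> e / (4 * 2 powr p * (K + 1)) * (K + 1)" using l' K(2) by (intro mult_right_mono) auto
        also have "\<dots> = e / (4 * 2 powr p)"
          unfolding times_divide_eq_left by (rule nonzero_mult_divide_mult_cancel_right) (use K(2) in simp)
        finally have "(1 - l) * K \<le> e / (4 * 2 powr p)" .
        then have "2 powr p * (2 * ((1 - l) * K)) \<le> 2 powr p * (2 * (e / (4 * 2 powr p)))"
          by (intro mult_left_mono) simp_all
        moreover have "2 powr p * (2 * (e / (4 * 2 powr p))) = e / 2" "2 powr p * ?\<eta> = e / 2" by simp_all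
        moreover have "2 powr p * (?\<eta> + 2 * (1 - l) * K) = 2 powr p * ?\<eta> + 2 powr p * (2 * ((1 - l) * K))"
          by (simp only: distrib_left mult.assoc)
        ultimately show "2 powr p * (?\<eta> + 2 * (1 - l) * K) \<le> e" by linarith
      qed
      finally show ?thesis .
    qed
    then show ?thesis by (rule eventually_mono[OF eventually_at_left_real[OF b1]])
  qed
  then have "eventually (\<lambda>l. \<forall>i. Lpow p (\<lambda>x. dilate l X x $ i - X x $ i) \<le> ennreal e) (at_left 1)"
    by (rule eventually_all_finite)
  moreover have "eventually (\<lambda>l. l \<in> {1 / 2<..<1}) (at_left (1 :: real))" by (rule eventually_at_left_real) simp
  ultimately have "eventually (\<lambda>l. (\<forall>i. Lpow p (\<lambda>x. dilate l X x $ i - X x $ i) \<le> ennreal e) \<and> l \<in> {1 / 2<..<1}) (at_left (1 :: real))"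
    by (rule eventually_conj)
  then obtain l where "\<forall>i. Lpow p (\<lambda>x. dilate l X x $ i - X x $ i) \<le> ennreal e" "l \<in> {1 / 2<..<1}"
    using eventually_happens'[OF trivial_limit_at_left_real] by blast
  then show ?thesis by (intro that[of l]) auto
qed

lemma AE_lborel_scale:
  fixes P :: "'a::euclidean_space \<Rightarrow> bool"
  assumes P: "AE x in lborel. P x" and l: "l \<noteq> 0"
  shows "AE x in lborel. P (l *\<^sub>R x)"
proof -
  obtain N where N: "{x. \<not> P x} \<subseteq> N" "emeasure lborel N = 0" and [measurable]: "N \<in> sets borel"
    using P by (auto elim!: AE_E)
  have "0 = (\<integral>\<^sup>+x. indicator N x \<partial>lborel :: ennreal)" using N(2) by simp
  also have "\<dots> = ennreal (\<bar>l\<bar> ^ DIM('a)) * (\<integral>\<^sup>+x. indicator N (0 + l *\<^sub>R x) \<partial>lborel)"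
    by (rule nn_integral_affine) (use l in auto)
  finally have "(\<integral>\<^sup>+x. indicator N (0 + l *\<^sub>R x) \<partial>(lborel :: 'a measure) :: ennreal) = 0" using l by simp
  then have "AE x in lborel. (indicator N (0 + l *\<^sub>R x) :: ennreal) = 0"
    by (subst (asm) nn_integral_0_iff_AE) auto
  then show ?thesis
  proof eventually_elim
    case (elim x)
    then have "l *\<^sub>R x \<notin> N" by (simp add: indicator_def split: if_splits)
    then show ?case using N(1) by auto
  qed
qed

lemma AE_lborel_interval:
  fixes P :: "real \<Rightarrow> bool"
  assumes P: "AE r in lborel. P r" and ab: "a < b"
  obtains r where "a < r" "r < b" "P r"
proof (rule ccontr)
  assume "\<not> thesis"
  then have no: "\<not> P r" if "r \<in> {a<..<b}" for r using that \<open>\<And>r. a < r \<Longrightarrow> r < b \<Longrightarrow> P r \<Longrightarrow> thesis\<close> by auto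
  have "AE r in lborel. r \<notin> {a<..<b}" using P by eventually_elim (use no in blast)
  then have "{a<..<b} \<in> null_sets lborel" by (subst AE_iff_null_sets) auto
  then have "emeasure lborel {a<..<b} = 0" by (rule null_setsD1)
  then show False using ab by simp
qed

text \<open>Integrality for every centre and almost every side length gives, by Fubini's theorem,
  integrality for almost every side length and almost every centre. This is why arbitrarily fine
  lattices all of whose cubes have integer fluxes exist, although for a given centre nothing is known
  about a given side length.\<close>

lemma generic_scale:
  assumes p: "p \<ge> 1" and F: "F \<in> Omega2_Z p" and X: "represents X F" "\<And>i. Lpow p (\<lambda>x. X x $ i) < \<infinity>"
    and l: "0 < l" "l < 1" and \<delta>: "\<delta> > 0"
  obtains \<epsilon> where "0 < \<epsilon>" "\<epsilon> < \<delta>" "AE c in lborel. norm c < 1 + 3 * \<epsilon> \<longrightarrow> field_flux (dilate l X) c \<epsilon> \<in> \<int>"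
proof -
  have [measurable]: "X \<in> borel_measurable borel" using X(1) by (simp add: represents_def)
  define P where "P c r \<longleftrightarrow> (norm c < 1 \<and> 0 < r \<and> sqrt 3 * r < 1 - norm c \<longrightarrow> dist_int (field_flux X c r) = 0)" for c :: "real^3" and r :: real
  have FL: "F \<in> Omega2_Lp p" using F by (simp add: Omega2_Z_def)
  have "AE r in lborel. P c r" for c
  proof (cases "c \<in> B3")
    case True
    have "AE r in lborel. r \<in> {0<..<max_side c} \<longrightarrow> field_flux X c r \<in> \<int>"
      using F True Omega2_Z_iff[OF p FL X] by blast
    then show ?thesis
    proof eventually_elim
      case (elim r)
      have "max_side c = 1 / sqrt 3 * (1 - norm c)" unfolding max_side_def infdist_frontier_ball[OF True] ..
      then have "r \<in> {0<..<max_side c}" if "0 < r" "sqrt 3 * r < 1 - norm c"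
        using that by (simp add: pos_less_divide_eq mult.commute)
      then show ?case using elim by (auto simp: P_def dist_int_eq_0)
    qed
  qed (simp add: P_def)
  then have "AE c in lborel. AE r in lborel. P c r" by simp
  moreover have "{z \<in> space (lborel \<Otimes>\<^sub>M lborel). P (fst z) (snd z)} \<in> sets (lborel \<Otimes>\<^sub>M lborel)"
    unfolding P_def by measurable
  ultimately have AE: "AE r in lborel. AE c in lborel. P c r"
    using lborel_pair.AE_commute[of P] by blast
  define \<delta>' where "\<delta>' = min (l * \<delta>) ((1 - l) / 5)"
  have "0 < \<delta>'" using l \<delta> by (simp add: \<delta>'_def)
  from AE this obtain r where r: "0 < r" "r < \<delta>'" "AE c in lborel. P c r" by (rule AE_lborel_interval)
  show ?thesis
  proof (rule that[of "r / l"])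
    show "0 < r / l" using r l by simp
    show "r / l < \<delta>" using r(2) l by (simp add: \<delta>'_def field_simps)
    have "AE c in lborel. P (l *\<^sub>R c) r" by (rule AE_lborel_scale[OF r(3)]) (use l in simp)
    then show "AE c in lborel. norm c < 1 + 3 * (r / l) \<longrightarrow> field_flux (dilate l X) c (r / l) \<in> \<int>"
    proof eventually_elim
      case (elim c)
      show ?case
      proof
        assume "norm c < 1 + 3 * (r / l)"
        then have "l * norm c < l * (1 + 3 * (r / l))" using l by (intro mult_strict_left_mono)
        also have "\<dots> = l + 3 * r" using l by (simp add: field_simps)
        finally have "l * norm c < l + 3 * r" .
        moreover have "sqrt 3 * r \<le> 2 * r" using r(1) by (intro mult_right_mono real_le_lsqrt) auto
        moreover have "5 * r < 1 - l" using r(2) by (simp add: \<delta>'_def)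
        ultimately have "l * norm c < 1 \<and> sqrt 3 * r < 1 - l * norm c" using r(1) by linarith
        then have "dist_int (field_flux X (l *\<^sub>R c) r) = 0" using elim r(1) l by (simp add: P_def)
        then show "field_flux (dilate l X) c (r / l) \<in> \<int>"
          using l by (simp add: field_flux_dilate dist_int_eq_0)
      qed
    qed
  qed
qed

lemma form_of_component: "\<exists>k s. \<bar>s\<bar> \<le> 1 \<and> (\<forall>v. form_of v $ i $ j = s * v $ k)"
proof -
  consider "j = i + 1" | "j \<noteq> i + 1" "j = i + 2" | "j \<noteq> i + 1" "j \<noteq> i + 2" by blast
  then show ?thesis
  proof cases
    case 1 then show ?thesis by (intro exI[of _ "i + 2"] exI[of _ 1]) (simp add: form_of_def)
  next
    case 2 then show ?thesis by (intro exI[of _ "i + 1"] exI[of _ "-1"]) (simp add: form_of_def)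
  next
    case 3 then show ?thesis by (intro exI[of _ i] exI[of _ 0]) (simp add: form_of_def)
  qed
qed

lemma represents_form_of:
  assumes "Y \<in> borel_measurable borel" "\<And>x. x \<notin> B3 \<Longrightarrow> Y x = 0"
  shows "represents Y (\<lambda>x. form_of (Y x))"
  using assms by (simp add: represents_def field_of_form_of)

lemma form_of_Omega2_Lp:
  assumes p: "p \<ge> 1" and [measurable]: "Y \<in> borel_measurable borel" and fin: "\<And>i. Lpow p (\<lambda>x. Y x $ i) < \<infinity>"
  shows "(\<lambda>x. form_of (Y x)) \<in> Omega2_Lp p"
proof -
  have "Lp_on p B3 (\<lambda>x. form_of (Y x) $ i $ j)" for i j
  proof -
    obtain k s where s: "\<bar>s\<bar> \<le> 1" "\<And>v. form_of v $ i $ j = s * v $ k" using form_of_component[of i j] by blast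
    have m: "(\<lambda>x. s * Y x $ k) \<in> borel_measurable lborel" by measurable
    have "integrable lborel (\<lambda>x. \<bar>s * Y x $ k\<bar> powr p)"
    proof (rule integrableI_bounded)
      have "(\<integral>\<^sup>+x. ennreal (norm (\<bar>s * Y x $ k\<bar> powr p)) \<partial>lborel) = Lpow p (\<lambda>x. s * Y x $ k)" by (simp add: Lpow_def)
      also have "\<dots> \<le> Lpow p (\<lambda>x. Y x $ k)"
        by (rule Lpow_mono) (use s(1) p in \<open>auto simp: abs_mult intro: mult_left_le_one_le\<close>)
      also have "\<dots> < \<infinity>" by (rule fin)
      finally show "(\<integral>\<^sup>+x. ennreal (norm (\<bar>s * Y x $ k\<bar> powr p)) \<partial>lborel) < \<infinity>" .
    qed measurable
    then have "integrable lebesgue (\<lambda>x. \<bar>s * Y x $ k\<bar> powr p)" by (subst integrable_completion) auto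
    then have "integrable lebesgue (\<lambda>x. indicator B3 x *\<^sub>R (\<bar>s * Y x $ k\<bar> powr p))"
      by (rule integrable_mult_indicator[rotated]) simp
    then have "integrable (lebesgue_on B3) (\<lambda>x. \<bar>s * Y x $ k\<bar> powr p)" by (simp add: integrable_restrict_space)
    moreover have "(\<lambda>x. s * Y x $ k) \<in> borel_measurable (lebesgue_on B3)"
      by (rule measurable_restrict_space1[OF measurable_completion[OF m]])
    ultimately show ?thesis by (simp add: Lp_on_def s(2))
  qed
  then show ?thesis by (simp add: Omega2_Lp_def alternating_form_of)
qed

lemma form_of_Omega2_R:
  fixes h :: "real^3 \<Rightarrow> int"
  assumes p: "p \<ge> 1" and Y: "Y \<in> borel_measurable borel" "\<And>x. x \<notin> B3 \<Longrightarrow> Y x = 0" "\<And>i. Lpow p (\<lambda>x. Y x $ i) < \<infinity>"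
    and S: "finite S" "S \<subseteq> B3" and smooth: "\<And>i. smooth_on (B3 - S) (\<lambda>x. Y x $ i)"
    and div: "\<And>\<phi>. \<phi> \<in> test_functions B3 \<Longrightarrow>
      (\<integral>x. (\<Sum>i\<in>UNIV. Y x $ i * partial_d i \<phi> x) \<partial>lborel) = - (\<Sum>a\<in>S. 2 * pi * of_int (h a) * \<phi> a)"
  shows "(\<lambda>x. form_of (Y x)) \<in> Omega2_R p"
proof -
  have "smooth_on (B3 - S) (\<lambda>x. form_of (Y x) $ i $ j)" for i j
  proof -
    obtain k s where s: "\<And>v. form_of v $ i $ j = s * v $ k" using form_of_component[of i j] by blast
    have "open (B3 - S)" using S by (intro open_Diff finite_imp_closed) auto
    then show ?thesis unfolding s by (rule smooth_on_cmult[OF _ smooth])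
  qed
  moreover have "distr_d (\<lambda>x. form_of (Y x)) \<phi> = (\<Sum>a\<in>S. 2 * pi * of_int (h a) * \<phi> a)" if "\<phi> \<in> test_functions B3" for \<phi>
    using distr_d_eq[OF alternating_form_of represents_form_of[OF Y(1,2)] that] div[OF that] by simp
  ultimately show ?thesis
    unfolding Omega2_R_def using form_of_Omega2_Lp[OF p Y(1,3)] S by blast
qed

section \<open>Approximation by fields with finitely many singularities\<close>

definition lattice_constant :: "real \<Rightarrow> real" where
  "lattice_constant p = 3 * (64 * 2 powr p) + (2 powr p * (6 powr p * 6 * 2 powr p) + 4 powr p)"

lemma lattice_constant_pos: "lattice_constant p > 0"
  unfolding lattice_constant_def by (intro add_pos_pos mult_pos_pos) auto

lemma measurable_ball_pred[measurable]: "Measurable.pred borel (\<lambda>x :: real^3. x \<in> B3)"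
  by (rule pred_sets2[OF borel_open[OF open_ball] measurable_ident_sets[OF refl]])

lemma sum_3_ennreal: "x \<ge> 0 \<Longrightarrow> (\<Sum>i\<in>(UNIV :: 3 set). ennreal x) = ennreal (3 * x)"
  by (subst sum_ennreal) auto

context lattice
begin

text \<open>An offset of the lattice is chosen for which the interpolation error and the contribution of
  the bad cubes are at most twice their means. For \<open>p \<ge> 3/2\<close>, where the point source is not in
  \<open>L\<^sup>p\<close>, the bound forces the set of bad cubes to be empty, and the approximation has no
  singularities at all.\<close>

lemma approximation_at_scale:
  assumes \<tau>: "\<tau> > 0"
    and trans: "\<And>v i. norm v \<le> 9 * \<epsilon> \<Longrightarrow> Lpow p (\<lambda>x. X (v + x) $ i - X x $ i) \<le> ennreal \<tau>"
    and big: "(\<integral>\<^sup>+x. (if (\<Sum>i\<in>UNIV. \<bar>X x $ i\<bar>) \<ge> pi / (2 * \<epsilon>\<^sup>2) then ennreal ((\<Sum>i\<in>UNIV. \<bar>X x $ i\<bar>) powr p) else 0) \<partial>lborel) \<le> ennreal \<tau>"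
    and good: "AE c in lborel. norm c < 1 + 3 * \<epsilon> \<longrightarrow> field_flux X c \<epsilon> \<in> \<int>"
    and small: "2 * lattice_constant p * \<tau> < 1"
    and \<zeta>: "\<zeta> \<ge> 0" "\<And>i. p < 3 / 2 \<Longrightarrow> Lpow p (\<lambda>x. point_source x $ i) \<le> ennreal \<zeta>"
  obtains Y S and h :: "real^3 \<Rightarrow> int" where "Y \<in> borel_measurable borel" "\<And>x. x \<notin> B3 \<Longrightarrow> Y x = 0" "finite S" "S \<subseteq> B3"
    "\<And>i. smooth_on (B3 - S) (\<lambda>x. Y x $ i)"
    "\<And>\<phi>. \<phi> \<in> test_functions B3 \<Longrightarrow>
      (\<integral>x. (\<Sum>i\<in>UNIV. Y x $ i * partial_d i \<phi> x) \<partial>lborel) = - (\<Sum>a\<in>S. 2 * pi * of_int (h a) * \<phi> a)"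
    "\<And>i. Lpow p (\<lambda>x. if x \<in> B3 then Y x $ i - X x $ i else 0) \<le>
      ennreal (2 powr p * (2 * lattice_constant p * \<tau> * (1 + 64 powr p * \<zeta>)))"
proof -
  let ?C = "2 powr p * (6 powr p * 6 * 2 powr p) + 4 powr p"
  let ?K = "lattice_constant p"
  let ?T = "2 * ?K * \<tau>"
  have K: "?K > 0" by (rule lattice_constant_pos)
  define f where "f c = (\<Sum>i\<in>UNIV. interp_error i c) + ennreal (\<epsilon> ^ 3) * bad_error c" for c
  have [measurable]: "f \<in> borel_measurable borel" unfolding f_def by measurable
  have "(\<integral>\<^sup>+c. f c \<partial>lborel) = (\<Sum>i\<in>UNIV. \<integral>\<^sup>+c. interp_error i c \<partial>lborel) + ennreal (\<epsilon> ^ 3) * (\<integral>\<^sup>+c. bad_error c \<partial>lborel)"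
    unfolding f_def by (subst nn_integral_add, measurable) (subst nn_integral_sum, measurable, subst nn_integral_cmult, measurable)
  also have "\<dots> \<le> (\<Sum>i\<in>(UNIV :: 3 set). ennreal (64 * 2 powr p * \<tau> * \<epsilon> ^ 3)) + ennreal (\<epsilon> ^ 3) * ennreal (?C * \<tau>)"
    by (intro add_mono sum_mono mult_left_mono interp_error_integral[OF \<tau> trans] bad_error_integral[OF \<tau> trans big]) auto
  also have "\<dots> = ennreal (3 * (64 * 2 powr p * \<tau> * \<epsilon> ^ 3)) + ennreal (\<epsilon> ^ 3 * (?C * \<tau>))"
  proof -
    have nn: "0 \<le> 64 * 2 powr p * \<tau> * \<epsilon> ^ 3" "0 \<le> \<epsilon> ^ 3" "0 \<le> ?C * \<tau>" using \<tau> \<epsilon> by auto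
    show ?thesis unfolding sum_3_ennreal[OF nn(1)] ennreal_mult[OF nn(2,3)] ..
  qed
  also have "\<dots> = ennreal (3 * (64 * 2 powr p * \<tau> * \<epsilon> ^ 3) + \<epsilon> ^ 3 * (?C * \<tau>))"
    by (rule ennreal_plus[symmetric]) (use \<tau> \<epsilon> in auto)
  also have "3 * (64 * 2 powr p * \<tau> * \<epsilon> ^ 3) + \<epsilon> ^ 3 * (?C * \<tau>) = ?K * \<tau> * \<epsilon> ^ 3"
    unfolding lattice_constant_def by (simp add: algebra_simps)
  finally have f: "(\<integral>\<^sup>+c. f c \<partial>lborel) \<le> ennreal (?K * \<tau> * \<epsilon> ^ 3)" .
  obtain a where a: "a \<in> cell" and P: "\<And>g. norm (node a g) < 1 + 3 * \<epsilon> \<longrightarrow> field_flux X (node a g) \<epsilon> \<in> \<int>"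
    and fa: "(\<Sum>g\<in>indices. f (node a g)) \<le> ennreal (2 * (?K * \<tau>))"
    by (rule good_offset[OF _ f _ good]) (use K \<tau> in auto)
  have int: "field_flux X (node a g) \<epsilon> \<in> \<int>" if "norm (node a g) < 1 + 3 * \<epsilon>" for g using P that by blast
  let ?I = "\<lambda>i. \<Sum>g\<in>indices. interp_error i (node a g)"
  let ?B = "ennreal (\<epsilon> ^ 3) * (\<Sum>g\<in>indices. bad_error (node a g))"
  have T: "ennreal (2 * (?K * \<tau>)) = ennreal ?T" by (simp add: mult.assoc)
  have I: "?I i \<le> ennreal ?T" for i
  proof -
    have "interp_error i c \<le> f c" for c
    proof -
      have "interp_error i c \<le> (\<Sum>i\<in>UNIV. interp_error i c)" by (rule member_le_sum) auto
      also have "\<dots> \<le> f c" by (simp add: f_def)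
      finally show ?thesis .
    qed
    then have "?I i \<le> (\<Sum>g\<in>indices. f (node a g))" by (intro sum_mono)
    with fa T show ?thesis by simp
  qed
  have B: "?B \<le> ennreal ?T"
  proof -
    have "?B = (\<Sum>g\<in>indices. ennreal (\<epsilon> ^ 3) * bad_error (node a g))" by (simp add: sum_distrib_left)
    also have "\<dots> \<le> (\<Sum>g\<in>indices. f (node a g))" by (intro sum_mono) (simp add: f_def)
    finally show ?thesis using fa T by simp
  qed
  have corr: "Lpow p (\<lambda>x. correction a x $ i) \<le> ennreal (64 powr p * (\<zeta> * ?T))" for i
  proof (cases "p < 3 / 2")
    case True
    have "Lpow p (\<lambda>x. correction a x $ i) \<le> ennreal (64 powr p) * (Lpow p (\<lambda>y. point_source y $ i) * ?B)"
      by (rule correction_error(1)[OF a int])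
    also have "\<dots> \<le> ennreal (64 powr p) * (ennreal \<zeta> * ennreal ?T)"
      by (intro mult_left_mono mult_mono \<zeta>(2)[OF True] B) auto
    also have "\<dots> = ennreal (64 powr p * (\<zeta> * ?T))" using \<zeta>(1) K \<tau> by (simp add: ennreal_mult)
    finally show ?thesis .
  next
    case False
    have "ennreal ?T < 1" using small by (simp only: ennreal_less_one_iff)
    then have "?B < 1" by (rule order.strict_trans1[OF B])
    then have "bad a = {}" using correction_error(2)[OF a int] False by auto
    then show ?thesis using p by (simp add: correction_def Lpow_def)
  qed
  define Z where "Z x = interpolant a x + correction a x" for x
  define Y where "Y x = (if x \<in> B3 then Z x else 0)" for x
  define S where "S = node a ` bad a \<inter> B3"
  define h where "h s = \<lfloor>field_flux X s \<epsilon>\<rfloor>" for s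
  have fin: "finite (node a ` bad a)" using finite_bad by (rule finite_imageI)
  have [measurable]: "Z \<in> borel_measurable borel" unfolding Z_def by measurable
  show ?thesis
  proof (rule that[of Y S h])
    show "Y \<in> borel_measurable borel"
      unfolding Y_def by (rule measurable_If_set) auto
    show "Y x = 0" if "x \<notin> B3" for x using that by (simp add: Y_def)
    show "finite S" "S \<subseteq> B3" using fin by (auto simp: S_def)
    show "smooth_on (B3 - S) (\<lambda>x. Y x $ i)" for i
    proof -
      have o: "open (B3 - S)" using fin by (intro open_Diff finite_imp_closed) (auto simp: S_def)
      have "smooth_on (B3 - S) (\<lambda>x. Z x $ i)"
        unfolding Z_def by (rule smooth_on_subset[OF smooth_on_approximation[of a i]]) (auto simp: S_def)
      then show ?thesis by (rule smooth_on_cong[OF o, rotated]) (simp add: Y_def)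
    qed
    show "(\<integral>x. (\<Sum>i\<in>UNIV. Y x $ i * partial_d i \<phi> x) \<partial>lborel) = - (\<Sum>a\<in>S. 2 * pi * of_int (h a) * \<phi> a)"
      if \<phi>: "\<phi> \<in> test_functions B3" for \<phi>
    proof -
      obtain R where R: "test_function \<phi> (\<lambda>i. partial_d i \<phi>) R" by (rule test_function_of_test_functions[OF \<phi>])
      have "(\<integral>x. (\<Sum>i\<in>UNIV. Z x $ i * partial_d i \<phi> x) \<partial>lborel) =
          - (\<Sum>g\<in>bad a. 2 * pi * field_flux X (node a g) \<epsilon> * \<phi> (node a g))"
        unfolding Z_def by (rule total_divergence[OF a R]) (rule partial_eq_0_outside(2)[OF \<phi>])
      moreover have "(\<lambda>x. \<Sum>i\<in>UNIV. Y x $ i * partial_d i \<phi> x) = (\<lambda>x. \<Sum>i\<in>UNIV. Z x $ i * partial_d i \<phi> x)"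
      proof
        show "(\<Sum>i\<in>UNIV. Y x $ i * partial_d i \<phi> x) = (\<Sum>i\<in>UNIV. Z x $ i * partial_d i \<phi> x)" for x
        proof (cases "x \<in> B3")
          case True
          then show ?thesis by (simp only: Y_def if_True)
        next
          case False
          then show ?thesis by (simp only: partial_eq_0_outside(1)[OF \<phi> False] mult_zero_right)
        qed
      qed
      ultimately have "(\<integral>x. (\<Sum>i\<in>UNIV. Y x $ i * partial_d i \<phi> x) \<partial>lborel) =
          - (\<Sum>g\<in>bad a. 2 * pi * field_flux X (node a g) \<epsilon> * \<phi> (node a g))"
        by (simp only:)
      also have "(\<Sum>g\<in>bad a. 2 * pi * field_flux X (node a g) \<epsilon> * \<phi> (node a g)) =
          (\<Sum>s\<in>node a ` bad a. 2 * pi * of_int (h s) * \<phi> s)"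
      proof (subst sum.reindex)
        show "inj_on (node a) (bad a)" using node_inj by (rule inj_onI)
        show "(\<Sum>g\<in>bad a. 2 * pi * field_flux X (node a g) \<epsilon> * \<phi> (node a g)) =
            sum ((\<lambda>s. 2 * pi * of_int (h s) * \<phi> s) \<circ> node a) (bad a)"
        proof (intro sum.cong refl)
          fix g assume "g \<in> bad a"
          then have "of_int (h (node a g)) = field_flux X (node a g) \<epsilon>"
            using int[of g] by (simp add: bad_def h_def of_int_floor_cancel)
          then show "2 * pi * field_flux X (node a g) \<epsilon> * \<phi> (node a g) =
              ((\<lambda>s. 2 * pi * of_int (h s) * \<phi> s) \<circ> node a) g" by simp
        qed
      qed
      also have "\<dots> = (\<Sum>s\<in>S. 2 * pi * of_int (h s) * \<phi> s)"
        by (rule sum.mono_neutral_right[OF fin]) (use partial_eq_0_outside(2)[OF \<phi>] in \<open>auto simp: S_def\<close>)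
      finally show ?thesis .
    qed
    show "Lpow p (\<lambda>x. if x \<in> B3 then Y x $ i - X x $ i else 0) \<le> ennreal (2 powr p * (?T * (1 + 64 powr p * \<zeta>)))" for i
    proof -
      let ?u = "\<lambda>x. if x \<in> B3 then interpolant a x $ i - X x $ i else 0"
      have "(\<lambda>x. if x \<in> B3 then Y x $ i - X x $ i else 0) = (\<lambda>x. ?u x + (if x \<in> B3 then correction a x $ i else 0))"
        by (auto simp: Y_def Z_def)
      then have "Lpow p (\<lambda>x. if x \<in> B3 then Y x $ i - X x $ i else 0) \<le>
          ennreal (2 powr p) * (Lpow p ?u + Lpow p (\<lambda>x. if x \<in> B3 then correction a x $ i else 0))"
        by (simp only:) (rule Lpow_add_le; (use p in simp)?; measurable)
      also have "\<dots> \<le> ennreal (2 powr p) * (ennreal ?T + ennreal (64 powr p * (\<zeta> * ?T)))"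
      proof (intro mult_left_mono add_mono)
        have "Lpow p ?u = (\<integral>\<^sup>+x. ennreal (\<bar>interpolant a x $ i - X x $ i\<bar> powr p) * indicator B3 x \<partial>lborel)"
          unfolding Lpow_def by (intro nn_integral_cong) (use p in \<open>auto simp: indicator_def\<close>)
        also have "\<dots> \<le> ?I i" by (rule interpolant_error[OF a])
        also have "\<dots> \<le> ennreal ?T" by (rule I)
        finally show "Lpow p ?u \<le> ennreal ?T" .
        have "Lpow p (\<lambda>x. if x \<in> B3 then correction a x $ i else 0) \<le> Lpow p (\<lambda>x. correction a x $ i)"
          by (rule Lpow_mono) (use p in auto)
        then show "Lpow p (\<lambda>x. if x \<in> B3 then correction a x $ i else 0) \<le> ennreal (64 powr p * (\<zeta> * ?T))"
          using corr[of i] by (rule order_trans)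
      qed simp
      also have "\<dots> = ennreal (2 powr p * (?T + 64 powr p * (\<zeta> * ?T)))"
        using \<zeta>(1) K \<tau> by (simp only: ennreal_plus ennreal_mult mult_nonneg_nonneg add_nonneg_nonneg powr_ge_zero less_imp_le zero_le_numeral)
      finally show ?thesis by (simp add: algebra_simps)
    qed
  qed
qed

end

lemma lattice_approximation:
  assumes p: "p \<ge> 1" and X[measurable]: "X \<in> borel_measurable borel" and fin: "\<And>i. Lpow p (\<lambda>x. X x $ i) < \<infinity>"
    and support: "\<And>x. norm x \<ge> 2 \<Longrightarrow> X x = 0"
    and good: "\<And>\<delta>. \<delta> > 0 \<Longrightarrow> \<exists>\<epsilon>. 0 < \<epsilon> \<and> \<epsilon> < \<delta> \<and> (AE c in lborel. norm c < 1 + 3 * \<epsilon> \<longrightarrow> field_flux X c \<epsilon> \<in> \<int>)"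
    and e: "e > 0"
  obtains Y S and h :: "real^3 \<Rightarrow> int" where "Y \<in> borel_measurable borel" "\<And>x. x \<notin> B3 \<Longrightarrow> Y x = 0" "finite S" "S \<subseteq> B3"
    "\<And>i. smooth_on (B3 - S) (\<lambda>x. Y x $ i)"
    "\<And>\<phi>. \<phi> \<in> test_functions B3 \<Longrightarrow>
      (\<integral>x. (\<Sum>i\<in>UNIV. Y x $ i * partial_d i \<phi> x) \<partial>lborel) = - (\<Sum>a\<in>S. 2 * pi * of_int (h a) * \<phi> a)"
    "\<And>i. Lpow p (\<lambda>x. if x \<in> B3 then Y x $ i - X x $ i else 0) \<le> ennreal e"
proof -
  let ?K = "lattice_constant p"
  have K: "?K > 0" by (rule lattice_constant_pos)
  define \<zeta> where "\<zeta> = (\<Sum>i\<in>UNIV. enn2real (Lpow p (\<lambda>x. point_source x $ i)))"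
  have \<zeta>: "\<zeta> \<ge> 0" unfolding \<zeta>_def by (intro sum_nonneg) auto
  have \<zeta>2: "Lpow p (\<lambda>x. point_source x $ i) \<le> ennreal \<zeta>" if "p < 3 / 2" for i
  proof -
    have "Lpow p (\<lambda>x. point_source x $ i) < \<infinity>" unfolding Lpow_def by (rule point_source_Lp[OF p that])
    then have "Lpow p (\<lambda>x. point_source x $ i) = ennreal (enn2real (Lpow p (\<lambda>x. point_source x $ i)))" by simp
    also have "\<dots> \<le> ennreal \<zeta>" unfolding \<zeta>_def by (intro ennreal_leI member_le_sum) auto
    finally show ?thesis .
  qed
  let ?D = "2 powr p * (2 * ?K * (1 + 64 powr p * \<zeta>))"
  have D: "?D > 0" using K \<zeta> by (intro mult_pos_pos add_pos_nonneg) auto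
  define \<tau> where "\<tau> = min (1 / (4 * ?K)) (e / ?D)"
  have \<tau>: "\<tau> > 0" using K D e by (simp add: \<tau>_def)
  let ?s = "\<lambda>x. \<Sum>i\<in>UNIV. \<bar>X x $ i\<bar>"
  have sfin: "Lpow p ?s < \<infinity>"
    by (rule Lpow_sum_finite[OF _ p]) (use fin in \<open>auto simp: Lpow_def\<close>)
  have sm: "?s \<in> borel_measurable borel" by measurable
  have s0: "?s x \<ge> 0" for x by (intro sum_nonneg) auto
  obtain N where N: "\<And>M. M \<ge> N \<Longrightarrow> (\<integral>\<^sup>+x. (if ?s x \<ge> M then ennreal (?s x powr p) else 0) \<partial>lborel) \<le> ennreal \<tau>"
    by (rule large_values_small[OF p sm s0 sfin \<tau>]) (rule that)
  have "\<exists>d>0. \<forall>v. norm v < d \<longrightarrow> Lpow p (\<lambda>x. X (v + x) $ i - X x $ i) \<le> ennreal \<tau>" for i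
  proof -
    obtain d where d: "d > 0" "\<And>c v. \<bar>c - 1\<bar> < d \<Longrightarrow> norm v < d \<Longrightarrow> Lpow p (\<lambda>x. X (v + c *\<^sub>R x) $ i - X x $ i) \<le> ennreal \<tau>"
      using Lpow_perturb[of p "\<lambda>x. X x $ i" \<tau>, OF p _ fin \<tau>] by auto
    then show ?thesis using d(2)[of 1] by (intro exI[of _ d]) auto
  qed
  then have "\<forall>i. \<exists>d. d > 0 \<and> (\<forall>v. norm v < d \<longrightarrow> Lpow p (\<lambda>x. X (v + x) $ i - X x $ i) \<le> ennreal \<tau>)"
    by (intro allI)
  from choice[OF this] obtain d where d': "\<forall>i. d i > 0 \<and> (\<forall>v. norm v < d i \<longrightarrow> Lpow p (\<lambda>x. X (v + x) $ i - X x $ i) \<le> ennreal \<tau>)"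
    by (rule exE)
  have d: "d i > 0" "norm v < d i \<Longrightarrow> Lpow p (\<lambda>x. X (v + x) $ i - X x $ i) \<le> ennreal \<tau>" for i v
    by (rule conjunct1[OF spec[OF d']]) (rule mp[OF spec[OF conjunct2[OF spec[OF d']]]])
  define \<delta> where "\<delta> = Min (insert 1 (insert (1 / (\<bar>N\<bar> + 1)) (range (\<lambda>i. d i / 10))))"
  have "\<delta> > 0" using d(1) by (simp add: \<delta>_def)
  then obtain \<epsilon> where \<epsilon>: "0 < \<epsilon>" "\<epsilon> < \<delta>" and ge: "AE c in lborel. norm c < 1 + 3 * \<epsilon> \<longrightarrow> field_flux X c \<epsilon> \<in> \<int>"
    using good by blast
  have \<epsilon>': "\<epsilon> < 1" "\<epsilon> < 1 / (\<bar>N\<bar> + 1)" "\<epsilon> < d i / 10" for i using \<epsilon>(2) by (auto simp: \<delta>_def)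
  interpret lattice X p \<epsilon> by unfold_locales (use p fin support \<epsilon> \<epsilon>'(1) in auto)
  have "pi / (2 * \<epsilon>\<^sup>2) \<ge> N"
  proof -
    have "\<bar>N\<bar> + 1 < 1 / \<epsilon>" using \<epsilon>(1) \<epsilon>'(2) by (simp add: pos_less_divide_eq mult.commute)
    then have "N \<le> 1 / \<epsilon>" by linarith
    also have "\<dots> \<le> 1 / \<epsilon>\<^sup>2"
      using \<epsilon>(1) \<epsilon>'(1) by (intro divide_left_mono) (auto simp: power2_eq_square mult_left_le_one_le)
    also have "\<dots> \<le> pi / 2 / \<epsilon>\<^sup>2" using pi_gt3 by (intro divide_right_mono) auto
    finally show ?thesis by simp
  qed
  note big = N[OF this]
  have small: "2 * ?K * \<tau> < 1"
  proof -
    have "2 * ?K * \<tau> \<le> 2 * ?K * (1 / (4 * ?K))" using K by (intro mult_left_mono) (auto simp: \<tau>_def)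
    then show ?thesis using K by simp
  qed
  have bound: "2 powr p * (2 * ?K * \<tau> * (1 + 64 powr p * \<zeta>)) \<le> e"
  proof -
    have "2 powr p * (2 * ?K * \<tau> * (1 + 64 powr p * \<zeta>)) = ?D * \<tau>" by simp
    also have "\<dots> \<le> ?D * (e / ?D)" using D by (intro mult_left_mono) (auto simp: \<tau>_def)
    also have "\<dots> = e"
      unfolding times_divide_eq_right by (rule nonzero_mult_div_cancel_left[OF D[THEN less_imp_neq, THEN not_sym]])
    finally show ?thesis .
  qed
  show ?thesis
  proof (rule approximation_at_scale[OF \<tau> _ big ge small \<zeta> \<zeta>2])
    show "Lpow p (\<lambda>x. X (v + x) $ i - X x $ i) \<le> ennreal \<tau>" if "norm v \<le> 9 * \<epsilon>" for v i
      using that \<epsilon>'(3)[of i] \<epsilon>(1) by (intro d(2)) linarith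
  next
    fix Y S and h :: "real^3 \<Rightarrow> int"
    assume Y: "Y \<in> borel_measurable borel" "\<And>x. x \<notin> B3 \<Longrightarrow> Y x = 0" "finite S" "S \<subseteq> B3"
      "\<And>i. smooth_on (B3 - S) (\<lambda>x. Y x $ i)"
      "\<And>\<phi>. \<phi> \<in> test_functions B3 \<Longrightarrow>
        (\<integral>x. (\<Sum>i\<in>UNIV. Y x $ i * partial_d i \<phi> x) \<partial>lborel) = - (\<Sum>a\<in>S. 2 * pi * of_int (h a) * \<phi> a)"
      "\<And>i. Lpow p (\<lambda>x. if x \<in> B3 then Y x $ i - X x $ i else 0) \<le>
        ennreal (2 powr p * (2 * ?K * \<tau> * (1 + 64 powr p * \<zeta>)))"
    show thesis
      by (rule that[OF Y(1-6) order_trans[OF Y(7) ennreal_leI[OF bound]]])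
  qed
qed

text \<open>A form with integer fluxes is first contracted, so that nothing is lost near the
  boundary of the ball, and then approximated on a fine generic lattice.\<close>

lemma Omega2_R_dense:
  assumes p: "p \<ge> 1" and F: "F \<in> Omega2_Z p" and e: "e > 0"
  obtains G where "G \<in> Omega2_R p" "Lp_dist p F G < e"
proof -
  have FL: "F \<in> Omega2_Lp p" using F by (simp add: Omega2_Z_def)
  obtain X where X: "represents X F" "\<And>i. Lpow p (\<lambda>x. X x $ i) < \<infinity>" by (rule representative[OF p FL]) (rule that)
  have [measurable]: "X \<in> borel_measurable borel" and X0: "\<And>x. x \<notin> B3 \<Longrightarrow> X x = 0" using X(1) by (auto simp: represents_def)
  define \<eta> where "\<eta> = e powr p / (12 * 6 powr p * 2 powr p)"
  have \<eta>: "\<eta> > 0" using e by (simp add: \<eta>_def)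
  obtain l where l: "1 / 2 < l" "l < 1" and dil: "\<And>i. Lpow p (\<lambda>x. dilate l X x $ i - X x $ i) \<le> ennreal \<eta>"
    by (rule dilate_near[of p X \<eta>]) (use p X(2) \<eta> in auto)
  have l0: "0 < l" using l by simp
  have finD: "Lpow p (\<lambda>x. dilate l X x $ i) < \<infinity>" for i
  proof -
    have "Lpow p (\<lambda>x. (dilate l X x $ i - X x $ i) - (- X x $ i)) < \<infinity>"
    proof (rule Lpow_diff_finite[OF p])
      show "Lpow p (\<lambda>x. dilate l X x $ i - X x $ i) < \<infinity>" by (rule order.strict_trans1[OF dil]) simp
      show "Lpow p (\<lambda>x. - X x $ i) < \<infinity>" using X(2)[of i] by (simp add: Lpow_minus)
    qed measurable
    then show ?thesis by simp
  qed
  have support: "dilate l X x = 0" if "norm x \<ge> 2" for x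
  proof -
    have "1 \<le> l * norm x" using l that mult_mono[of "1 / 2" l 2 "norm x"] by simp
    then have "l *\<^sub>R x \<notin> B3" using l by simp
    from X0[OF this] show ?thesis by (simp add: dilate_def)
  qed
  have good: "\<exists>\<epsilon>. 0 < \<epsilon> \<and> \<epsilon> < \<delta> \<and> (AE c in lborel. norm c < 1 + 3 * \<epsilon> \<longrightarrow> field_flux (dilate l X) c \<epsilon> \<in> \<int>)" if "\<delta> > 0" for \<delta>
    by (rule generic_scale[OF p F X l0 l(2) that]) blast
  obtain Y S and h :: "real^3 \<Rightarrow> int" where Y: "Y \<in> borel_measurable borel" "\<And>x. x \<notin> B3 \<Longrightarrow> Y x = 0"
    and S: "finite S" "S \<subseteq> B3" and smooth: "\<And>i. smooth_on (B3 - S) (\<lambda>x. Y x $ i)"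
    and div: "\<And>\<phi>. \<phi> \<in> test_functions B3 \<Longrightarrow>
      (\<integral>x. (\<Sum>i\<in>UNIV. Y x $ i * partial_d i \<phi> x) \<partial>lborel) = - (\<Sum>a\<in>S. 2 * pi * of_int (h a) * \<phi> a)"
    and near: "\<And>i. Lpow p (\<lambda>x. if x \<in> B3 then Y x $ i - dilate l X x $ i else 0) \<le> ennreal \<eta>"
    by (rule lattice_approximation[OF p measurable_dilate[OF \<open>X \<in> borel_measurable borel\<close>] finD support good \<eta>]) (assumption, assumption, rule that)
  note [measurable] = Y(1)
  have XY: "Lpow p (\<lambda>x. X x $ i - Y x $ i) \<le> ennreal (2 powr p * (2 * \<eta>))" for i
  proof -
    let ?a = "\<lambda>x. dilate l X x $ i - X x $ i" and ?b = "\<lambda>x. if x \<in> B3 then Y x $ i - dilate l X x $ i else 0"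
    have "Lpow p (\<lambda>x. X x $ i - Y x $ i) \<le> Lpow p (\<lambda>x. ?a x + ?b x)"
      by (rule Lpow_mono) (use p X0 Y(2) in auto)
    also have "\<dots> \<le> ennreal (2 powr p) * (Lpow p ?a + Lpow p ?b)"
      by (rule Lpow_add_le; (use p in simp)?; measurable)
    also have "\<dots> \<le> ennreal (2 powr p) * (ennreal \<eta> + ennreal \<eta>)" by (intro mult_left_mono add_mono dil near) auto
    also have "\<dots> = ennreal (2 powr p * (2 * \<eta>))" using \<eta> by (simp add: ennreal_mult flip: ennreal_plus)
    finally show ?thesis .
  qed
  have finY: "Lpow p (\<lambda>x. Y x $ i) < \<infinity>" for i
  proof -
    have "Lpow p (\<lambda>x. X x $ i - (X x $ i - Y x $ i)) < \<infinity>"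
    proof (rule Lpow_diff_finite[OF p])
      show "Lpow p (\<lambda>x. X x $ i - Y x $ i) < \<infinity>" by (rule order.strict_trans1[OF XY]) simp
      show "Lpow p (\<lambda>x. X x $ i) < \<infinity>" by (rule X(2))
    qed measurable
    then show ?thesis by simp
  qed
  let ?G = "\<lambda>x. form_of (Y x)"
  show ?thesis
  proof (rule that)
    show "?G \<in> Omega2_R p" by (rule form_of_Omega2_R[OF p Y finY S smooth div])
    have "alternating_on B3 F" using FL by (simp add: Omega2_Lp_def)
    then have "ennreal (Lp_dist p F ?G powr p) \<le> ennreal (6 powr p) * (\<Sum>i\<in>UNIV. Lpow p (\<lambda>x. X x $ i - Y x $ i))"
      by (rule Lp_dist_bounds(2)[OF p _ alternating_form_of X represents_form_of[OF Y] finY])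
    also have "\<dots> \<le> ennreal (6 powr p) * (\<Sum>i\<in>(UNIV :: 3 set). ennreal (2 powr p * (2 * \<eta>)))"
      by (intro mult_left_mono sum_mono XY) auto
    also have "\<dots> = ennreal (6 powr p * (3 * (2 powr p * (2 * \<eta>))))" 
      using \<eta> by (subst sum_3_ennreal, simp) (subst ennreal_mult[symmetric], auto)
    also have "6 powr p * (3 * (2 powr p * (2 * \<eta>))) = e powr p / 2" by (simp add: \<eta>_def)
    finally have "Lp_dist p F ?G powr p \<le> e powr p / 2" by simp
    moreover have "e powr p > 0" using e by simp
    ultimately have "Lp_dist p F ?G powr p < e powr p" by linarith
    show "Lp_dist p F ?G < e"
    proof (rule ccontr)
      assume "\<not> Lp_dist p F ?G < e"
      then have "e powr p \<le> Lp_dist p F ?G powr p" using p e by (intro powr_mono2) auto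
      then show False using \<open>Lp_dist p F ?G powr p < e powr p\<close> by linarith
    qed
  qed
qed

lemma closedin_Omega2_Z:
  assumes p: "p \<ge> 1" shows "closedin (Lp_topology p) (Omega2_Z p)"
proof -
  have sub: "Omega2_Z p \<subseteq> Omega2_Lp p" by (auto simp: Omega2_Z_def)
  have "\<exists>e>0. \<forall>G\<in>Omega2_Lp p. Lp_dist p F G < e \<longrightarrow> G \<in> Omega2_Lp p - Omega2_Z p"
    if "F \<in> Omega2_Lp p - Omega2_Z p" for F
  proof (rule ccontr)
    assume no: "\<not> (\<exists>e>0. \<forall>G\<in>Omega2_Lp p. Lp_dist p F G < e \<longrightarrow> G \<in> Omega2_Lp p - Omega2_Z p)"
    have "\<exists>G\<in>Omega2_Z p. Lp_dist p F G < e" if "e > 0" for e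
      using no that by (meson DiffI)
    then have "F \<in> Omega2_Z p" using that by (intro Omega2_Z_closed[OF p]) auto
    with that show False by simp
  qed
  then have "openin (Lp_topology p) (Omega2_Lp p - Omega2_Z p)"
    unfolding openin_Lp_topology by (intro conjI ballI) auto
  then show ?thesis
    unfolding closedin_def topspace_Lp_topology using sub by (intro conjI)
qed

theorem corollary1p1:
  fixes p :: real
  assumes "1 \<le> p"
  shows "Lp_topology p closure_of Omega2_R p = Omega2_Z p"
proof
  show "Lp_topology p closure_of Omega2_R p \<subseteq> Omega2_Z p"
    by (rule closure_of_minimal[OF Omega2_R_subset_Z[OF assms] closedin_Omega2_Z[OF assms]])
  show "Omega2_Z p \<subseteq> Lp_topology p closure_of Omega2_R p"
  proof
    fix F assume F: "F \<in> Omega2_Z p"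
    have "\<exists>G. G \<in> Omega2_R p \<and> G \<in> T" if T: "F \<in> T \<and> openin (Lp_topology p) T" for T
    proof -
      obtain e where e: "e > 0" "\<And>G. G \<in> Omega2_Lp p \<Longrightarrow> Lp_dist p F G < e \<Longrightarrow> G \<in> T"
        using T unfolding openin_Lp_topology by meson
      obtain G where G: "G \<in> Omega2_R p" "Lp_dist p F G < e" by (rule Omega2_R_dense[OF assms F e(1)])
      then have "G \<in> T" by (intro e(2)) (auto simp: Omega2_R_def)
      with G(1) show ?thesis by blast
    qed
    moreover have "F \<in> topspace (Lp_topology p)" using F by (simp add: topspace_Lp_topology Omega2_Z_def)
    ultimately show "F \<in> Lp_topology p closure_of Omega2_R p"
      unfolding in_closure_of by blast
  qed
qed


end
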